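(* Assume $\gamma_j>0$ for all $1\le j\le k$. Let $\mu$ be a non-degenerate Mandelbrot measure on $K$, generated by the random vector $W$, and let $2\le i\le k$. Suppose that $T(q)>-\infty$ for some $q>1$. Then, with probability 1, conditional on $\mu\neq0$, the measure $\Pi_i\mu$ is exact dimensional on $(X_i,d_{\vec\gamma^i})$ and $\dim(\Pi_i\mu)=\dim_e^{\vec\gamma^i}(\Pi_i\mu)$, where $$\dim_e^{\vec\gamma^i}(\Pi_i\mu):=\sum_{j=i}^k\vec\gamma^i_j\dim_e(\Pi_j\mu)=\sum_{j=i}^k\vec\gamma^i_j\min(\dim_e(\mu),h_{\nu_j}(T_j)),$$ and $\nu_j=\mathbb E(\Pi_j\mu)$, which is a Bernoulli product measure on $X_j$.
   Context: Symbolic setting. Let $k\ge2$. For $1\le i\le k$ let $\mathcal A_i$ be a finite alphabet with at least 2 elements, $X_i=\mathcal A_i^{\{1,2,\dots\}}$ and $T_i$ the left shift on $X_i$. For $1\le i\le k-1$ let $\pi_i:\mathcal A_i\to\mathcal A_{i+1}$ be a surjective map, extended letter by letter to finite words and to $X_i$. Set $\Pi_i=\pi_{i-1}\circ\cdots\circ\pi_1$ ($\Pi_1$ the identity), and $\Pi_{i,j}=\pi_{j-1}\circ\cdots\circ\pi_i$ for $j>i$, $\Pi_{i,i}$ the identity. $f\nu$ denotes the push-forward of $\nu$ by $f$. $\mathcal A_i^*$ is the set of finite words (including the empty word $\epsilon$), $[u]$ the cylinder of points with prefix $u$, $x_{|n}$ the prefix of length $n$, $|x\wedge y|$ the length of the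 longest common prefix. Let $\gamma_1,\dots,\gamma_k>0$ and, for $2\le i\le k$, $\vec\gamma^i=(\vec\gamma^i_j)_{i\le j\le k}=(\gamma_1+\cdots+\gamma_i,\gamma_{i+1},\dots,\gamma_k)$. $X_i$ is endowed with the ultrametric $d_{\vec\gamma^i}(x,y)=\max_{i\le j\le k}\exp(-|\Pi_{i,j}(x)\wedge\Pi_{i,j}(y)|/(\gamma_1+\cdots+\gamma_j))$. Random sponge. Let $A=(c_a)_{a\in\mathcal A_1}$ be a random element of $\{0,1\}^{\mathcal A_1}$, identified with $\{a:c_a=1\}$, with $\mathbb E(\#A)>1$. Let $(A(u))_{u\in\mathcal A_1^*}$ be independent copies of $A$, $K_n=\{x\in X_1:c_{x_j}(x_{|j-1})=1,\ 1\le j\le n\}$, $K=\bigcap_{n\ge1}K_n$. Mandelbrot measures on $K$. Let $W=(W_a)_{a\in\mathcal A_1}$ be a non-negative random vector defined simultaneously with $A$, with $\{W_a>0\}\subset\{c_a=1\}$ for all $a$ and $\mathbb E\sum_aW_a=1$; $T(q)=-\log\mathbb E\sum_aW_a^q$, $q\ge 0$. Let $(A(u),W(u))_{u\in\mathcal A_1^*}$ be independent copies of $(A,W)$ ($K$ being built from the $A(u)$), $Q^u(v)=\prod_{j=1}^{|v|}W_{v_j}(u\cdot v_{|j-1})$, $Y(u)=\lim_n\sum_{|v|=n}Q^u(v)$ (a.s. martingale limit). The Mandelbrot measure $\mu$ on $X_1$ is defined by $\mu([u])=Q^\epsilon(u)Y(u)$; it is supported on $K$, and is non-degenerate if $\mathbb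 P(\mu\ne0)>0$. For a finite Borel measure $\nu$ on $X_i$, $\dim_e(\nu)=\lim_{n}-\frac1n\sum_{u\in\mathcal A_i^n}\nu([u])\log\nu([u])$ when the limit exists; for non-degenerate $\mu$, a.s. on $\mu\neq 0$, $\dim_e(\mu)=T'(1^-)$. $h_\nu(T_j)$ is the measure-theoretic entropy. A locally finite Borel measure $\nu$ on a metric space is exact dimensional with dimension $D=\dim(\nu)$ if $\lim_{r\to0^+}\log\nu(B(x,r))/\log r=D$ for $\nu$-a.e. $x$.
   Formalization: The entropy dimension dim_e of a finite measure is taken for the measure divided by its total mass; with the unnormalised formula the claim fails when the total mass of the Mandelbrot measure is random. *)

theory Defs
  imports "HOL-Probability.Probability"
begin

section \<open>Symbolic spaces and factor maps\<close>

text \<open>Points are streams indexed from 0, so the letter \<open>x\<^sub>j\<close> (\<open>j \<ge> 1\<close>) of the usual notation is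
  \<open>x !! (j - 1)\<close>. All the alphabets \<open>Alph i\<close> are finite subsets of one letter type. The cylinder
  \<open>[u]\<close> in \<open>streams A\<close> is \<open>sstart A u\<close>.\<close>

abbreviation shift_space :: "'a set \<Rightarrow> 'a stream measure" where
  "shift_space A \<equiv> stream_space (count_space A)"

text \<open>\<open>factor_letter \<pi> i j = \<pi> (j - 1) \<circ> \<dots> \<circ> \<pi> i\<close>, the identity for \<open>i = j\<close>.\<close>

definition factor_letter :: "(nat \<Rightarrow> 'a \<Rightarrow> 'a) \<Rightarrow> nat \<Rightarrow> nat \<Rightarrow> 'a \<Rightarrow> 'a" where
  "factor_letter \<pi> i j = fold \<pi> [i..<j]"

definition factor_map :: "(nat \<Rightarrow> 'a \<Rightarrow> 'a) \<Rightarrow> nat \<Rightarrow> nat \<Rightarrow> 'a stream \<Rightarrow> 'a stream" where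
  "factor_map \<pi> i j = smap (factor_letter \<pi> i j)"

definition push_factor ::
  "(nat \<Rightarrow> 'a set) \<Rightarrow> (nat \<Rightarrow> 'a \<Rightarrow> 'a) \<Rightarrow> nat \<Rightarrow> 'a stream measure \<Rightarrow> 'a stream measure" where
  "push_factor Alph \<pi> j \<nu> = distr \<nu> (shift_space (Alph j)) (factor_map \<pi> 1 j)"

definition lcp_length :: "'a stream \<Rightarrow> 'a stream \<Rightarrow> enat" where
  "lcp_length x y = (SUP n\<in>{n. stake n x = stake n y}. enat n)"

text \<open>\<open>exp_neg l s\<close> is \<open>exp (- l / s)\<close>, with \<open>exp (-\<infinity>) = 0\<close>.\<close>

definition exp_neg :: "enat \<Rightarrow> real \<Rightarrow> real" where
  "exp_neg l s = (case l of enat n \<Rightarrow> exp (- real n / s) | \<infinity> \<Rightarrow> 0)"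

definition gamma_vec :: "(nat \<Rightarrow> real) \<Rightarrow> nat \<Rightarrow> nat \<Rightarrow> real" where
  "gamma_vec \<gamma> i j = (if j = i then (\<Sum>l=1..i. \<gamma> l) else \<gamma> j)"

definition sponge_dist ::
  "nat \<Rightarrow> (nat \<Rightarrow> 'a \<Rightarrow> 'a) \<Rightarrow> (nat \<Rightarrow> real) \<Rightarrow> nat \<Rightarrow> 'a stream \<Rightarrow> 'a stream \<Rightarrow> real" where
  "sponge_dist k \<pi> \<gamma> i x y =
     Max ((\<lambda>j. exp_neg (lcp_length (factor_map \<pi> i j x) (factor_map \<pi> i j y)) (\<Sum>l=1..j. \<gamma> l))
          ` {i..k})"


section \<open>Dimensions and entropies\<close>

text \<open>Positivity of the ball masses holds for almost every point in the separable spaces below; it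
  is stated only because \<open>ln 0 = 0\<close> in HOL, whereas \<open>log 0 = -\<infinity>\<close> is meant here.\<close>

definition exact_dimensional ::
  "'b set \<Rightarrow> ('b \<Rightarrow> 'b \<Rightarrow> real) \<Rightarrow> 'b measure \<Rightarrow> real \<Rightarrow> bool" where
  "exact_dimensional X d \<nu> D \<longleftrightarrow>
     Metric_space X d \<and>
     space \<nu> = X \<and>
     sets \<nu> = sigma_sets X {U. openin (Metric_space.mtopology X d) U} \<and>
     (\<forall>x\<in>X. \<exists>r>0. emeasure \<nu> (Metric_space.mcball X d x r) < \<infinity>) \<and>
     (AE x in \<nu>.
        (\<forall>r>0. measure \<nu> (Metric_space.mcball X d x r) > 0) \<and>
        ((\<lambda>r. ln (measure \<nu> (Metric_space.mcball X d x r)) / ln r) \<longlongrightarrow> D) (at_right 0))"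

text \<open>The entropy dimension of a finite measure is that of its normalisation. Without dividing by
  the total mass, the limit would be multiplied by \<open>c\<close> when \<open>\<nu>\<close> is replaced by \<open>c \<nu>\<close>, and
  \<open>dim\<^sub>e \<mu> = T'(1-)\<close> would fail for Mandelbrot measures, whose total mass is random.\<close>

definition entropy_quotient :: "'a set \<Rightarrow> 'a stream measure \<Rightarrow> nat \<Rightarrow> real" where
  "entropy_quotient A \<nu> n =
     - (1 / real n) *
       (\<Sum>u\<in>{u. set u \<subseteq> A \<and> length u = n}.
          (measure \<nu> (sstart A u) / measure \<nu> (streams A)) *
          ln (measure \<nu> (sstart A u) / measure \<nu> (streams A)))"

definition has_entropy_dim :: "'a set \<Rightarrow> 'a stream measure \<Rightarrow> bool" where
  "has_entropy_dim A \<nu> \<longleftrightarrow> convergent (entropy_quotient A \<nu>)"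

definition entropy_dim :: "'a set \<Rightarrow> 'a stream measure \<Rightarrow> real" where
  "entropy_dim A \<nu> = lim (entropy_quotient A \<nu>)"

text \<open>\<open>weighted_entropy_dim\<close> is \<open>dim\<^sub>e\<close> of \<open>\<Pi>\<^sub>i \<mu>\<close> with respect to the weights \<open>gamma_vec \<gamma> i\<close>; its
  last argument is \<open>\<mu>\<close> itself.\<close>

definition weighted_entropy_dim ::
  "nat \<Rightarrow> (nat \<Rightarrow> 'a set) \<Rightarrow> (nat \<Rightarrow> 'a \<Rightarrow> 'a) \<Rightarrow> (nat \<Rightarrow> real) \<Rightarrow> nat \<Rightarrow> 'a stream measure \<Rightarrow> real"
where
  "weighted_entropy_dim k Alph \<pi> \<gamma> i \<mu> =
     (\<Sum>j=i..k. gamma_vec \<gamma> i j * entropy_dim (Alph j) (push_factor Alph \<pi> j \<mu>))"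

text \<open>Kolmogorov--Sinai entropy in nats. A finite measurable partition is given by a labelling
  \<open>f\<close> (a simple function into \<open>nat\<close>); the join of its first \<open>n\<close> preimages under \<open>T\<close> is the
  partition into the level sets of the itinerary map.\<close>

definition partition_entropy :: "'x measure \<Rightarrow> ('x \<Rightarrow> 'y) \<Rightarrow> real" where
  "partition_entropy M f =
     - (\<Sum>y\<in>f ` space M.
          measure M (f -` {y} \<inter> space M) * ln (measure M (f -` {y} \<inter> space M)))"

definition itinerary :: "('x \<Rightarrow> 'x) \<Rightarrow> ('x \<Rightarrow> 'y) \<Rightarrow> nat \<Rightarrow> 'x \<Rightarrow> 'y list" where
  "itinerary T f n x = map (\<lambda>l. f ((T ^^ l) x)) [0..<n]"

definition ks_entropy :: "'x measure \<Rightarrow> ('x \<Rightarrow> 'x) \<Rightarrow> ereal" where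
  "ks_entropy M T =
     (SUP f\<in>{f :: 'x \<Rightarrow> nat. simple_function M f}.
        ereal (lim (\<lambda>n. partition_entropy M (itinerary T f n) / real n)))"


section \<open>Mandelbrot measures\<close>

text \<open>Values of the pair \<open>(A, W)\<close>: a random subset of the alphabet (the set of letters \<open>a\<close> with
  \<open>c\<^sub>a = 1\<close>) together with a real vector indexed by the alphabet.\<close>

definition AW_space :: "'a set \<Rightarrow> ('a set \<times> ('a \<Rightarrow> real)) measure" where
  "AW_space S = count_space (Pow S) \<Otimes>\<^sub>M (\<Pi>\<^sub>M a\<in>S. borel)"

text \<open>\<open>T(q) = - log E (\<Sum>\<^sub>a W\<^sub>a\<^sup>q)\<close> as an extended real; \<open>P\<close> is the probability space on which the
  vector \<open>W\<close> is defined.\<close>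

definition T_fun :: "'v measure \<Rightarrow> 'a set \<Rightarrow> ('v \<Rightarrow> 'a \<Rightarrow> real) \<Rightarrow> real \<Rightarrow> ereal" where
  "T_fun P S W q =
     (let m = (\<integral>\<^sup>+ \<omega>. (\<Sum>a\<in>S. ennreal (W \<omega> a powr q)) \<partial>P)
      in if m = \<infinity> then - \<infinity> else if m = 0 then \<infinity> else ereal (- ln (enn2real m)))"

text \<open>Below, \<open>w u a\<close> is the realisation of \<open>W\<^sub>a(u)\<close>.\<close>

definition Q_weight :: "('a list \<Rightarrow> 'a \<Rightarrow> real) \<Rightarrow> 'a list \<Rightarrow> 'a list \<Rightarrow> real" where
  "Q_weight w u v = (\<Prod>j<length v. w (u @ take j v) (v ! j))"

definition Y_limit :: "'a set \<Rightarrow> ('a list \<Rightarrow> 'a \<Rightarrow> real) \<Rightarrow> 'a list \<Rightarrow> real" where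
  "Y_limit S w u = lim (\<lambda>n. \<Sum>v\<in>{v. set v \<subseteq> S \<and> length v = n}. Q_weight w u v)"

definition mandelbrot_measure :: "'a set \<Rightarrow> ('a list \<Rightarrow> 'a \<Rightarrow> real) \<Rightarrow> 'a stream measure" where
  "mandelbrot_measure S w =
     extend_measure (streams S) (lists S) (sstart S)
       (\<lambda>u. ennreal (Q_weight w [] u * Y_limit S w u))"

definition mean_measure :: "'w measure \<Rightarrow> 'x measure \<Rightarrow> ('w \<Rightarrow> 'x measure) \<Rightarrow> 'x measure" where
  "mean_measure P N \<kappa> =
     measure_of (space N) (sets N) (\<lambda>B. \<integral>\<^sup>+ \<omega>. emeasure (\<kappa> \<omega>) B \<partial>P)"

definition bernoulli_product :: "'a set \<Rightarrow> 'a stream measure \<Rightarrow> bool" where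
  "bernoulli_product S \<nu> \<longleftrightarrow>
     (\<exists>p. prob_space p \<and> sets p = sets (count_space S) \<and> \<nu> = stream_space p)"

end

theory Submission
  imports Defs "HOL-Real_Asymp.Real_Asymp"
begin

text \<open>Points of the ball of radius \<open>exp (- L)\<close> are those whose first letters agree after applying a
  code to each position: \<open>\<Pi>\<^sub>i\<close> on the first positions, then \<open>\<Pi>\<^sub>i\<^sub>+\<^sub>1\<close>, and so on up to \<open>\<Pi>\<^sub>k\<close>. For an
  arbitrary sequence of \<open>n\<close> codes, the sum over all the balls of the \<open>q\<close>-th powers of their masses is
  estimated by the branching recursion. For \<open>q > 1\<close> close to 1 its mean is at most
  \<open>n \<Prod>\<^sub>l max (E \<Sum>\<^sub>a W\<^sub>a\<^sup>q) (\<Sum>\<^sub>b p\<^sub>l(b)\<^sup>q)\<close> up to a constant, where \<open>p\<^sub>l\<close> is the mean of the weights summed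
  over the fibres of the \<open>l\<close>-th code. For \<open>q < 1\<close>, if the codes are injective on the first positions, it is
  at most the product of the first factors there and, by Jensen's inequality, of the second ones on
  the other positions. The derivatives of the factors at \<open>q = 1\<close> are \<open>- H\<close> with \<open>H = - E \<Sum>\<^sub>a W\<^sub>a ln W\<^sub>a\<close>, and
  minus the entropy \<open>h\<^sub>l\<close> of \<open>p\<^sub>l\<close>. By Markov's inequality and the Borel--Cantelli lemma, almost every ball
  has mass \<open>exp (o(n) - \<Sum>\<^sub>l min H h\<^sub>l)\<close>. Constant sequences of codes give the entropy dimensions, and the
  sequence above gives the exact dimension.

  The moments of the total mass that this requires are not assumed: a case distinction on the sign of
  \<open>H\<close> shows that they are finite unless the measure vanishes almost surely.\<close>

section \<open>Power inequalities\<close>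

text \<open>The upper and the lower bounds for ball masses are not symmetric. For
  \<open>q > 1\<close> one recursion treats any sequence of codes: at each position the mass either
  keeps branching or is replaced by its mean from there on, and positionwise maxima dominate both
  alternatives. For \<open>q < 1\<close> only two tools remain, exact factorisation where a code is
  injective and Jensen's inequality for an entire remaining tail, so the two cannot be mixed freely
  from one position to the next. The bound is rescued by an ordering: the codes of a metric ball
  become coarser along the word, and entropy decreases under factor maps. Hence the positions with
  \<open>H \<le> h j\<close> form a prefix. There all letters may be prescribed, at the cost of
  shrinking the ball, and Jensen's inequality is left with the suffix.

  The Kolmogorov--Sinai entropy is a supremum over all finite partitions and has to be computed from
  that definition. The Mandelbrot measure is defined as an extension that exists only if the
  cylinder masses are consistent; this holds for environments of full probability, and statements
  about the measure are made there.\<close>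

lemma powr_add_le:
  fixes x y s :: real
  assumes "0 \<le> x" "0 \<le> y" "0 \<le> s" "s \<le> 1"
  shows "(x + y) powr s \<le> x powr s + y powr s"
proof (cases "x + y = 0")
  case False
  define t where "t = x / (x + y)"
  have xy: "x + y > 0" using assms False by simp
  have le: "z \<le> z powr s" if "0 \<le> z" "z \<le> 1" for z :: real
    using powr_mono'[of s 1 z] that assms by simp
  have t: "0 \<le> t" "t \<le> 1" "x = t * (x + y)" "y = (1 - t) * (x + y)"
    using assms xy by (auto simp: t_def field_simps)
  have "1 \<le> t powr s + (1 - t) powr s" using le[of t] le[of "1 - t"] t by simp
  then have "(x + y) powr s * 1 \<le> (x + y) powr s * (t powr s + (1 - t) powr s)"
    by (intro mult_left_mono) auto
  also have "\<dots> = t powr s * (x + y) powr s + (1 - t) powr s * (x + y) powr s"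
    by (subst distrib_left, subst (1 2) mult.commute, rule refl)
  also have "\<dots> = (t * (x + y)) powr s + ((1 - t) * (x + y)) powr s"
    by (simp only: powr_mult)
  finally show ?thesis unfolding t(3,4)[symmetric] by simp
qed (use assms in auto)

lemma powr_sum_le:
  fixes x :: "'i \<Rightarrow> real"
  assumes "finite I" "\<And>i. i \<in> I \<Longrightarrow> 0 \<le> x i" "0 \<le> s" "s \<le> 1"
  shows "(\<Sum>i\<in>I. x i) powr s \<le> (\<Sum>i\<in>I. x i powr s)"
  using assms(1,2)
proof (induction I rule: finite_induct)
  case (insert i I)
  then show ?case
    using powr_add_le[of "x i" "sum x I" s] assms by (auto simp: sum_nonneg intro: order_trans)
qed simp

text \<open>Bernoulli's inequality for the larger term: if \<open>y \<le> x\<close>, then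
  \<open>(1 + y / x) powr h\<close> is at most \<open>1 + h * (y / x)\<close>, and
  \<open>x powr h * (y / x)\<close> is at most \<open>y powr h\<close>. The deficit measures how far
  subadditivity is from equality when both terms are large.\<close>

lemma powr_add_le_min:
  fixes x y h :: real
  assumes "0 \<le> x" "0 \<le> y" "0 < h" "h < 1"
  shows "(x + y) powr h \<le> x powr h + y powr h - (1 - h) * min x y powr h"
  using assms(1,2)
proof (induction x y rule: linorder_wlog)
  case (le y x)
  show ?case
  proof (cases "y = 0")
    case False
    then have y: "y > 0" and x: "x > 0" using le by auto
    have "(1 + y / x) powr h \<le> 1 + h * (y / x)"
      using Youngs_inequality_0[of h "1 - h" "1 + y / x" 1] assms x y add_pos_pos[OF zero_less_one divide_pos_pos[OF y x]]
      by (simp add: algebra_simps)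
    then have "x powr h * (1 + y / x) powr h \<le> x powr h * (1 + h * (y / x))"
      by (intro mult_left_mono) auto
    moreover have "x powr h * (1 + y / x) powr h = (x + y) powr h"
    proof -
      have "x * (1 + y / x) = x + y" using x by (simp add: distrib_left)
      then show ?thesis by (simp only: powr_mult[symmetric])
    qed
    moreover have "x powr h * (y / x) = x powr (h - 1) * y"
      using x by (simp add: powr_diff)
    moreover have "x powr (h - 1) * y \<le> y powr (h - 1) * y"
      using x y le assms by (intro mult_right_mono powr_mono2') auto
    moreover have "y powr (h - 1) * y = y powr h"
      using y by (simp add: powr_diff)
    ultimately have *: "(x + y) powr h \<le> x powr h * (1 + h * (y / x))" "x powr h * (y / x) \<le> y powr h"
      by simp_all
    have "x powr h * (1 + h * (y / x)) = x powr h + h * (x powr h * (y / x))" by (simp add: algebra_simps)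
    also have "\<dots> \<le> x powr h + h * y powr h" using assms *(2) by (intro add_left_mono mult_left_mono) auto
    finally have "(x + y) powr h \<le> x powr h + h * y powr h" using *(1) by simp
    then show ?thesis using le by (simp add: min_def algebra_simps)
  qed (use le in auto)
next
  case (sym y x)
  then show ?case by (simp add: add.commute min.commute)
qed

lemma powr_sum_le_min:
  fixes x :: "'i \<Rightarrow> real"
  assumes "finite I" "\<And>i. i \<in> I \<Longrightarrow> 0 \<le> x i" "0 < h" "h < 1" "a \<in> I" "b \<in> I" "a \<noteq> b"
  shows "(\<Sum>i\<in>I. x i) powr h \<le> (\<Sum>i\<in>I. x i powr h) - (1 - h) * min (x a) (x b) powr h"
proof -
  have I: "I = insert a (insert b (I - {a, b}))" using assms by auto
  have s: "(\<Sum>i\<in>I. f i) = f a + f b + (\<Sum>i\<in>I - {a, b}. f i)" for f :: "'i \<Rightarrow> real"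
    using assms by (subst I) auto
  have "(\<Sum>i\<in>I. x i) powr h \<le> (x a + x b) powr h + (\<Sum>i\<in>I - {a, b}. x i) powr h"
    unfolding s[of x] by (rule powr_add_le) (use assms in \<open>auto intro!: sum_nonneg\<close>)
  also have "\<dots> \<le> x a powr h + x b powr h - (1 - h) * min (x a) (x b) powr h
      + (\<Sum>i\<in>I - {a, b}. x i powr h)"
    by (intro add_mono powr_add_le_min powr_sum_le) (use assms in auto)
  finally show ?thesis by (simp add: s)
qed

text \<open>Convexity: the graph of the \<open>p\<close>-th power of the modulus lies above its
  tangent at \<open>z\<close>. Young's inequality with the conjugate exponents
  \<open>p / (p - 1)\<close> and \<open>p\<close> gives it without differentiation.\<close>

lemma abs_powr_tangent:
  fixes x z p :: real
  assumes "1 < p"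
  shows "\<bar>z\<bar> powr p + p * (sgn z * \<bar>z\<bar> powr (p - 1)) * (x - z) \<le> \<bar>x\<bar> powr p"
proof -
  have "(\<bar>z\<bar> powr (p - 1)) * \<bar>x\<bar> \<le> (\<bar>z\<bar> powr (p - 1)) powr (p / (p - 1)) / (p / (p - 1)) + \<bar>x\<bar> powr p / p"
    using assms by (intro Youngs_inequality) (auto simp: field_simps)
  also have "(\<bar>z\<bar> powr (p - 1)) powr (p / (p - 1)) = \<bar>z\<bar> powr p"
    using assms by (simp add: powr_powr)
  finally have "p * (\<bar>z\<bar> powr (p - 1) * \<bar>x\<bar>) \<le> p * (\<bar>z\<bar> powr p / (p / (p - 1)) + \<bar>x\<bar> powr p / p)"
    using assms by (intro mult_left_mono) auto
  also have "\<dots> = (p - 1) * \<bar>z\<bar> powr p + \<bar>x\<bar> powr p"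
    using assms by (simp add: field_simps)
  finally have 1: "p * (\<bar>z\<bar> powr (p - 1) * \<bar>x\<bar>) \<le> (p - 1) * \<bar>z\<bar> powr p + \<bar>x\<bar> powr p" .
  have "sgn z * x \<le> \<bar>x\<bar>" by (auto simp: sgn_if)
  then have "p * \<bar>z\<bar> powr (p - 1) * (sgn z * x) \<le> p * \<bar>z\<bar> powr (p - 1) * \<bar>x\<bar>"
    using assms by (intro mult_left_mono) auto
  moreover have "(sgn z * \<bar>z\<bar> powr (p - 1)) * z = \<bar>z\<bar> powr p"
  proof (cases "z = 0")
    case False
    have "(sgn z * \<bar>z\<bar> powr (p - 1)) * z = \<bar>z\<bar> powr (p - 1) * \<bar>z\<bar> powr 1"
      using False by (auto simp: sgn_if)
    also have "\<dots> = \<bar>z\<bar> powr p" unfolding powr_add[symmetric] by simp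
    finally show ?thesis .
  qed simp
  ultimately show ?thesis using 1 by (simp add: algebra_simps)
qed

text \<open>With \<open>s = p - 1\<close> the signed power is, up to the factor \<open>p\<close>,
  the derivative of \<open>\<bar>x\<bar> powr p\<close>. It is Hoelder continuous by subadditivity;
  the constant 2 comes from opposite signs, where each of the two powers is at most that of the
  distance.\<close>

lemma signed_powr_holder:
  fixes x z s :: real
  assumes "0 < s" "s \<le> 1"
  shows "\<bar>sgn z * \<bar>z\<bar> powr s - sgn x * \<bar>x\<bar> powr s\<bar> \<le> 2 * \<bar>z - x\<bar> powr s"
proof -
  have same: "\<bar>a powr s - b powr s\<bar> \<le> \<bar>a - b\<bar> powr s" if "0 \<le> a" "0 \<le> b" for a b :: real
  proof -
    have *: "u powr s - v powr s \<le> \<bar>u - v\<bar> powr s" if "0 \<le> u" "0 \<le> v" for u v :: real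
    proof (cases "v \<le> u")
      case True
      then show ?thesis using powr_add_le[of v "u - v" s] that assms by auto
    next
      case False
      then have "u powr s \<le> v powr s" using that assms by (intro powr_mono2) auto
      then show ?thesis by (smt (verit) powr_ge_zero)
    qed
    show ?thesis using *[OF that] *[OF that(2,1)] by (simp add: abs_if minus_diff_commute split: if_splits)
  qed
  have opp: "a powr s + b powr s \<le> 2 * (a + b) powr s" if "0 \<le> a" "0 \<le> b" for a b :: real
    using powr_mono2[of s a "a + b"] powr_mono2[of s b "a + b"] that assms by auto
  consider "0 \<le> z" "0 \<le> x" | "z \<le> 0" "x \<le> 0" | "z < 0" "0 < x" | "x < 0" "0 < z" by linarith
  then show ?thesis
  proof cases
    case 1
    have "sgn z * \<bar>z\<bar> powr s = z powr s" "sgn x * \<bar>x\<bar> powr s = x powr s"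
      using 1 by (auto simp: sgn_if)
    then show ?thesis using same[OF 1] by (smt (verit) powr_ge_zero)
  next
    case 2
    have e: "sgn z * \<bar>z\<bar> powr s = - ((-z) powr s)" "sgn x * \<bar>x\<bar> powr s = - ((-x) powr s)"
      using 2 by (auto simp: sgn_if)
    have "\<bar>-z - -x\<bar> = \<bar>z - x\<bar>" by simp
    then show ?thesis using same[of "-z" "-x"] 2 unfolding e by (smt (verit) powr_ge_zero)
  next
    case 3
    have "sgn z * \<bar>z\<bar> powr s - sgn x * \<bar>x\<bar> powr s = - ((-z) powr s + x powr s)" "\<bar>z - x\<bar> = -z + x"
      using 3 by auto
    then show ?thesis using opp[of "-z" x] 3 add_nonneg_nonneg[OF powr_ge_zero powr_ge_zero, of "-z" s x s]
      by (simp only: abs_minus_cancel abs_of_nonneg)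
  next
    case 4
    have "sgn z * \<bar>z\<bar> powr s - sgn x * \<bar>x\<bar> powr s = (-x) powr s + z powr s" "\<bar>z - x\<bar> = -x + z"
      using 4 by auto
    then show ?thesis using opp[of "-x" z] 4 add_nonneg_nonneg[OF powr_ge_zero powr_ge_zero, of "-x" s z s]
      by (simp only: abs_of_nonneg)
  qed
qed

text \<open>The tangent at \<open>x + y\<close>, evaluated at \<open>x\<close>, has slope taken at
  the wrong point; Hoelder continuity moves it to \<open>x\<close> at the cost of the last term.
  What remains is linear in \<open>y\<close>, so it has mean 0 when \<open>y\<close> is centred and
  independent of \<open>x\<close>.\<close>

lemma abs_powr_add_le:
  fixes x y p :: real
  assumes "1 < p" "p \<le> 2"
  shows "\<bar>x + y\<bar> powr p \<le> \<bar>x\<bar> powr p + p * (sgn x * \<bar>x\<bar> powr (p - 1)) * y + 2 * p * \<bar>y\<bar> powr p"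
proof -
  define \<sigma> where "\<sigma> z = sgn z * \<bar>z\<bar> powr (p - 1)" for z :: real
  have "\<bar>x + y\<bar> powr p \<le> \<bar>x\<bar> powr p + p * \<sigma> (x + y) * y"
    using abs_powr_tangent[of p "x + y" x] assms by (simp add: \<sigma>_def)
  also have "p * \<sigma> (x + y) * y = p * \<sigma> x * y + p * ((\<sigma> (x + y) - \<sigma> x) * y)"
    by (simp add: algebra_simps)
  also have "(\<sigma> (x + y) - \<sigma> x) * y \<le> \<bar>\<sigma> (x + y) - \<sigma> x\<bar> * \<bar>y\<bar>"
    by (simp add: abs_mult[symmetric])
  also have "\<dots> \<le> 2 * \<bar>y\<bar> powr (p - 1) * \<bar>y\<bar>"
    using signed_powr_holder[of "p - 1" "x + y" x] assms
    by (intro mult_right_mono) (auto simp: \<sigma>_def)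
  also have "\<dots> = 2 * \<bar>y\<bar> powr p"
    by (cases "y = 0") (auto simp: powr_diff)
  finally show ?thesis using assms by (simp add: \<sigma>_def algebra_simps)
qed

section \<open>Moments of sums of independent random variables\<close>

lemma powr_le_one_plus:
  fixes x s q :: real
  assumes "0 \<le> x" "0 \<le> s" "s \<le> q"
  shows "x powr s \<le> 1 + x powr q"
proof (cases "x \<le> 1")
  case True
  then have "x powr s \<le> 1" using assms by (intro powr_le1) auto
  then show ?thesis by (simp add: add_increasing2)
next
  case False
  then show ?thesis using powr_mono[of s q x] assms by (simp add: add_increasing)
qed

context finite_measure
begin

lemma integral_finite_range:
  fixes \<phi> :: "'b \<Rightarrow> real"
  assumes f: "simple_function M f"
  shows "(\<integral>x. \<phi> (f x) \<partial>M) = (\<Sum>y\<in>f ` space M. measure M (f -` {y} \<inter> space M) * \<phi> y)"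
    and "integrable M (\<lambda>x. \<phi> (f x))"
proof -
  have fin: "finite (f ` space M)" and ev: "\<And>y. y \<in> f ` space M \<Longrightarrow> f -` {y} \<inter> space M \<in> sets M"
    using f by (auto simp: simple_function_def)
  have eq: "\<phi> (f x) = (\<Sum>y\<in>f ` space M. \<phi> y * indicator (f -` {y} \<inter> space M) x)" if "x \<in> space M" for x
  proof -
    have "(\<Sum>y\<in>f ` space M. \<phi> y * indicator (f -` {y} \<inter> space M) x) = (\<Sum>y\<in>{f x}. \<phi> y * indicator (f -` {y} \<inter> space M) x)"
      using that fin by (intro sum.mono_neutral_right) (auto simp: indicator_def)
    then show ?thesis using that by simp
  qed
  have i: "integrable M (\<lambda>x. \<Sum>y\<in>f ` space M. \<phi> y * indicator (f -` {y} \<inter> space M) x)"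
    using ev by (intro Bochner_Integration.integrable_sum integrable_mult_right) (auto simp: emeasure_eq_measure)
  then show "integrable M (\<lambda>x. \<phi> (f x))"
    by (rule Bochner_Integration.integrable_cong[THEN iffD1, OF refl, rotated]) (simp add: eq)
  have "(\<integral>x. \<phi> (f x) \<partial>M) = (\<integral>x. (\<Sum>y\<in>f ` space M. \<phi> y * indicator (f -` {y} \<inter> space M) x) \<partial>M)"
    by (intro Bochner_Integration.integral_cong) (auto simp: eq)
  also have "\<dots> = (\<Sum>y\<in>f ` space M. \<integral>x. \<phi> y * indicator (f -` {y} \<inter> space M) x \<partial>M)"
    using ev by (intro Bochner_Integration.integral_sum integrable_mult_right) (auto simp: emeasure_eq_measure)
  also have "\<dots> = (\<Sum>y\<in>f ` space M. measure M (f -` {y} \<inter> space M) * \<phi> y)"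
    using ev by (intro sum.cong refl) (simp add: Int_absorb1 mult.commute)
  finally show "(\<integral>x. \<phi> (f x) \<partial>M) = (\<Sum>y\<in>f ` space M. measure M (f -` {y} \<inter> space M) * \<phi> y)" .
qed

end

context prob_space
begin

text \<open>Fubini's theorem as a substitute for conditioning: \<open>X\<close> is frozen and
  \<open>Y\<close> is integrated against an independent copy.\<close>

lemma indep_var_nn_integral_freeze:
  assumes I: "indep_var A X B Y" and F[measurable]: "F \<in> borel_measurable (A \<Otimes>\<^sub>M B)"
  shows "(\<integral>\<^sup>+\<omega>. F (X \<omega>, Y \<omega>) \<partial>M) = (\<integral>\<^sup>+\<omega>. (\<integral>\<^sup>+\<omega>'. F (X \<omega>, Y \<omega>') \<partial>M) \<partial>M)"
proof -
  have X[measurable]: "X \<in> measurable M A" and Y[measurable]: "Y \<in> measurable M B"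
    and d: "distr M A X \<Otimes>\<^sub>M distr M B Y = distr M (A \<Otimes>\<^sub>M B) (\<lambda>\<omega>. (X \<omega>, Y \<omega>))"
    using I by (auto simp: indep_var_distribution_eq)
  interpret Y: prob_space "distr M B Y" by (rule prob_space_distr) fact
  have "(\<integral>\<^sup>+\<omega>. F (X \<omega>, Y \<omega>) \<partial>M) = (\<integral>\<^sup>+z. F z \<partial>(distr M A X \<Otimes>\<^sub>M distr M B Y))"
    unfolding d by (subst nn_integral_distr) auto
  also have "\<dots> = (\<integral>\<^sup>+x. (\<integral>\<^sup>+y. F (x, y) \<partial>distr M B Y) \<partial>distr M A X)"
    by (rule Y.nn_integral_fst[symmetric]) measurable
  also have "\<dots> = (\<integral>\<^sup>+\<omega>. (\<integral>\<^sup>+y. F (X \<omega>, y) \<partial>distr M B Y) \<partial>M)"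
    by (subst nn_integral_distr) auto
  also have "\<dots> = (\<integral>\<^sup>+\<omega>. (\<integral>\<^sup>+\<omega>'. F (X \<omega>, Y \<omega>') \<partial>M) \<partial>M)"
    by (intro nn_integral_cong, subst nn_integral_distr) (auto dest: measurable_space[OF X])
  finally show ?thesis .
qed

text \<open>Jensen's inequality for a concave power. The right-hand side of \<open>le\<close> is the
  tangent at the mean \<open>m\<close>, so its expectation is \<open>m powr s\<close>.\<close>

lemma nn_integral_powr_le:
  assumes Z: "integrable M Z" "\<And>\<omega>. \<omega> \<in> space M \<Longrightarrow> 0 \<le> Z \<omega>" and s: "0 < s" "s \<le> 1"
  shows "(\<integral>\<^sup>+\<omega>. ennreal (Z \<omega> powr s) \<partial>M) \<le> ennreal (expectation Z powr s)"
proof (cases "expectation Z = 0")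
  case True
  then have "AE \<omega> in M. Z \<omega> = 0"
    using integral_nonneg_eq_0_iff_AE[OF Z(1)] Z(2) by auto
  then have "(\<integral>\<^sup>+\<omega>. ennreal (Z \<omega> powr s) \<partial>M) = (\<integral>\<^sup>+\<omega>. 0 \<partial>M)"
    by (intro nn_integral_cong_AE) auto
  then show ?thesis by simp
next
  case False
  define m where "m = expectation Z"
  have m: "m > 0" using False integral_nonneg_AE[of Z M] Z(2) by (simp add: m_def AE_I2 less_le)
  have le: "z powr s \<le> m powr (s - 1) * (s * z + (1 - s) * m)" if "0 \<le> z" for z
  proof (cases "z = 0")
    case False
    then have "z powr s * m powr (1 - s) \<le> s * z + (1 - s) * m"
      using that s m by (intro Youngs_inequality_0) auto
    then have "m powr (s - 1) * (z powr s * m powr (1 - s)) \<le> m powr (s - 1) * (s * z + (1 - s) * m)"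
      by (intro mult_left_mono) auto
    moreover have "m powr (s - 1) * (z powr s * m powr (1 - s)) = z powr s * (m powr (s - 1) * m powr (1 - s))"
      by simp
    moreover have "m powr (s - 1) * m powr (1 - s) = 1"
      using m unfolding powr_add[symmetric] by simp
    ultimately show ?thesis by simp
  qed (use s m in auto)
  have "(\<integral>\<^sup>+\<omega>. ennreal (Z \<omega> powr s) \<partial>M) \<le> (\<integral>\<^sup>+\<omega>. ennreal (m powr (s - 1) * (s * Z \<omega> + (1 - s) * m)) \<partial>M)"
    by (intro nn_integral_mono ennreal_leI le Z(2))
  also have "\<dots> = ennreal (\<integral>\<omega>. m powr (s - 1) * (s * Z \<omega> + (1 - s) * m) \<partial>M)"
    using Z s m by (intro nn_integral_eq_integral) (auto intro!: AE_I2 mult_nonneg_nonneg add_nonneg_nonneg)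
  also have "(\<integral>\<omega>. m powr (s - 1) * (s * Z \<omega> + (1 - s) * m) \<partial>M) = m powr (s - 1) * (s * m + (1 - s) * m)"
    using Z by (simp add: m_def prob_space)
  also have "\<dots> = m powr s" using m by (simp add: powr_diff algebra_simps)
  finally show ?thesis by (simp add: m_def)
qed

text \<open>Split \<open>(\<Sum>X)\<^sup>p = \<Sum>\<^sub>u X\<^sub>u (X\<^sub>u + \<Sum>\<^sub>v\<^sub>\<noteq>\<^sub>u X\<^sub>v)\<^sup>p\<^sup>-\<^sup>1\<close>, use subadditivity of the power \<open>p - 1 \<le> 1\<close>, independence and
  Jensen's inequality.\<close>

lemma nn_integral_sum_powr_le:
  fixes X :: "'i \<Rightarrow> 'a \<Rightarrow> real"
  assumes U: "finite U" and ind: "indep_vars (\<lambda>_. borel) X U"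
    and nn: "\<And>u \<omega>. u \<in> U \<Longrightarrow> \<omega> \<in> space M \<Longrightarrow> 0 \<le> X u \<omega>"
    and int: "\<And>u. u \<in> U \<Longrightarrow> integrable M (X u)" and p: "1 < p" "p \<le> 2"
  shows "(\<integral>\<^sup>+\<omega>. ennreal ((\<Sum>u\<in>U. X u \<omega>) powr p) \<partial>M) \<le>
    (\<Sum>u\<in>U. \<integral>\<^sup>+\<omega>. ennreal (X u \<omega> powr p) \<partial>M) + ennreal ((\<Sum>u\<in>U. expectation (X u)) powr p)"
proof -
  define R where "R u \<omega> = (\<Sum>v\<in>U - {u}. X v \<omega>)" for u \<omega>
  have X[measurable]: "X u \<in> borel_measurable M" if "u \<in> U" for u
    using int that by auto
  have R[measurable]: "R u \<in> borel_measurable M" for u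
    unfolding R_def by (intro borel_measurable_sum) auto
  have Rint: "integrable M (R u)" for u unfolding R_def using int by (intro Bochner_Integration.integrable_sum) auto
  have Rnn: "0 \<le> R u \<omega>" if "\<omega> \<in> space M" for u \<omega> unfolding R_def using nn that by (intro sum_nonneg) auto
  have "ennreal ((\<Sum>u\<in>U. X u \<omega>) powr p) \<le>
     (\<Sum>u\<in>U. ennreal (X u \<omega> powr p) + ennreal (X u \<omega>) * ennreal (R u \<omega> powr (p - 1)))" if w: "\<omega> \<in> space M" for \<omega>
  proof -
    let ?S = "\<Sum>u\<in>U. X u \<omega>"
    have "?S powr p = (\<Sum>u\<in>U. X u \<omega> * ?S powr (p - 1))"
      unfolding sum_distrib_right[symmetric]
      using sum_nonneg[of U "\<lambda>u. X u \<omega>"] nn w by (cases "?S = 0") (auto simp: powr_diff)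
    also have "\<dots> \<le> (\<Sum>u\<in>U. X u \<omega> powr p + X u \<omega> * R u \<omega> powr (p - 1))"
    proof (rule sum_mono)
      fix u assume u: "u \<in> U"
      have S: "?S = X u \<omega> + R u \<omega>" using U u by (simp add: R_def sum.remove)
      have "X u \<omega> * ?S powr (p - 1) \<le> X u \<omega> * (X u \<omega> powr (p - 1) + R u \<omega> powr (p - 1))"
        unfolding S using nn[OF u w] Rnn[OF w] p by (intro mult_left_mono powr_add_le) auto
      also have "\<dots> = X u \<omega> powr p + X u \<omega> * R u \<omega> powr (p - 1)"
        using nn[OF u w] by (cases "X u \<omega> = 0") (auto simp: powr_diff algebra_simps)
      finally show "X u \<omega> * ?S powr (p - 1) \<le> X u \<omega> powr p + X u \<omega> * R u \<omega> powr (p - 1)" .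
    qed
    finally have "ennreal (?S powr p) \<le> ennreal (\<Sum>u\<in>U. X u \<omega> powr p + X u \<omega> * R u \<omega> powr (p - 1))"
      by (rule ennreal_leI)
    also have "\<dots> = (\<Sum>u\<in>U. ennreal (X u \<omega> powr p) + ennreal (X u \<omega>) * ennreal (R u \<omega> powr (p - 1)))"
      using nn w by (subst sum_ennreal[symmetric]) (auto simp: ennreal_mult[OF _ powr_ge_zero] intro!: sum.cong)
    finally show ?thesis .
  qed
  then have "(\<integral>\<^sup>+\<omega>. ennreal ((\<Sum>u\<in>U. X u \<omega>) powr p) \<partial>M) \<le>
      (\<integral>\<^sup>+\<omega>. (\<Sum>u\<in>U. ennreal (X u \<omega> powr p) + ennreal (X u \<omega>) * ennreal (R u \<omega> powr (p - 1))) \<partial>M)"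
    by (rule nn_integral_mono)
  also have "\<dots> = (\<Sum>u\<in>U. (\<integral>\<^sup>+\<omega>. ennreal (X u \<omega> powr p) \<partial>M) + (\<integral>\<^sup>+\<omega>. ennreal (X u \<omega>) * ennreal (R u \<omega> powr (p - 1)) \<partial>M))"
    by (subst nn_integral_sum) (auto intro!: sum.cong nn_integral_add)
  also have "\<dots> \<le> (\<Sum>u\<in>U. (\<integral>\<^sup>+\<omega>. ennreal (X u \<omega> powr p) \<partial>M) +
      ennreal (expectation (X u) * (\<Sum>v\<in>U. expectation (X v)) powr (p - 1)))"
  proof (intro sum_mono add_left_mono)
    fix u assume u: "u \<in> U"
    have iv: "indep_var borel (X u) borel (R u)"
      unfolding R_def by (rule indep_vars_sum) (use U u ind in \<open>auto simp: insert_absorb\<close>)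
    have "(\<integral>\<^sup>+\<omega>. ennreal (X u \<omega>) * ennreal (R u \<omega> powr (p - 1)) \<partial>M)
        = (\<integral>\<^sup>+\<omega>. (\<integral>\<^sup>+\<omega>'. ennreal (X u \<omega>) * ennreal (R u \<omega>' powr (p - 1)) \<partial>M) \<partial>M)"
      using indep_var_nn_integral_freeze[OF iv, of "\<lambda>(x, y). ennreal x * ennreal (y powr (p - 1))"] by simp
    also have "\<dots> = (\<integral>\<^sup>+\<omega>. ennreal (X u \<omega>) * (\<integral>\<^sup>+\<omega>'. ennreal (R u \<omega>' powr (p - 1)) \<partial>M) \<partial>M)"
      using u by (intro nn_integral_cong nn_integral_cmult) auto
    also have "\<dots> = (\<integral>\<^sup>+\<omega>. ennreal (X u \<omega>) \<partial>M) * (\<integral>\<^sup>+\<omega>'. ennreal (R u \<omega>' powr (p - 1)) \<partial>M)"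
      using u by (intro nn_integral_multc) auto
    also have "\<dots> \<le> ennreal (expectation (X u)) * ennreal (expectation (R u) powr (p - 1))"
      using nn_integral_eq_integral[OF int[OF u]] nn[OF u] nn_integral_powr_le[OF Rint Rnn, of "p - 1" u] p
      by (intro mult_mono) (auto simp: AE_I2)
    also have "\<dots> = ennreal (expectation (X u) * expectation (R u) powr (p - 1))"
      using nn[OF u] by (intro ennreal_mult[symmetric]) (auto intro!: integral_nonneg_AE AE_I2)
    also have "\<dots> \<le> ennreal (expectation (X u) * (\<Sum>v\<in>U. expectation (X v)) powr (p - 1))"
    proof (intro ennreal_leI mult_left_mono powr_mono2)
      have "expectation (R u) = (\<Sum>v\<in>U - {u}. expectation (X v))"
        unfolding R_def using int by (intro Bochner_Integration.integral_sum) auto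
      also have "\<dots> \<le> (\<Sum>v\<in>U. expectation (X v))"
        using U nn by (intro sum_mono2) (auto intro!: integral_nonneg_AE AE_I2)
      finally show "expectation (R u) \<le> (\<Sum>v\<in>U. expectation (X v))" .
    qed (use p nn[OF u] Rnn in \<open>auto intro!: integral_nonneg_AE AE_I2\<close>)
    finally show "(\<integral>\<^sup>+\<omega>. ennreal (X u \<omega>) * ennreal (R u \<omega> powr (p - 1)) \<partial>M) \<le>
        ennreal (expectation (X u) * (\<Sum>v\<in>U. expectation (X v)) powr (p - 1))" .
  qed
  also have "\<dots> = (\<Sum>u\<in>U. \<integral>\<^sup>+\<omega>. ennreal (X u \<omega> powr p) \<partial>M) + ennreal (\<Sum>u\<in>U. expectation (X u) * (\<Sum>v\<in>U. expectation (X v)) powr (p - 1))"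
    unfolding sum.distrib using nn by (subst sum_ennreal) (auto intro!: mult_nonneg_nonneg integral_nonneg_AE AE_I2)
  also have "(\<Sum>u\<in>U. expectation (X u) * (\<Sum>v\<in>U. expectation (X v)) powr (p - 1)) = (\<Sum>u\<in>U. expectation (X u)) powr p"
    unfolding sum_distrib_right[symmetric]
    using sum_nonneg[of U "\<lambda>u. expectation (X u)"] nn
    by (cases "(\<Sum>u\<in>U. expectation (X u)) = 0") (auto simp: powr_diff integral_nonneg_AE AE_I2)
  finally show ?thesis .
qed

text \<open>The variables are added one at a time. In the expansion of the new power the linear term
  is the centred new variable times a function of the independent earlier sum, so its expectation is
  0.\<close>

lemma von_Bahr_Esseen:
  fixes X :: "'i \<Rightarrow> 'a \<Rightarrow> real"
  assumes U: "finite U" and ind: "indep_vars (\<lambda>_. borel) X U"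
    and int: "\<And>u. u \<in> U \<Longrightarrow> integrable M (X u)" "\<And>u. u \<in> U \<Longrightarrow> integrable M (\<lambda>\<omega>. \<bar>X u \<omega>\<bar> powr p)"
    and zero: "\<And>u. u \<in> U \<Longrightarrow> expectation (X u) = 0" and p: "1 < p" "p \<le> 2"
  shows "integrable M (\<lambda>\<omega>. \<bar>\<Sum>u\<in>U. X u \<omega>\<bar> powr p) \<and>
    (\<integral>\<omega>. \<bar>\<Sum>u\<in>U. X u \<omega>\<bar> powr p \<partial>M) \<le> 2 * p * (\<Sum>u\<in>U. \<integral>\<omega>. \<bar>X u \<omega>\<bar> powr p \<partial>M)"
  using U ind int zero
proof (induction U rule: finite_induct)
  case empty
  then show ?case by simp
next
  case (insert v U)
  let ?S = "\<lambda>\<omega>. \<Sum>u\<in>U. X u \<omega>"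
  have ivs: "indep_vars (\<lambda>_. borel) X U" using insert.prems(1) by (rule indep_vars_subset) auto
  have IH: "integrable M (\<lambda>\<omega>. \<bar>?S \<omega>\<bar> powr p)"
    "(\<integral>\<omega>. \<bar>?S \<omega>\<bar> powr p \<partial>M) \<le> 2 * p * (\<Sum>u\<in>U. \<integral>\<omega>. \<bar>X u \<omega>\<bar> powr p \<partial>M)"
    using insert.IH[OF ivs] insert.prems by auto
  have [measurable]: "X u \<in> borel_measurable M" if "u \<in> insert v U" for u
    using insert.prems(2)[OF that] by auto
  have [measurable]: "X v \<in> borel_measurable M" "?S \<in> borel_measurable M" by auto
  define \<sigma> where "\<sigma> z = sgn z * \<bar>z\<bar> powr (p - 1)" for z :: real
  have [measurable]: "\<sigma> \<in> borel_measurable borel" unfolding \<sigma>_def by measurable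
  have si: "integrable M (\<lambda>\<omega>. \<sigma> (?S \<omega>))"
  proof (rule Bochner_Integration.integrable_bound)
    show "integrable M (\<lambda>\<omega>. 1 + \<bar>?S \<omega>\<bar> powr p)" using IH by auto
    show "AE \<omega> in M. norm (\<sigma> (?S \<omega>)) \<le> norm (1 + \<bar>?S \<omega>\<bar> powr p)"
    proof (rule AE_I2)
      fix \<omega>
      have "\<bar>\<sigma> (?S \<omega>)\<bar> \<le> \<bar>?S \<omega>\<bar> powr (p - 1)" by (auto simp: \<sigma>_def abs_mult sgn_if)
      also have "\<dots> \<le> 1 + \<bar>?S \<omega>\<bar> powr p" using p by (intro powr_le_one_plus) auto
      finally show "norm (\<sigma> (?S \<omega>)) \<le> norm (1 + \<bar>?S \<omega>\<bar> powr p)" by simp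
    qed
  qed simp
  have "indep_var borel (X v) borel ?S"
    using insert by (intro indep_vars_sum) auto
  then have iv: "indep_var borel (X v) borel (\<lambda>\<omega>. \<sigma> (?S \<omega>))"
    using indep_var_compose[of borel "X v" borel ?S "\<lambda>x. x" borel \<sigma> borel] by (simp add: comp_def)
  have pi: "integrable M (\<lambda>\<omega>. X v \<omega> * \<sigma> (?S \<omega>))"
    using insert.prems si by (intro indep_var_integrable[OF iv]) auto
  have p0: "(\<integral>\<omega>. X v \<omega> * \<sigma> (?S \<omega>) \<partial>M) = 0"
    using insert.prems si by (subst indep_var_lebesgue_integral[OF iv]) auto
  let ?B = "\<lambda>\<omega>. \<bar>?S \<omega>\<bar> powr p + p * (X v \<omega> * \<sigma> (?S \<omega>)) + 2 * p * \<bar>X v \<omega>\<bar> powr p"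
  have Bi: "integrable M ?B" using IH(1) pi insert.prems(3)[of v] by auto
  have le: "\<bar>\<Sum>u\<in>insert v U. X u \<omega>\<bar> powr p \<le> ?B \<omega>" for \<omega>
    using abs_powr_add_le[OF p, of "?S \<omega>" "X v \<omega>"] insert.hyps by (simp add: \<sigma>_def add.commute mult.commute mult.left_commute)
  have i: "integrable M (\<lambda>\<omega>. \<bar>\<Sum>u\<in>insert v U. X u \<omega>\<bar> powr p)"
  proof (rule Bochner_Integration.integrable_bound[OF Bi])
    show "AE \<omega> in M. norm (\<bar>\<Sum>u\<in>insert v U. X u \<omega>\<bar> powr p) \<le> norm (?B \<omega>)"
      using order_trans[OF le abs_ge_self] by (intro AE_I2) (simp only: real_norm_def abs_of_nonneg[OF powr_ge_zero])
  qed measurable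
  have "(\<integral>\<omega>. \<bar>\<Sum>u\<in>insert v U. X u \<omega>\<bar> powr p \<partial>M) \<le> (\<integral>\<omega>. ?B \<omega> \<partial>M)"
    by (intro integral_mono i Bi le)
  also have "\<dots> = (\<integral>\<omega>. \<bar>?S \<omega>\<bar> powr p \<partial>M) + 2 * p * (\<integral>\<omega>. \<bar>X v \<omega>\<bar> powr p \<partial>M)"
    using IH(1) pi insert.prems(3)[of v] p0 by simp
  finally show ?case using i IH(2) insert.hyps by (simp add: algebra_simps)
qed

end

section \<open>One-sided derivatives of moments\<close>

text \<open>A fixed null sequence of positive numbers. One-sided derivatives at 1 are taken along
  it, so that dominated convergence applies; it also supplies the countably many error bounds of
  almost sure statements.\<close>

definition step :: "nat \<Rightarrow> real" where "step n = inverse (real (Suc n))"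

lemma step_pos: "step n > 0" by (simp add: step_def)

lemma step_tendsto: "step \<longlonglongrightarrow> 0"
  unfolding step_def by (rule LIMSEQ_inverse_real_of_nat)

text \<open>Difference quotients of a convex function increase, so that the quotient at one fixed
  increment bounds all those at smaller increments from above.\<close>

lemma exp_slope_mono:
  fixes c s r :: real
  assumes "0 < s" "s \<le> r"
  shows "(exp (s * c) - 1) / s \<le> (exp (r * c) - 1) / r"
proof -
  have "exp (r * c) powr (s / r) * 1 powr (1 - s / r) \<le> (s / r) * exp (r * c) + (1 - s / r) * 1"
    using assms by (intro Youngs_inequality_0) auto
  then have "exp (s * c) - 1 \<le> (s / r) * (exp (r * c) - 1)"
    using assms by (simp add: powr_def algebra_simps)
  then show ?thesis using assms by (simp add: field_simps)
qed

lemma exp_slope_ge: "0 < s \<Longrightarrow> c \<le> (exp (s * c) - 1) / s" for c s :: real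
  using exp_ge_add_one_self[of "s * c"] by (simp add: field_simps)

lemma exp_slope_tendsto: "(\<lambda>n. (exp (step n * c) - 1) / step n) \<longlonglongrightarrow> c"
proof -
  have "((\<lambda>x. exp (x * c)) has_real_derivative c) (at 0)"
    by (auto intro!: derivative_eq_intros)
  then have "((\<lambda>h. (exp (h * c) - 1) / h) \<longlongrightarrow> c) (at 0)"
    by (simp add: has_field_derivative_iff)
  moreover have "filterlim step (at 0) sequentially"
    using step_tendsto step_pos by (auto simp: filterlim_at less_imp_neq[symmetric])
  ultimately show ?thesis by (rule filterlim_compose)
qed

lemma xlnx_ge: "0 \<le> t \<Longrightarrow> t - 1 \<le> t * ln t" for t :: real
proof (cases "t = 0")
  case False
  assume "0 \<le> t"
  then have "ln (1 / t) \<le> 1 / t - 1" using False by (intro ln_le_minus_one) auto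
  then have "t * (1 - 1 / t) \<le> t * ln t" using False \<open>0 \<le> t\<close> by (intro mult_left_mono) (auto simp: ln_div)
  then show ?thesis using False by (simp add: algebra_simps)
qed simp

text \<open>The sign of \<open>c\<close> selects the side of 1 on which the derivative is taken. The
  case \<open>t = 0\<close> is covered because the factor \<open>t\<close> removes the default value
  of \<open>ln 0\<close>.\<close>

lemma powr_slope_eq:
  fixes t c s :: real
  assumes "0 \<le> t"
  shows "(t powr (1 + c * s) - t) / s = t * ((exp (s * (c * ln t)) - 1) / s)"
proof (cases "t = 0")
  case False
  then have "t powr (1 + c * s) = t * exp (s * (c * ln t))"
    using assms by (simp add: powr_add powr_def exp_add algebra_simps)
  then show ?thesis by (simp add: algebra_simps diff_divide_distrib)
qed simp

text \<open>Each quotient lies between its limit \<open>c * (t * ln t)\<close> and the quotient at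
  the increment \<open>r\<close>, by convexity; both are integrable and together dominate the
  sequence.\<close>

lemma (in prob_space) moment_derivative_aux:
  fixes X :: "'a \<Rightarrow> real" and c r :: real
  assumes X: "integrable M X" "\<And>\<omega>. \<omega> \<in> space M \<Longrightarrow> 0 \<le> X \<omega>"
    and r: "0 < r" "integrable M (\<lambda>\<omega>. X \<omega> powr (1 + c * r))"
    and xl: "integrable M (\<lambda>\<omega>. X \<omega> * ln (X \<omega>))"
  shows "(\<lambda>n. ((\<integral>\<omega>. X \<omega> powr (1 + c * step n) \<partial>M) - expectation X) / step n) \<longlonglongrightarrow> c * (\<integral>\<omega>. X \<omega> * ln (X \<omega>) \<partial>M)"
    and "eventually (\<lambda>n. integrable M (\<lambda>\<omega>. X \<omega> powr (1 + c * step n))) sequentially"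
proof -
  have [measurable]: "X \<in> borel_measurable M" using X by auto
  define K where "K s t = t * ((exp (s * (c * ln t)) - 1) / s)" for s t :: real
  have [measurable]: "K s \<in> borel_measurable borel" for s unfolding K_def by measurable
  have Kr: "integrable M (\<lambda>\<omega>. K r (X \<omega>))"
  proof -
    have "integrable M (\<lambda>\<omega>. (X \<omega> powr (1 + c * r) - X \<omega>) / r)" using X r by auto
    then show ?thesis
      by (rule Bochner_Integration.integrable_cong[THEN iffD1, OF refl, rotated])
        (use X(2) in \<open>simp add: K_def powr_slope_eq\<close>)
  qed
  have bnd: "\<bar>K s t\<bar> \<le> \<bar>K r t\<bar> + \<bar>c * (t * ln t)\<bar>" if "0 \<le> t" "0 < s" "s \<le> r" for s t
  proof -
    have "t * (c * ln t) \<le> K s t" unfolding K_def using that by (intro mult_left_mono exp_slope_ge)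
    moreover have "K s t \<le> K r t" unfolding K_def using that by (intro mult_left_mono exp_slope_mono)
    ultimately show ?thesis by (simp add: mult.left_commute abs_if split: if_splits)
  qed
  obtain N where N: "\<And>n. n \<ge> N \<Longrightarrow> step n \<le> r"
    using order_tendstoD(2)[OF step_tendsto r(1)] by (auto simp: eventually_sequentially intro: less_imp_le)
  have dom: "integrable M (\<lambda>\<omega>. \<bar>K r (X \<omega>)\<bar> + \<bar>c * (X \<omega> * ln (X \<omega>))\<bar>)"
    using Kr xl by auto
  have Ki: "integrable M (\<lambda>\<omega>. K (step n) (X \<omega>))" if "n \<ge> N" for n
    using bnd[OF X(2) step_pos N[OF that]]
    by (intro Bochner_Integration.integrable_bound[OF dom]) (auto intro!: AE_I2)
  have pw: "X \<omega> powr (1 + c * step n) = X \<omega> + step n * K (step n) (X \<omega>)" if "\<omega> \<in> space M" for \<omega> n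
    using powr_slope_eq[OF X(2)[OF that], of c "step n", folded K_def] step_pos[of n]
    by (simp add: field_simps del: times_divide_eq_right)
  have pint: "integrable M (\<lambda>\<omega>. X \<omega> powr (1 + c * step n))" if "n \<ge> N" for n
  proof -
    have "integrable M (\<lambda>\<omega>. X \<omega> + step n * K (step n) (X \<omega>))" using X(1) Ki[OF that] by auto
    then show ?thesis by (rule Bochner_Integration.integrable_cong[THEN iffD1, OF refl, rotated]) (simp add: pw)
  qed
  then show "eventually (\<lambda>n. integrable M (\<lambda>\<omega>. X \<omega> powr (1 + c * step n))) sequentially"
    by (auto simp: eventually_sequentially)
  have "(\<lambda>n. \<integral>\<omega>. K (step (n + N)) (X \<omega>) \<partial>M) \<longlonglongrightarrow> (\<integral>\<omega>. c * (X \<omega> * ln (X \<omega>)) \<partial>M)"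
  proof (rule integral_dominated_convergence[OF _ _ dom])
    show "AE \<omega> in M. (\<lambda>n. K (step (n + N)) (X \<omega>)) \<longlonglongrightarrow> c * (X \<omega> * ln (X \<omega>))"
    proof (rule AE_I2)
      fix \<omega> assume "\<omega> \<in> space M"
      have "(\<lambda>n. K (step n) (X \<omega>)) \<longlonglongrightarrow> X \<omega> * (c * ln (X \<omega>))"
        unfolding K_def by (intro tendsto_mult tendsto_const exp_slope_tendsto)
      then show "(\<lambda>n. K (step (n + N)) (X \<omega>)) \<longlonglongrightarrow> c * (X \<omega> * ln (X \<omega>))"
        using LIMSEQ_ignore_initial_segment[of _ _ N] by (simp add: mult.left_commute)
    qed
    show "AE \<omega> in M. norm (K (step (n + N)) (X \<omega>)) \<le> \<bar>K r (X \<omega>)\<bar> + \<bar>c * (X \<omega> * ln (X \<omega>))\<bar>" for n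
      using bnd[OF X(2) step_pos N[of "n + N"]] by (intro AE_I2) auto
  qed auto
  then have "(\<lambda>n. \<integral>\<omega>. K (step n) (X \<omega>) \<partial>M) \<longlonglongrightarrow> c * (\<integral>\<omega>. X \<omega> * ln (X \<omega>) \<partial>M)"
    by (simp add: LIMSEQ_offset)
  then show "(\<lambda>n. ((\<integral>\<omega>. X \<omega> powr (1 + c * step n) \<partial>M) - expectation X) / step n) \<longlonglongrightarrow> c * (\<integral>\<omega>. X \<omega> * ln (X \<omega>) \<partial>M)"
  proof (rule Lim_transform_eventually)
    show "\<forall>\<^sub>F n in sequentially. (\<integral>\<omega>. K (step n) (X \<omega>) \<partial>M) = ((\<integral>\<omega>. X \<omega> powr (1 + c * step n) \<partial>M) - expectation X) / step n"
      using eventually_ge_at_top[of N]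
    proof eventually_elim
      case (elim n)
      have "(\<integral>\<omega>. X \<omega> powr (1 + c * step n) \<partial>M) = (\<integral>\<omega>. X \<omega> + step n * K (step n) (X \<omega>) \<partial>M)"
        by (intro Bochner_Integration.integral_cong) (auto simp: pw)
      also have "\<dots> = expectation X + step n * (\<integral>\<omega>. K (step n) (X \<omega>) \<partial>M)" using X Ki[OF elim] by simp
      finally show ?case using step_pos[of n] by simp
    qed
  qed
qed

text \<open>A moment of order above 1 controls \<open>t * ln t\<close> from above through the slope
  at \<open>q - 1\<close>, while \<open>t - 1 \<le> t * ln t\<close> controls it from below.\<close>

lemma (in prob_space) moment_derivative:
  fixes X :: "'a \<Rightarrow> real"
  assumes X: "integrable M X" "\<And>\<omega>. \<omega> \<in> space M \<Longrightarrow> 0 \<le> X \<omega>"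
    and q: "1 < q" "integrable M (\<lambda>\<omega>. X \<omega> powr q)"
  shows "integrable M (\<lambda>\<omega>. X \<omega> * ln (X \<omega>))"
    and "(\<lambda>n. ((\<integral>\<omega>. X \<omega> powr (1 + step n) \<partial>M) - expectation X) / step n) \<longlonglongrightarrow> (\<integral>\<omega>. X \<omega> * ln (X \<omega>) \<partial>M)"
    and "(\<lambda>n. ((\<integral>\<omega>. X \<omega> powr (1 - step n) \<partial>M) - expectation X) / step n) \<longlonglongrightarrow> - (\<integral>\<omega>. X \<omega> * ln (X \<omega>) \<partial>M)"
    and "eventually (\<lambda>n. integrable M (\<lambda>\<omega>. X \<omega> powr (1 + step n))) sequentially"
    and "eventually (\<lambda>n. integrable M (\<lambda>\<omega>. X \<omega> powr (1 - step n))) sequentially"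
proof -
  have [measurable]: "X \<in> borel_measurable M" using X by auto
  show xl: "integrable M (\<lambda>\<omega>. X \<omega> * ln (X \<omega>))"
  proof (rule Bochner_Integration.integrable_bound)
    show "integrable M (\<lambda>\<omega>. 1 + (X \<omega> powr q + X \<omega>) / (q - 1))" using X q by auto
    show "AE \<omega> in M. norm (X \<omega> * ln (X \<omega>)) \<le> norm (1 + (X \<omega> powr q + X \<omega>) / (q - 1))"
    proof (rule AE_I2)
      fix \<omega> assume w: "\<omega> \<in> space M"
      let ?t = "X \<omega>"
      have t: "0 \<le> ?t" using X w by auto
      have "?t * ln ?t \<le> ?t * ((exp ((q - 1) * (1 * ln ?t)) - 1) / (q - 1))"
        using t q exp_slope_ge[of "q - 1" "ln ?t"] by (intro mult_left_mono) auto
      also have "\<dots> = (?t powr q - ?t) / (q - 1)"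
        using powr_slope_eq[OF t, of 1 "q - 1", symmetric] by simp
      also have "\<dots> \<le> (?t powr q + ?t) / (q - 1)" using t q by (intro divide_right_mono) auto
      finally have "?t * ln ?t \<le> (?t powr q + ?t) / (q - 1)" .
      moreover have "- 1 \<le> ?t * ln ?t" using xlnx_ge[OF t] t by linarith
      moreover have "0 \<le> (?t powr q + ?t) / (q - 1)" using t q by auto
      ultimately show "norm (?t * ln ?t) \<le> norm (1 + (?t powr q + ?t) / (q - 1))" by auto
    qed
  qed simp
  have "integrable M (\<lambda>\<omega>. X \<omega> powr (1 + 1 * (q - 1)))" using q by simp
  from moment_derivative_aux[OF X _ this xl] q
  show "(\<lambda>n. ((\<integral>\<omega>. X \<omega> powr (1 + step n) \<partial>M) - expectation X) / step n) \<longlonglongrightarrow> (\<integral>\<omega>. X \<omega> * ln (X \<omega>) \<partial>M)"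
    "eventually (\<lambda>n. integrable M (\<lambda>\<omega>. X \<omega> powr (1 + step n))) sequentially" by auto
  \<comment> \<open>To the left of 1 the comparison moment has order 1/2, which the mean
    controls.\<close>
  have "integrable M (\<lambda>\<omega>. X \<omega> powr (1 + (- 1) * (1 / 2)))"
  proof (rule Bochner_Integration.integrable_bound)
    show "integrable M (\<lambda>\<omega>. 1 + X \<omega>)" using X by auto
    show "AE \<omega> in M. norm (X \<omega> powr (1 + (- 1) * (1 / 2))) \<le> norm (1 + X \<omega>)"
      using powr_le_one_plus[OF X(2), of _ "1/2" 1] X(2) by (intro AE_I2) (auto simp: )
  qed simp
  from moment_derivative_aux[OF X _ this xl]
  show "(\<lambda>n. ((\<integral>\<omega>. X \<omega> powr (1 - step n) \<partial>M) - expectation X) / step n) \<longlonglongrightarrow> - (\<integral>\<omega>. X \<omega> * ln (X \<omega>) \<partial>M)"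
    "eventually (\<lambda>n. integrable M (\<lambda>\<omega>. X \<omega> powr (1 - step n))) sequentially" by auto
qed

section \<open>Words and cylinders\<close>

abbreviation words :: "'a set \<Rightarrow> nat \<Rightarrow> 'a list set" where
  "words S n \<equiv> {u. set u \<subseteq> S \<and> length u = n}"

lemma finite_words: "finite S \<Longrightarrow> finite (words S n)"
  by (rule finite_lists_length_eq)

lemma words_0: "words S 0 = {[]}"
  by auto

lemma sum_words_Suc:
  fixes F :: "'a list \<Rightarrow> 'b::comm_monoid_add"
  assumes "finite S"
  shows "(\<Sum>v\<in>words S (Suc n). F v) = (\<Sum>a\<in>S. \<Sum>v\<in>words S n. F (a # v))"
proof -
  have *: "words S (Suc n) = (\<lambda>(a, v). a # v) ` (S \<times> words S n)"
    by (auto simp: image_iff length_Suc_conv)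
  have "(\<Sum>v\<in>words S (Suc n). F v) = (\<Sum>z\<in>S \<times> words S n. F (fst z # snd z))"
    unfolding * by (subst sum.reindex) (auto simp: inj_on_def case_prod_beta)
  also have "\<dots> = (\<Sum>a\<in>S. \<Sum>v\<in>words S n. F (a # v))"
    by (subst sum.cartesian_product) (simp add: case_prod_beta)
  finally show ?thesis .
qed

lemma sum_words_snoc:
  fixes F :: "'a list \<Rightarrow> 'b::comm_monoid_add"
  assumes "finite S"
  shows "(\<Sum>v\<in>words S (Suc n). F v) = (\<Sum>v\<in>words S n. \<Sum>a\<in>S. F (v @ [a]))"
proof -
  have *: "words S (Suc n) = (\<lambda>(v, a). v @ [a]) ` (words S n \<times> S)"
  proof (intro equalityI subsetI)
    fix u assume "u \<in> words S (Suc n)"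
    then show "u \<in> (\<lambda>(v, a). v @ [a]) ` (words S n \<times> S)"
      by (intro image_eqI[of _ _ "(butlast u, last u)"])
        (auto dest: in_set_butlastD intro!: subsetD[OF _ last_in_set] append_butlast_last_id[symmetric])
  qed auto
  have "(\<Sum>v\<in>words S (Suc n). F v) = (\<Sum>z\<in>words S n \<times> S. F (fst z @ [snd z]))"
    unfolding * by (subst sum.reindex) (auto simp: inj_on_def case_prod_beta)
  also have "\<dots> = (\<Sum>v\<in>words S n. \<Sum>a\<in>S. F (v @ [a]))"
    by (subst sum.cartesian_product) (simp add: case_prod_beta)
  finally show ?thesis .
qed

lemma sum_words_prod:
  fixes k :: "nat \<Rightarrow> 'a \<Rightarrow> 'b::comm_semiring_1"
  assumes "finite S"
  shows "(\<Sum>v\<in>words S n. \<Prod>l<n. k l (v ! l)) = (\<Prod>l<n. \<Sum>a\<in>S. k l a)"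
proof (induction n)
  case (Suc n)
  have "(\<Sum>v\<in>words S (Suc n). \<Prod>l<Suc n. k l (v ! l))
      = (\<Sum>v\<in>words S n. \<Sum>a\<in>S. (\<Prod>l<n. k l (v ! l)) * k n a)"
    unfolding sum_words_snoc[OF assms]
    by (intro sum.cong refl) (auto simp: nth_append intro!: prod.cong)
  also have "\<dots> = (\<Prod>l<Suc n. \<Sum>a\<in>S. k l a)"
    by (simp add: sum_distrib_left[symmetric] sum_distrib_right[symmetric] Suc)
  finally show ?case .
qed (simp only: words_0 sum.insert finite.emptyI, simp)

lemma mem_sstart_iff: "x \<in> streams S \<Longrightarrow> x \<in> sstart S u \<longleftrightarrow> stake (length u) x = u"
  by (simp add: sstart_eq list_eq_iff_nth_eq)

lemma sstart_eq_Collect: "u \<in> lists S \<Longrightarrow> sstart S u = {x \<in> streams S. stake (length u) x = u}"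
  using sstart_in_streams[of u S] mem_sstart_iff by blast

lemma stake_in_words: "x \<in> streams S \<Longrightarrow> stake n x \<in> words S n"
  by (auto simp: in_set_conv_nth snth_in)

lemma sets_sstart_count_space:
  assumes "countable S" "u \<in> lists S"
  shows "sstart S u \<in> sets (stream_space (count_space S))"
proof -
  have "sstart S ` lists S \<union> {{}} \<subseteq> Pow (streams S)"
    by (auto dest: sstart_in_streams del: in_listsD)
  then show ?thesis using assms by (auto simp: sets_stream_space_sstart intro!: sigma_sets.Basic)
qed

lemma sets_stream_space_eq_sigma_sets:
  assumes "countable S"
  shows "sets (stream_space (count_space S)) = sigma_sets (streams S) (sstart S ` lists S \<union> {{}})"
proof -
  have "sstart S ` lists S \<union> {{}} \<subseteq> Pow (streams S)"
    by (auto dest: sstart_in_streams del: in_listsD)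
  then show ?thesis using assms by (simp add: sets_stream_space_sstart)
qed

lemma measurable_stake_countable:
  assumes S: "finite S"
  shows "(\<lambda>x. F (stake n x)) \<in> measurable (stream_space (count_space S)) (count_space UNIV)"
proof (rule measurable_compose_countable'[where I="words S n" and f="\<lambda>u _. F u" and g="stake n"])
  show "stake n \<in> measurable (stream_space (count_space S)) (count_space (words S n))"
  proof (subst measurable_count_space_eq2[OF finite_words[OF S]], intro conjI ballI)
    show "stake n \<in> space (stream_space (count_space S)) \<rightarrow> words S n"
      using stake_in_words by (auto simp: space_stream_space simp del: mem_Collect_eq)
    fix u assume u: "u \<in> words S n"
    then have "stake n -` {u} \<inter> space (stream_space (count_space S)) = sstart S u"
      by (subst sstart_eq_Collect) (auto simp: space_stream_space)
    then show "stake n -` {u} \<inter> space (stream_space (count_space S)) \<in> sets (stream_space (count_space S))"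
      using sets_sstart_count_space[of S u] S u by (auto simp: uncountable_infinite countable_finite)
  qed
qed (use S finite_words in \<open>auto intro: countable_finite\<close>)

section \<open>Measures with prescribed cylinder masses\<close>

primrec follow_word :: "('a list \<Rightarrow> 'a) \<Rightarrow> nat \<Rightarrow> 'a list" where
  "follow_word c 0 = []"
| "follow_word c (Suc n) = follow_word c n @ [c (follow_word c n)]"

definition follow :: "('a list \<Rightarrow> 'a) \<Rightarrow> 'a stream" where
  "follow c = to_stream (\<lambda>n. c (follow_word c n))"

lemma stake_follow: "stake n (follow c) = follow_word c n"
  by (induction n) (auto simp: stake_Suc follow_def to_stream_def simp del: stake.simps(2))

lemma follow_in_streams:
  assumes "\<And>u. u \<in> lists S \<Longrightarrow> c u \<in> S"
  shows "follow c \<in> streams S"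
proof -
  have "follow_word c n \<in> lists S" for n by (induction n) (auto simp: assms)
  then show ?thesis by (auto simp: follow_def to_stream_in_streams assms simp del: in_lists_conv_set)
qed

text \<open>That the path begins with \<open>u\<close> constrains only the choices at the proper
  prefixes of \<open>u\<close>, one value at each. Under a product measure its probability is
  therefore a product.\<close>

lemma follow_word_eq_iff: "follow_word c (length u) = u \<longleftrightarrow> (\<forall>l<length u. c (take l u) = u ! l)"
proof (induction u rule: rev_induct)
  case (snoc a u)
  have "follow_word c (length (u @ [a])) = u @ [a] \<longleftrightarrow> follow_word c (length u) = u \<and> c u = a"
    by auto
  also have "\<dots> \<longleftrightarrow> (\<forall>l<length u. c (take l u) = u ! l) \<and> c u = a" by (simp add: snoc)
  also have "\<dots> \<longleftrightarrow> (\<forall>l<length (u @ [a]). c (take l (u @ [a])) = (u @ [a]) ! l)"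
    by (auto simp: nth_append less_Suc_eq)
  finally show ?case .
qed simp

text \<open>Choose, independently for every word \<open>u\<close>, a successor letter with the conditional law given by
  \<open>m\<close>; the path followed from the empty word then has the prescribed law.\<close>

lemma ex_measure_sstart:
  fixes m :: "'a list \<Rightarrow> real"
  assumes S: "finite S" and nn: "\<And>u. u \<in> lists S \<Longrightarrow> 0 \<le> m u"
    and cons: "\<And>u. u \<in> lists S \<Longrightarrow> m u = (\<Sum>a\<in>S. m (u @ [a]))"
  shows "\<exists>N. sets N = sets (stream_space (count_space S)) \<and>
    (\<forall>u\<in>lists S. emeasure N (sstart S u) = ennreal (m u))"
proof (cases "m [] = 0")
  case True
  have "m u = 0" if "u \<in> lists S" for u
    using that
  proof (induction u rule: rev_induct)
    case (snoc a u)
    then have "(\<Sum>a\<in>S. m (u @ [a])) = 0" using cons[of u] by auto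
    then show ?case using snoc.prems nn S by (subst (asm) sum_nonneg_eq_0_iff) auto
  qed (simp add: True)
  then show ?thesis
    by (intro exI[of _ "null_measure (stream_space (count_space S))"]) auto
next
  case False
  then have "S \<noteq> {}" using cons[of "[]"] by auto
  then obtain a0 where a0: "a0 \<in> S" by auto
  \<comment> \<open>Where \<open>m u\<close> vanishes there is no conditional law; the choice of
    \<open>a0\<close> there is arbitrary and only keeps \<open>g u\<close> a probability.\<close>
  define g where "g u a = (if u \<in> lists S \<and> m u \<noteq> 0 then m (u @ [a]) / m u else of_bool (a = a0))" for u a
  have g_nn: "0 \<le> g u a" if "a \<in> S" for u a using nn that by (auto simp: g_def)
  define K where "K u = point_measure S (\<lambda>a. ennreal (g u a))" for u
  have K_prob: "prob_space (K u)" for u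
  proof
    have "(\<Sum>a\<in>S. g u a) = 1"
    proof (cases "u \<in> lists S \<and> m u \<noteq> 0")
      case True
      then show ?thesis using cons[of u] by (simp add: g_def sum_divide_distrib[symmetric])
    next
      case False
      then have "g u = (\<lambda>a. of_bool (a = a0))" by (auto simp: g_def fun_eq_iff)
      then show ?thesis using S a0 by simp
    qed
    then show "emeasure (K u) (space (K u)) = 1"
      using S g_nn by (simp add: K_def space_point_measure emeasure_point_measure_finite sum_ennreal)
  qed
  have sets_K: "sets (K u) = Pow S" "space (K u) = S" for u
    by (simp_all add: K_def sets_point_measure space_point_measure)
  interpret product_prob_space K "lists S"
    by (intro product_prob_spaceI K_prob)
  let ?P = "PiM (lists S) K" and ?SS = "stream_space (count_space S)"
  have in_S: "follow c \<in> streams S" if "c \<in> space ?P" for c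
    using that by (intro follow_in_streams) (auto simp: space_PiM sets_K PiE_iff)
  have pre: "follow -` sstart S u \<inter> space ?P
      = {c\<in>space ?P. \<forall>v\<in>(\<lambda>l. take l u) ` {..<length u}. c v \<in> {u ! length v}}" if "u \<in> lists S" for u
    using in_S by (auto simp: mem_sstart_iff stake_follow follow_word_eq_iff)
  have J: "(\<lambda>l. take l u) ` {..<length u} \<subseteq> lists S" if "u \<in> lists S" for u
    using that by (auto dest: in_set_takeD)
  have X: "{u ! length v} \<in> sets (K v)" if "u \<in> lists S" "v \<in> (\<lambda>l. take l u) ` {..<length u}" for u v
    using that by (auto simp: sets_K in_lists_conv_set)
  have meas: "follow \<in> measurable ?P ?SS"
    unfolding measurable_cong_sets[OF refl sets_stream_space_sstart[OF countable_finite[OF S]]]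
  proof (rule measurable_measure_of)
    show "sstart S ` lists S \<union> {{}} \<subseteq> Pow (streams S)"
      by (auto dest: sstart_in_streams del: in_listsD)
    show "follow \<in> space ?P \<rightarrow> streams S" using in_S by auto
    fix B assume "B \<in> sstart S ` lists S \<union> {{}}"
    then consider "B = {}" | u where "u \<in> lists S" "B = sstart S u" by blast
    then show "follow -` B \<inter> space ?P \<in> sets ?P"
    proof cases
      case 2
      show ?thesis unfolding 2 pre[OF 2(1)]
        using J[OF 2(1)] X[OF 2(1)] by (intro sets.sets_Collect_finite_All) (auto intro!: sets_Collect_single' simp: sets_K)
    qed simp
  qed
  have em: "emeasure (distr ?P ?SS follow) (sstart S u) = ennreal (m u / m [])" if "u \<in> lists S" for u
  proof -
    have "emeasure (distr ?P ?SS follow) (sstart S u) = emeasure ?P (follow -` sstart S u \<inter> space ?P)"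
      using that S by (intro emeasure_distr meas sets_sstart_count_space) (auto intro: countable_finite)
    also have "\<dots> = (\<Prod>v\<in>(\<lambda>l. take l u) ` {..<length u}. emeasure (K v) {u ! length v})"
      unfolding pre[OF that] by (intro emeasure_PiM_Collect J X that) auto
    also have "\<dots> = (\<Prod>l<length u. emeasure (K (take l u)) {u ! l})"
      by (subst prod.reindex) (auto intro!: inj_on_inverseI[of _ length] prod.cong)
    also have "\<dots> = (\<Prod>l<length u. ennreal (g (take l u) (u ! l)))"
      using that S by (intro prod.cong refl) (auto simp: K_def emeasure_point_measure_finite in_lists_conv_set)
    also have "\<dots> = ennreal (\<Prod>l<length u. g (take l u) (u ! l))"
      using that by (intro prod_ennreal g_nn) (auto simp: in_lists_conv_set)
    also have "(\<Prod>l<length u. g (take l u) (u ! l)) = m u / m []"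
      using that
    proof (induction u rule: rev_induct)
      case (snoc a u)
      then have u: "u \<in> lists S" "a \<in> S" by auto
      have "(\<Prod>l<length (u @ [a]). g (take l (u @ [a])) ((u @ [a]) ! l)) =
          (\<Prod>l<length u. g (take l u) (u ! l)) * g u a"
        by (auto simp: nth_append intro!: prod.cong)
      also have "\<dots> = m u / m [] * g u a" using snoc u by simp
      also have "\<dots> = m (u @ [a]) / m []"
      proof (cases "m u = 0")
        case True
        then have "(\<Sum>a\<in>S. m (u @ [a])) = 0" using cons[of u] u by auto
        then have "m (u @ [a]) = 0" using u nn S by (subst (asm) sum_nonneg_eq_0_iff) auto
        then show ?thesis using True by simp
      qed (use u in \<open>auto simp: g_def\<close>)
      finally show ?case .
    qed (use False in simp)
    finally show ?thesis .
  qed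
  have "emeasure (scale_measure (ennreal (m [])) (distr ?P ?SS follow)) (sstart S u) = ennreal (m u)" if "u \<in> lists S" for u
    using em[OF that] nn[of "[]"] nn[OF that] False by (simp add: ennreal_mult[symmetric])
  then show ?thesis
    by (intro exI[of _ "scale_measure (ennreal (m [])) (distr ?P ?SS follow)"]) auto
qed

lemma sets_mandelbrot_measure:
  assumes "countable S"
  shows "sets (mandelbrot_measure S w) = sets (stream_space (count_space S))"
proof -
  have *: "sstart S ` lists S \<subseteq> Pow (streams S)"
    by (auto dest: sstart_in_streams del: in_listsD)
  have "sigma_sets (streams S) (sstart S ` lists S) = sigma_sets (streams S) (sstart S ` lists S \<union> {{}})"
    by (intro sigma_sets_eqI) (auto intro: sigma_sets.Basic sigma_sets.Empty)
  then show ?thesis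
    unfolding mandelbrot_measure_def sets_extend_measure[OF *] sets_stream_space_eq_sigma_sets[OF assms] .
qed

text \<open>\<open>extend_measure\<close> takes the prescribed values only if some measure has them;
  non-negativity and consistency of the cylinder masses provide one.\<close>

lemma emeasure_mandelbrot_measure:
  assumes S: "finite S"
    and nn: "\<And>u. u \<in> lists S \<Longrightarrow> 0 \<le> Q_weight w [] u * Y_limit S w u"
    and cons: "\<And>u. u \<in> lists S \<Longrightarrow> Y_limit S w u = (\<Sum>a\<in>S. w u a * Y_limit S w (u @ [a]))"
    and u: "u \<in> lists S"
  shows "emeasure (mandelbrot_measure S w) (sstart S u) = ennreal (Q_weight w [] u * Y_limit S w u)"
proof -
  have Q: "Q_weight w [] (u @ [a]) = Q_weight w [] u * w u a" for u a
    by (auto simp: Q_weight_def nth_append intro!: prod.cong)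
  obtain N where N: "sets N = sets (stream_space (count_space S))"
    "\<And>u. u \<in> lists S \<Longrightarrow> emeasure N (sstart S u) = ennreal (Q_weight w [] u * Y_limit S w u)"
    using ex_measure_sstart[of S "\<lambda>u. Q_weight w [] u * Y_limit S w u"] S nn cons
    by (auto simp: Q sum_distrib_left mult.assoc)
  have *: "sstart S ` lists S \<subseteq> Pow (streams S)"
    by (auto dest: sstart_in_streams del: in_listsD)
  note sN = N(1)[folded sets_mandelbrot_measure[OF countable_finite[OF S], of w]]
  show ?thesis
  proof (rule emeasure_extend_measure[OF mandelbrot_measure_def _ * _ _ u])
    show "positive (sets (mandelbrot_measure S w)) (emeasure N)"
      "countably_additive (sets (mandelbrot_measure S w)) (emeasure N)"
      unfolding sN[symmetric] by (rule emeasure_positive emeasure_countably_additive)+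
  qed (use N in auto)
qed

section \<open>Kolmogorov--Sinai entropy of Bernoulli shifts\<close>

text \<open>Fekete's lemma: cut \<open>n\<close> into blocks of a length \<open>N\<close> that
  almost attains the infimum \<open>I\<close>.\<close>

lemma Fekete_convergent:
  fixes a :: "nat \<Rightarrow> real"
  assumes nn: "\<And>n. 0 \<le> a n" and sub: "\<And>m n. a (m + n) \<le> a m + a n"
  shows "convergent (\<lambda>n. a n / real n)"
proof -
  have mult: "a (k * n) \<le> real k * a n + a 0" for k n
  proof (induction k)
    case (Suc k)
    then show ?case using sub[of n "k * n"] by (simp add: algebra_simps)
  qed simp
  define I where "I = (INF n\<in>{1..}. a n / real n)"
  have bdd: "bdd_below ((\<lambda>n. a n / real n) ` {1..})"
    using nn by (intro bdd_belowI[of _ 0]) auto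
  have low: "I \<le> a n / real n" if "n \<ge> 1" for n
    unfolding I_def using that bdd by (intro cINF_lower) auto
  have "(\<lambda>n. a n / real n) \<longlonglongrightarrow> I"
  proof (rule LIMSEQ_I)
    fix e :: real assume e: "e > 0"
    then obtain N where N: "N \<ge> 1" "a N / real N < I + e / 2"
      using cINF_less_iff[OF _ bdd, of "I + e / 2"] by (auto simp: I_def)
    \<comment> \<open>\<open>B\<close> absorbs the last incomplete block and the value
      \<open>a 0\<close>, which subadditivity does not force to vanish.\<close>
    define B where "B = a 0 + Max (a ` {..<N})"
    obtain n0 where n0: "real n0 > 2 * B / e" using reals_Archimedean2 by blast
    show "\<exists>n0. \<forall>n\<ge>n0. norm (a n / real n - I) < e"
    proof (intro exI allI impI)
      fix n assume n: "n \<ge> max n0 1"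
      let ?k = "n div N" and ?r = "n mod N"
      have "a n = a (?k * N + ?r)" by simp
      also have "\<dots> \<le> real ?k * a N + a 0 + a ?r" using sub[of "?k * N" ?r] mult[of ?k N] by linarith
      also have "a ?r \<le> Max (a ` {..<N})" using N by (intro Max_ge) auto
      finally have "a n \<le> real ?k * a N + B" by (simp add: B_def)
      also have "real ?k * a N \<le> (real n / real N) * a N"
        using N nn[of N] by (intro mult_right_mono of_nat_div_le_of_nat) auto
      finally have "a n \<le> real n * (a N / real N) + B" by simp
      then have "a n / real n \<le> a N / real N + B / real n"
        using n by (simp add: field_simps)
      also have "B / real n < e / 2"
      proof -
        have "2 * B / e < real n" using n0 n by (smt (verit) max.bounded_iff of_nat_mono)
        then show ?thesis using e n by (simp add: field_simps)
      qed
      finally have "a n / real n < I + e" using N by linarith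
      then show "norm (a n / real n - I) < e" using low[of n] n by auto
    qed
  qed
  then show ?thesis by (auto simp: convergent_def)
qed

section \<open>Entropy of finite partitions\<close>

context prob_space
begin

lemma partition_entropy_eq_integral:
  assumes "simple_function M f"
  shows "partition_entropy M f = (\<integral>x. - ln (prob (f -` {f x} \<inter> space M)) \<partial>M)"
  using integral_finite_range(1)[OF assms, of "\<lambda>y. - ln (prob (f -` {y} \<inter> space M))"]
  by (simp add: partition_entropy_def sum_negf)

lemma partition_entropy_nonneg:
  assumes "simple_function M f"
  shows "0 \<le> partition_entropy M f"
proof -
  have "ln (prob A) \<le> 0" for A
    using measure_nonneg[of M A] by (cases "prob A = 0") (auto simp: less_le)
  then show ?thesis
    unfolding partition_entropy_eq_integral[OF assms] by (intro integral_nonneg_AE AE_I2) simp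
qed

lemma sum_prob_partition:
  assumes f: "simple_function M f"
  shows "(\<Sum>y\<in>f ` space M. prob (f -` {y} \<inter> space M)) = 1"
  using integral_finite_range(1)[OF f, of "\<lambda>_. 1"] by (simp add: prob_space)

text \<open>Gibbs' inequality, from \<open>ln x \<le> x - 1\<close>. Every comparison law
  \<open>R\<close>, even a defective one, yields an upper bound for the entropy; the later bounds
  differ only in the choice of \<open>R\<close>.\<close>

lemma partition_entropy_Gibbs:
  assumes f: "simple_function M f"
    and R: "\<And>y. y \<in> f ` space M \<Longrightarrow> 0 \<le> R y" "(\<Sum>y\<in>f ` space M. R y) \<le> 1"
    and pos: "\<And>y. y \<in> f ` space M \<Longrightarrow> 0 < prob (f -` {y} \<inter> space M) \<Longrightarrow> 0 < R y"
  shows "partition_entropy M f \<le> (\<integral>x. - ln (R (f x)) \<partial>M)"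
proof -
  let ?p = "\<lambda>y. prob (f -` {y} \<inter> space M)"
  have "(\<Sum>y\<in>f ` space M. ?p y * ln (R y) - ?p y * ln (?p y)) \<le> (\<Sum>y\<in>f ` space M. R y - ?p y)"
  proof (rule sum_mono)
    fix y assume y: "y \<in> f ` space M"
    show "?p y * ln (R y) - ?p y * ln (?p y) \<le> R y - ?p y"
    proof (cases "?p y = 0")
      case False
      then have p: "?p y > 0" by (simp add: less_le)
      have r: "R y > 0" using pos[OF y p] .
      have "ln (R y / ?p y) \<le> R y / ?p y - 1" using p r by (intro ln_le_minus_one) auto
      then have "?p y * ln (R y / ?p y) \<le> ?p y * (R y / ?p y - 1)" using p by (intro mult_left_mono) auto
      then show ?thesis using p r by (simp add: ln_div algebra_simps)
    qed (use R y in simp)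
  qed
  also have "\<dots> \<le> 0" using R(2) sum_prob_partition[OF f] by (simp add: sum_subtractf)
  finally have "- (\<Sum>y\<in>f ` space M. ?p y * ln (?p y)) \<le> (\<Sum>y\<in>f ` space M. ?p y * - ln (R y))"
    by (simp add: sum_subtractf sum_negf)
  also have "\<dots> = (\<integral>x. - ln (R (f x)) \<partial>M)"
    using integral_finite_range(1)[OF f, of "\<lambda>y. - ln (R y)"] by simp
  finally show ?thesis by (simp add: partition_entropy_def)
qed

lemma AE_prob_fibre_pos:
  assumes e: "simple_function M e"
  shows "AE x in M. prob (e -` {e x} \<inter> space M) > 0"
proof -
  have "AE x in M. \<forall>y\<in>e ` space M. prob (e -` {y} \<inter> space M) = 0 \<longrightarrow> e x \<noteq> y"
  proof (rule AE_finite_allI)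
    show "finite (e ` space M)" using e by (auto simp: simple_function_def)
    fix y assume y: "y \<in> e ` space M"
    show "AE x in M. prob (e -` {y} \<inter> space M) = 0 \<longrightarrow> e x \<noteq> y"
    proof (cases "prob (e -` {y} \<inter> space M) = 0")
      case True
      then have "e -` {y} \<inter> space M \<in> null_sets M"
        using e y by (auto simp: emeasure_eq_measure simple_function_def)
      then have "AE x in M. x \<notin> e -` {y} \<inter> space M" by (rule AE_not_in)
      then show ?thesis using AE_space by eventually_elim auto
    qed simp
  qed
  then show ?thesis using AE_space
    by eventually_elim (auto simp: less_le)
qed

text \<open>The atom of a point in the coarser partition contains its atom in the finer one, so the
  information function is pointwise smaller, at least off the null atoms, where
  \<open>ln 0 = 0\<close> would spoil the comparison.\<close>

lemma partition_entropy_refine: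
  assumes f: "simple_function M f" and e: "simple_function M e" and fe: "\<And>x. x \<in> space M \<Longrightarrow> f x = F (e x)"
  shows "partition_entropy M f \<le> partition_entropy M e"
  unfolding partition_entropy_eq_integral[OF f] partition_entropy_eq_integral[OF e]
proof (rule integral_mono_AE)
  show "integrable M (\<lambda>x. - ln (prob (f -` {f x} \<inter> space M)))"
    using integral_finite_range(2)[OF f, of "\<lambda>y. - ln (prob (f -` {y} \<inter> space M))"] .
  show "integrable M (\<lambda>x. - ln (prob (e -` {e x} \<inter> space M)))"
    using integral_finite_range(2)[OF e, of "\<lambda>y. - ln (prob (e -` {y} \<inter> space M))"] .
  have ev: "\<And>y. y \<in> e ` space M \<Longrightarrow> e -` {y} \<inter> space M \<in> events" "\<And>y. y \<in> f ` space M \<Longrightarrow> f -` {y} \<inter> space M \<in> events"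
    using e f by (auto simp: simple_function_def)
  have "AE x in M. prob (e -` {e x} \<inter> space M) > 0" by (rule AE_prob_fibre_pos[OF e])
  then show "AE x in M. - ln (prob (f -` {f x} \<inter> space M)) \<le> - ln (prob (e -` {e x} \<inter> space M))"
    using AE_space
  proof eventually_elim
    case (elim x)
    have "prob (e -` {e x} \<inter> space M) \<le> prob (f -` {f x} \<inter> space M)"
      using elim ev(2) by (intro finite_measure_mono) (auto simp: fe)
    then show ?case using elim by simp
  qed
qed

end

lemma itinerary_append:
  "itinerary T f (m + n) x = itinerary T f m x @ itinerary T f n ((T ^^ m) x)"
  by (rule nth_equalityI) (auto simp: itinerary_def nth_append funpow_add[of _ m, THEN fun_cong, unfolded comp_def, symmetric]
      simp del: funpow.simps intro!: arg_cong[of _ _ f] simp flip: funpow_add[THEN fun_cong, unfolded comp_def])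

section \<open>Entropy along a measure-preserving map\<close>

locale measure_preserving = prob_space +
  fixes T
  assumes T_meas: "T \<in> measurable M M" and T_inv: "distr M M T = M"
begin

lemma iter_meas: "(T ^^ n) \<in> measurable M M"
  using T_meas by (induction n) (auto simp del: id_apply)

lemma iter_inv: "distr M M (T ^^ n) = M"
proof (induction n)
  case (Suc n)
  have "distr M M (T ^^ Suc n) = distr (distr M M (T ^^ n)) M T"
    using iter_meas[of n] T_meas by (subst distr_distr) auto
  then show ?case using Suc T_inv by (simp add: comp_def)
qed (simp add: distr_id[unfolded id_def] id_def)

lemma integral_iter:
  fixes \<phi> :: "'a \<Rightarrow> real"
  assumes "\<phi> \<in> borel_measurable M"
  shows "(\<integral>x. \<phi> ((T ^^ n) x) \<partial>M) = (\<integral>x. \<phi> x \<partial>M)"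
  using integral_distr[OF iter_meas[of n] assms] by (simp add: iter_inv)

lemma integrable_iter:
  fixes \<phi> :: "'a \<Rightarrow> real"
  assumes "\<phi> \<in> borel_measurable M"
  shows "integrable M (\<lambda>x. \<phi> ((T ^^ n) x)) \<longleftrightarrow> integrable M \<phi>"
  using integrable_distr_eq[OF iter_meas[of n] assms] by (simp add: iter_inv)

lemma AE_iter: "AE x in M. P x \<Longrightarrow> AE x in M. P ((T ^^ n) x)"
  using AE_distrD[OF iter_meas[of n], of P] unfolding iter_inv by blast

lemma simple_function_iter:
  assumes "simple_function M f"
  shows "simple_function M (\<lambda>x. f ((T ^^ n) x))"
  using simple_function_comp[OF iter_meas[of n] assms] by (simp add: comp_def)

lemma simple_function_itinerary:
  assumes f: "simple_function M f"
  shows "simple_function M (itinerary T f n)"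
proof (induction n)
  case 0
  show ?case by (auto simp: itinerary_def[abs_def])
next
  case (Suc n)
  have "itinerary T f (Suc n) = (\<lambda>x. (\<lambda>(u, a). u @ [a]) (itinerary T f n x, f ((T ^^ n) x)))"
    by (auto simp: itinerary_def fun_eq_iff)
  then show ?case
    using simple_function_compose1[OF simple_function_Pair[OF Suc simple_function_iter[OF f]], of "\<lambda>(u, a). u @ [a]" n]
    by simp
qed

text \<open>Gibbs' inequality with the law that makes the first \<open>m\<close> and the last
  \<open>n\<close> labels independent. By invariance the last \<open>n\<close> labels have the law
  of the first \<open>n\<close>.\<close>

lemma partition_entropy_itinerary_subadditive:
  assumes f: "simple_function M f"
  shows "partition_entropy M (itinerary T f (m + n)) \<le>
    partition_entropy M (itinerary T f m) + partition_entropy M (itinerary T f n)"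
proof -
  let ?e = "itinerary T f"
  define p where "p k y = prob (?e k -` {y} \<inter> space M)" for k y
  note sf = simple_function_itinerary[OF f]
  have meas_p: "(\<lambda>x. ln (p k (?e k x))) \<in> borel_measurable M" for k
    using integral_finite_range(2)[OF sf, of "\<lambda>y. ln (p k y)"] by blast
  have len: "length (?e k x) = k" for k x by (simp add: itinerary_def)
  have Tsp: "(T ^^ m) x \<in> space M" if "x \<in> space M" for x
    using that measurable_space[OF iter_meas] by blast
  have "partition_entropy M (?e (m + n)) \<le> (\<integral>x. - ln (p m (take m (?e (m + n) x)) * p n (drop m (?e (m + n) x))) \<partial>M)"
  proof (rule partition_entropy_Gibbs[OF sf])
    show "0 \<le> p m (take m y) * p n (drop m y)" for y by (simp add: p_def)
    \<comment> \<open>Cutting a word in two is injective, so the sum over itineraries is part of a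
      sum over pairs, which factorises.\<close>
    let ?h = "\<lambda>y. (take m y, drop m y)"
    have inj: "inj_on ?h A" for A :: "'b list set"
      by (rule inj_on_inverseI[of _ "\<lambda>(u, v). u @ v"]) auto
    have "(\<Sum>y\<in>?e (m + n) ` space M. p m (take m y) * p n (drop m y))
        = (\<Sum>z\<in>?h ` ?e (m + n) ` space M. p m (fst z) * p n (snd z))"
      by (subst sum.reindex[OF inj]) simp
    also have "\<dots> \<le> (\<Sum>z\<in>(?e m ` space M) \<times> (?e n ` space M). p m (fst z) * p n (snd z))"
    proof (rule sum_mono2)
      show "finite ((?e m ` space M) \<times> (?e n ` space M))" using sf by (auto simp: simple_function_def)
      show "?h ` ?e (m + n) ` space M \<subseteq> (?e m ` space M) \<times> (?e n ` space M)"
        using Tsp by (auto simp: itinerary_append len)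
    qed (auto simp: p_def)
    also have "\<dots> = (\<Sum>y\<in>?e m ` space M. p m y) * (\<Sum>y\<in>?e n ` space M. p n y)"
      by (simp add: sum_product sum.cartesian_product case_prod_beta)
    also have "\<dots> = 1" using sum_prob_partition[OF sf] by (simp add: p_def)
    finally show "(\<Sum>y\<in>?e (m + n) ` space M. p m (take m y) * p n (drop m y)) \<le> 1" .
    fix y assume y: "y \<in> ?e (m + n) ` space M" and pos: "0 < prob (?e (m + n) -` {y} \<inter> space M)"
    have ev: "?e k -` {z} \<inter> space M \<in> events" for k z
      by (rule simple_functionD[OF sf])
    have "prob (?e (m + n) -` {y} \<inter> space M) \<le> p m (take m y)"
      unfolding p_def using ev by (intro finite_measure_mono) (auto simp: itinerary_append len)
    moreover have "prob (?e (m + n) -` {y} \<inter> space M) \<le> p n (drop m y)"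
    proof -
      have "p n (drop m y) = measure (distr M M (T ^^ m)) (?e n -` {drop m y} \<inter> space M)"
        by (simp add: p_def iter_inv)
      also have "\<dots> = prob ((T ^^ m) -` (?e n -` {drop m y} \<inter> space M) \<inter> space M)"
        using ev iter_meas by (intro measure_distr) auto
      also have "\<dots> \<ge> prob (?e (m + n) -` {y} \<inter> space M)"
        using Tsp ev by (intro finite_measure_mono measurable_sets[OF iter_meas]) (auto simp: itinerary_append len)
      finally show ?thesis .
    qed
    ultimately show "0 < p m (take m y) * p n (drop m y)" using pos by simp
  qed
  also have "\<dots> = (\<integral>x. - ln (p m (?e m x)) + - ln (p n (?e n ((T ^^ m) x))) \<partial>M)"
  proof (rule integral_cong_AE)
    show "(\<lambda>x. - ln (p m (take m (?e (m + n) x)) * p n (drop m (?e (m + n) x)))) \<in> borel_measurable M"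
      using integral_finite_range(2)[OF sf, of "\<lambda>y. - ln (p m (take m y) * p n (drop m y))" "m + n"] by blast
    show "(\<lambda>x. - ln (p m (?e m x)) + - ln (p n (?e n ((T ^^ m) x)))) \<in> borel_measurable M"
      using meas_p[of m] measurable_compose[OF iter_meas meas_p[of n], of m] by (simp add: comp_def)
    show "AE x in M. - ln (p m (take m (?e (m + n) x)) * p n (drop m (?e (m + n) x))) =
        - ln (p m (?e m x)) + - ln (p n (?e n ((T ^^ m) x)))"
      using AE_prob_fibre_pos[OF sf[of m]] AE_iter[OF AE_prob_fibre_pos[OF sf[of n]], of m]
      by eventually_elim (auto simp: itinerary_append len p_def[symmetric] ln_mult)
  qed
  also have "\<dots> = (\<integral>x. - ln (p m (?e m x)) \<partial>M) + (\<integral>x. - ln (p n (?e n ((T ^^ m) x))) \<partial>M)"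
    using integral_finite_range(2)[OF sf, of "\<lambda>y. ln (p m y)" m]
      integral_finite_range(2)[OF sf, of "\<lambda>y. ln (p n y)" n] integrable_iter[OF meas_p[of n], of m]
    by (intro Bochner_Integration.integral_add) auto
  also have "(\<integral>x. - ln (p n (?e n ((T ^^ m) x))) \<partial>M) = (\<integral>x. - ln (p n (?e n x)) \<partial>M)"
    using integral_iter[of "\<lambda>x. - ln (p n (?e n x))" m] meas_p[of n] by simp
  finally show ?thesis
    by (simp add: partition_entropy_eq_integral[OF sf] p_def)
qed

lemma partition_entropy_itinerary_convergent:
  assumes f: "simple_function M f"
  shows "convergent (\<lambda>n. partition_entropy M (itinerary T f n) / real n)"
  by (rule Fekete_convergent)
    (use partition_entropy_nonneg[OF simple_function_itinerary[OF f]]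
       partition_entropy_itinerary_subadditive[OF f] in auto)

end

lemma measure_preserving_stream_space:
  assumes "prob_space p"
  shows "measure_preserving (stream_space p) stl"
proof -
  interpret p: prob_space p by fact
  interpret N: prob_space "stream_space p" by (rule p.prob_space_stream_space)
  show ?thesis
  proof
    show "distr (stream_space p) (stream_space p) stl = stream_space p"
    proof (rule measure_eqI)
      fix A assume "A \<in> sets (distr (stream_space p) (stream_space p) stl)"
      then have A[measurable]: "A \<in> sets (stream_space p)" by simp
      have "emeasure (distr (stream_space p) (stream_space p) stl) A
          = emeasure (stream_space p) (stl -` A \<inter> space (stream_space p))"
        by (rule emeasure_distr) auto
      also have "\<dots> = (\<integral>\<^sup>+t. emeasure (stream_space p) {x\<in>space (stream_space p). t ## x \<in> stl -` A \<inter> space (stream_space p)} \<partial>p)"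
        by (rule p.emeasure_stream_space) simp
      also have "\<dots> = (\<integral>\<^sup>+t. emeasure (stream_space p) A \<partial>p)"
        using sets.sets_into_space[OF A]
        by (intro nn_integral_cong arg_cong2[where f=emeasure]) (auto simp: space_stream_space streams_Stream)
      finally show "emeasure (distr (stream_space p) (stream_space p) stl) A = emeasure (stream_space p) A"
        by (simp add: p.emeasure_space_1)
    qed simp
  qed simp
qed

section \<open>Bernoulli shifts and their Kolmogorov--Sinai entropy\<close>

locale bernoulli_shift =
  fixes S :: "'a set" and p :: "'a measure"
  assumes finS: "finite S" and prob_p: "prob_space p" and sets_p: "sets p = Pow S"
begin

abbreviation "N \<equiv> stream_space p"

lemma sets_N: "sets N = sets (stream_space (count_space S))"
  by (rule sets_stream_space_cong) (simp add: sets_p)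

lemma space_p: "space p = S"
  using sets_eq_imp_space_eq[of p "count_space S"] sets_p by simp

lemma space_N: "space N = streams S"
  by (simp add: space_stream_space space_p)

sublocale p: prob_space p by (rule prob_p)

sublocale N: measure_preserving N stl
  by (rule measure_preserving_stream_space) (rule prob_p)

lemma S_nonempty: "S \<noteq> {}"
  using p.not_empty space_p by simp

lemma emeasure_sstart: "u \<in> lists S \<Longrightarrow> emeasure N (sstart S u) = (\<Prod>l<length u. emeasure p {u ! l})"
proof (induction u)
  case Nil
  then show ?case using N.emeasure_space_1 by (simp add: space_N)
next
  case (Cons a u)
  then have u: "u \<in> lists S" "a \<in> S" by auto
  have "emeasure N (sstart S (a # u)) = (\<integral>\<^sup>+t. emeasure N {x\<in>space N. t ## x \<in> sstart S (a # u)} \<partial>p)"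
    using Cons.prems finS by (intro p.emeasure_stream_space) (auto simp: sets_N intro!: sets_sstart_count_space countable_finite simp del: in_sstart)
  also have "\<dots> = (\<integral>\<^sup>+t. emeasure N (sstart S u) * indicator {a} t \<partial>p)"
    using sstart_in_streams[OF u(1)]
    by (intro nn_integral_cong) (auto simp: indicator_def space_N intro!: arg_cong2[where f=emeasure])
  also have "\<dots> = emeasure p {a} * emeasure N (sstart S u)"
    using u by (subst nn_integral_cmult_indicator) (auto simp: sets_p mult.commute)
  also have "\<dots> = (\<Prod>l<length (a # u). emeasure p {(a # u) ! l})"
    using Cons.IH u by (simp add: lessThan_Suc_eq_insert_0 prod.reindex)
  finally show ?case .
qed

lemma simple_function_stake: "simple_function N (stake n)"
  unfolding simple_function_def
proof (intro conjI ballI)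
  have "stake n ` space N \<subseteq> words S n" using stake_in_words by (auto simp: space_N simp del: mem_Collect_eq)
  then show "finite (stake n ` space N)" using finite_words[OF finS] by (rule finite_subset)
  fix u assume "u \<in> stake n ` space N"
  show "stake n -` {u} \<inter> space N \<in> sets N"
    using measurable_sets[OF measurable_stake_countable[OF finS, of "\<lambda>u. u" n], of "{u}"]
    by (simp add: sets_N space_N space_stream_space[of "count_space S"])
qed

lemma prob_fibre_stake:
  assumes "x \<in> streams S"
  shows "N.prob (stake n -` {stake n x} \<inter> space N) = (\<Prod>l<n. p.prob {x !! l})"
proof -
  have u: "stake n x \<in> lists S" using stake_in_words[OF assms, of n] by auto
  have "stake n -` {stake n x} \<inter> space N = sstart S (stake n x)"
    by (subst sstart_eq_Collect[OF u]) (auto simp: space_N)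
  then have "N.prob (stake n -` {stake n x} \<inter> space N) = enn2real (\<Prod>l<n. emeasure p {stake n x ! l})"
    using emeasure_sstart[OF u] by (simp add: measure_def)
  also have "(\<Prod>l<n. emeasure p {stake n x ! l}) = ennreal (\<Prod>l<n. p.prob {x !! l})"
    by (subst prod_ennreal[symmetric]) (auto simp: p.emeasure_eq_measure)
  finally show ?thesis by (simp add: prod_nonneg)
qed

lemma simple_function_shd: "simple_function N shd"
proof -
  have "simple_function N (\<lambda>x. hd (stake 1 x))"
    by (rule simple_function_compose1[OF simple_function_stake])
  then show ?thesis by simp
qed

lemma shd_image: "shd ` space N = S"
proof
  show "S \<subseteq> shd ` space N"
  proof
    fix a assume "a \<in> S"
    then show "a \<in> shd ` space N"
      by (intro image_eqI[of _ _ "sconst a"]) (auto simp: space_N streams_iff_sset)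
  qed
qed (auto simp: space_N streams_shd)

lemma prob_shd: "a \<in> S \<Longrightarrow> N.prob (shd -` {a} \<inter> space N) = p.prob {a}"
proof -
  have "shd -` {a} \<inter> space N = stake 1 -` {stake 1 (sconst a)} \<inter> space N" by auto
  moreover assume "a \<in> S"
  ultimately show ?thesis using prob_fibre_stake[of "sconst a" 1] by (simp add: streams_iff_sset)
qed

definition entropy :: real where
  "entropy = - (\<Sum>a\<in>S. p.prob {a} * ln (p.prob {a}))"

lemma entropy_eq_integral: "entropy = (\<integral>x. - ln (p.prob {shd x}) \<partial>N)"
  using N.integral_finite_range(1)[OF simple_function_shd, of "\<lambda>a. - ln (p.prob {a})"]
  by (simp add: entropy_def shd_image prob_shd sum_negf)

lemma AE_prob_letter_pos: "AE x in N. p.prob {shd x} > 0"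
  using N.AE_prob_fibre_pos[OF simple_function_shd] AE_space
  by eventually_elim (auto simp: prob_shd[unfolded space_N] space_N streams_shd)

lemma stl_iter: "(stl ^^ n) x = sdrop n x"
  by (induction n arbitrary: x) (auto simp: funpow_swap1)

lemma partition_entropy_stake: "partition_entropy N (stake n) = n * entropy"
proof -
  have m: "(\<lambda>x. ln (p.prob {shd x})) \<in> borel_measurable N"
    using N.integral_finite_range(2)[OF simple_function_shd, of "\<lambda>a. ln (p.prob {a})"] by blast
  have i: "integrable N (\<lambda>x. - ln (p.prob {x !! l}))" for l
    using N.integrable_iter[of "\<lambda>x. - ln (p.prob {shd x})" l] m
      N.integral_finite_range(2)[OF simple_function_shd, of "\<lambda>a. ln (p.prob {a})"]
    by (simp add: stl_iter)
  have "partition_entropy N (stake n) = (\<integral>x. - ln (N.prob (stake n -` {stake n x} \<inter> space N)) \<partial>N)"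
    by (rule N.partition_entropy_eq_integral[OF simple_function_stake])
  also have "\<dots> = (\<integral>x. (\<Sum>l<n. - ln (p.prob {x !! l})) \<partial>N)"
  proof (rule integral_cong_AE)
    show "(\<lambda>x. - ln (N.prob (stake n -` {stake n x} \<inter> space N))) \<in> borel_measurable N"
      using N.integral_finite_range(2)[OF simple_function_stake, of "\<lambda>u. - ln (N.prob (stake n -` {u} \<inter> space N))"] by blast
    have "AE x in N. \<forall>l. p.prob {x !! l} > 0"
      using N.AE_iter[OF AE_prob_letter_pos] by (auto simp: AE_all_countable stl_iter)
    then show "AE x in N. - ln (N.prob (stake n -` {stake n x} \<inter> space N)) = (\<Sum>l<n. - ln (p.prob {x !! l}))"
      using AE_space
      by eventually_elim (simp add: prob_fibre_stake[unfolded space_N] space_N, subst ln_prod, auto simp: sum_negf less_imp_neq[symmetric])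
  qed (use i in auto)
  also have "\<dots> = (\<Sum>l<n. \<integral>x. - ln (p.prob {x !! l}) \<partial>N)"
    using i by (rule Bochner_Integration.integral_sum)
  also have "\<dots> = (\<Sum>l<n. entropy)"
  proof (rule sum.cong)
    fix l
    show "(\<integral>x. - ln (p.prob {x !! l}) \<partial>N) = entropy"
      using N.integral_iter[of "\<lambda>x. - ln (p.prob {shd x})" l] m by (simp add: stl_iter entropy_eq_integral)
  qed simp
  finally show ?thesis by simp
qed

text \<open>The events that are determined up to small probability by finitely many letters include
  the cylinders and are closed under complements and countable disjoint unions, hence are all
  events.\<close>

lemma approx_event:
  assumes "B \<in> sets N" "\<epsilon> > 0"
  shows "\<exists>m G. N.prob {x\<in>streams S. (x \<in> B) \<noteq> (stake m x \<in> G)} < \<epsilon>"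
proof -
  have ev: "{x\<in>streams S. stake m x \<in> G} \<in> sets N" for m G
    using measurable_sets[OF measurable_stake_countable[OF finS, of "\<lambda>u. u" m], of G]
    by (simp add: sets_N space_stream_space vimage_def Int_def conj_commute)
  have ev2: "{x\<in>streams S. (x \<in> B) \<noteq> (stake m x \<in> G)} \<in> sets N" if "B \<in> sets N" for m G B
  proof -
    have "{x\<in>streams S. (x \<in> B) \<noteq> (stake m x \<in> G)} = (B - {x\<in>streams S. stake m x \<in> G}) \<union> ({x\<in>streams S. stake m x \<in> G} - B)"
      using sets.sets_into_space[OF that] by (auto simp: space_N)
    then show ?thesis using ev that by auto
  qed
  have "B \<in> sigma_sets (streams S) (sstart S ` lists S \<union> {{}})"
    using assms(1) finS by (simp add: sets_N sets_stream_space_eq_sigma_sets countable_finite)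
  moreover have sub: "sstart S ` lists S \<union> {{}} \<subseteq> Pow (streams S)"
    by (auto dest: sstart_in_streams del: in_listsD)
  moreover have sN: "C \<in> sets N" if "C \<in> sigma_sets (streams S) (sstart S ` lists S \<union> {{}})" for C
    using that finS by (simp add: sets_N sets_stream_space_eq_sigma_sets countable_finite)
  ultimately have "\<forall>\<epsilon>>0. \<exists>m G. N.prob {x\<in>streams S. (x \<in> B) \<noteq> (stake m x \<in> G)} < \<epsilon>"
  proof (induction rule: sigma_sets_induct_disjoint[OF Int_stable_sstart sub, consumes 1, case_names basic empty compl union])
    case (basic C)
    then consider "C = {}" | u where "u \<in> lists S" "C = sstart S u" by blast
    then show ?case
    proof cases
      case 1
      then show ?thesis by (intro allI impI exI[of _ 0] exI[of _ "{}"]) simp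
    next
      case 2
      then have "{x\<in>streams S. (x \<in> C) \<noteq> (stake (length u) x \<in> {u})} = {}"
        by (auto simp: sstart_eq_Collect)
      then show ?thesis by (intro allI impI exI[of _ "length u"] exI[of _ "{u}"]) (simp only: measure_empty)
    qed
  next
    case empty
    then show ?case by (intro allI impI exI[of _ 0] exI[of _ "{}"]) simp
  next
    case (compl C)
    show ?case
    proof (intro allI impI)
      fix \<epsilon> :: real assume "\<epsilon> > 0"
      then obtain m G where "N.prob {x\<in>streams S. (x \<in> C) \<noteq> (stake m x \<in> G)} < \<epsilon>" using compl by blast
      moreover have "{x\<in>streams S. (x \<in> streams S - C) \<noteq> (stake m x \<in> - G)} = {x\<in>streams S. (x \<in> C) \<noteq> (stake m x \<in> G)}"
        by auto
      ultimately show "\<exists>m G. N.prob {x\<in>streams S. (x \<in> streams S - C) \<noteq> (stake m x \<in> G)} < \<epsilon>"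
        by (intro exI[of _ m] exI[of _ "- G"]) simp
    qed
  next
    case (union C)
    have CN: "range C \<subseteq> sets N" using union sN by auto
    show ?case
    proof (intro allI impI)
      fix \<epsilon> :: real assume e: "\<epsilon> > 0"
      have "(\<lambda>n. N.prob (\<Union>i<n. C i)) \<longlonglongrightarrow> N.prob (\<Union>n. \<Union>i<n. C i)"
        using CN by (intro N.finite_Lim_measure_incseq) (auto simp: incseq_def intro: less_le_trans)
      moreover have U: "(\<Union>n. \<Union>i<n. C i) = (\<Union>i. C i)" by auto
      ultimately have "eventually (\<lambda>n. N.prob (\<Union>i<n. C i) > N.prob (\<Union>i. C i) - \<epsilon> / 2) sequentially"
        using e by (intro order_tendstoD) auto
      then obtain n where n: "N.prob (\<Union>i<n. C i) > N.prob (\<Union>i. C i) - \<epsilon> / 2"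
        by (auto simp: eventually_sequentially)
      have tail: "N.prob ((\<Union>i. C i) - (\<Union>i<n. C i)) < \<epsilon> / 2"
        using n CN by (subst N.finite_measure_Diff) auto
      \<comment> \<open>The tail of the union costs \<open>\<epsilon> / 2\<close>; the first
        \<open>n\<close> sets share the other half.\<close>
      have "\<forall>i. \<exists>m G. N.prob {x\<in>streams S. (x \<in> C i) \<noteq> (stake m x \<in> G)} < \<epsilon> / 2 / (n + 1)"
        using union e by simp
      then obtain m G where mG: "\<And>i. N.prob {x\<in>streams S. (x \<in> C i) \<noteq> (stake (m i) x \<in> G i)} < \<epsilon> / 2 / (n + 1)"
        unfolding choice_iff by blast
      define k where "k = Max (m ` {..n})"
      \<comment> \<open>The approximations of the first \<open>n\<close> sets use different word
        lengths; all are read off from prefixes of a word of the common length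
        \<open>k\<close>.\<close>
      define H where "H = {u. \<exists>i<n. take (m i) u \<in> G i}"
      have mk: "m i \<le> k" if "i < n" for i using that by (auto simp: k_def intro!: Max_ge)
      have "{x\<in>streams S. (x \<in> (\<Union>i. C i)) \<noteq> (stake k x \<in> H)} \<subseteq>
          ((\<Union>i. C i) - (\<Union>i<n. C i)) \<union> (\<Union>i<n. {x\<in>streams S. (x \<in> C i) \<noteq> (stake (m i) x \<in> G i)})"
        using mk by (auto simp: H_def take_stake min_absorb1)
      then have "N.prob {x\<in>streams S. (x \<in> (\<Union>i. C i)) \<noteq> (stake k x \<in> H)} \<le>
          N.prob (((\<Union>i. C i) - (\<Union>i<n. C i)) \<union> (\<Union>i<n. {x\<in>streams S. (x \<in> C i) \<noteq> (stake (m i) x \<in> G i)}))"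
        using CN ev2 by (intro N.finite_measure_mono) (auto intro!: sets.Un sets.Diff sets.finite_UN)
      also have "\<dots> \<le> N.prob ((\<Union>i. C i) - (\<Union>i<n. C i)) + N.prob (\<Union>i<n. {x\<in>streams S. (x \<in> C i) \<noteq> (stake (m i) x \<in> G i)})"
        using CN ev2 by (intro measure_Un_le) (auto intro!: sets.finite_UN)
      also have "N.prob (\<Union>i<n. {x\<in>streams S. (x \<in> C i) \<noteq> (stake (m i) x \<in> G i)}) \<le>
          (\<Sum>i<n. N.prob {x\<in>streams S. (x \<in> C i) \<noteq> (stake (m i) x \<in> G i)})"
        using CN ev2 by (intro N.finite_measure_subadditive_finite) auto
      also have "\<dots> \<le> (\<Sum>i<n. \<epsilon> / 2 / (n + 1))" by (intro sum_mono less_imp_le mG)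
      also have "\<dots> \<le> \<epsilon> / 2" using e by (simp add: field_simps)
      finally have "N.prob {x\<in>streams S. (x \<in> (\<Union>i. C i)) \<noteq> (stake k x \<in> H)} < \<epsilon>" using tail by simp
      then show "\<exists>m G. N.prob {x\<in>streams S. (x \<in> (\<Union>i. C i)) \<noteq> (stake m x \<in> G)} < \<epsilon>" by blast
    qed
  qed
  then show ?thesis using assms by blast
qed

lemma approx_simple_function:
  fixes f :: "'a stream \<Rightarrow> nat"
  assumes f: "simple_function N f" and e: "\<epsilon> > 0"
  shows "\<exists>m g. N.prob {x\<in>streams S. f x \<noteq> g (stake m x)} < \<epsilon>"
proof -
  define F where "F = f ` space N"
  have fin: "finite F" using f by (auto simp: F_def simple_function_def)
  define B where "B y = f -` {y} \<inter> space N" for y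
  have B: "B y \<in> sets N" for y unfolding B_def by (rule simple_functionD[OF f])
  have "\<forall>y. \<exists>m G. N.prob {x\<in>streams S. (x \<in> B y) \<noteq> (stake m x \<in> G)} < \<epsilon> / (card F + 1)"
    using approx_event[OF B] e by simp
  then obtain m G where mG: "\<And>y. N.prob {x\<in>streams S. (x \<in> B y) \<noteq> (stake (m y) x \<in> G y)} < \<epsilon> / (card F + 1)"
    unfolding choice_iff by blast
  define k where "k = Max (insert 0 (m ` F))"
  have mk: "m y \<le> k" if "y \<in> F" for y using that fin by (auto simp: k_def intro!: Max_ge)
  \<comment> \<open>The guess is any label whose approximating set contains the word. If it is
    wrong, the point lies in the error set of its true label or in that of the guessed one.\<close>
  define g where "g u = (SOME y. y \<in> F \<and> take (m y) u \<in> G y)" for u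
  let ?D = "\<lambda>y. {x\<in>streams S. (x \<in> B y) \<noteq> (stake (m y) x \<in> G y)}"
  have D: "?D y \<in> sets N" for y
  proof -
    have "{x\<in>streams S. stake (m y) x \<in> G y} \<in> sets N"
      using measurable_sets[OF measurable_stake_countable[OF finS, of "\<lambda>u. u" "m y"], of "G y"]
      by (simp add: sets_N space_stream_space vimage_def Int_def conj_commute)
    moreover have "?D y = (B y - {x\<in>streams S. stake (m y) x \<in> G y}) \<union> ({x\<in>streams S. stake (m y) x \<in> G y} - B y)"
      using sets.sets_into_space[OF B] by (auto simp: space_N)
    ultimately show ?thesis using B by auto
  qed
  have "{x\<in>streams S. f x \<noteq> g (stake k x)} \<subseteq> (\<Union>y\<in>F. ?D y)"
  proof
    fix x assume "x \<in> {x\<in>streams S. f x \<noteq> g (stake k x)}"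
    then have x: "x \<in> streams S" "f x \<noteq> g (stake k x)" by auto
    have fx: "f x \<in> F" "x \<in> B (f x)" using x by (auto simp: F_def B_def space_N)
    show "x \<in> (\<Union>y\<in>F. ?D y)"
    proof (cases "stake (m (f x)) x \<in> G (f x)")
      case True
      then have "f x \<in> F \<and> take (m (f x)) (stake k x) \<in> G (f x)"
        using fx mk by (simp add: take_stake min_absorb1)
      then have "g (stake k x) \<in> F \<and> take (m (g (stake k x))) (stake k x) \<in> G (g (stake k x))"
        unfolding g_def by (rule someI)
      then have g: "g (stake k x) \<in> F" "stake (m (g (stake k x))) x \<in> G (g (stake k x))"
        using mk by (auto simp: take_stake min_absorb1)
      moreover have "x \<notin> B (g (stake k x))" using x by (auto simp: B_def)
      ultimately show ?thesis using x by auto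
    qed (use x fx in auto)
  qed
  then have "N.prob {x\<in>streams S. f x \<noteq> g (stake k x)} \<le> N.prob (\<Union>y\<in>F. ?D y)"
    using D fin by (intro N.finite_measure_mono) auto
  also have "\<dots> \<le> (\<Sum>y\<in>F. N.prob (?D y))"
    using D fin by (intro N.finite_measure_subadditive_finite) auto
  also have "\<dots> \<le> (\<Sum>y\<in>F. \<epsilon> / (card F + 1))" by (intro sum_mono less_imp_le mG)
  also have "\<dots> < \<epsilon>" using e by (simp add: field_simps)
  finally show ?thesis by blast
qed

text \<open>Refine the itinerary of \<open>f\<close> by the word that determines its approximation \<open>g\<close>, and compare with
  the law under which \<open>f\<close> is read off from \<open>g\<close> up to independent errors of probability \<open>\<delta>\<close>.\<close>

lemma partition_entropy_itinerary_le:
  fixes f :: "'a stream \<Rightarrow> nat"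
  assumes f: "simple_function N f" and d: "0 < \<delta>" "\<delta> < 1"
  shows "partition_entropy N (itinerary stl f n) \<le> real (n + m) * entropy +
    real n * (- ln (1 - \<delta>) + N.prob {x\<in>streams S. f x \<noteq> g (stake m x)} * ln (card (f ` streams S) / \<delta>))"
proof -
  \<comment> \<open>Each of the \<open>n\<close> labels is predicted from a window of
    \<open>m\<close> letters, so that \<open>n + m\<close> letters determine all
    predictions.\<close>
  let ?e = "\<lambda>x. (itinerary stl f n x, stake (n + m) x)"
  define F where "F = f ` streams S"
  have fin: "finite F" using f by (auto simp: F_def simple_function_def space_N)
  have Fne: "F \<noteq> {}" using N.not_empty by (auto simp: F_def space_N)
  define r where "r = real (card F)"
  have r: "r \<ge> 1" using fin Fne by (simp add: r_def Suc_leI card_gt_0_iff)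
  \<comment> \<open>Sharing \<open>\<delta>\<close> evenly keeps every label possible: a failed
    prediction costs \<open>ln (r / \<delta>)\<close>, a correct one only
    \<open>- ln (1 - \<delta>)\<close>.\<close>
  define K where "K v y = (if y = g v then 1 - \<delta> else \<delta> / r)" for v y
  have K_pos: "K v y > 0" for v y using d r by (auto simp: K_def)
  have K_sum: "(\<Sum>y\<in>F. K v y) \<le> 1" for v
  proof -
    have "(\<Sum>y\<in>F. K v y) \<le> (\<Sum>y\<in>F. (if y = g v then 1 - \<delta> else 0) + \<delta> / r)"
      using d r by (intro sum_mono) (auto simp: K_def)
    also have "\<dots> = (if g v \<in> F then 1 - \<delta> else 0) + \<delta>"
      using Fne fin by (simp add: sum.distrib r_def sum.delta)
    finally show ?thesis using d by (auto split: if_splits)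
  qed
  define P where "P w = N.prob (stake (n + m) -` {w} \<inter> space N)" for w
  define R where "R z = P (snd z) * (\<Prod>l<n. K (take m (drop l (snd z))) (fst z ! l))" for z
  note sf = N.simple_function_itinerary[OF f]
  have se: "simple_function N ?e" by (rule simple_function_Pair[OF sf simple_function_stake])
  have K0: "integrable N (\<lambda>x. - ln (K (stake m x) (f x)))"
    using N.integral_finite_range(2)[OF simple_function_Pair[OF simple_function_stake f], of "\<lambda>(v, y). - ln (K v y)" m]
    by auto
  then have mb: "(\<lambda>x. - ln (K (stake m x) (f x))) \<in> borel_measurable N" by (rule borel_measurable_integrable)
  have Ki: "integrable N (\<lambda>x. - ln (K (stake m (sdrop l x)) (f (sdrop l x))))" for l
    using N.integrable_iter[OF mb, of l] K0 by (simp add: stl_iter)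
  have PI: "integrable N (\<lambda>x. - ln (P (stake (n + m) x)))"
    using N.integral_finite_range(2)[OF simple_function_stake, of "\<lambda>w. - ln (P w)" "n + m"] .
  have "partition_entropy N (itinerary stl f n) \<le> partition_entropy N ?e"
    by (rule N.partition_entropy_refine[OF sf se, of _ fst]) simp
  also have "\<dots> \<le> (\<integral>x. - ln (R (?e x)) \<partial>N)"
  proof (rule N.partition_entropy_Gibbs[OF se])
    show R_nn: "0 \<le> R z" for z
      unfolding R_def using K_pos by (intro mult_nonneg_nonneg prod_nonneg) (auto simp: P_def less_imp_le)
    let ?W = "stake (n + m) ` space N"
    have "(\<Sum>z\<in>?e ` space N. R z) \<le> (\<Sum>z\<in>words F n \<times> ?W. R z)"
    proof (rule sum_mono2)
      show "finite (words F n \<times> ?W)" using simple_function_stake fin by (auto simp: simple_function_def finite_words)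
      have "set (itinerary stl f n x) \<subseteq> F" if "x \<in> streams S" for x
        using that measurable_space[OF N.iter_meas, of x] by (auto simp: itinerary_def F_def space_N)
      then show "?e ` space N \<subseteq> words F n \<times> ?W" by (auto simp: space_N itinerary_def image_subset_iff)
    qed (rule R_nn)
    also have "\<dots> = (\<Sum>w\<in>?W. \<Sum>y\<in>words F n. R (y, w))"
      by (subst sum.swap) (simp add: sum.cartesian_product case_prod_beta)
    also have "\<dots> = (\<Sum>w\<in>?W. P w * (\<Sum>y\<in>words F n. (\<Prod>l<n. K (take m (drop l w)) (y ! l))))"
      by (simp add: R_def sum_distrib_left)
    also have "\<dots> = (\<Sum>w\<in>?W. P w * (\<Prod>l<n. \<Sum>y\<in>F. K (take m (drop l w)) y))"
      by (subst sum_words_prod[OF fin]) simp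
    also have "\<dots> \<le> (\<Sum>w\<in>?W. P w * 1)"
      using K_pos K_sum
      by (intro sum_mono mult_left_mono prod_le_1) (auto simp: P_def less_imp_le intro!: sum_nonneg)
    also have "\<dots> = 1" using N.sum_prob_partition[OF simple_function_stake] by (simp add: P_def)
    finally show "(\<Sum>z\<in>?e ` space N. R z) \<le> 1" .
    fix z assume z: "z \<in> ?e ` space N" and pos: "0 < N.prob (?e -` {z} \<inter> space N)"
    have "N.prob (?e -` {z} \<inter> space N) \<le> P (snd z)"
      unfolding P_def using simple_functionD[OF simple_function_stake] by (intro N.finite_measure_mono) auto
    then show "0 < R z" using pos K_pos by (auto simp: R_def intro!: mult_pos_pos prod_pos)
  qed
  also have "\<dots> = (\<integral>x. - ln (P (stake (n + m) x)) + (\<Sum>l<n. - ln (K (stake m (sdrop l x)) (f (sdrop l x)))) \<partial>N)"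
  proof (rule integral_cong_AE)
    show "(\<lambda>x. - ln (R (?e x))) \<in> borel_measurable N"
      using N.integral_finite_range(2)[OF se, of "\<lambda>z. - ln (R z)"] by blast
    show "(\<lambda>x. - ln (P (stake (n + m) x)) + (\<Sum>l<n. - ln (K (stake m (sdrop l x)) (f (sdrop l x))))) \<in> borel_measurable N"
      using Ki PI by (intro borel_measurable_add borel_measurable_sum borel_measurable_integrable)
    show "AE x in N. - ln (R (?e x)) = - ln (P (stake (n + m) x)) + (\<Sum>l<n. - ln (K (stake m (sdrop l x)) (f (sdrop l x))))"
      using N.AE_prob_fibre_pos[OF simple_function_stake[of "n + m"]]
    proof eventually_elim
      case (elim x)
      have "take m (drop l (stake (n + m) x)) = stake m (sdrop l x)" if "l < n" for l
        using that by (simp add: drop_stake take_stake min_absorb1)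
      then have "R (?e x) = P (stake (n + m) x) * (\<Prod>l<n. K (stake m (sdrop l x)) (f (sdrop l x)))"
        by (auto simp: R_def itinerary_def stl_iter intro!: prod.cong)
      moreover have "P (stake (n + m) x) > 0" using elim by (simp add: P_def)
      ultimately show ?case using K_pos
        by (simp add: ln_mult prod_pos) (subst ln_prod, auto simp: sum_negf less_imp_neq[symmetric])
    qed
  qed
  also have "\<dots> = (\<integral>x. - ln (P (stake (n + m) x)) \<partial>N) + (\<Sum>l<n. \<integral>x. - ln (K (stake m (sdrop l x)) (f (sdrop l x))) \<partial>N)"
    using Ki PI by (subst Bochner_Integration.integral_add)
      (auto simp del: Bochner_Integration.integral_minus intro!: Bochner_Integration.integral_sum)
  also have "(\<Sum>l<n. \<integral>x. - ln (K (stake m (sdrop l x)) (f (sdrop l x))) \<partial>N) = real n * (\<integral>x. - ln (K (stake m x) (f x)) \<partial>N)"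
    using N.integral_iter[OF mb] by (simp add: stl_iter)
  also have "(\<integral>x. - ln (P (stake (n + m) x)) \<partial>N) = real (n + m) * entropy"
    using partition_entropy_stake[of "n + m"] N.partition_entropy_eq_integral[OF simple_function_stake, of "n + m"]
    by (simp add: P_def)
  also have "(\<integral>x. - ln (K (stake m x) (f x)) \<partial>N) \<le>
      - ln (1 - \<delta>) + N.prob {x\<in>streams S. f x \<noteq> g (stake m x)} * ln (r / \<delta>)"
  proof -
    have Dm: "{x\<in>streams S. f x \<noteq> g (stake m x)} \<in> sets N"
    proof -
      have "{x\<in>streams S. f x \<noteq> g (stake m x)} = (\<lambda>x. (f x, stake m x)) -` {(y, v). y \<noteq> g v} \<inter> space N"
        by (auto simp: space_N)
      then show ?thesis using simple_functionD(2)[OF simple_function_Pair[OF f simple_function_stake]] by (simp only:)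
    qed
    have "(\<integral>x. - ln (K (stake m x) (f x)) \<partial>N) \<le>
        (\<integral>x. - ln (1 - \<delta>) + ln (r / \<delta>) * indicator {x\<in>streams S. f x \<noteq> g (stake m x)} x \<partial>N)"
    proof (rule integral_mono)
      show "integrable N (\<lambda>x. - ln (K (stake m x) (f x)))" by (rule K0)
      show "integrable N (\<lambda>x. - ln (1 - \<delta>) + ln (r / \<delta>) * indicator {x\<in>streams S. f x \<noteq> g (stake m x)} x)"
        using Dm by (auto simp: N.emeasure_eq_measure)
      fix x assume "x \<in> space N"
      then show "- ln (K (stake m x) (f x)) \<le> - ln (1 - \<delta>) + ln (r / \<delta>) * indicator {x\<in>streams S. f x \<noteq> g (stake m x)} x"
        using d r ln_le_zero_iff[of "1 - \<delta>"] by (auto simp: K_def space_N ln_div indicator_def)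
    qed
    also have "\<dots> = - ln (1 - \<delta>) + N.prob {x\<in>streams S. f x \<noteq> g (stake m x)} * ln (r / \<delta>)"
      using Dm by (simp add: N.emeasure_eq_measure N.prob_space mult.commute)
    finally show ?thesis .
  qed
  finally show ?thesis by (simp add: r_def F_def mult_left_mono)
qed

text \<open>The order of the choices matters: first \<open>\<delta>\<close>, then an approximation
  whose error probability is small compared with the logarithmic penalty belonging to
  \<open>\<delta>\<close>, and only then \<open>n\<close> tends to infinity, which removes the extra
  \<open>m\<close> letters.\<close>

lemma lim_partition_entropy_itinerary_le:
  fixes f :: "'a stream \<Rightarrow> nat"
  assumes f: "simple_function N f"
  shows "lim (\<lambda>n. partition_entropy N (itinerary stl f n) / real n) \<le> entropy"
proof -
  define L where "L = lim (\<lambda>n. partition_entropy N (itinerary stl f n) / real n)"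
  have lim: "(\<lambda>n. partition_entropy N (itinerary stl f n) / real n) \<longlonglongrightarrow> L"
    using N.partition_entropy_itinerary_convergent[OF f] by (simp add: L_def convergent_LIMSEQ_iff)
  have b: "L \<le> entropy + - ln (1 - \<delta>) + \<epsilon>" if d: "0 < \<delta>" "\<delta> < 1" and e: "0 < \<epsilon>" for \<delta> \<epsilon>
  proof -
    define c where "c = ln (card (f ` streams S) / \<delta>)"
    have "\<epsilon> / (\<bar>c\<bar> + 1) > 0" using e by simp
    then obtain m g where mg: "N.prob {x\<in>streams S. f x \<noteq> g (stake m x)} < \<epsilon> / (\<bar>c\<bar> + 1)"
      using approx_simple_function[OF f] by blast
    let ?\<eta> = "N.prob {x\<in>streams S. f x \<noteq> g (stake m x)}"
    have "?\<eta> * c \<le> ?\<eta> * (\<bar>c\<bar> + 1)" by (intro mult_left_mono) auto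
    also have "\<dots> \<le> \<epsilon>" using mg by (simp add: field_simps)
    finally have ec: "?\<eta> * c \<le> \<epsilon>" .
    have "eventually (\<lambda>n. partition_entropy N (itinerary stl f n) / real n \<le>
        (1 + real m / real n) * entropy + (- ln (1 - \<delta>) + \<epsilon>)) sequentially"
      using eventually_gt_at_top[of 0]
    proof eventually_elim
      case (elim n)
      have "partition_entropy N (itinerary stl f n) \<le> real (n + m) * entropy + real n * (- ln (1 - \<delta>) + ?\<eta> * c)"
        unfolding c_def by (rule partition_entropy_itinerary_le[OF f d])
      also have "\<dots> \<le> real (n + m) * entropy + real n * (- ln (1 - \<delta>) + \<epsilon>)"
        using ec by (intro add_left_mono mult_left_mono) auto
      finally show ?case using elim by (simp add: field_simps)
    qed
    moreover have "(\<lambda>n. (1 + real m / real n) * entropy + (- ln (1 - \<delta>) + \<epsilon>)) \<longlonglongrightarrow> (1 + 0) * entropy + (- ln (1 - \<delta>) + \<epsilon>)"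
      by (intro tendsto_intros lim_const_over_n)
    ultimately have "L \<le> (1 + 0) * entropy + (- ln (1 - \<delta>) + \<epsilon>)"
      using lim by (intro tendsto_le[OF sequentially_bot]) auto
    then show ?thesis by simp
  qed
  have "L \<le> entropy + \<epsilon>" if e: "0 < \<epsilon>" for \<epsilon>
  proof -
    \<comment> \<open>For this \<open>\<delta>\<close> the term \<open>- ln (1 - \<delta>)\<close>
      equals \<open>\<epsilon> / 2\<close>.\<close>
    have "1 - exp (- (\<epsilon> / 2)) > 0" "1 - exp (- (\<epsilon> / 2)) < 1" using e by auto
    from b[OF this, of "\<epsilon> / 2"] show ?thesis using e by simp
  qed
  then show ?thesis unfolding L_def[symmetric] by (rule field_le_epsilon)
qed

text \<open>The supremum is attained by the partition according to the first letter, whose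
  itineraries are the words.\<close>

theorem ks_entropy_eq: "ks_entropy N stl = ereal entropy"
  unfolding ks_entropy_def
proof (rule antisym)
  show "(SUP f\<in>{f :: 'a stream \<Rightarrow> nat. simple_function N f}. ereal (lim (\<lambda>n. partition_entropy N (itinerary stl f n) / real n))) \<le> ereal entropy"
    by (rule SUP_least) (auto intro: lim_partition_entropy_itinerary_le)
  \<comment> \<open>Partitions are labelled by natural numbers, so the letters have to be
    encoded.\<close>
  obtain c :: "'a \<Rightarrow> nat" where c: "inj_on c S" using finite_imp_inj_to_nat_seg[OF finS] by blast
  have sf: "simple_function N (\<lambda>x. c (shd x))" by (rule simple_function_compose1[OF simple_function_shd])
  have "partition_entropy N (itinerary stl (\<lambda>x. c (shd x)) n) = real n * entropy" for n
  proof (rule antisym)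
    have it: "itinerary stl (\<lambda>x. c (shd x)) n x = map c (stake n x)" for x
      by (rule nth_equalityI) (auto simp: itinerary_def stl_iter)
    show "partition_entropy N (itinerary stl (\<lambda>x. c (shd x)) n) \<le> real n * entropy"
      unfolding partition_entropy_stake[symmetric]
      by (rule N.partition_entropy_refine[OF N.simple_function_itinerary[OF sf] simple_function_stake]) (rule it)
    show "real n * entropy \<le> partition_entropy N (itinerary stl (\<lambda>x. c (shd x)) n)"
      unfolding partition_entropy_stake[symmetric]
    proof (rule N.partition_entropy_refine[OF simple_function_stake N.simple_function_itinerary[OF sf], of _ "map (inv_into S c)"])
      fix x assume "x \<in> space N"
      then have "stake n x \<in> words S n" by (intro stake_in_words) (simp add: space_N)
      then show "stake n x = map (inv_into S c) (itinerary stl (\<lambda>x. c (shd x)) n x)"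
        using c by (auto simp: it intro!: map_idI[symmetric])
    qed
  qed
  then have "(\<lambda>n. partition_entropy N (itinerary stl (\<lambda>x. c (shd x)) n) / real n) \<longlonglongrightarrow> entropy"
    by (intro Lim_transform_eventually[OF tendsto_const eventually_sequentiallyI[of 1]]) auto
  then have "lim (\<lambda>n. partition_entropy N (itinerary stl (\<lambda>x. c (shd x)) n) / real n) = entropy" by (rule limI)
  then show "ereal entropy \<le> (SUP f\<in>{f :: 'a stream \<Rightarrow> nat. simple_function N f}. ereal (lim (\<lambda>n. partition_entropy N (itinerary stl f n) / real n)))"
    using sf by (intro SUP_upper2[of "\<lambda>x. c (shd x)"]) auto
qed

end

section \<open>Mandelbrot cascades\<close>

lemma Q_weight_Nil [simp]: "Q_weight w u [] = 1"
  by (simp add: Q_weight_def)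

lemma Q_weight_snoc: "Q_weight w u (v @ [a]) = Q_weight w u v * w (u @ v) a"
  by (auto simp: Q_weight_def nth_append intro!: prod.cong)

text \<open>\<open>M\<close> is the law of the weight vector at a single node. Weights are
  non-negative at every point of its space, not just almost everywhere, so masses are non-negative
  without exceptional sets.\<close>

locale cascade =
  fixes S :: "'a set" and M :: "('a \<Rightarrow> real) measure" and q0 :: real
  assumes finS: "finite S" and prob_M: "prob_space M"
    and meas: "\<And>a. a \<in> S \<Longrightarrow> (\<lambda>x. x a) \<in> borel_measurable M"
    and nonneg: "\<And>x a. x \<in> space M \<Longrightarrow> a \<in> S \<Longrightarrow> 0 \<le> x a"
    and q0: "1 < q0" and int_q0: "\<And>a. a \<in> S \<Longrightarrow> integrable M (\<lambda>x. x a powr q0)"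
    and mean_one: "(\<Sum>a\<in>S. \<integral>x. x a \<partial>M) = 1"
begin

definition G :: "('a list \<Rightarrow> 'a \<Rightarrow> real) measure" where
  "G = PiM (lists S) (\<lambda>_. M)"

text \<open>The environment seen from the child \<open>a\<close>. Restricting it to
  \<open>lists S\<close> keeps it extensional, hence a point of the space of
  \<open>G\<close>.\<close>

definition shift :: "'a \<Rightarrow> ('a list \<Rightarrow> 'a \<Rightarrow> real) \<Rightarrow> 'a list \<Rightarrow> 'a \<Rightarrow> real" where
  "shift a w = (\<lambda>v\<in>lists S. w (a # v))"

definition mass :: "nat \<Rightarrow> ('a list \<Rightarrow> 'a \<Rightarrow> real) \<Rightarrow> real" where
  "mass n w = (\<Sum>v\<in>words S n. Q_weight w [] v)"

text \<open>In terms of the function \<open>T\<close> of the cascade, for positive \<open>q\<close>: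
  \<open>\<phi> q\<close> is \<open>exp (- T q)\<close>, and \<open>H\<close> is the derivative of
  \<open>T\<close> at 1.\<close>

definition \<phi> :: "real \<Rightarrow> real" where
  "\<phi> q = (\<Sum>a\<in>S. \<integral>x. x a powr q \<partial>M)"

definition H :: real where
  "H = - (\<Sum>a\<in>S. \<integral>x. x a * ln (x a) \<partial>M)"

sublocale M: prob_space M by (rule prob_M)

sublocale G: prob_space G
  unfolding G_def by (rule prob_space_PiM) (rule prob_M)

lemma S_nonempty: "S \<noteq> {}"
  using mean_one by auto

lemma space_G: "w \<in> space G \<Longrightarrow> u \<in> lists S \<Longrightarrow> w u \<in> space M"
  by (auto simp: G_def space_PiM PiE_iff)

lemma coord_nonneg: "w \<in> space G \<Longrightarrow> u \<in> lists S \<Longrightarrow> a \<in> S \<Longrightarrow> 0 \<le> w u a"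
  using space_G nonneg by blast

lemma measurable_coord_PiM:
  "u \<in> J \<Longrightarrow> a \<in> S \<Longrightarrow> (\<lambda>w. w u a) \<in> borel_measurable (PiM J (\<lambda>_. M))"
  by (rule measurable_compose[OF measurable_component_singleton[of u J "\<lambda>_. M"] meas])

lemma measurable_coord: "u \<in> lists S \<Longrightarrow> a \<in> S \<Longrightarrow> (\<lambda>w. w u a) \<in> borel_measurable G"
  unfolding G_def by (rule measurable_coord_PiM)

lemma take_in_lists: "v \<in> lists S \<Longrightarrow> take j v \<in> lists S"
  by (auto dest: in_set_takeD)

lemma measurable_Q_PiM:
  assumes "v \<in> lists S" "\<And>j. j < length v \<Longrightarrow> take j v \<in> J"
  shows "(\<lambda>w. Q_weight w [] v) \<in> borel_measurable (PiM J (\<lambda>_. M))"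
  unfolding Q_weight_def using assms
  by (intro borel_measurable_prod measurable_coord_PiM) (auto simp: in_lists_conv_set)

lemma measurable_Q: "v \<in> lists S \<Longrightarrow> (\<lambda>w. Q_weight w [] v) \<in> borel_measurable G"
  unfolding G_def by (intro measurable_Q_PiM take_in_lists)

lemma Q_nonneg: "w \<in> space G \<Longrightarrow> u \<in> lists S \<Longrightarrow> v \<in> lists S \<Longrightarrow> 0 \<le> Q_weight w u v"
  unfolding Q_weight_def
  by (intro prod_nonneg coord_nonneg ballI) (auto simp: in_lists_conv_set dest: in_set_takeD)

lemma words_in_lists: "v \<in> words S n \<Longrightarrow> v \<in> lists S"
  by auto

lemma measurable_mass [measurable]: "mass n \<in> borel_measurable G"
  unfolding mass_def by (intro borel_measurable_sum measurable_Q words_in_lists)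

lemma mass_nonneg: "w \<in> space G \<Longrightarrow> 0 \<le> mass n w"
  unfolding mass_def by (intro sum_nonneg Q_nonneg words_in_lists) auto

lemma mass_0 [simp]: "mass 0 w = 1"
  by (simp only: mass_def words_0 sum.insert finite.emptyI) simp

lemma Q_weight_Cons:
  assumes "a \<in> S" "v \<in> lists S"
  shows "Q_weight w [] (a # v) = w [] a * Q_weight (shift a w) [] v"
proof -
  have "Q_weight w [] (a # v) = w [] a * (\<Prod>j<length v. w (a # take j v) (v ! j))"
    unfolding Q_weight_def by (simp add: lessThan_Suc_eq_insert_0 prod.reindex)
  also have "(\<Prod>j<length v. w (a # take j v) (v ! j)) = Q_weight (shift a w) [] v"
    unfolding Q_weight_def using assms by (intro prod.cong refl) (simp add: shift_def take_in_lists del: in_lists_conv_set)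
  finally show ?thesis .
qed

lemma mass_Suc: "mass (Suc n) w = (\<Sum>a\<in>S. w [] a * mass n (shift a w))"
  unfolding mass_def sum_words_Suc[OF finS] sum_distrib_left
  by (intro sum.cong refl Q_weight_Cons words_in_lists)

lemma mass_Suc_snoc: "mass (Suc n) w = (\<Sum>v\<in>words S n. Q_weight w [] v * (\<Sum>a\<in>S. w v a))"
  unfolding mass_def sum_words_snoc[OF finS] by (simp add: Q_weight_snoc sum_distrib_left)

lemma measurable_shift [measurable]: "a \<in> S \<Longrightarrow> shift a \<in> measurable G G"
  unfolding shift_def G_def
  by (intro measurable_restrict measurable_component_singleton) auto

lemma distr_shift: "a \<in> S \<Longrightarrow> distr G G (shift a) = G"
  unfolding shift_def G_def
  using distr_PiM_reindex[of "lists S" "\<lambda>_. M" "(#) a" "lists S"] prob_M by auto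

lemma distr_coord: "u \<in> lists S \<Longrightarrow> distr G M (\<lambda>w. w u) = M"
  unfolding G_def by (rule distr_PiM_component) (rule prob_M)

lemma indep_coord: "G.indep_vars (\<lambda>_. M) (\<lambda>u w. w u) (lists S)"
proof (subst G.indep_vars_iff_distr_eq_PiM')
  show "lists S \<noteq> {}" by auto
  show "(\<lambda>w. w u) \<in> measurable G M" if "u \<in> lists S" for u
    unfolding G_def using that by (rule measurable_component_singleton)
  have "distr G (PiM (lists S) (\<lambda>_. M)) (\<lambda>w. \<lambda>u\<in>lists S. w u) = distr G G (\<lambda>w. w)"
    by (intro distr_cong) (auto simp: G_def space_PiM PiE_restrict[unfolded restrict_def] restrict_def PiE_iff extensional_def fun_eq_iff)
  also have "\<dots> = PiM (lists S) (\<lambda>u. distr G M (\<lambda>w. w u))"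
    unfolding distr_id by (subst G_def) (intro PiM_cong refl distr_coord[symmetric])
  finally show "distr G (PiM (lists S) (\<lambda>_. M)) (\<lambda>w. \<lambda>u\<in>lists S. w u) = PiM (lists S) (\<lambda>u. distr G M (\<lambda>w. w u))" .
qed

lemma indep_shifts: "G.indep_vars (\<lambda>_. G) shift S"
proof -
  let ?K = "\<lambda>a. (#) a ` lists S"
  have 1: "G.indep_vars (\<lambda>a. PiM (?K a) (\<lambda>_. M)) (\<lambda>a w. restrict (\<lambda>u. w u) (?K a)) S"
    by (rule G.indep_vars_restrict[OF indep_coord]) (auto simp: disjoint_family_on_def)
  have 2: "(\<lambda>z. \<lambda>v\<in>lists S. z (a # v)) \<in> measurable (PiM (?K a) (\<lambda>_. M)) G" if "a \<in> S" for a
    unfolding G_def by (intro measurable_restrict measurable_component_singleton) auto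
  have "G.indep_vars (\<lambda>_. G) (\<lambda>a w. \<lambda>v\<in>lists S. (restrict (\<lambda>u. w u) (?K a)) (a # v)) S"
    using G.indep_vars_compose2[OF 1 2] by simp
  moreover have "(\<lambda>a w. \<lambda>v\<in>lists S. (restrict (\<lambda>u. w u) (?K a)) (a # v)) = shift"
    by (auto simp: shift_def fun_eq_iff restrict_def)
  ultimately show ?thesis by simp
qed

text \<open>The root weights and the environments below the children read disjoint sets of
  coordinates, so the root may be frozen and integrated separately. The recursions on the first
  letter start here.\<close>

lemma branching:
  assumes F: "F \<in> borel_measurable (M \<Otimes>\<^sub>M PiM S (\<lambda>_. G))"
  shows "(\<integral>\<^sup>+w. F (w [], \<lambda>a\<in>S. shift a w) \<partial>G) = (\<integral>\<^sup>+x. (\<integral>\<^sup>+w. F (x, \<lambda>a\<in>S. shift a w) \<partial>G) \<partial>M)"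
proof -
  let ?B = "lists S - {[]}"
  let ?h = "\<lambda>z. \<lambda>a\<in>S. \<lambda>v\<in>lists S. z (a # v)"
  have 1: "G.indep_var (PiM {[]} (\<lambda>_. M)) (\<lambda>w. restrict (\<lambda>u. w u) {[]}) (PiM ?B (\<lambda>_. M)) (\<lambda>w. restrict (\<lambda>u. w u) ?B)"
    by (rule G.indep_var_restrict[OF indep_coord]) auto
  have 2: "(\<lambda>z. z []) \<in> measurable (PiM {[]} (\<lambda>_. M)) M"
    by (rule measurable_component_singleton) simp
  have 3: "?h \<in> measurable (PiM ?B (\<lambda>_. M)) (PiM S (\<lambda>_. G))"
    unfolding G_def by (intro measurable_restrict measurable_component_singleton) auto
  have 4: "(\<lambda>z. F (fst z [], ?h (snd z))) \<in> borel_measurable (PiM {[]} (\<lambda>_. M) \<Otimes>\<^sub>M PiM ?B (\<lambda>_. M))"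
    using measurable_compose[OF measurable_Pair[OF measurable_compose[OF measurable_fst 2] measurable_compose[OF measurable_snd 3]] F] .
  have h: "?h (restrict (\<lambda>u. w u) ?B) = (\<lambda>a\<in>S. shift a w)" for w
    by (auto simp: shift_def fun_eq_iff restrict_def)
  have w0: "(\<lambda>w. w []) \<in> measurable G M"
    unfolding G_def by (rule measurable_component_singleton) simp
  have sh: "(\<lambda>w. \<lambda>a\<in>S. shift a w) \<in> measurable G (PiM S (\<lambda>_. G))"
    by (intro measurable_restrict measurable_shift)
  have "(\<integral>\<^sup>+w. F (w [], \<lambda>a\<in>S. shift a w) \<partial>G) = (\<integral>\<^sup>+w. (\<integral>\<^sup>+w'. F (w [], \<lambda>a\<in>S. shift a w') \<partial>G) \<partial>G)"
    using G.indep_var_nn_integral_freeze[OF 1 4] unfolding fst_conv snd_conv h by simp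
  also have "\<dots> = (\<integral>\<^sup>+x. (\<integral>\<^sup>+w'. F (x, \<lambda>a\<in>S. shift a w') \<partial>G) \<partial>distr G M (\<lambda>w. w []))"
  proof (rule nn_integral_distr[OF w0, symmetric])
    have "(\<lambda>z. F (fst z, \<lambda>a\<in>S. shift a (snd z))) \<in> borel_measurable (M \<Otimes>\<^sub>M G)"
      using measurable_compose[OF measurable_Pair[OF measurable_fst measurable_compose[OF measurable_snd sh]] F] .
    then show "(\<lambda>x. \<integral>\<^sup>+w'. F (x, \<lambda>a\<in>S. shift a w') \<partial>G) \<in> borel_measurable (distr G M (\<lambda>w. w []))"
      using G.borel_measurable_nn_integral_fst by fastforce
  qed
  finally show ?thesis by (simp add: distr_coord)
qed

lemma nn_integral_shift:
  assumes "a \<in> S" "g \<in> borel_measurable G"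
  shows "(\<integral>\<^sup>+w. g (shift a w) \<partial>G) = (\<integral>\<^sup>+w. g w \<partial>G)"
  using nn_integral_distr[OF measurable_shift[OF assms(1)], of g] assms distr_shift[OF assms(1)] by simp

lemma branching_linear:
  assumes f[measurable]: "\<And>a. a \<in> C \<Longrightarrow> f a \<in> borel_measurable M" and g[measurable]: "g \<in> borel_measurable G"
    and C: "C \<subseteq> S"
  shows "(\<integral>\<^sup>+w. (\<Sum>a\<in>C. f a (w []) * g (shift a w)) \<partial>G) = (\<Sum>a\<in>C. \<integral>\<^sup>+x. f a x \<partial>M) * (\<integral>\<^sup>+w. g w \<partial>G)"
proof -
  have [measurable]: "(\<lambda>w. w []) \<in> measurable G M"
    unfolding G_def by (rule measurable_component_singleton) simp
  have gs[measurable]: "(\<lambda>w. g (shift a w)) \<in> borel_measurable G" if "a \<in> C" for a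
    using that C by (intro measurable_compose[OF measurable_shift g]) auto
  have "(\<integral>\<^sup>+w. (\<Sum>a\<in>C. f a (w []) * g (shift a w)) \<partial>G) = (\<Sum>a\<in>C. \<integral>\<^sup>+w. f a (w []) * g (shift a w) \<partial>G)"
    by (rule nn_integral_sum) auto
  also have "\<dots> = (\<Sum>a\<in>C. (\<integral>\<^sup>+x. f a x \<partial>M) * (\<integral>\<^sup>+w. g w \<partial>G))"
  proof (rule sum.cong)
    fix a assume a: "a \<in> C"
    then have aS: "a \<in> S" using C by auto
    have "(\<lambda>z. f a (fst z) * g (snd z a)) \<in> borel_measurable (M \<Otimes>\<^sub>M PiM S (\<lambda>_. G))"
      using a measurable_compose[OF measurable_compose[OF measurable_snd measurable_component_singleton[OF aS]] g] by measurable
    then have "(\<integral>\<^sup>+w. f a (w []) * g (shift a w) \<partial>G) = (\<integral>\<^sup>+x. (\<integral>\<^sup>+w. f a x * g (shift a w) \<partial>G) \<partial>M)"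
      using branching[of "\<lambda>z. f a (fst z) * g (snd z a)"] aS by simp
    also have "\<dots> = (\<integral>\<^sup>+x. f a x * (\<integral>\<^sup>+w. g w \<partial>G) \<partial>M)"
      using a aS by (intro nn_integral_cong) (simp add: nn_integral_cmult nn_integral_shift)
    also have "\<dots> = (\<integral>\<^sup>+x. f a x \<partial>M) * (\<integral>\<^sup>+w. g w \<partial>G)"
      using a by (intro nn_integral_multc) auto
    finally show "(\<integral>\<^sup>+w. f a (w []) * g (shift a w) \<partial>G) = (\<integral>\<^sup>+x. f a x \<partial>M) * (\<integral>\<^sup>+w. g w \<partial>G)" .
  qed simp
  finally show ?thesis by (simp add: sum_distrib_right)
qed

lemma int_powr:
  assumes "a \<in> S" "0 \<le> q" "q \<le> q0"
  shows "integrable M (\<lambda>x. x a powr q)"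
proof (rule Bochner_Integration.integrable_bound)
  show "integrable M (\<lambda>x. 1 + x a powr q0)" using int_q0[OF assms(1)] by auto
  show "(\<lambda>x. x a powr q) \<in> borel_measurable M" using meas[OF assms(1)] by measurable
  show "AE x in M. norm (x a powr q) \<le> norm (1 + x a powr q0)"
    using powr_le_one_plus[OF nonneg[OF _ assms(1)] assms(2,3)] by (intro AE_I2) auto
qed

lemma int_coord: "a \<in> S \<Longrightarrow> integrable M (\<lambda>x. x a)"
  using int_powr[of a 1] q0 nonneg by (subst Bochner_Integration.integrable_cong[OF refl, of _ _ "\<lambda>x. x a powr 1"]) auto

lemma nn_int_powr:
  assumes "a \<in> S" "0 \<le> q" "q \<le> q0"
  shows "(\<integral>\<^sup>+x. ennreal (x a powr q) \<partial>M) = ennreal (\<integral>x. x a powr q \<partial>M)"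
  by (intro nn_integral_eq_integral int_powr assms) auto

lemma nn_int_coord: "a \<in> S \<Longrightarrow> (\<integral>\<^sup>+x. ennreal (x a) \<partial>M) = ennreal (\<integral>x. x a \<partial>M)"
  using nonneg by (intro nn_integral_eq_integral int_coord) (auto intro!: AE_I2)

lemma mean_nonneg: "a \<in> S \<Longrightarrow> 0 \<le> (\<integral>x. x a \<partial>M)"
  using nonneg by (intro integral_nonneg_AE AE_I2) auto

lemma sum_nn_int_powr:
  assumes "0 \<le> q" "q \<le> q0"
  shows "(\<Sum>a\<in>S. \<integral>\<^sup>+x. ennreal (x a powr q) \<partial>M) = ennreal (\<phi> q)"
  unfolding \<phi>_def using assms by (subst sum_ennreal[symmetric]) (auto simp: nn_int_powr intro!: sum.cong)

lemma phi_nonneg: "0 \<le> \<phi> q"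
  unfolding \<phi>_def by (intro sum_nonneg integral_nonneg_AE) auto

lemma nn_integral_mass: "(\<integral>\<^sup>+w. ennreal (mass n w) \<partial>G) = 1"
proof (induction n)
  case (Suc n)
  have "(\<integral>\<^sup>+w. ennreal (mass (Suc n) w) \<partial>G) = (\<integral>\<^sup>+w. (\<Sum>a\<in>S. ennreal (w [] a) * ennreal (mass n (shift a w))) \<partial>G)"
  proof (rule nn_integral_cong)
    fix w assume w: "w \<in> space G"
    have "0 \<le> mass n (shift a w)" if "a \<in> S" for a
      using measurable_space[OF measurable_shift[OF that] w] by (rule mass_nonneg)
    then show "ennreal (mass (Suc n) w) = (\<Sum>a\<in>S. ennreal (w [] a) * ennreal (mass n (shift a w)))"
      unfolding mass_Suc using coord_nonneg[OF w, of "[]"]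
      by (subst sum_ennreal[symmetric]) (auto simp: ennreal_mult)
  qed
  also have "\<dots> = (\<Sum>a\<in>S. \<integral>\<^sup>+x. ennreal (x a) \<partial>M) * (\<integral>\<^sup>+w. ennreal (mass n w) \<partial>G)"
    using meas by (intro branching_linear) auto
  also have "(\<Sum>a\<in>S. \<integral>\<^sup>+x. ennreal (x a) \<partial>M) = ennreal (\<Sum>a\<in>S. \<integral>x. x a \<partial>M)"
    using mean_nonneg by (subst sum_ennreal[symmetric]) (auto simp: nn_int_coord)
  finally show ?case using Suc mean_one by simp
qed (simp add: G.emeasure_space_1)

lemma integrable_mass: "integrable G (mass n)" and expectation_mass: "(\<integral>w. mass n w \<partial>G) = 1"
proof -
  show i: "integrable G (mass n)"
    by (rule integrableI_nonneg) (auto intro!: AE_I2 mass_nonneg simp: nn_integral_mass)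
  have "ennreal (\<integral>w. mass n w \<partial>G) = 1"
    using nn_integral_eq_integral[OF i] mass_nonneg nn_integral_mass[of n] by (auto simp: AE_I2)
  then show "(\<integral>w. mass n w \<partial>G) = 1" by (metis ennreal_1 ennreal_inj integral_nonneg_AE AE_I2 mass_nonneg zero_le_one)
qed

lemma nn_integral_Q_powr:
  assumes q: "0 < q" "q \<le> q0"
  shows "(\<integral>\<^sup>+w. (\<Sum>v\<in>words S n. ennreal (Q_weight w [] v powr q)) \<partial>G) = ennreal (\<phi> q ^ n)"
proof (induction n)
  case 0
  have "(\<Sum>v\<in>words S 0. ennreal (Q_weight w [] v powr q)) = 1" for w
    by (simp only: words_0 sum.insert finite.emptyI) simp
  then show ?case using q by (simp add: G.emeasure_space_1)
next
  case (Suc n)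
  have "(\<integral>\<^sup>+w. (\<Sum>v\<in>words S (Suc n). ennreal (Q_weight w [] v powr q)) \<partial>G)
      = (\<integral>\<^sup>+w. (\<Sum>a\<in>S. ennreal (w [] a powr q) * (\<Sum>v\<in>words S n. ennreal (Q_weight (shift a w) [] v powr q))) \<partial>G)"
    unfolding sum_words_Suc[OF finS] sum_distrib_left
    by (intro nn_integral_cong sum.cong refl)
      (simp add: Q_weight_Cons[OF _ words_in_lists] powr_mult ennreal_mult)
  also have "\<dots> = (\<Sum>a\<in>S. \<integral>\<^sup>+x. ennreal (x a powr q) \<partial>M) * (\<integral>\<^sup>+w. (\<Sum>v\<in>words S n. ennreal (Q_weight w [] v powr q)) \<partial>G)"
  proof (rule branching_linear)
    show "(\<lambda>x. ennreal (x a powr q)) \<in> borel_measurable M" if "a \<in> S" for a using meas[OF that] by measurable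
    show "(\<lambda>w. \<Sum>v\<in>words S n. ennreal (Q_weight w [] v powr q)) \<in> borel_measurable G"
    proof (rule borel_measurable_sum)
      fix v assume "v \<in> words S n"
      from measurable_Q[OF words_in_lists[OF this]]
      show "(\<lambda>w. ennreal (Q_weight w [] v powr q)) \<in> borel_measurable G" by measurable
    qed
  qed simp
  also have "\<dots> = ennreal (\<phi> q) * ennreal (\<phi> q ^ n)"
    using q Suc by (simp add: sum_nn_int_powr)
  finally show ?case by (simp add: ennreal_mult[symmetric] phi_nonneg)
qed

text \<open>Given the root weights, the contributions of the children are independent, and the
  inequality for sums of independent variables applies. The powers of the terms give the first
  summand, the power of the conditional mean gives the second.\<close>

lemma moment_upper:
  assumes C: "C \<subseteq> S" and Zm[measurable]: "Z \<in> borel_measurable G" and Znn: "\<And>w. w \<in> space G \<Longrightarrow> 0 \<le> Z w"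
    and Zi: "integrable G Z" and p: "1 < p" "p \<le> 2"
  shows "(\<integral>\<^sup>+w. ennreal ((\<Sum>a\<in>C. w [] a * Z (shift a w)) powr p) \<partial>G) \<le>
    (\<Sum>a\<in>C. \<integral>\<^sup>+x. ennreal (x a powr p) \<partial>M) * (\<integral>\<^sup>+w. ennreal (Z w powr p) \<partial>G) +
    (\<integral>\<^sup>+x. ennreal ((\<Sum>a\<in>C. x a) powr p) \<partial>M) * ennreal ((\<integral>w. Z w \<partial>G) powr p)"
proof -
  have m[measurable]: "\<And>a. a \<in> C \<Longrightarrow> (\<lambda>x. x a) \<in> borel_measurable M" using meas C by auto
  have Zs[measurable]: "(\<lambda>w. Z (shift a w)) \<in> borel_measurable G" if "a \<in> C" for a
    using that C by (intro measurable_compose[OF measurable_shift Zm]) auto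
  have Zsnn: "0 \<le> Z (shift a w)" if "a \<in> C" "w \<in> space G" for a w
    using that C by (intro Znn measurable_space[OF measurable_shift]) auto
  have Zsi: "integrable G (\<lambda>w. Z (shift a w))" "(\<integral>w. Z (shift a w) \<partial>G) = (\<integral>w. Z w \<partial>G)" if "a \<in> C" for a
    using integrable_distr_eq[OF measurable_shift[of a] Zm] integral_distr[OF measurable_shift[of a] Zm]
      distr_shift[of a] Zi that C by auto
  let ?F = "\<lambda>z. ennreal ((\<Sum>a\<in>C. fst z a * Z (snd z a)) powr p)"
  have "(\<lambda>z. fst z a * Z (snd z a)) \<in> borel_measurable (M \<Otimes>\<^sub>M PiM S (\<lambda>_. G))" if a: "a \<in> C" for a
    using C a measurable_compose[OF measurable_fst m[OF a]]
      measurable_compose[OF measurable_compose[OF measurable_snd measurable_component_singleton[of a S]] Zm]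
    by (intro borel_measurable_times) auto
  then have "?F \<in> borel_measurable (M \<Otimes>\<^sub>M PiM S (\<lambda>_. G))"
    by (intro measurable_compose[OF borel_measurable_sum[of C "\<lambda>a z. fst z a * Z (snd z a)"]]) auto
  from branching[OF this]
  have "(\<integral>\<^sup>+w. ennreal ((\<Sum>a\<in>C. w [] a * Z (shift a w)) powr p) \<partial>G)
     = (\<integral>\<^sup>+x. (\<integral>\<^sup>+w. ennreal ((\<Sum>a\<in>C. x a * Z (shift a w)) powr p) \<partial>G) \<partial>M)"
    using C by (simp add: subset_eq cong: sum.cong)
  also have "\<dots> \<le> (\<integral>\<^sup>+x. (\<Sum>a\<in>C. ennreal (x a powr p)) * (\<integral>\<^sup>+w. ennreal (Z w powr p) \<partial>G)
      + ennreal ((\<Sum>a\<in>C. x a) powr p) * ennreal ((\<integral>w. Z w \<partial>G) powr p) \<partial>M)"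
  proof (rule nn_integral_mono)
    fix x assume x: "x \<in> space M"
    have xn: "0 \<le> x a" if "a \<in> C" for a using nonneg[OF x] that C by auto
    have "G.indep_vars (\<lambda>_. borel) (\<lambda>a w. x a * Z (shift a w)) C"
      by (rule G.indep_vars_compose2[OF G.indep_vars_subset[OF indep_shifts C], of "\<lambda>a w. x a * Z w"]) measurable
    then have "(\<integral>\<^sup>+w. ennreal ((\<Sum>a\<in>C. x a * Z (shift a w)) powr p) \<partial>G) \<le>
       (\<Sum>a\<in>C. \<integral>\<^sup>+w. ennreal ((x a * Z (shift a w)) powr p) \<partial>G) + ennreal ((\<Sum>a\<in>C. \<integral>w. x a * Z (shift a w) \<partial>G) powr p)"
      using finite_subset[OF C finS] xn Zsnn Zsi p by (intro G.nn_integral_sum_powr_le) auto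
    also have "(\<Sum>a\<in>C. \<integral>\<^sup>+w. ennreal ((x a * Z (shift a w)) powr p) \<partial>G) = (\<Sum>a\<in>C. ennreal (x a powr p) * (\<integral>\<^sup>+w. ennreal (Z w powr p) \<partial>G))"
    proof (rule sum.cong)
      fix a assume a: "a \<in> C"
      have "(\<integral>\<^sup>+w. ennreal ((x a * Z (shift a w)) powr p) \<partial>G) = (\<integral>\<^sup>+w. ennreal (x a powr p) * ennreal (Z (shift a w) powr p) \<partial>G)"
        by (simp add: powr_mult ennreal_mult)
      also have "\<dots> = ennreal (x a powr p) * (\<integral>\<^sup>+w. ennreal (Z (shift a w) powr p) \<partial>G)"
        using a by (intro nn_integral_cmult) auto
      also have "(\<integral>\<^sup>+w. ennreal (Z (shift a w) powr p) \<partial>G) = (\<integral>\<^sup>+w. ennreal (Z w powr p) \<partial>G)"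
        using nn_integral_shift[of a "\<lambda>w. ennreal (Z w powr p)"] a C by auto
      finally show "(\<integral>\<^sup>+w. ennreal ((x a * Z (shift a w)) powr p) \<partial>G) = ennreal (x a powr p) * (\<integral>\<^sup>+w. ennreal (Z w powr p) \<partial>G)" .
    qed simp
    also have "(\<Sum>a\<in>C. \<integral>w. x a * Z (shift a w) \<partial>G) = (\<Sum>a\<in>C. x a) * (\<integral>w. Z w \<partial>G)"
      using Zsi by (simp add: sum_distrib_right)
    also have "ennreal (((\<Sum>a\<in>C. x a) * (\<integral>w. Z w \<partial>G)) powr p) = ennreal ((\<Sum>a\<in>C. x a) powr p) * ennreal ((\<integral>w. Z w \<partial>G) powr p)"
      by (simp only: powr_mult ennreal_mult[OF powr_ge_zero powr_ge_zero])
    finally show "(\<integral>\<^sup>+w. ennreal ((\<Sum>a\<in>C. x a * Z (shift a w)) powr p) \<partial>G) \<le> (\<Sum>a\<in>C. ennreal (x a powr p)) * (\<integral>\<^sup>+w. ennreal (Z w powr p) \<partial>G)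
      + ennreal ((\<Sum>a\<in>C. x a) powr p) * ennreal ((\<integral>w. Z w \<partial>G) powr p)"
      by (simp only: sum_distrib_right)
  qed
  also have "\<dots> = (\<Sum>a\<in>C. \<integral>\<^sup>+x. ennreal (x a powr p) \<partial>M) * (\<integral>\<^sup>+w. ennreal (Z w powr p) \<partial>G) +
    (\<integral>\<^sup>+x. ennreal ((\<Sum>a\<in>C. x a) powr p) \<partial>M) * ennreal ((\<integral>w. Z w \<partial>G) powr p)"
    by (subst nn_integral_add, measurable, subst (1 2) nn_integral_multc, measurable, subst nn_integral_sum, measurable)
  finally show ?thesis .
qed

lemma nn_integral_sum_coord_powr_finite:
  assumes "C \<subseteq> S" "1 \<le> p" "p \<le> q0"
  shows "(\<integral>\<^sup>+x. ennreal ((\<Sum>a\<in>C. x a) powr p) \<partial>M) < \<infinity>"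
proof -
  have fC: "finite C" using assms finS finite_subset by auto
  have le: "(\<Sum>a\<in>C. x a) powr p \<le> real (card C) powr p * (\<Sum>a\<in>C. x a powr p)" if x: "x \<in> space M" for x
  proof (cases "C = {}")
    case False
    define m where "m = Max (x ` C)"
    have m: "\<And>a. a \<in> C \<Longrightarrow> x a \<le> m" using fC by (auto simp: m_def)
    have "m \<in> x ` C" unfolding m_def using fC False by (intro Max_in) auto
    then obtain b where b: "b \<in> C" "x b = m" by auto
    have xn: "\<And>a. a \<in> C \<Longrightarrow> 0 \<le> x a" using nonneg[OF x] assms by auto
    have "(\<Sum>a\<in>C. x a) \<le> real (card C) * m" using sum_bounded_above[of C x m] m by simp
    then have "(\<Sum>a\<in>C. x a) powr p \<le> (real (card C) * m) powr p"
      using xn assms by (intro powr_mono2 sum_nonneg) auto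
    also have "\<dots> = real (card C) powr p * x b powr p" using b by (simp add: powr_mult)
    also have "\<dots> \<le> real (card C) powr p * (\<Sum>a\<in>C. x a powr p)"
      using b fC by (intro mult_left_mono member_le_sum) auto
    finally show ?thesis .
  qed (use assms in simp)
  have i: "integrable M (\<lambda>x. real (card C) powr p * (\<Sum>a\<in>C. x a powr p))"
    using assms int_powr by (intro integrable_mult_right Bochner_Integration.integrable_sum) auto
  have "(\<integral>\<^sup>+x. ennreal ((\<Sum>a\<in>C. x a) powr p) \<partial>M) \<le> (\<integral>\<^sup>+x. ennreal (real (card C) powr p * (\<Sum>a\<in>C. x a powr p)) \<partial>M)"
    by (intro nn_integral_mono ennreal_leI le)
  also have "\<dots> = ennreal (\<integral>x. real (card C) powr p * (\<Sum>a\<in>C. x a powr p) \<partial>M)"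
    by (intro nn_integral_eq_integral i) (auto intro!: mult_nonneg_nonneg sum_nonneg)
  finally show ?thesis by (auto simp: top_unique less_top intro: le_less_trans)
qed

lemma phi_derivative:
  shows "(\<lambda>n. (\<phi> (1 + step n) - 1) / step n) \<longlonglongrightarrow> - H"
    and "(\<lambda>n. (\<phi> (1 - step n) - 1) / step n) \<longlonglongrightarrow> H"
proof -
  note d = M.moment_derivative[OF int_coord nonneg q0 int_q0]
  have e: "(\<phi> q - 1) / s = (\<Sum>a\<in>S. ((\<integral>x. x a powr q \<partial>M) - (\<integral>x. x a \<partial>M)) / s)" for q s
    by (simp add: \<phi>_def sum_divide_distrib[symmetric] sum_subtractf mean_one)
  have "(\<lambda>n. (\<phi> (1 + step n) - 1) / step n) \<longlonglongrightarrow> (\<Sum>a\<in>S. \<integral>x. x a * ln (x a) \<partial>M)"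
    unfolding e by (intro tendsto_sum d(2))
  then show "(\<lambda>n. (\<phi> (1 + step n) - 1) / step n) \<longlonglongrightarrow> - H" by (simp add: H_def)
  have "(\<lambda>n. (\<phi> (1 - step n) - 1) / step n) \<longlonglongrightarrow> (\<Sum>a\<in>S. - (\<integral>x. x a * ln (x a) \<partial>M))"
    unfolding e by (intro tendsto_sum d(3))
  then show "(\<lambda>n. (\<phi> (1 - step n) - 1) / step n) \<longlonglongrightarrow> H" by (simp add: H_def sum_negf)
qed

end

section \<open>Convergence and moments of the total mass\<close>

context cascade
begin

text \<open>Where the masses do not converge, \<open>lim\<close> is an unspecified value; the
  maximum makes \<open>Y\<close> non-negative at every environment.\<close>

definition Y :: "('a list \<Rightarrow> 'a \<Rightarrow> real) \<Rightarrow> real" where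
  "Y w = max 0 (lim (\<lambda>n. mass n w))"

lemma measurable_Y [measurable]: "Y \<in> borel_measurable G"
  unfolding Y_def by (intro borel_measurable_max borel_measurable_const borel_measurable_lim_metric measurable_mass)

lemma Y_nonneg: "0 \<le> Y w"
  by (simp add: Y_def)

lemma Y_eqI: "(\<lambda>n. mass n w) \<longlonglongrightarrow> l \<Longrightarrow> 0 \<le> l \<Longrightarrow> Y w = l"
  by (simp add: Y_def limI)

text \<open>This covers both ways in which the limit can be non-trivial:
  \<open>\<phi> p < 1\<close>, and a total mass that is almost surely equal to 1.\<close>

definition regular :: "real \<Rightarrow> bool" where
  "regular p \<longleftrightarrow> 1 < p \<and> p \<le> 2 \<and> p \<le> q0 \<and> (AE w in G. (\<lambda>n. mass n w) \<longlonglongrightarrow> Y w) \<and>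
    integrable G Y \<and> (\<integral>w. Y w \<partial>G) = 1 \<and> (\<integral>\<^sup>+w. ennreal (Y w powr p) \<partial>G) < \<infinity>"

lemma measurable_coord_M [measurable]: "u \<in> lists S \<Longrightarrow> (\<lambda>w. w u) \<in> measurable G M"
  unfolding G_def by (rule measurable_component_singleton)

lemma integral_coord:
  fixes f :: "('a \<Rightarrow> real) \<Rightarrow> real"
  assumes "u \<in> lists S" "f \<in> borel_measurable M"
  shows "(\<integral>w. f (w u) \<partial>G) = (\<integral>x. f x \<partial>M)" "integrable G (\<lambda>w. f (w u)) \<longleftrightarrow> integrable M f"
  using integral_distr[OF measurable_coord_M[OF assms(1)] assms(2)]
    integrable_distr_eq[OF measurable_coord_M[OF assms(1)] assms(2)]
  by (simp_all add: distr_coord assms)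

lemma AE_coord:
  assumes "AE x in M. P x"
  shows "AE w in G. \<forall>u\<in>lists S. P (w u)"
proof -
  have "countable (lists S)" using finS by (simp add: countable_finite)
  then show ?thesis
  proof (subst AE_ball_countable, assumption, intro ballI)
    fix u assume "u \<in> lists S"
    then show "AE w in G. P (w u)"
      unfolding G_def by (rule AE_PiM_component[OF prob_M _ assms])
  qed
qed

text \<open>The coordinates that determine the masses up to time \<open>n\<close>; restriction to
  them takes the place of a filtration.\<close>

definition level :: "nat \<Rightarrow> 'a list set" where
  "level n = {v \<in> lists S. length v < n}"

lemma Q_weight_restrict_level:
  assumes "v \<in> lists S" "length v \<le> n"
  shows "Q_weight (restrict w (level n)) [] v = Q_weight w [] v"
  unfolding Q_weight_def using assms
  by (intro prod.cong refl) (simp add: level_def take_in_lists del: in_lists_conv_set)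

lemma mass_restrict_level: "m \<le> n \<Longrightarrow> mass m (restrict w (level n)) = mass m w"
  unfolding mass_def by (intro sum.cong refl Q_weight_restrict_level) auto

lemma measurable_Q_level:
  "v \<in> lists S \<Longrightarrow> length v \<le> n \<Longrightarrow> (\<lambda>w. Q_weight w [] v) \<in> borel_measurable (PiM (level n) (\<lambda>_. M))"
  by (intro measurable_Q_PiM) (auto simp: level_def dest: in_set_takeD)

lemma measurable_mass_level:
  "m \<le> n \<Longrightarrow> mass m \<in> borel_measurable (PiM (level n) (\<lambda>_. M))"
  unfolding mass_def by (intro borel_measurable_sum measurable_Q_level) auto

lemma indep_level:
  "G.indep_var (PiM (level n) (\<lambda>_. M)) (\<lambda>w. restrict (\<lambda>u. w u) (level n))
     (PiM (words S n) (\<lambda>_. M)) (\<lambda>w. restrict (\<lambda>u. w u) (words S n))"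
  by (rule G.indep_var_restrict[OF indep_coord]) (auto simp: level_def)

lemma measurable_sum_coord: "(\<lambda>x. \<Sum>a\<in>S. x a) \<in> borel_measurable M"
  using meas by measurable

lemma mean_sum: "(\<integral>x. (\<Sum>a\<in>S. x a) \<partial>M) = 1" "integrable M (\<lambda>x. \<Sum>a\<in>S. x a)"
  using int_coord mean_one by auto

text \<open>Conditioning on the first \<open>n\<close> generations: the vectors that are added next
  sit at the words of length \<open>n\<close>, disjoint from \<open>level n\<close>, and may be
  integrated over an independent copy.\<close>

lemma level_moment:
  fixes F :: "('a list \<Rightarrow> 'a \<Rightarrow> real) \<Rightarrow> real \<Rightarrow> ennreal"
  assumes F: "(\<lambda>z. F (fst z) (snd z)) \<in> borel_measurable (PiM (level n) (\<lambda>_. M) \<Otimes>\<^sub>M borel)"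
  shows "(\<integral>\<^sup>+w. F (restrict w (level n)) (mass (Suc n) w) \<partial>G) =
    (\<integral>\<^sup>+w. (\<integral>\<^sup>+w'. F (restrict w (level n)) (\<Sum>v\<in>words S n. Q_weight w [] v * (\<Sum>a\<in>S. w' v a)) \<partial>G) \<partial>G)"
proof -
  let ?s = "\<lambda>z. \<Sum>v\<in>words S n. Q_weight (fst z) [] v * (\<Sum>a\<in>S. snd z v a)"
  have m: "?s \<in> borel_measurable (PiM (level n) (\<lambda>_. M) \<Otimes>\<^sub>M PiM (words S n) (\<lambda>_. M))"
  proof (intro borel_measurable_sum borel_measurable_times)
    fix v assume v: "v \<in> words S n"
    then show "(\<lambda>z. Q_weight (fst z) [] v) \<in> borel_measurable (PiM (level n) (\<lambda>_. M) \<Otimes>\<^sub>M PiM (words S n) (\<lambda>_. M))"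
      by (intro measurable_compose[OF measurable_fst measurable_Q_level]) auto
    fix a assume "a \<in> S"
    with v show "(\<lambda>z. snd z v a) \<in> borel_measurable (PiM (level n) (\<lambda>_. M) \<Otimes>\<^sub>M PiM (words S n) (\<lambda>_. M))"
      by (intro measurable_compose[OF measurable_snd measurable_coord_PiM])
  qed
  have FM: "(\<lambda>z. F (fst z) (?s z)) \<in> borel_measurable (PiM (level n) (\<lambda>_. M) \<Otimes>\<^sub>M PiM (words S n) (\<lambda>_. M))"
    using measurable_compose[OF measurable_Pair[OF measurable_fst m] F] by simp
  have s: "(\<Sum>v\<in>words S n. Q_weight (restrict w (level n)) [] v * (\<Sum>a\<in>S. restrict w' (words S n) v a)) =
      (\<Sum>v\<in>words S n. Q_weight w [] v * (\<Sum>a\<in>S. w' v a))" for w w'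
    by (intro sum.cong refl arg_cong2[where f="(*)"] Q_weight_restrict_level) auto
  show ?thesis
    using G.indep_var_nn_integral_freeze[OF indep_level FM]
    by (simp only: fst_conv snd_conv s mass_Suc_snoc)
qed

text \<open>The martingale property, tested against functions \<open>g\<close> of the past instead
  of being phrased with conditional expectations.\<close>

lemma mass_martingale:
  assumes g: "g \<in> borel_measurable (PiM (level n) (\<lambda>_. M))"
  shows "(\<integral>\<^sup>+w. ennreal (mass (Suc n) w) * g (restrict w (level n)) \<partial>G) =
    (\<integral>\<^sup>+w. ennreal (mass n w) * g (restrict w (level n)) \<partial>G)"
proof -
  have "(\<lambda>z. ennreal (snd z) * g (fst z)) \<in> borel_measurable (PiM (level n) (\<lambda>_. M) \<Otimes>\<^sub>M borel)"
    using g by measurable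
  from level_moment[of "\<lambda>x y. ennreal y * g x" n, OF this]
  have "(\<integral>\<^sup>+w. ennreal (mass (Suc n) w) * g (restrict w (level n)) \<partial>G) =
    (\<integral>\<^sup>+w. (\<integral>\<^sup>+w'. ennreal (\<Sum>v\<in>words S n. Q_weight w [] v * (\<Sum>a\<in>S. w' v a)) * g (restrict w (level n)) \<partial>G) \<partial>G)"
    by (simp only:)
  also have "\<dots> = (\<integral>\<^sup>+w. ennreal (mass n w) * g (restrict w (level n)) \<partial>G)"
  proof (rule nn_integral_cong)
    fix w assume w: "w \<in> space G"
    let ?q = "\<lambda>v. Q_weight w [] v" and ?t = "\<lambda>w' v. \<Sum>a\<in>S. w' v a"
    have i: "integrable G (\<lambda>w'. ?t w' v)" "(\<integral>w'. ?t w' v \<partial>G) = 1" if "v \<in> words S n" for v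
      using integral_coord[of v "\<lambda>x. \<Sum>a\<in>S. x a"] that measurable_sum_coord mean_sum by auto
    have qn: "0 \<le> ?q v" if "v \<in> words S n" for v
      using Q_nonneg[OF w _ words_in_lists[OF that]] by simp
    have tn: "0 \<le> ?t w' v" if "w' \<in> space G" "v \<in> words S n" for w' v
      using coord_nonneg[OF that(1) words_in_lists[OF that(2)]] by (rule sum_nonneg)
    have si: "integrable G (\<lambda>w'. \<Sum>v\<in>words S n. ?q v * ?t w' v)"
      by (intro Bochner_Integration.integrable_sum integrable_mult_right i)
    have "(\<integral>\<^sup>+w'. ennreal (\<Sum>v\<in>words S n. ?q v * ?t w' v) \<partial>G) = ennreal (\<integral>w'. (\<Sum>v\<in>words S n. ?q v * ?t w' v) \<partial>G)"
      by (intro nn_integral_eq_integral[OF si] AE_I2 sum_nonneg mult_nonneg_nonneg qn tn)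
    also have "(\<integral>w'. (\<Sum>v\<in>words S n. ?q v * ?t w' v) \<partial>G) = (\<Sum>v\<in>words S n. \<integral>w'. ?q v * ?t w' v \<partial>G)"
      using i by (intro Bochner_Integration.integral_sum integrable_mult_right)
    also have "\<dots> = mass n w" using i unfolding mass_def by (intro sum.cong refl) simp
    finally have "(\<integral>\<^sup>+w'. ennreal (\<Sum>v\<in>words S n. ?q v * ?t w' v) \<partial>G) = ennreal (mass n w)" .
    moreover have "(\<lambda>w'. ennreal (\<Sum>v\<in>words S n. ?q v * ?t w' v)) \<in> borel_measurable G"
      by (rule measurable_compose[OF borel_measurable_integrable[OF si] measurable_ennreal])
    ultimately show "(\<integral>\<^sup>+w'. ennreal (\<Sum>v\<in>words S n. ?q v * ?t w' v) * g (restrict w (level n)) \<partial>G) =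
        ennreal (mass n w) * g (restrict w (level n))"
      by (subst nn_integral_multc) auto
  qed
  finally show ?thesis .
qed

text \<open>Given the past, the increment is a sum of independent centred variables,
  \<open>Q_weight w [] v\<close> times the sum of the weights at \<open>v\<close> minus 1. The von
  Bahr--Esseen inequality leaves the sum of the \<open>p\<close>-th powers of the
  \<open>Q_weight w [] v\<close>, whose mean is \<open>\<phi> p ^ n\<close>.\<close>

lemma increment_moment:
  assumes p: "1 < p" "p \<le> 2" "p \<le> q0"
  shows "\<exists>c\<ge>0. \<forall>n. (\<integral>\<^sup>+w. ennreal (\<bar>mass (Suc n) w - mass n w\<bar> powr p) \<partial>G) \<le> ennreal (c * \<phi> p ^ n)"
proof -
  let ?s = "\<lambda>x :: 'a \<Rightarrow> real. \<Sum>a\<in>S. x a"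
  have snn: "0 \<le> ?s x" if "x \<in> space M" for x using nonneg[OF that] by (intro sum_nonneg)
  have sp: "integrable M (\<lambda>x. ?s x powr p)"
    using nn_integral_sum_coord_powr_finite[of S p] p measurable_sum_coord by (intro integrableI_nonneg) auto
  have Ki: "integrable M (\<lambda>x. \<bar>?s x - 1\<bar> powr p)"
  proof (rule Bochner_Integration.integrable_bound)
    show "integrable M (\<lambda>x. 1 + ?s x powr p)" using sp by auto
    show "(\<lambda>x. \<bar>?s x - 1\<bar> powr p) \<in> borel_measurable M" using measurable_sum_coord by measurable
    show "AE x in M. norm (\<bar>?s x - 1\<bar> powr p) \<le> norm (1 + ?s x powr p)"
    proof (rule AE_I2)
      fix x assume x: "x \<in> space M"
      have "\<bar>?s x - 1\<bar> powr p \<le> (max 1 (?s x)) powr p"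
        using snn[OF x] p by (intro powr_mono2) auto
      also have "\<dots> \<le> 1 + ?s x powr p" by (auto simp: max_def)
      finally show "norm (\<bar>?s x - 1\<bar> powr p) \<le> norm (1 + ?s x powr p)" by simp
    qed
  qed
  define K where "K = (\<integral>x. \<bar>?s x - 1\<bar> powr p \<partial>M)"
  have K0: "K \<ge> 0" unfolding K_def by (intro integral_nonneg_AE) auto
  have "(\<integral>\<^sup>+w. ennreal (\<bar>mass (Suc n) w - mass n w\<bar> powr p) \<partial>G) \<le> ennreal (2 * p * K * \<phi> p ^ n)" for n
  proof -
    have "(\<lambda>z. ennreal (\<bar>snd z - mass n (fst z)\<bar> powr p)) \<in> borel_measurable (PiM (level n) (\<lambda>_. M) \<Otimes>\<^sub>M borel)"
      using measurable_compose[OF measurable_fst measurable_mass_level[of n n]] by measurable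
    from level_moment[of "\<lambda>x y. ennreal (\<bar>y - mass n x\<bar> powr p)" n, OF this]
    have "(\<integral>\<^sup>+w. ennreal (\<bar>mass (Suc n) w - mass n w\<bar> powr p) \<partial>G) =
       (\<integral>\<^sup>+w. (\<integral>\<^sup>+w'. ennreal (\<bar>(\<Sum>v\<in>words S n. Q_weight w [] v * ?s (w' v)) - mass n w\<bar> powr p) \<partial>G) \<partial>G)"
      by (simp only: mass_restrict_level[OF order_refl])
    also have "\<dots> \<le> (\<integral>\<^sup>+w. ennreal (2 * p * K) * (\<Sum>v\<in>words S n. ennreal (Q_weight w [] v powr p)) \<partial>G)"
    proof (rule nn_integral_mono)
      fix w assume w: "w \<in> space G"
      let ?X = "\<lambda>v w'. Q_weight w [] v * (?s (w' v) - 1)"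
      have ix: "integrable G (?X v)" "(\<integral>w'. ?X v w' \<partial>G) = 0" "integrable G (\<lambda>w'. \<bar>?X v w'\<bar> powr p)"
        "(\<integral>w'. \<bar>?X v w'\<bar> powr p \<partial>G) = Q_weight w [] v powr p * K" if v: "v \<in> words S n" for v
      proof -
        have vl: "v \<in> lists S" using v by auto
        have q: "0 \<le> Q_weight w [] v" using Q_nonneg[OF w _ vl] by simp
        have "integrable G (\<lambda>w'. ?s (w' v) - 1)" "(\<integral>w'. ?s (w' v) - 1 \<partial>G) = 0"
          using integral_coord[OF vl, of "\<lambda>x. ?s x"] measurable_sum_coord mean_sum by (auto simp: G.prob_space)
        then show "integrable G (?X v)" "(\<integral>w'. ?X v w' \<partial>G) = 0" by auto
        have a: "\<bar>?X v w'\<bar> powr p = Q_weight w [] v powr p * \<bar>?s (w' v) - 1\<bar> powr p" for w'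
          using q by (simp add: abs_mult powr_mult)
        have "(\<lambda>x. \<bar>?s x - 1\<bar> powr p) \<in> borel_measurable M" using measurable_sum_coord by measurable
        from integral_coord[OF vl this] Ki
        show "integrable G (\<lambda>w'. \<bar>?X v w'\<bar> powr p)"
          "(\<integral>w'. \<bar>?X v w'\<bar> powr p \<partial>G) = Q_weight w [] v powr p * K" unfolding a by (simp_all add: K_def)
      qed
      have "words S n \<subseteq> lists S" by auto
      then have ind: "G.indep_vars (\<lambda>_. borel) ?X (words S n)"
        using measurable_sum_coord
        by (intro G.indep_vars_compose2[OF G.indep_vars_subset[OF indep_coord], of _ "\<lambda>v x. Q_weight w [] v * (?s x - 1)"]) auto
      note vbe = G.von_Bahr_Esseen[OF finite_words[OF finS] ind ix(1,3,2) p(1,2)]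
      have "(\<integral>\<^sup>+w'. ennreal (\<bar>(\<Sum>v\<in>words S n. Q_weight w [] v * ?s (w' v)) - mass n w\<bar> powr p) \<partial>G)
          = (\<integral>\<^sup>+w'. ennreal (\<bar>\<Sum>v\<in>words S n. ?X v w'\<bar> powr p) \<partial>G)"
        by (simp add: mass_def right_diff_distrib sum_subtractf)
      also have "\<dots> = ennreal (\<integral>w'. \<bar>\<Sum>v\<in>words S n. ?X v w'\<bar> powr p \<partial>G)"
        using vbe by (intro nn_integral_eq_integral) auto
      also have "\<dots> \<le> ennreal (2 * p * (\<Sum>v\<in>words S n. \<integral>w'. \<bar>?X v w'\<bar> powr p \<partial>G))"
        using vbe by (intro ennreal_leI) simp
      also have "2 * p * (\<Sum>v\<in>words S n. \<integral>w'. \<bar>?X v w'\<bar> powr p \<partial>G) = 2 * p * K * (\<Sum>v\<in>words S n. Q_weight w [] v powr p)"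
        by (simp add: ix sum_distrib_left mult_ac)
      also have "ennreal \<dots> = ennreal (2 * p * K) * (\<Sum>v\<in>words S n. ennreal (Q_weight w [] v powr p))"
        using p K0 by (subst ennreal_mult) (auto intro!: sum_nonneg)
      finally show "(\<integral>\<^sup>+w'. ennreal (\<bar>(\<Sum>v\<in>words S n. Q_weight w [] v * ?s (w' v)) - mass n w\<bar> powr p) \<partial>G)
        \<le> ennreal (2 * p * K) * (\<Sum>v\<in>words S n. ennreal (Q_weight w [] v powr p))" .
    qed
    also have "\<dots> = ennreal (2 * p * K) * (\<integral>\<^sup>+w. (\<Sum>v\<in>words S n. ennreal (Q_weight w [] v powr p)) \<partial>G)"
    proof (rule nn_integral_cmult, rule borel_measurable_sum)
      fix v assume "v \<in> words S n"
      from measurable_Q[OF words_in_lists[OF this]]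
      show "(\<lambda>w. ennreal (Q_weight w [] v powr p)) \<in> borel_measurable G" by measurable
    qed
    also have "\<dots> = ennreal (2 * p * K * \<phi> p ^ n)"
      using p K0 phi_nonneg[of p] by (subst nn_integral_Q_powr) (auto simp: ennreal_mult)
    finally show ?thesis .
  qed
  then show ?thesis using p K0 by (intro exI[of _ "2 * p * K"]) auto
qed

lemma mass_moment_bounded:
  assumes p: "1 < p" "p \<le> 2" "p \<le> q0" and lt: "\<phi> p < 1"
  shows "\<exists>K. \<forall>n. (\<integral>\<^sup>+w. ennreal (mass n w powr p) \<partial>G) \<le> ennreal K"
proof -
  define c where "c = enn2real (\<integral>\<^sup>+x. ennreal ((\<Sum>a\<in>S. x a) powr p) \<partial>M)"
  have c: "(\<integral>\<^sup>+x. ennreal ((\<Sum>a\<in>S. x a) powr p) \<partial>M) = ennreal c" "c \<ge> 0"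
    using nn_integral_sum_coord_powr_finite[of S p] p by (auto simp: c_def less_top)
  \<comment> \<open>The fixed point of the affine recursion with slope \<open>\<phi> p\<close> and
    constant \<open>c\<close>, increased by 1 to cover the initial mass.\<close>
  define K where "K = 1 + c / (1 - \<phi> p)"
  have "\<phi> p * (c / (1 - \<phi> p)) + c = c / (1 - \<phi> p)" using lt by (simp add: field_simps)
  then have K: "\<phi> p * K + c \<le> K" "K \<ge> 1" using lt c by (auto simp: K_def distrib_left)
  have "(\<integral>\<^sup>+w. ennreal (mass n w powr p) \<partial>G) \<le> ennreal K" for n
  proof (induction n)
    case 0
    then show ?case using K by (simp add: G.emeasure_space_1)
  next
    case (Suc n)
    have "(\<integral>\<^sup>+w. ennreal (mass (Suc n) w powr p) \<partial>G) \<le>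
        (\<Sum>a\<in>S. \<integral>\<^sup>+x. ennreal (x a powr p) \<partial>M) * (\<integral>\<^sup>+w. ennreal (mass n w powr p) \<partial>G) +
        (\<integral>\<^sup>+x. ennreal ((\<Sum>a\<in>S. x a) powr p) \<partial>M) * ennreal ((\<integral>w. mass n w \<partial>G) powr p)"
      unfolding mass_Suc using p by (intro moment_upper measurable_mass mass_nonneg integrable_mass) auto
    also have "\<dots> \<le> ennreal (\<phi> p) * ennreal K + ennreal c"
      using p Suc by (auto simp: sum_nn_int_powr c expectation_mass intro!: add_mono mult_left_mono)
    also have "\<dots> = ennreal (\<phi> p * K + c)"
      using K c phi_nonneg[of p] by (subst ennreal_plus) (auto simp: ennreal_mult)
    also have "\<dots> \<le> ennreal K" using K by (intro ennreal_leI)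
    finally show ?case .
  qed
  then show ?thesis by blast
qed

text \<open>The increments are geometrically small in mean, so the masses converge almost surely and
  in mean, which preserves the expectation 1. Fatou's lemma then carries the uniform moment bound
  over to the limit.\<close>

lemma supercritical_regular:
  assumes p: "1 < p" "p \<le> 2" "p \<le> q0" and lt: "\<phi> p < 1"
  shows "regular p"
proof -
  let ?D = "\<lambda>n w. mass (Suc n) w - mass n w"
  obtain c where c: "c \<ge> 0" "\<And>n. (\<integral>\<^sup>+w. ennreal (\<bar>?D n w\<bar> powr p) \<partial>G) \<le> ennreal (c * \<phi> p ^ n)"
    using increment_moment[OF p] by blast
  \<comment> \<open>By Jensen's inequality the rate \<open>\<phi> p\<close> of the
    \<open>p\<close>-th moments becomes the rate \<open>\<rho>\<close> of the first absolute
    moments.\<close>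
  define \<rho> where "\<rho> = \<phi> p powr (1 / p)"
  define c' where "c' = c powr (1 / p)"
  have \<rho>: "0 \<le> \<rho>" "\<rho> < 1"
    using lt p phi_nonneg[of p] powr_less_mono2[of "1 / p" "\<phi> p" 1] by (auto simp: \<rho>_def)
  have pn: "(\<phi> p ^ n) powr (1 / p) = \<rho> ^ n" for n
    unfolding \<rho>_def by (induction n) (auto simp: powr_mult)
  have Di: "integrable G (?D n)" for n using integrable_mass by auto
  have Dn: "(\<integral>w. \<bar>?D n w\<bar> \<partial>G) \<le> c' * \<rho> ^ n" for n
  proof -
    let ?Z = "\<lambda>w. \<bar>?D n w\<bar> powr p"
    have Zi: "integrable G ?Z"
      using c(2)[of n] by (intro integrableI_nonneg) (auto simp: less_top[symmetric] top_unique intro: le_less_trans)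
    have EZ: "(\<integral>w. ?Z w \<partial>G) \<le> c * \<phi> p ^ n"
      using c(2)[of n] nn_integral_eq_integral[OF Zi] c(1) phi_nonneg[of p]
      by (simp add: ennreal_le_iff)
    have "ennreal (\<integral>w. \<bar>?D n w\<bar> \<partial>G) = (\<integral>\<^sup>+w. ennreal \<bar>?D n w\<bar> \<partial>G)"
      using Di by (intro nn_integral_eq_integral[symmetric]) auto
    also have "\<dots> = (\<integral>\<^sup>+w. ennreal (?Z w powr (1 / p)) \<partial>G)"
      using p by (simp add: powr_powr)
    also have "\<dots> \<le> ennreal ((\<integral>w. ?Z w \<partial>G) powr (1 / p))"
      using p by (intro G.nn_integral_powr_le Zi) auto
    also have "\<dots> \<le> ennreal ((c * \<phi> p ^ n) powr (1 / p))"
      using EZ p by (intro ennreal_leI powr_mono2) auto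
    also have "(c * \<phi> p ^ n) powr (1 / p) = c' * \<rho> ^ n" by (simp add: powr_mult pn c'_def)
    finally show ?thesis using \<rho> by (subst (asm) ennreal_le_iff) (auto simp: c'_def)
  qed
  have sumE: "summable (\<lambda>n. \<integral>w. norm (?D n w) \<partial>G)"
  proof (rule summable_comparison_test')
    show "summable (\<lambda>n. c' * \<rho> ^ n)" using \<rho> by (intro summable_mult summable_geometric) auto
    show "norm (\<integral>w. norm (?D n w) \<partial>G) \<le> c' * \<rho> ^ n" if "n \<ge> 0" for n
      using Dn[of n] by (simp add: integral_nonneg_AE)
  qed
  have "(\<integral>\<^sup>+w. (\<Sum>n. ennreal (norm (?D n w))) \<partial>G) = (\<Sum>n. \<integral>\<^sup>+w. ennreal (norm (?D n w)) \<partial>G)"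
    by (rule nn_integral_suminf) measurable
  also have "\<dots> = (\<Sum>n. ennreal (\<integral>w. norm (?D n w) \<partial>G))"
    using Di by (intro suminf_cong nn_integral_eq_integral) auto
  also have "\<dots> \<noteq> \<infinity>" using sumE by (subst suminf_ennreal_eq[OF _ summable_sums]) (auto simp: integral_nonneg_AE)
  finally have "AE w in G. (\<Sum>n. ennreal (norm (?D n w))) \<noteq> \<infinity>"
    by (intro nn_integral_noteq_infinite) measurable
  then have sumD: "AE w in G. summable (\<lambda>n. norm (?D n w))"
    by eventually_elim (auto intro: summable_suminf_not_top)
  have lim: "AE w in G. (\<lambda>n. mass n w) \<longlonglongrightarrow> 1 + (\<Sum>n. ?D n w)"
    using sumD
  proof eventually_elim
    case (elim w)
    have "(\<lambda>n. \<Sum>k<n. ?D k w) \<longlonglongrightarrow> (\<Sum>n. ?D n w)"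
      by (rule summable_LIMSEQ) (rule summable_norm_cancel[OF elim])
    then have "(\<lambda>n. 1 + (\<Sum>k<n. ?D k w)) \<longlonglongrightarrow> 1 + (\<Sum>n. ?D n w)" by (intro tendsto_intros)
    moreover have "1 + (\<Sum>k<n. ?D k w) = mass n w" for n by (subst sum_lessThan_telescope) simp
    ultimately show ?case by simp
  qed
  have limY: "AE w in G. (\<lambda>n. mass n w) \<longlonglongrightarrow> Y w" and Yeq: "AE w in G. 1 + (\<Sum>n. ?D n w) = Y w"
  proof -
    have "AE w in G. 1 + (\<Sum>n. ?D n w) = Y w \<and> (\<lambda>n. mass n w) \<longlonglongrightarrow> Y w"
      using lim AE_space
    proof eventually_elim
      case (elim w)
      have "0 \<le> 1 + (\<Sum>n. ?D n w)"
        using elim mass_nonneg by (intro LIMSEQ_le_const[OF elim(1)]) auto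
      then show ?case using elim Y_eqI by metis
    qed
    then show "AE w in G. (\<lambda>n. mass n w) \<longlonglongrightarrow> Y w" "AE w in G. 1 + (\<Sum>n. ?D n w) = Y w" by auto
  qed
  have si: "integrable G (\<lambda>w. 1 + (\<Sum>n. ?D n w))"
    using integrable_suminf[OF Di sumD sumE] by auto
  have sE: "(\<integral>w. 1 + (\<Sum>n. ?D n w) \<partial>G) = 1"
    using integral_suminf[OF Di sumD sumE] integrable_suminf[OF Di sumD sumE]
    by (simp add: integrable_mass expectation_mass G.prob_space)
  have Ym: "(\<lambda>w. Y w) \<in> borel_measurable G" by measurable
  have Yi: "integrable G Y"
    using integrable_cong_AE[OF borel_measurable_integrable[OF si] Ym Yeq] si by simp
  have YE: "(\<integral>w. Y w \<partial>G) = 1"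
    using integral_cong_AE[OF borel_measurable_integrable[OF si] Ym Yeq] sE by simp
  obtain K where K: "\<And>n. (\<integral>\<^sup>+w. ennreal (mass n w powr p) \<partial>G) \<le> ennreal K"
    using mass_moment_bounded[OF p lt] by blast
  have "(\<integral>\<^sup>+w. ennreal (Y w powr p) \<partial>G) = (\<integral>\<^sup>+w. liminf (\<lambda>n. ennreal (mass n w powr p)) \<partial>G)"
  proof (rule nn_integral_cong_AE)
    show "AE w in G. ennreal (Y w powr p) = liminf (\<lambda>n. ennreal (mass n w powr p))"
      using limY AE_space
    proof eventually_elim
      case (elim w)
      have "(\<lambda>n. ennreal (mass n w powr p)) \<longlonglongrightarrow> ennreal (Y w powr p)"
        using p elim mass_nonneg by (intro tendsto_ennrealI tendsto_powr' tendsto_const) auto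
      then show ?case by (rule lim_imp_Liminf[OF sequentially_bot, symmetric])
    qed
  qed
  also have "\<dots> \<le> liminf (\<lambda>n. \<integral>\<^sup>+w. ennreal (mass n w powr p) \<partial>G)"
    by (rule nn_integral_liminf) measurable
  also have "\<dots> \<le> ennreal K"
    using K by (intro Liminf_le) (auto intro: always_eventually)
  finally have "(\<integral>\<^sup>+w. ennreal (Y w powr p) \<partial>G) < \<infinity>" by (auto simp: top_unique less_top intro: le_less_trans)
  then show ?thesis using p limY Yi YE by (simp add: regular_def)
qed

end

section \<open>Vanishing total mass and the critical case\<close>

context cascade
begin

lemma mass_shift_nonneg: "w \<in> space G \<Longrightarrow> a \<in> S \<Longrightarrow> 0 \<le> mass n (shift a w)"
  by (rule mass_nonneg) (rule measurable_space[OF measurable_shift])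

lemma measurable_mass_shift: "a \<in> S \<Longrightarrow> (\<lambda>w. mass n (shift a w)) \<in> borel_measurable G"
  by (rule measurable_compose[OF measurable_shift measurable_mass])

lemma nn_integral_sum_coord_mass_powr:
  assumes h: "0 < h" "h < 1"
  shows "(\<integral>\<^sup>+w. (\<Sum>c\<in>S. ennreal ((w [] c * mass n (shift c w)) powr h)) \<partial>G) = ennreal (\<phi> h) * (\<integral>\<^sup>+w. ennreal (mass n w powr h) \<partial>G)"
proof -
  have "(\<integral>\<^sup>+w. (\<Sum>c\<in>S. ennreal ((w [] c * mass n (shift c w)) powr h)) \<partial>G) =
      (\<integral>\<^sup>+w. (\<Sum>c\<in>S. ennreal (w [] c powr h) * ennreal (mass n (shift c w) powr h)) \<partial>G)"
    by (simp add: powr_mult ennreal_mult)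
  also have "\<dots> = (\<Sum>c\<in>S. \<integral>\<^sup>+x. ennreal (x c powr h) \<partial>M) * (\<integral>\<^sup>+w. ennreal (mass n w powr h) \<partial>G)"
  proof (rule branching_linear[where g="\<lambda>w. ennreal (mass n w powr h)" and f="\<lambda>c x. ennreal (x c powr h)"])
    show "(\<lambda>x. ennreal (x c powr h)) \<in> borel_measurable M" if "c \<in> S" for c using meas[OF that] by measurable
    show "(\<lambda>w. ennreal (mass n w powr h)) \<in> borel_measurable G" by measurable
  qed simp
  also have "(\<Sum>c\<in>S. \<integral>\<^sup>+x. ennreal (x c powr h) \<partial>M) = ennreal (\<phi> h)"
    using h q0 by (intro sum_nn_int_powr) auto
  finally show ?thesis .
qed

lemma low_moment_step:
  assumes h: "0 < h" "h < 1"
  shows "(\<integral>\<^sup>+w. ennreal (mass (Suc n) w powr h) \<partial>G) \<le> ennreal (\<phi> h) * (\<integral>\<^sup>+w. ennreal (mass n w powr h) \<partial>G)"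
proof -
  have "(\<integral>\<^sup>+w. ennreal (mass (Suc n) w powr h) \<partial>G) \<le> (\<integral>\<^sup>+w. (\<Sum>c\<in>S. ennreal ((w [] c * mass n (shift c w)) powr h)) \<partial>G)"
  proof (rule nn_integral_mono)
    fix w assume w: "w \<in> space G"
    have "mass (Suc n) w powr h \<le> (\<Sum>c\<in>S. (w [] c * mass n (shift c w)) powr h)"
      unfolding mass_Suc using h coord_nonneg[OF w, of "[]"] mass_shift_nonneg[OF w]
      by (intro powr_sum_le finS) auto
    then show "ennreal (mass (Suc n) w powr h) \<le> (\<Sum>c\<in>S. ennreal ((w [] c * mass n (shift c w)) powr h))"
      by (subst sum_ennreal) (auto intro: ennreal_leI)
  qed
  then show ?thesis by (simp only: nn_integral_sum_coord_mass_powr[OF h])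
qed

text \<open>The recursion for moments of order below 1 with the deficit of subadditivity retained
  for one pair of letters.\<close>

lemma low_moment_step_min:
  assumes h: "0 < h" "h < 1" and ab: "a \<in> S" "b \<in> S" "a \<noteq> b"
  shows "(\<integral>\<^sup>+w. ennreal (mass (Suc n) w powr h) \<partial>G) +
      ennreal (1 - h) * (\<integral>\<^sup>+w. ennreal (min (w [] a * mass n (shift a w)) (w [] b * mass n (shift b w)) powr h) \<partial>G)
    \<le> ennreal (\<phi> h) * (\<integral>\<^sup>+w. ennreal (mass n w powr h) \<partial>G)"
proof -
  let ?m = "\<lambda>w. min (w [] a * mass n (shift a w)) (w [] b * mass n (shift b w)) powr h"
  have [measurable]: "?m \<in> borel_measurable G"
    using measurable_coord[of "[]"] measurable_mass_shift ab by measurable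
  have "(\<integral>\<^sup>+w. ennreal (mass (Suc n) w powr h) \<partial>G) + ennreal (1 - h) * (\<integral>\<^sup>+w. ennreal (?m w) \<partial>G)
      = (\<integral>\<^sup>+w. ennreal (mass (Suc n) w powr h) + ennreal (1 - h) * ennreal (?m w) \<partial>G)"
    by (subst nn_integral_add, measurable, subst nn_integral_cmult, measurable)
  also have "\<dots> \<le> (\<integral>\<^sup>+w. (\<Sum>c\<in>S. ennreal ((w [] c * mass n (shift c w)) powr h)) \<partial>G)"
  proof (rule nn_integral_mono)
    fix w assume w: "w \<in> space G"
    have "mass (Suc n) w powr h \<le> (\<Sum>c\<in>S. (w [] c * mass n (shift c w)) powr h) - (1 - h) * ?m w"
      unfolding mass_Suc using h coord_nonneg[OF w, of "[]"] mass_shift_nonneg[OF w] ab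
      by (intro powr_sum_le_min finS) auto
    then have "mass (Suc n) w powr h + (1 - h) * ?m w \<le> (\<Sum>c\<in>S. (w [] c * mass n (shift c w)) powr h)" by simp
    then have "ennreal (mass (Suc n) w powr h + (1 - h) * ?m w) \<le> ennreal (\<Sum>c\<in>S. (w [] c * mass n (shift c w)) powr h)"
      by (rule ennreal_leI)
    then show "ennreal (mass (Suc n) w powr h) + ennreal (1 - h) * ennreal (?m w)
        \<le> (\<Sum>c\<in>S. ennreal ((w [] c * mass n (shift c w)) powr h))"
      using h by (subst sum_ennreal) (auto simp: ennreal_mult)
  qed
  also have "\<dots> = ennreal (\<phi> h) * (\<integral>\<^sup>+w. ennreal (mass n w powr h) \<partial>G)"
    by (rule nn_integral_sum_coord_mass_powr[OF h])
  finally show ?thesis .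
qed

text \<open>Consider the event that both root weights are at least \<open>\<eta>\<close> and both
  subtrees have mass at least \<open>\<delta>\<close>. By independence its probability is at least
  \<open>\<eta> * (\<delta> * \<delta>)\<close>, and on it the power is at least
  \<open>\<eta> * \<delta>\<close>, since a power \<open>h < 1\<close> does not decrease numbers of
  \<open>[0, 1]\<close>.\<close>

lemma min_moment_lower_bound:
  assumes h: "0 < h" "h < 1" and ab: "a \<in> S" "b \<in> S" "a \<noteq> b"
    and \<eta>: "0 < \<eta>" "\<eta> \<le> 1" "\<eta> \<le> M.prob {x \<in> space M. \<eta> \<le> x a \<and> \<eta> \<le> x b}"
    and \<delta>: "0 < \<delta>" "\<delta> \<le> 1" "\<delta> \<le> G.prob {w \<in> space G. \<delta> \<le> mass n w}"
  shows "ennreal (\<eta> * \<delta> * \<eta> * (\<delta> * \<delta>)) \<le>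
    (\<integral>\<^sup>+w. ennreal (min (w [] a * mass n (shift a w)) (w [] b * mass n (shift b w)) powr h) \<partial>G)"
proof -
  define f :: "('a \<Rightarrow> real) \<Rightarrow> ennreal" where "f x = indicator {x. \<eta> \<le> x a \<and> \<eta> \<le> x b} x" for x
  define g :: "('a list \<Rightarrow> 'a \<Rightarrow> real) \<Rightarrow> ennreal" where "g w = indicator {w. \<delta> \<le> mass n w} w" for w
  have f_eq: "f x = indicator {x \<in> space M. \<eta> \<le> x a \<and> \<eta> \<le> x b} x" if "x \<in> space M" for x
    using that by (simp add: f_def indicator_def)
  have g_eq: "g w = indicator {w \<in> space G. \<delta> \<le> mass n w} w" if "w \<in> space G" for w
    using that by (simp add: g_def indicator_def)
  have sM: "{x \<in> space M. \<eta> \<le> x a \<and> \<eta> \<le> x b} \<in> sets M"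
    using meas[OF ab(1)] meas[OF ab(2)] by measurable
  have sG: "{w \<in> space G. \<delta> \<le> mass n w} \<in> sets G" by measurable
  have fm: "f \<in> borel_measurable M"
    using sM by (subst measurable_cong[OF f_eq]) auto
  have gm: "g \<in> borel_measurable G"
    using sG by (subst measurable_cong[OF g_eq]) auto
  have gsm: "(\<lambda>w. g (shift c w)) \<in> borel_measurable G" if "c \<in> S" for c
    by (rule measurable_compose[OF measurable_shift[OF that] gm])
  have fi: "(\<integral>\<^sup>+x. f x \<partial>M) = ennreal (M.prob {x \<in> space M. \<eta> \<le> x a \<and> \<eta> \<le> x b})"
    using sM by (subst nn_integral_cong[OF f_eq]) (auto simp: M.emeasure_eq_measure)
  have gi: "(\<integral>\<^sup>+w. g w \<partial>G) = ennreal (G.prob {w \<in> space G. \<delta> \<le> mass n w})"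
    using sG by (subst nn_integral_cong[OF g_eq]) (auto simp: G.emeasure_eq_measure)
  have gg: "(\<integral>\<^sup>+w. g (shift a w) * g (shift b w) \<partial>G) = (\<integral>\<^sup>+w. g w \<partial>G) * (\<integral>\<^sup>+w. g w \<partial>G)"
  proof -
    have "G.indep_vars (\<lambda>_. borel) (\<lambda>c w. g (shift c w)) {a, b}"
      using ab by (intro G.indep_vars_compose2[OF G.indep_vars_subset[OF indep_shifts], of _ "\<lambda>c. g"] gm) auto
    from G.indep_vars_nn_integral[OF _ this] ab show ?thesis
      by (simp add: nn_integral_shift gm)
  qed
  have F: "(\<lambda>z. f (fst z) * (g (snd z a) * g (snd z b))) \<in> borel_measurable (M \<Otimes>\<^sub>M PiM S (\<lambda>_. G))"
    using measurable_compose[OF measurable_fst fm]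
      measurable_compose[OF measurable_compose[OF measurable_snd measurable_component_singleton[OF ab(1)]] gm]
      measurable_compose[OF measurable_compose[OF measurable_snd measurable_component_singleton[OF ab(2)]] gm]
    by measurable
  have "(\<integral>\<^sup>+w. f (w []) * (g (shift a w) * g (shift b w)) \<partial>G)
     = (\<integral>\<^sup>+x. (\<integral>\<^sup>+w. f x * (g (shift a w) * g (shift b w)) \<partial>G) \<partial>M)"
    using branching[OF F] ab by simp
  also have "\<dots> = (\<integral>\<^sup>+x. f x * ((\<integral>\<^sup>+w. g w \<partial>G) * (\<integral>\<^sup>+w. g w \<partial>G)) \<partial>M)"
    using gsm ab by (intro nn_integral_cong) (simp add: nn_integral_cmult gg)
  also have "\<dots> = (\<integral>\<^sup>+x. f x \<partial>M) * ((\<integral>\<^sup>+w. g w \<partial>G) * (\<integral>\<^sup>+w. g w \<partial>G))"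
    by (rule nn_integral_multc[OF fm])
  finally have I: "(\<integral>\<^sup>+w. f (w []) * (g (shift a w) * g (shift b w)) \<partial>G) = (\<integral>\<^sup>+x. f x \<partial>M) * ((\<integral>\<^sup>+w. g w \<partial>G) * (\<integral>\<^sup>+w. g w \<partial>G))" .
  have "ennreal (\<eta> * \<delta> * \<eta> * (\<delta> * \<delta>)) = ennreal (\<eta> * \<delta>) * (ennreal \<eta> * (ennreal \<delta> * ennreal \<delta>))"
    using \<eta> \<delta> by (simp add: ennreal_mult[symmetric] mult.assoc)
  also have "\<dots> \<le> ennreal (\<eta> * \<delta>) * (\<integral>\<^sup>+w. f (w []) * (g (shift a w) * g (shift b w)) \<partial>G)"
    unfolding I fi gi using \<eta> \<delta> by (intro mult_left_mono mult_mono ennreal_leI) auto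
  also have "\<dots> = (\<integral>\<^sup>+w. ennreal (\<eta> * \<delta>) * (f (w []) * (g (shift a w) * g (shift b w))) \<partial>G)"
    using gsm[OF ab(1)] gsm[OF ab(2)] measurable_compose[OF measurable_coord_M fm, of "[]"]
    by (intro nn_integral_cmult[symmetric]) auto
  also have "\<dots> \<le> (\<integral>\<^sup>+w. ennreal (min (w [] a * mass n (shift a w)) (w [] b * mass n (shift b w)) powr h) \<partial>G)"
  proof (rule nn_integral_mono)
    fix w assume w: "w \<in> space G"
    show "ennreal (\<eta> * \<delta>) * (f (w []) * (g (shift a w) * g (shift b w)))
        \<le> ennreal (min (w [] a * mass n (shift a w)) (w [] b * mass n (shift b w)) powr h)"
    proof (cases "\<eta> \<le> w [] a \<and> \<eta> \<le> w [] b \<and> \<delta> \<le> mass n (shift a w) \<and> \<delta> \<le> mass n (shift b w)")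
      case True
      have "\<eta> * \<delta> \<le> min (w [] a * mass n (shift a w)) (w [] b * mass n (shift b w))"
        using True \<eta> \<delta> by (auto intro!: mult_mono)
      moreover have "\<eta> * \<delta> \<le> (\<eta> * \<delta>) powr h"
        using powr_mono'[of h 1 "\<eta> * \<delta>"] h \<eta> \<delta> by (auto simp: mult_le_one)
      ultimately have "\<eta> * \<delta> \<le> min (w [] a * mass n (shift a w)) (w [] b * mass n (shift b w)) powr h"
        using h \<eta> \<delta> powr_mono2[of h "\<eta> * \<delta>" "min (w [] a * mass n (shift a w)) (w [] b * mass n (shift b w))"] by simp
      then show ?thesis using True by (simp add: f_def g_def ennreal_leI)
    qed (auto simp: f_def g_def)
  qed
  finally show ?thesis .
qed

lemma low_moment_le_1:
  assumes h: "0 < h" "h < 1"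
  shows "(\<integral>\<^sup>+w. ennreal (mass n w powr h) \<partial>G) \<le> 1"
  using G.nn_integral_powr_le[OF integrable_mass mass_nonneg, of h n] h by (simp add: expectation_mass)

text \<open>If the masses stayed away from 0, two subtrees would be large simultaneously with a probability
  bounded from below. Strict subadditivity of the power \<open>h < 1\<close> then makes the moment of order \<open>h\<close>
  drop by a fixed amount at every generation, although it is non-negative.\<close>

lemma frequently_small_critical:
  assumes H: "H \<le> 0" and ab: "a \<in> S" "b \<in> S" "a \<noteq> b"
    and pos: "M.prob {x \<in> space M. 0 < x a \<and> 0 < x b} > 0"
    and \<delta>: "0 < \<delta>" "\<delta> \<le> 1"
  shows "\<exists>n. G.prob {w \<in> space G. \<delta> \<le> mass n w} < \<delta>"
proof (rule ccontr)
  assume "\<not> ?thesis"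
  then have ge: "\<And>n. \<delta> \<le> G.prob {w \<in> space G. \<delta> \<le> mass n w}" by (auto simp: not_less)
  \<comment> \<open>Continuity from below: two weights that are positive together with positive
    probability are also bounded away from 0 together, and one number can serve both as bound and as
    probability.\<close>
  have "\<exists>k. M.prob {x \<in> space M. step k \<le> x a \<and> step k \<le> x b} \<ge> step k"
  proof (rule ccontr)
    assume "\<not> ?thesis"
    then have lt: "\<And>k. M.prob {x \<in> space M. step k \<le> x a \<and> step k \<le> x b} < step k" by (auto simp: not_le)
    have sM: "{x \<in> space M. c \<le> x a \<and> c \<le> x b} \<in> sets M" for c
      using meas[OF ab(1)] meas[OF ab(2)] by measurable
    have step_anti: "step n \<le> step m" if "m \<le> n" for m n using that by (simp add: step_def le_imp_inverse_le)
    have "(\<lambda>k. M.prob {x \<in> space M. step k \<le> x a \<and> step k \<le> x b}) \<longlonglongrightarrow> M.prob (\<Union>k. {x \<in> space M. step k \<le> x a \<and> step k \<le> x b})"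
      using sM by (intro M.finite_Lim_measure_incseq) (auto simp: incseq_def intro: order_trans[OF step_anti])
    moreover have "(\<Union>k. {x \<in> space M. step k \<le> x a \<and> step k \<le> x b}) = {x \<in> space M. 0 < x a \<and> 0 < x b}"
    proof (intro equalityI subsetI)
      fix x assume x: "x \<in> {x \<in> space M. 0 < x a \<and> 0 < x b}"
      then have "0 < min (x a) (x b)" by auto
      then obtain k where "step k < min (x a) (x b)" unfolding step_def using reals_Archimedean by blast
      then show "x \<in> (\<Union>k. {x \<in> space M. step k \<le> x a \<and> step k \<le> x b})" using x by (auto intro!: exI[of _ k])
    qed (use step_pos in \<open>auto intro: less_le_trans\<close>)
    ultimately have "(\<lambda>k. M.prob {x \<in> space M. step k \<le> x a \<and> step k \<le> x b}) \<longlonglongrightarrow> M.prob {x \<in> space M. 0 < x a \<and> 0 < x b}"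
      by simp
    then have "M.prob {x \<in> space M. 0 < x a \<and> 0 < x b} \<le> 0"
      using lt by (intro LIMSEQ_le[OF _ step_tendsto]) (auto intro: less_imp_le)
    then show False using pos by simp
  qed
  then obtain k where k: "step k \<le> M.prob {x \<in> space M. step k \<le> x a \<and> step k \<le> x b}" by blast
  define \<eta> where "\<eta> = step k"
  have \<eta>: "0 < \<eta>" "\<eta> \<le> 1" "\<eta> \<le> M.prob {x \<in> space M. \<eta> \<le> x a \<and> \<eta> \<le> x b}"
    using step_pos[of k] order_trans[OF k M.prob_le_1] k by (simp_all add: \<eta>_def)
  define c where "c = \<eta> * \<delta> * \<eta> * (\<delta> * \<delta>)"
  have c: "c > 0" using \<eta> \<delta> by (simp add: c_def)
  \<comment> \<open>The left slope tends to \<open>H \<le> 0\<close>. For \<open>h\<close> close to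
    1 the possible growth factor \<open>\<phi> h\<close> therefore costs at most half of the loss
    \<open>(1 - h) * c\<close>.\<close>
  have "eventually (\<lambda>k. (\<phi> (1 - step k) - 1) / step k < c / 2) sequentially"
    using phi_derivative(2) H c by (intro order_tendstoD(2)[where a="c / 2" and y=H]) auto
  moreover have "eventually (\<lambda>k. step k < 1) sequentially"
    by (rule order_tendstoD(2)[OF step_tendsto]) simp
  ultimately obtain k where k: "(\<phi> (1 - step k) - 1) / step k < c / 2" "step k < 1"
    using eventually_happens[OF eventually_conj] by force
  define h where "h = 1 - step k"
  have h: "0 < h" "h < 1" using k step_pos[of k] by (auto simp: h_def)
  define m where "m n = enn2real (\<integral>\<^sup>+w. ennreal (mass n w powr h) \<partial>G)" for n
  have m: "(\<integral>\<^sup>+w. ennreal (mass n w powr h) \<partial>G) = ennreal (m n)" "0 \<le> m n" "m n \<le> 1" for n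
  proof -
    show 1: "(\<integral>\<^sup>+w. ennreal (mass n w powr h) \<partial>G) = ennreal (m n)" "0 \<le> m n"
      using neq_top_trans[OF ennreal_one_neq_top low_moment_le_1[OF h, of n]] by (auto simp: m_def ennreal_enn2real_if)
    show "m n \<le> 1" using low_moment_le_1[OF h, of n] unfolding 1 by (simp add: ennreal_le_1)
  qed
  have dec: "m (Suc n) \<le> m n - (1 - h) * (c / 2)" for n
  proof -
    have "ennreal (m (Suc n)) + ennreal (1 - h) * ennreal c \<le>
        (\<integral>\<^sup>+w. ennreal (mass (Suc n) w powr h) \<partial>G) +
        ennreal (1 - h) * (\<integral>\<^sup>+w. ennreal (min (w [] a * mass n (shift a w)) (w [] b * mass n (shift b w)) powr h) \<partial>G)"
      unfolding m(1) c_def using min_moment_lower_bound[OF h ab \<eta> \<delta> ge] by (intro add_left_mono mult_left_mono) auto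
    also have "\<dots> \<le> ennreal (\<phi> h) * (\<integral>\<^sup>+w. ennreal (mass n w powr h) \<partial>G)"
      by (rule low_moment_step_min[OF h ab])
    finally have "ennreal (m (Suc n) + (1 - h) * c) \<le> ennreal (\<phi> h * m n)"
      unfolding m(1) using h c m(2)[of "Suc n"] m(2)[of n] phi_nonneg[of h] by (simp add: ennreal_mult)
    then have 1: "m (Suc n) + (1 - h) * c \<le> \<phi> h * m n"
      using m(2)[of n] phi_nonneg[of h] by (subst (asm) ennreal_le_iff) auto
    have "\<phi> h - 1 \<le> (1 - h) * (c / 2)" using k step_pos[of k] by (simp add: h_def field_simps)
    then have "(\<phi> h - 1) * m n \<le> (1 - h) * (c / 2) * m n" using m(2) by (rule mult_right_mono)
    also have "\<dots> \<le> (1 - h) * (c / 2)" using m(3)[of n] h c by (intro mult_left_le) auto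
    finally have "\<phi> h * m n - m n \<le> (1 - h) * (c / 2)" by (simp only: left_diff_distrib mult_1)
    moreover have "(1 - h) * c = (1 - h) * (c / 2) + (1 - h) * (c / 2)" by (simp add: field_simps)
    ultimately show ?thesis using 1 by linarith
  qed
  have lin: "m n \<le> 1 - real n * ((1 - h) * (c / 2))" for n
  proof (induction n)
    case (Suc n)
    have "real (Suc n) * ((1 - h) * (c / 2)) = real n * ((1 - h) * (c / 2)) + (1 - h) * (c / 2)"
      by (simp only: of_nat_Suc distrib_right mult_1 add.commute)
    then show ?case using dec[of n] Suc by linarith
  qed (use m in auto)
  obtain n where "1 / ((1 - h) * (c / 2)) < real n" using reals_Archimedean2 by blast
  then have "1 < real n * ((1 - h) * (c / 2))" using h c by (simp add: divide_less_eq)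
  then show False using lin[of n] m(2)[of n] by simp
qed

text \<open>A negative \<open>H\<close> gives \<open>\<phi> h < 1\<close> for some
  \<open>h < 1\<close>; the moments of order \<open>h\<close> then decay geometrically and Markov's
  inequality concludes.\<close>

lemma frequently_small_subcritical:
  assumes H: "H < 0" and \<delta>: "0 < \<delta>" "\<delta> \<le> 1"
  shows "\<exists>n. G.prob {w \<in> space G. \<delta> \<le> mass n w} < \<delta>"
proof -
  have "eventually (\<lambda>k. (\<phi> (1 - step k) - 1) / step k < 0) sequentially"
    using phi_derivative(2) H by (intro order_tendstoD(2)) auto
  moreover have "eventually (\<lambda>k. step k < 1) sequentially"
    by (rule order_tendstoD(2)[OF step_tendsto]) simp
  ultimately obtain k where k: "(\<phi> (1 - step k) - 1) / step k < 0" "step k < 1"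
    using eventually_happens[OF eventually_conj] by force
  define h where "h = 1 - step k"
  have h: "0 < h" "h < 1" "\<phi> h < 1" using k step_pos[of k] by (auto simp: h_def divide_less_0_iff)
  have b: "(\<integral>\<^sup>+w. ennreal (mass n w powr h) \<partial>G) \<le> ennreal (\<phi> h ^ n)" for n
  proof (induction n)
    case (Suc n)
    have "(\<integral>\<^sup>+w. ennreal (mass (Suc n) w powr h) \<partial>G) \<le> ennreal (\<phi> h) * ennreal (\<phi> h ^ n)"
      using low_moment_step[OF h(1,2), of n] Suc by (auto elim!: order_trans intro!: mult_left_mono)
    then show ?case using phi_nonneg by (simp add: ennreal_mult)
  qed (simp add: G.emeasure_space_1)
  have "(\<lambda>n. \<phi> h ^ n) \<longlonglongrightarrow> 0" using h phi_nonneg by (intro LIMSEQ_realpow_zero) auto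
  \<comment> \<open>Markov's inequality at the level \<open>\<delta>\<close> divides by
    \<open>\<delta> powr h\<close>; the other factor is the wanted probability.\<close>
  then have "eventually (\<lambda>n. \<phi> h ^ n < \<delta> * \<delta> powr h) sequentially"
    using \<delta> by (intro order_tendstoD(2)) auto
  then obtain n where n: "\<phi> h ^ n < \<delta> * \<delta> powr h" by (auto simp: eventually_sequentially)
  have sG: "{w \<in> space G. \<delta> \<le> mass n w} \<in> sets G" by measurable
  have "ennreal (\<delta> powr h * G.prob {w \<in> space G. \<delta> \<le> mass n w})
      = (\<integral>\<^sup>+w. ennreal (\<delta> powr h) * indicator {w \<in> space G. \<delta> \<le> mass n w} w \<partial>G)"
    using sG by (subst nn_integral_cmult_indicator) (auto simp: G.emeasure_eq_measure ennreal_mult)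
  also have "\<dots> \<le> (\<integral>\<^sup>+w. ennreal (mass n w powr h) \<partial>G)"
    using \<delta> h by (intro nn_integral_mono) (auto simp: indicator_def intro!: ennreal_leI powr_mono2)
  also have "\<dots> \<le> ennreal (\<phi> h ^ n)" by (rule b)
  finally have "\<delta> powr h * G.prob {w \<in> space G. \<delta> \<le> mass n w} \<le> \<phi> h ^ n"
    using phi_nonneg by (subst (asm) ennreal_le_iff) auto
  also have "\<dots> < \<delta> powr h * \<delta>" using n by (simp add: mult.commute)
  finally show ?thesis using \<delta> by (auto simp: mult_less_cancel_left)
qed

lemma add_le_trans3:
  fixes a b c d e :: "'b :: ordered_ab_semigroup_add"
  assumes "a \<le> b + c" "c + d \<le> e"
  shows "a + d \<le> b + e"
  using add_right_mono[OF assms(1), of d] add_left_mono[OF assms(2), of b] by (simp add: add.assoc)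

text \<open>Doob's inequality for the martingale started at time \<open>n\<close> on
  \<open>mass n < \<eta>\<close>. The second summand, the mean mass on paths that have stayed below
  \<open>L\<close>, makes the induction close: it is preserved for one step, and a path that then
  crosses contributes at least \<open>L\<close>.\<close>

lemma maximal_inequality:
  assumes "0 \<le> L" "0 \<le> \<eta>"
  shows "ennreal L * emeasure G {w \<in> space G. mass n w < \<eta> \<and> (\<exists>j\<le>k. L \<le> mass (n + j) w)} +
    (\<integral>\<^sup>+w. ennreal (mass (n + k) w) * indicator {w. mass n w < \<eta> \<and> (\<forall>j\<le>k. mass (n + j) w < L)} w \<partial>G) \<le> ennreal \<eta>"
proof (induction k)
  case 0
  have "ennreal L * emeasure G {w \<in> space G. mass n w < \<eta> \<and> (\<exists>j\<le>0. L \<le> mass (n + j) w)} +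
    (\<integral>\<^sup>+w. ennreal (mass (n + 0) w) * indicator {w. mass n w < \<eta> \<and> (\<forall>j\<le>0. mass (n + j) w < L)} w \<partial>G)
    = (\<integral>\<^sup>+w. ennreal L * indicator {w \<in> space G. mass n w < \<eta> \<and> L \<le> mass n w} w +
      ennreal (mass n w) * indicator {w. mass n w < \<eta> \<and> mass n w < L} w \<partial>G)"
    by (subst nn_integral_add) (auto simp: nn_integral_cmult_indicator)
  also have "\<dots> \<le> (\<integral>\<^sup>+w. ennreal \<eta> \<partial>G)"
    using assms by (intro nn_integral_mono) (auto simp: indicator_def intro!: ennreal_leI)
  finally show ?case by (simp add: G.emeasure_space_1)
next
  case (Suc k)
  let ?A = "\<lambda>k. {w \<in> space G. mass n w < \<eta> \<and> (\<exists>j\<le>k. L \<le> mass (n + j) w)}"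
  let ?E = "\<lambda>k. {w. mass n w < \<eta> \<and> (\<forall>j\<le>k. mass (n + j) w < L)}"
  let ?N = "{w \<in> space G. w \<in> ?E k \<and> L \<le> mass (n + Suc k) w}"
  have EG: "{w \<in> space G. w \<in> ?E k} \<in> sets G" for k
  proof -
    have "{w \<in> space G. w \<in> ?E k} = {w \<in> space G. mass n w < \<eta>} \<inter> {w \<in> space G. \<forall>j\<in>{..k}. mass (n + j) w < L}" by auto
    also have "\<dots> \<in> sets G" by measurable
    finally show ?thesis .
  qed
  have Em: "(\<lambda>w. ennreal (mass m w) * indicator (?E k) w) \<in> borel_measurable G" for k m
  proof -
    have "(\<lambda>w. ennreal (mass m w) * indicator {w \<in> space G. w \<in> ?E k} w) \<in> borel_measurable G"
      using EG[of k] by measurable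
    then show ?thesis by (rule measurable_cong[THEN iffD2, rotated]) (auto simp: indicator_def)
  qed
  have NG: "?N \<in> sets G"
  proof -
    have "?N = {w \<in> space G. w \<in> ?E k} \<inter> {w \<in> space G. L \<le> mass (n + Suc k) w}" by auto
    also have "\<dots> \<in> sets G" using EG[of k] by measurable
    finally show ?thesis .
  qed
  have AG: "?A k \<in> sets G"
  proof -
    have "?A k = {w \<in> space G. mass n w < \<eta>} \<inter> {w \<in> space G. \<exists>j\<in>{..k}. L \<le> mass (n + j) w}" by auto
    also have "\<dots> \<in> sets G" by measurable
    finally show ?thesis .
  qed
  have "?A (Suc k) = ?A k \<union> ?N" by (auto simp: le_Suc_eq not_less)
  then have "emeasure G (?A (Suc k)) \<le> emeasure G (?A k) + emeasure G ?N"
    using emeasure_subadditive[OF AG NG] by simp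
  then have "ennreal L * emeasure G (?A (Suc k)) \<le> ennreal L * (emeasure G (?A k) + emeasure G ?N)"
    by (rule mult_left_mono) simp
  then have "ennreal L * emeasure G (?A (Suc k)) \<le> ennreal L * emeasure G (?A k) + ennreal L * emeasure G ?N"
    by (simp only: distrib_left)
  moreover have "ennreal L * emeasure G ?N + (\<integral>\<^sup>+w. ennreal (mass (n + Suc k) w) * indicator (?E (Suc k)) w \<partial>G)
      \<le> (\<integral>\<^sup>+w. ennreal (mass (n + k) w) * indicator (?E k) w \<partial>G)"
  proof -
    have "ennreal L * emeasure G ?N + (\<integral>\<^sup>+w. ennreal (mass (n + Suc k) w) * indicator (?E (Suc k)) w \<partial>G)
      = (\<integral>\<^sup>+w. ennreal L * indicator ?N w + ennreal (mass (n + Suc k) w) * indicator (?E (Suc k)) w \<partial>G)"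
      using NG Em by (subst nn_integral_add) (auto simp: nn_integral_cmult_indicator)
    also have "\<dots> \<le> (\<integral>\<^sup>+w. ennreal (mass (Suc (n + k)) w) * indicator (?E k) w \<partial>G)"
      by (intro nn_integral_mono) (auto simp: indicator_def le_Suc_eq intro!: ennreal_leI)
    also have "\<dots> = (\<integral>\<^sup>+w. ennreal (mass (Suc (n + k)) w) * indicator (?E k) (restrict w (level (n + k))) \<partial>G)"
      by (intro nn_integral_cong) (auto simp: indicator_def mass_restrict_level)
    also have "\<dots> = (\<integral>\<^sup>+w. ennreal (mass (n + k) w) * indicator (?E k) (restrict w (level (n + k))) \<partial>G)"
    proof (rule mass_martingale)
      let ?P = "PiM (level (n + k)) (\<lambda>_. M)"
      note [measurable] = measurable_mass_level[of n "n + k"]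
      have mj: "mass (n + j) \<in> borel_measurable ?P" if "j \<le> k" for j
        using that by (intro measurable_mass_level) auto
      have "{w \<in> space ?P. w \<in> ?E k} = {w \<in> space ?P. mass n w < \<eta>} \<inter> {w \<in> space ?P. \<forall>j\<in>{..k}. mass (n + j) w < L}" by auto
      also have "\<dots> \<in> sets ?P"
        using mj by (intro sets.Int sets.sets_Collect_finite_All) auto
      finally have s: "{w \<in> space ?P. w \<in> ?E k} \<in> sets ?P" .
      have "(indicator {w \<in> space ?P. w \<in> ?E k} :: _ \<Rightarrow> ennreal) \<in> borel_measurable ?P" using s by measurable
      then show "(indicator (?E k) :: _ \<Rightarrow> ennreal) \<in> borel_measurable ?P"
        by (rule measurable_cong[THEN iffD2, rotated]) (auto simp: indicator_def)
    qed
    also have "\<dots> = (\<integral>\<^sup>+w. ennreal (mass (n + k) w) * indicator (?E k) w \<partial>G)"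
      by (intro nn_integral_cong) (auto simp: indicator_def mass_restrict_level)
    finally show ?thesis .
  qed
  ultimately have "ennreal L * emeasure G (?A (Suc k)) + (\<integral>\<^sup>+w. ennreal (mass (n + Suc k) w) * indicator (?E (Suc k)) w \<partial>G)
      \<le> ennreal L * emeasure G (?A k) + (\<integral>\<^sup>+w. ennreal (mass (n + k) w) * indicator (?E k) w \<partial>G)"
    by (rule add_le_trans3)
  also have "\<dots> \<le> ennreal \<eta>" by (rule Suc)
  finally show ?case .
qed

text \<open>Once the mass is below \<open>\<delta>\<close>, it exceeds \<open>L\<close> later only
  with probability at most \<open>\<delta> / L\<close>. So being small at some time with probability
  close to 1 prevents the mass from returning to any fixed level infinitely often.\<close>

lemma mass_tendsto_0:
  assumes small: "\<And>\<delta>. 0 < \<delta> \<Longrightarrow> \<delta> \<le> 1 \<Longrightarrow> \<exists>n. G.prob {w \<in> space G. \<delta> \<le> mass n w} < \<delta>"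
  shows "AE w in G. (\<lambda>n. mass n w) \<longlonglongrightarrow> 0"
proof -
  have "AE w in G. \<exists>n. \<forall>m\<ge>n. mass m w < step i" for i
  proof -
    let ?L = "step i"
    let ?B = "{w \<in> space G. \<forall>n. \<exists>m\<ge>n. ?L \<le> mass m w}"
    have BG: "?B \<in> sets G" by measurable
    have bound: "G.prob ?B \<le> \<epsilon>" if e: "0 < \<epsilon>" for \<epsilon>
    proof -
      \<comment> \<open>One bound is for the probability that the mass is not yet small at time
        \<open>n\<close>, the other for \<open>\<delta> / L\<close>; each contributes at most
        \<open>\<epsilon> / 2\<close>.\<close>
      define \<delta> where "\<delta> = min 1 (min (\<epsilon> / 2) (\<epsilon> * ?L / 2))"
      have d: "0 < \<delta>" "\<delta> \<le> 1" "\<delta> \<le> \<epsilon> / 2" "\<delta> \<le> \<epsilon> * ?L / 2" using e step_pos[of i] by (auto simp: \<delta>_def)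
      obtain n where n: "G.prob {w \<in> space G. \<delta> \<le> mass n w} < \<delta>" using small[OF d(1,2)] by blast
      let ?A = "\<lambda>k. {w \<in> space G. mass n w < \<delta> \<and> (\<exists>j\<le>k. ?L \<le> mass (n + j) w)}"
      have AG: "?A k \<in> sets G" for k
      proof -
        have "?A k = {w \<in> space G. mass n w < \<delta>} \<inter> {w \<in> space G. \<exists>j\<in>{..k}. ?L \<le> mass (n + j) w}" by auto
        also have "\<dots> \<in> sets G" by measurable
        finally show ?thesis .
      qed
      have Ak: "G.prob (?A k) \<le> \<epsilon> / 2" for k
      proof -
        have "ennreal ?L * emeasure G (?A k) \<le> ennreal \<delta>"
          using d step_pos[of i] by (intro order_trans[OF _ maximal_inequality[of ?L \<delta> n k]]) auto
        then have "?L * G.prob (?A k) \<le> \<delta>"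
          using d step_pos[of i] by (simp add: G.emeasure_eq_measure ennreal_mult[symmetric] ennreal_le_iff)
        also have "\<dots> \<le> ?L * (\<epsilon> / 2)" using d by (simp add: mult.commute)
        finally show ?thesis using step_pos[of i] by (simp add: mult_le_cancel_left)
      qed
      have "(\<lambda>k. G.prob (?A k)) \<longlonglongrightarrow> G.prob (\<Union>k. ?A k)"
        using AG by (intro G.finite_Lim_measure_incseq) (auto simp: incseq_def intro: order_trans)
      then have UA: "G.prob (\<Union>k. ?A k) \<le> \<epsilon> / 2"
        using Ak by (intro LIMSEQ_le_const2[where a="\<epsilon> / 2"]) auto
      have "?B \<subseteq> {w \<in> space G. \<delta> \<le> mass n w} \<union> (\<Union>k. ?A k)"
      proof
        fix w assume w: "w \<in> ?B"
        then obtain m where m: "m \<ge> n" "?L \<le> mass m w" by auto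
        show "w \<in> {w \<in> space G. \<delta> \<le> mass n w} \<union> (\<Union>k. ?A k)"
        proof (cases "\<delta> \<le> mass n w")
          case False
          then have "w \<in> ?A (m - n)" using w m by (auto intro!: exI[of _ "m - n"])
          then show ?thesis by blast
        qed (use w in auto)
      qed
      then have "G.prob ?B \<le> G.prob ({w \<in> space G. \<delta> \<le> mass n w} \<union> (\<Union>k. ?A k))"
        using AG by (intro G.finite_measure_mono) auto
      also have "\<dots> \<le> G.prob {w \<in> space G. \<delta> \<le> mass n w} + G.prob (\<Union>k. ?A k)"
        using AG by (intro measure_Un_le) auto
      finally show ?thesis using n d UA by simp
    qed
    have "G.prob ?B = 0"
      using bound[of "G.prob ?B / 2"] measure_nonneg[of G ?B] by (cases "G.prob ?B = 0") auto
    then have "AE w in G. w \<notin> ?B"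
      using BG by (intro AE_not_in) (auto simp: G.emeasure_eq_measure)
    then show ?thesis using AE_space by eventually_elim (simp, meson not_le)
  qed
  then have "AE w in G. \<forall>i. \<exists>n. \<forall>m\<ge>n. mass m w < step i" by (simp add: AE_all_countable)
  then show ?thesis using AE_space
  proof eventually_elim
    case (elim w)
    show ?case
    proof (rule LIMSEQ_I)
      fix r :: real assume "r > 0"
      then obtain i where "step i < r" using reals_Archimedean by (auto simp: step_def)
      moreover obtain n where "\<forall>m\<ge>n. mass m w < step i" using elim by auto
      ultimately show "\<exists>n. \<forall>m\<ge>n. norm (mass m w - 0) < r"
        using mass_nonneg[OF elim(2)] by (intro exI[of _ n]) force
    qed
  qed
qed

text \<open>At most one weight is positive, so \<open>H = 0\<close> says that the sum \<open>s\<close> of the weights satisfies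
  \<open>E (s ln s) = 0 = E (s - 1)\<close>; hence \<open>s = 1\<close> almost surely.\<close>

lemma degenerate_regular:
  assumes H: "H = 0" and single: "\<And>a b. a \<in> S \<Longrightarrow> b \<in> S \<Longrightarrow> a \<noteq> b \<Longrightarrow> M.prob {x \<in> space M. 0 < x a \<and> 0 < x b} = 0"
  shows "regular (min 2 q0)"
proof -
  let ?s = "\<lambda>x :: 'a \<Rightarrow> real. \<Sum>a\<in>S. x a"
  have "AE x in M. \<forall>a\<in>S. \<forall>b\<in>S. a \<noteq> b \<longrightarrow> \<not> (0 < x a \<and> 0 < x b)"
  proof (intro AE_finite_allI finS)
    fix a b assume ab: "a \<in> S" "b \<in> S"
    show "AE x in M. a \<noteq> b \<longrightarrow> \<not> (0 < x a \<and> 0 < x b)"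
    proof (cases "a = b")
      case False
      have "{x \<in> space M. 0 < x a \<and> 0 < x b} \<in> sets M" using meas[OF ab(1)] meas[OF ab(2)] by measurable
      then have "AE x in M. x \<notin> {x \<in> space M. 0 < x a \<and> 0 < x b}"
        using single[OF ab False] by (intro AE_not_in) (auto simp: M.emeasure_eq_measure)
      then show ?thesis using AE_space by eventually_elim auto
    qed simp
  qed
  then have eq: "AE x in M. (\<Sum>a\<in>S. x a * ln (x a)) = ?s x * ln (?s x)"
    using AE_space
  proof eventually_elim
    case (elim x)
    show ?case
    proof (cases "\<exists>a\<in>S. 0 < x a")
      case True
      then obtain a where a: "a \<in> S" "0 < x a" by auto
      have z: "x b = 0" if "b \<in> S - {a}" for b
        using elim a that nonneg[OF elim(2), of b] by (auto simp: le_less)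
      show ?thesis using a z finS by (simp add: sum.remove[OF finS a(1)])
    next
      case False
      then have "x a = 0" if "a \<in> S" for a using nonneg[OF elim(2) that] that by (auto simp: le_less)
      then show ?thesis by simp
    qed
  qed
  have lni: "integrable M (\<lambda>x. x a * ln (x a))" if "a \<in> S" for a
    by (rule M.moment_derivative(1)[of "\<lambda>x. x a" q0]) (use int_coord nonneg q0 int_q0 that in auto)
  have [measurable]: "(\<lambda>x. x a) \<in> borel_measurable M" if "a \<in> S" for a using meas[OF that] .
  have i1: "integrable M (\<lambda>x. \<Sum>a\<in>S. x a * ln (x a))" "(\<integral>x. (\<Sum>a\<in>S. x a * ln (x a)) \<partial>M) = 0"
    using lni H by (auto simp: H_def)
  have m1: "(\<lambda>x. ?s x * ln (?s x)) \<in> borel_measurable M" using measurable_sum_coord by measurable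
  have i2: "integrable M (\<lambda>x. ?s x * ln (?s x))" "(\<integral>x. ?s x * ln (?s x) \<partial>M) = 0"
    using integrable_cong_AE[OF borel_measurable_integrable[OF i1(1)] m1 eq]
      integral_cong_AE[OF borel_measurable_integrable[OF i1(1)] m1 eq] i1 by auto
  have i3: "integrable M (\<lambda>x. ?s x * ln (?s x) - (?s x - 1))" "(\<integral>x. ?s x * ln (?s x) - (?s x - 1) \<partial>M) = 0"
    using i2 mean_sum by (auto simp: M.prob_space)
  have snn: "0 \<le> ?s x" if "x \<in> space M" for x using nonneg[OF that] by (intro sum_nonneg)
  have "AE x in M. ?s x * ln (?s x) - (?s x - 1) = 0"
    using integral_nonneg_eq_0_iff_AE[OF i3(1)] i3(2) xlnx_ge[OF snn] by (auto simp: AE_I2)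
  then have "AE x in M. ?s x = 1"
    using AE_space
  proof eventually_elim
    case (elim x)
    have "?s x \<noteq> 0" using elim by auto
    then have s: "?s x > 0" using snn[OF elim(2)] by simp
    have "ln (1 / ?s x) = 1 / ?s x - 1" using elim s by (simp add: ln_div field_simps)
    then show ?case using ln_eq_minus_one[of "1 / ?s x"] s by simp
  qed
  from AE_coord[OF this] have one: "AE w in G. \<forall>n. mass n w = 1"
  proof eventually_elim
    case (elim w)
    show ?case
    proof
      fix n show "mass n w = 1"
      proof (induction n)
        case (Suc n)
        have "mass (Suc n) w = (\<Sum>v\<in>words S n. Q_weight w [] v * 1)"
          unfolding mass_Suc_snoc using elim by (intro sum.cong refl) auto
        then show ?case using Suc by (simp add: mass_def)
      qed simp
    qed
  qed
  have Y1: "AE w in G. Y w = 1" using one by eventually_elim (simp add: Y_def)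
  have "AE w in G. (\<lambda>n. mass n w) \<longlonglongrightarrow> Y w" using one Y1 by eventually_elim simp
  moreover have "integrable G Y" "(\<integral>w. Y w \<partial>G) = 1"
    using integrable_cong_AE[of Y G "\<lambda>_. 1"] integral_cong_AE[of Y G "\<lambda>_. 1"] Y1 by (auto simp: G.prob_space)
  moreover have "(\<integral>\<^sup>+w. ennreal (Y w powr min 2 q0) \<partial>G) = (\<integral>\<^sup>+w. 1 \<partial>G)"
    using Y1 by (intro nn_integral_cong_AE) auto
  ultimately show ?thesis using q0 by (auto simp: regular_def G.emeasure_space_1)
qed

theorem dichotomy: "(\<exists>p. regular p) \<or> (AE w in G. (\<lambda>n. mass n w) \<longlonglongrightarrow> 0)"
proof -
  consider "H > 0" | "H < 0" | (pair) a b where "H = 0" "a \<in> S" "b \<in> S" "a \<noteq> b" "M.prob {x \<in> space M. 0 < x a \<and> 0 < x b} > 0"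
    | (single) "H = 0" "\<And>a b. a \<in> S \<Longrightarrow> b \<in> S \<Longrightarrow> a \<noteq> b \<Longrightarrow> M.prob {x \<in> space M. 0 < x a \<and> 0 < x b} = 0"
    using less_linear[of H 0] by (force simp: zero_less_measure_iff)
  then show ?thesis
  proof cases
    case 1
    \<comment> \<open>The right slope of \<open>\<phi>\<close> at 1 is \<open>- H < 0\<close>, so
      \<open>\<phi>\<close> is below 1 immediately to the right of 1.\<close>
    have "eventually (\<lambda>k. (\<phi> (1 + step k) - 1) / step k < 0) sequentially"
      using phi_derivative(1) 1 by (intro order_tendstoD(2)) auto
    moreover have "eventually (\<lambda>k. step k < min 1 (q0 - 1)) sequentially"
      using q0 by (intro order_tendstoD(2)[OF step_tendsto]) simp
    ultimately obtain k where k: "(\<phi> (1 + step k) - 1) / step k < 0" "step k < min 1 (q0 - 1)"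
      using eventually_happens[OF eventually_conj] by force
    then have "regular (1 + step k)"
      using step_pos[of k] by (intro supercritical_regular) (auto simp: divide_less_0_iff)
    then show ?thesis by blast
  next
    case 2
    then show ?thesis using mass_tendsto_0 frequently_small_subcritical by blast
  next
    case pair
    then show ?thesis using mass_tendsto_0 frequently_small_critical[of a b] by simp
  next
    case single
    then show ?thesis using degenerate_regular by blast
  qed
qed

end

section \<open>Moments of ball masses\<close>

locale coded_cascade = cascade S M q0 for S :: "'a set" and M and q0 +
  fixes f :: "'j \<Rightarrow> 'a \<Rightarrow> 'b"
begin

definition fib :: "'j \<Rightarrow> 'b \<Rightarrow> 'a set" where
  "fib j b = {a \<in> S. f j a = b}"

definition mean :: "'a \<Rightarrow> real" where
  "mean a = (\<integral>x. x a \<partial>M)"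

definition fib_mean :: "'j \<Rightarrow> 'b \<Rightarrow> real" where
  "fib_mean j b = (\<Sum>a\<in>fib j b. mean a)"

text \<open>The Shannon entropy of the law \<open>fib_mean j\<close>; the function
  \<open>g j\<close> below is the corresponding power sum, with derivative \<open>- h j\<close> at
  1.\<close>

definition h :: "'j \<Rightarrow> real" where
  "h j = - (\<Sum>b\<in>f j ` S. fib_mean j b * ln (fib_mean j b))"

definition g :: "'j \<Rightarrow> real \<Rightarrow> real" where
  "g j q = (\<Sum>b\<in>f j ` S. fib_mean j b powr q)"

primrec labels :: "'j list \<Rightarrow> 'b list set" where
  "labels [] = {[]}"
| "labels (j # ks) = (\<lambda>(b, bs). b # bs) ` ((f j ` S) \<times> labels ks)"

text \<open>The mass of the points whose first letters are coded into \<open>bs\<close>, written as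
  a branching recursion. It is defined and measurable on all of \<open>G\<close>, before it is known
  to be the mass of a ball for any measure.\<close>

primrec ball_mass :: "'j list \<Rightarrow> 'b list \<Rightarrow> ('a list \<Rightarrow> 'a \<Rightarrow> real) \<Rightarrow> real" where
  "ball_mass [] bs w = Y w"
| "ball_mass (j # ks) bs w = (\<Sum>a\<in>fib j (hd bs). w [] a * ball_mass ks (tl bs) (shift a w))"

primrec ball_mean :: "'j list \<Rightarrow> 'b list \<Rightarrow> real" where
  "ball_mean [] bs = 1"
| "ball_mean (j # ks) bs = fib_mean j (hd bs) * ball_mean ks (tl bs)"

definition moment :: "real \<Rightarrow> 'j list \<Rightarrow> ennreal" where
  "moment q ks = (\<Sum>bs\<in>labels ks. \<integral>\<^sup>+w. ennreal (ball_mass ks bs w powr q) \<partial>G)"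

lemma fib_subset: "fib j b \<subseteq> S"
  by (auto simp: fib_def)

lemma fib_in_S: "a \<in> fib j b \<Longrightarrow> a \<in> S"
  by (simp add: fib_def)

lemma finite_fib: "finite (fib j b)"
  using finS by (auto simp: fib_def)

lemma mean_ge_0: "a \<in> S \<Longrightarrow> 0 \<le> mean a"
  using mean_nonneg by (simp add: mean_def)

lemma fib_mean_nonneg: "0 \<le> fib_mean j b"
  unfolding fib_mean_def using fib_subset by (intro sum_nonneg mean_ge_0) auto

lemma finite_labels: "finite (labels ks)"
  using finS by (induction ks) auto

lemma sum_labels_Cons:
  "(\<Sum>bs\<in>labels (j # ks). F bs) = (\<Sum>b\<in>f j ` S. \<Sum>bs\<in>labels ks. F (b # bs))"
  by (simp add: sum.reindex inj_on_def case_prod_beta sum.cartesian_product)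

lemma sum_fib: "(\<Sum>b\<in>f j ` S. \<Sum>a\<in>fib j b. F a) = (\<Sum>a\<in>S. F a)"
  unfolding fib_def using sum.image_gen[OF finS, of F "f j"] by simp

lemma sum_fib_mean: "(\<Sum>b\<in>f j ` S. fib_mean j b) = 1"
  unfolding fib_mean_def sum_fib using mean_one by (simp add: mean_def)

lemma measurable_ball_mass [measurable]: "ball_mass ks bs \<in> borel_measurable G"
proof (induction ks arbitrary: bs)
  case Nil
  have "ball_mass [] bs = Y" by (simp add: fun_eq_iff)
  then show ?case by simp
next
  case (Cons j ks)
  have "(\<lambda>w. \<Sum>a\<in>fib j (hd bs). w [] a * ball_mass ks (tl bs) (shift a w)) \<in> borel_measurable G"
    using fib_subset
    by (intro borel_measurable_sum borel_measurable_times measurable_coord measurable_compose[OF measurable_shift Cons]) auto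
  then show ?case by simp
qed

lemma ball_mass_nonneg: "w \<in> space G \<Longrightarrow> 0 \<le> ball_mass ks bs w"
proof (induction ks arbitrary: bs w)
  case (Cons j ks)
  then show ?case
    using coord_nonneg[OF Cons.prems] measurable_space[OF measurable_shift Cons.prems]
    by (auto intro!: sum_nonneg mult_nonneg_nonneg dest: fib_in_S)
qed (simp add: Y_nonneg)

lemma ball_mean_nonneg: "0 \<le> ball_mean ks bs"
  by (induction ks arbitrary: bs) (auto simp: fib_mean_nonneg)

lemma sum_ball_mean_powr: "(\<Sum>bs\<in>labels ks. ball_mean ks bs powr q) = (\<Prod>j\<leftarrow>ks. g j q)"
proof (induction ks)
  case (Cons j ks)
  have "(\<Sum>bs\<in>labels (j # ks). ball_mean (j # ks) bs powr q) = (\<Sum>b\<in>f j ` S. fib_mean j b powr q * (\<Sum>bs\<in>labels ks. ball_mean ks bs powr q))"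
    unfolding sum_labels_Cons by (simp add: powr_mult sum_distrib_left)
  then show ?case by (simp add: Cons g_def sum_distrib_right)
qed simp

lemma nn_integral_fib_sum:
  assumes "g' \<in> borel_measurable G" "\<And>w. w \<in> space G \<Longrightarrow> 0 \<le> g' w"
  shows "(\<integral>\<^sup>+w. ennreal (\<Sum>a\<in>fib j b. w [] a * g' (shift a w)) \<partial>G) = ennreal (fib_mean j b) * (\<integral>\<^sup>+w. ennreal (g' w) \<partial>G)"
proof -
  have "(\<integral>\<^sup>+w. ennreal (\<Sum>a\<in>fib j b. w [] a * g' (shift a w)) \<partial>G) = (\<integral>\<^sup>+w. (\<Sum>a\<in>fib j b. ennreal (w [] a) * ennreal (g' (shift a w))) \<partial>G)"
  proof (rule nn_integral_cong)
    fix w assume w: "w \<in> space G"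
    have "0 \<le> g' (shift a w)" "0 \<le> w [] a" if "a \<in> fib j b" for a
      using fib_in_S[OF that] coord_nonneg[OF w, of "[]"] measurable_space[OF measurable_shift w] assms(2) by auto
    then show "ennreal (\<Sum>a\<in>fib j b. w [] a * g' (shift a w)) = (\<Sum>a\<in>fib j b. ennreal (w [] a) * ennreal (g' (shift a w)))"
      by (subst sum_ennreal[symmetric]) (auto simp: ennreal_mult)
  qed
  also have "\<dots> = (\<Sum>a\<in>fib j b. \<integral>\<^sup>+x. ennreal (x a) \<partial>M) * (\<integral>\<^sup>+w. ennreal (g' w) \<partial>G)"
    using measurable_compose[OF meas measurable_ennreal] fib_subset assms(1)
    by (intro branching_linear[where f="\<lambda>a x. ennreal (x a)" and g="\<lambda>w. ennreal (g' w)"]) (auto dest: fib_in_S)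
  also have "(\<Sum>a\<in>fib j b. \<integral>\<^sup>+x. ennreal (x a) \<partial>M) = ennreal (fib_mean j b)"
  proof -
    have "(\<Sum>a\<in>fib j b. \<integral>\<^sup>+x. ennreal (x a) \<partial>M) = (\<Sum>a\<in>fib j b. ennreal (mean a))"
      using fib_subset by (intro sum.cong refl) (auto simp: nn_int_coord mean_def dest: fib_in_S)
    then show ?thesis unfolding fib_mean_def using fib_subset mean_ge_0 by (subst (asm) sum_ennreal) auto
  qed
  finally show ?thesis .
qed

end

text \<open>The cascade has a non-trivial limit mass with a moment of order \<open>p\<close>;
  nothing is required of the codes \<open>f\<close>.\<close>

locale regular_cascade = coded_cascade S M q0 f for S :: "'a set" and M and q0 and f :: "'j \<Rightarrow> 'a \<Rightarrow> 'b" +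
  fixes p :: real
  assumes reg: "regular p"
begin

lemma p: "1 < p" "p \<le> 2" "p \<le> q0"
  and int_Y: "integrable G Y" and exp_Y: "(\<integral>w. Y w \<partial>G) = 1"
  and AE_mass_tendsto: "AE w in G. (\<lambda>n. mass n w) \<longlonglongrightarrow> Y w"
  and Y_moment: "(\<integral>\<^sup>+w. ennreal (Y w powr p) \<partial>G) < \<infinity>"
  using reg by (auto simp: regular_def)

lemma nn_integral_ball_mass: "(\<integral>\<^sup>+w. ennreal (ball_mass ks bs w) \<partial>G) = ennreal (ball_mean ks bs)"
proof (induction ks arbitrary: bs)
  case Nil
  show ?case using nn_integral_eq_integral[OF int_Y] Y_nonneg by (simp add: exp_Y)
next
  case (Cons j ks)
  show ?case
    using nn_integral_fib_sum[OF measurable_ball_mass ball_mass_nonneg, of ks "tl bs" j "hd bs"]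
    by (simp add: Cons ennreal_mult fib_mean_nonneg ball_mean_nonneg)
qed

lemma integrable_ball_mass: "integrable G (ball_mass ks bs)"
  by (rule integrableI_nonneg) (auto intro!: AE_I2 ball_mass_nonneg simp: nn_integral_ball_mass)

lemma expectation_ball_mass: "(\<integral>w. ball_mass ks bs w \<partial>G) = ball_mean ks bs"
proof -
  have "ennreal (\<integral>w. ball_mass ks bs w \<partial>G) = ennreal (ball_mean ks bs)"
    using nn_integral_eq_integral[OF integrable_ball_mass[of ks bs]] nn_integral_ball_mass[of ks bs] ball_mass_nonneg
    by (simp add: AE_I2)
  then show ?thesis
    using ball_mean_nonneg[of ks bs] by (subst (asm) ennreal_inj) (auto intro!: integral_nonneg_AE AE_I2 ball_mass_nonneg)
qed

lemma moment_low_le: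
  assumes "0 < q" "q < 1"
  shows "moment q ks \<le> ennreal (\<Prod>j\<leftarrow>ks. g j q)"
proof -
  have "moment q ks \<le> (\<Sum>bs\<in>labels ks. ennreal (ball_mean ks bs powr q))"
    unfolding moment_def
    using G.nn_integral_powr_le[OF integrable_ball_mass ball_mass_nonneg, of q ks] assms
    by (intro sum_mono) (auto simp: expectation_ball_mass)
  also have "\<dots> = ennreal (\<Sum>bs\<in>labels ks. ball_mean ks bs powr q)" by (rule sum_ennreal) auto
  finally show ?thesis by (simp add: sum_ball_mean_powr)
qed

text \<open>Under an injective code each fibre has one letter. The sum inside the power has a single
  term, and the first position factors out exactly, on either side of 1.\<close>

lemma moment_inj_Cons:
  assumes q: "0 < q" "q \<le> q0" and inj: "inj_on (f j) S"
  shows "moment q (j # ks) = ennreal (\<phi> q) * moment q ks"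
proof -
  have fb: "fib j (f j a) = {a}" if "a \<in> S" for a
    using inj that by (auto simp: fib_def inj_on_def)
  have "moment q (j # ks) = (\<Sum>a\<in>S. \<Sum>bs\<in>labels ks. \<integral>\<^sup>+w. ennreal (ball_mass (j # ks) (f j a # bs) w powr q) \<partial>G)"
    unfolding moment_def sum_labels_Cons by (subst sum.reindex[OF inj]) simp
  also have "\<dots> = (\<Sum>a\<in>S. \<Sum>bs\<in>labels ks. (\<integral>\<^sup>+x. ennreal (x a powr q) \<partial>M) * (\<integral>\<^sup>+w. ennreal (ball_mass ks bs w powr q) \<partial>G))"
  proof (intro sum.cong refl)
    fix a bs assume a: "a \<in> S"
    have "(\<integral>\<^sup>+w. ennreal (ball_mass (j # ks) (f j a # bs) w powr q) \<partial>G)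
        = (\<integral>\<^sup>+w. (\<Sum>c\<in>{a}. ennreal (w [] c powr q) * ennreal (ball_mass ks bs (shift c w) powr q)) \<partial>G)"
      using a by (simp add: fb powr_mult ennreal_mult)
    also have "\<dots> = (\<Sum>c\<in>{a}. \<integral>\<^sup>+x. ennreal (x c powr q) \<partial>M) * (\<integral>\<^sup>+w. ennreal (ball_mass ks bs w powr q) \<partial>G)"
    proof (rule branching_linear[where f="\<lambda>c x. ennreal (x c powr q)" and g="\<lambda>w. ennreal (ball_mass ks bs w powr q)"])
      show "(\<lambda>x. ennreal (x c powr q)) \<in> borel_measurable M" if "c \<in> {a}" for c using meas[OF a] that by auto
      show "(\<lambda>w. ennreal (ball_mass ks bs w powr q)) \<in> borel_measurable G" by measurable
    qed (use a in simp)
    finally show "(\<integral>\<^sup>+w. ennreal (ball_mass (j # ks) (f j a # bs) w powr q) \<partial>G) =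
        (\<integral>\<^sup>+x. ennreal (x a powr q) \<partial>M) * (\<integral>\<^sup>+w. ennreal (ball_mass ks bs w powr q) \<partial>G)" by simp
  qed
  also have "\<dots> = (\<Sum>a\<in>S. \<integral>\<^sup>+x. ennreal (x a powr q) \<partial>M) * moment q ks"
    by (simp add: moment_def sum_product)
  also have "\<dots> = ennreal (\<phi> q) * moment q ks" using q by (subst sum_nn_int_powr) auto
  finally show ?thesis .
qed

text \<open>The injective positions are peeled off exactly; Jensen's inequality is applied only to
  the remaining tail, where it replaces all masses by their means.\<close>

lemma moment_low_pinned_le:
  assumes q: "0 < q" "q < 1" and inj: "inj_on (f j) S"
  shows "moment q (replicate n j @ ks) \<le> ennreal (\<phi> q ^ n * (\<Prod>j\<leftarrow>ks. g j q))"
proof (induction n)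
  case (Suc n)
  have "0 \<le> (\<Prod>j\<leftarrow>ks. g j q)"
    by (induction ks) (auto simp: g_def intro!: mult_nonneg_nonneg sum_nonneg)
  then show ?case
    using q q0 Suc moment_inj_Cons[OF q(1) _ inj, of "replicate n j @ ks"] phi_nonneg[of q]
    by (simp add: mult.assoc ennreal_mult[of "\<phi> q"] mult_left_mono)
qed (use moment_low_le[OF q] in simp)

text \<open>Unfolding the recursion \<open>step\<close> gives one term for each position at which
  branching stops and means take over: factors \<open>\<phi> q\<close> before that position and
  \<open>g j q\<close> after it. As \<open>m\<close> dominates both, every term is at most the full
  product, and their number explains the linear factor. The constant does not depend on the sequence
  of codes.\<close>

lemma moment_high_le:
  assumes q: "1 < q" "q \<le> p"
  shows "\<exists>K\<ge>0. \<forall>ks m. (\<forall>j\<in>set ks. \<phi> q \<le> m j \<and> g j q \<le> m j) \<longrightarrow> 0 < \<phi> q \<longrightarrow>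
    moment q ks \<le> ennreal (K * (1 + real (length ks)) * (\<Prod>j\<leftarrow>ks. m j))"
proof -
  have q2: "q \<le> 2" "q \<le> q0" using q p by auto
  define c where "c = enn2real (\<integral>\<^sup>+x. ennreal ((\<Sum>a\<in>S. x a) powr q) \<partial>M)"
  have c: "(\<integral>\<^sup>+x. ennreal ((\<Sum>a\<in>S. x a) powr q) \<partial>M) = ennreal c" "c \<ge> 0"
    using nn_integral_sum_coord_powr_finite[of S q] q q2 by (auto simp: c_def less_top)
  have "(\<integral>\<^sup>+w. ennreal (Y w powr q) \<partial>G) \<le> (\<integral>\<^sup>+w. ennreal (1 + Y w powr p) \<partial>G)"
    using q Y_nonneg by (intro nn_integral_mono ennreal_leI powr_le_one_plus) auto
  also have "\<dots> = 1 + (\<integral>\<^sup>+w. ennreal (Y w powr p) \<partial>G)"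
    by (subst ennreal_plus) (auto simp: nn_integral_add G.emeasure_space_1)
  also have "\<dots> < \<infinity>" using Y_moment by (simp add: ennreal_add_eq_top less_top)
  finally obtain KY where KY: "(\<integral>\<^sup>+w. ennreal (Y w powr q) \<partial>G) = ennreal KY" "KY \<ge> 0"
    by (metis ennreal_cases infinity_ennreal_def less_irrefl)
  define d where "d = real (card S) * c"
  \<comment> \<open>The position where the switch takes place carries no factor of its own; dividing
    by \<open>\<phi> q\<close> pays for supplying one.\<close>
  define K where "K = KY + d / \<phi> q"
  have step: "moment q (j # ks) \<le> ennreal (\<phi> q) * moment q ks + ennreal (d * (\<Prod>j\<leftarrow>ks. g j q))" for j ks
  proof -
    have "moment q (j # ks) \<le> (\<Sum>b\<in>f j ` S. \<Sum>bs\<in>labels ks.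
        (\<Sum>a\<in>fib j b. \<integral>\<^sup>+x. ennreal (x a powr q) \<partial>M) * (\<integral>\<^sup>+w. ennreal (ball_mass ks bs w powr q) \<partial>G) +
        ennreal c * ennreal (ball_mean ks bs powr q))"
      unfolding moment_def sum_labels_Cons
    proof (intro sum_mono)
      fix b bs
      have "(\<integral>\<^sup>+w. ennreal (ball_mass (j # ks) (b # bs) w powr q) \<partial>G) \<le>
        (\<Sum>a\<in>fib j b. \<integral>\<^sup>+x. ennreal (x a powr q) \<partial>M) * (\<integral>\<^sup>+w. ennreal (ball_mass ks bs w powr q) \<partial>G) +
        (\<integral>\<^sup>+x. ennreal ((\<Sum>a\<in>fib j b. x a) powr q) \<partial>M) * ennreal ((\<integral>w. ball_mass ks bs w \<partial>G) powr q)"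
        using moment_upper[of "fib j b" "ball_mass ks bs" q, OF fib_subset measurable_ball_mass ball_mass_nonneg integrable_ball_mass q(1) q2(1)]
        by simp
      also have "\<dots> \<le> (\<Sum>a\<in>fib j b. \<integral>\<^sup>+x. ennreal (x a powr q) \<partial>M) * (\<integral>\<^sup>+w. ennreal (ball_mass ks bs w powr q) \<partial>G) +
        ennreal c * ennreal (ball_mean ks bs powr q)"
      proof (intro add_left_mono mult_mono)
        show "(\<integral>\<^sup>+x. ennreal ((\<Sum>a\<in>fib j b. x a) powr q) \<partial>M) \<le> ennreal c"
          unfolding c(1)[symmetric] using q fib_subset nonneg finS
          by (intro nn_integral_mono ennreal_leI powr_mono2 sum_nonneg sum_mono2) (auto dest: fib_in_S)
      qed (auto simp: expectation_ball_mass)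
      finally show "(\<integral>\<^sup>+w. ennreal (ball_mass (j # ks) (b # bs) w powr q) \<partial>G) \<le>
        (\<Sum>a\<in>fib j b. \<integral>\<^sup>+x. ennreal (x a powr q) \<partial>M) * (\<integral>\<^sup>+w. ennreal (ball_mass ks bs w powr q) \<partial>G) +
        ennreal c * ennreal (ball_mean ks bs powr q)" .
    qed
    also have "\<dots> = (\<Sum>b\<in>f j ` S. (\<Sum>a\<in>fib j b. \<integral>\<^sup>+x. ennreal (x a powr q) \<partial>M) * moment q ks +
        ennreal c * (\<Sum>bs\<in>labels ks. ennreal (ball_mean ks bs powr q)))"
      by (simp only: moment_def sum.distrib sum_distrib_left)
    also have "\<dots> = (\<Sum>b\<in>f j ` S. \<Sum>a\<in>fib j b. \<integral>\<^sup>+x. ennreal (x a powr q) \<partial>M) * moment q ks +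
        (\<Sum>b\<in>f j ` S. ennreal c * (\<Sum>bs\<in>labels ks. ennreal (ball_mean ks bs powr q)))"
      by (simp only: sum.distrib sum_distrib_right)
    also have "(\<Sum>b\<in>f j ` S. \<Sum>a\<in>fib j b. \<integral>\<^sup>+x. ennreal (x a powr q) \<partial>M) = ennreal (\<phi> q)"
      unfolding sum_fib using q q2 by (subst sum_nn_int_powr) auto
    also have "(\<Sum>bs\<in>labels ks. ennreal (ball_mean ks bs powr q)) = ennreal (\<Prod>j\<leftarrow>ks. g j q)"
      by (subst sum_ennreal) (auto simp: sum_ball_mean_powr)
    also have "(\<Sum>b\<in>f j ` S. ennreal c * ennreal (\<Prod>j\<leftarrow>ks. g j q)) = ennreal (real (card (f j ` S)) * c * (\<Prod>j\<leftarrow>ks. g j q))"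
      using c sum_nonneg[of "labels ks" "\<lambda>bs. ball_mean ks bs powr q"]
      by (simp add: ennreal_mult sum_ball_mean_powr ennreal_of_nat_eq_real_of_nat mult.assoc)
    also have "\<dots> \<le> ennreal (d * (\<Prod>j\<leftarrow>ks. g j q))"
      using c sum_nonneg[of "labels ks" "\<lambda>bs. ball_mean ks bs powr q"] card_image_le[OF finS, of "f j"]
      by (intro ennreal_leI mult_right_mono) (auto simp: d_def sum_ball_mean_powr intro!: mult_right_mono)
    finally show ?thesis by (simp add: add_left_mono)
  qed
  have d0: "d \<ge> 0" using c by (simp add: d_def)
  show ?thesis
  proof (intro exI[of _ K] conjI allI impI)
    show K0: "K \<ge> 0" using KY d0 phi_nonneg[of q] by (simp add: K_def)
    fix ks and m :: "'j \<Rightarrow> real"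
    assume m: "\<forall>j\<in>set ks. \<phi> q \<le> m j \<and> g j q \<le> m j" and pos: "0 < \<phi> q"
    have gnn: "0 \<le> g j q" for j by (auto simp: g_def intro: sum_nonneg)
    have "moment q ks \<le> ennreal ((KY + d / \<phi> q * real (length ks)) * (\<Prod>j\<leftarrow>ks. m j))
      \<and> 0 \<le> (\<Prod>j\<leftarrow>ks. g j q) \<and> (\<Prod>j\<leftarrow>ks. g j q) \<le> (\<Prod>j\<leftarrow>ks. m j)"
      using m
    proof (induction ks)
      case Nil
      show ?case using KY by (simp add: moment_def)
    next
      case (Cons j ks)
      let ?P = "\<Prod>j\<leftarrow>ks. m j" and ?g = "\<Prod>j\<leftarrow>ks. g j q" and ?c = "KY + d / \<phi> q * real (length ks)"
      have IH: "moment q ks \<le> ennreal (?c * ?P)" "0 \<le> ?g" "?g \<le> ?P" using Cons by auto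
      have mj: "\<phi> q \<le> m j" "g j q \<le> m j" using Cons.prems by auto
      have P0: "0 \<le> ?P" using IH by simp
      have c0: "0 \<le> ?c" using KY d0 pos by simp
      have "moment q (j # ks) \<le> ennreal (\<phi> q) * ennreal (?c * ?P) + ennreal (d * ?g)"
        using step[of j ks] IH(1) by (auto elim!: order_trans intro!: add_right_mono mult_left_mono)
      also have "\<dots> = ennreal (\<phi> q * (?c * ?P) + d * ?g)"
        using pos c0 P0 d0 IH by (simp add: ennreal_mult)
      also have "\<dots> \<le> ennreal ((KY + d / \<phi> q * real (length (j # ks))) * (m j * ?P))"
      proof (rule ennreal_leI)
        have "\<phi> q * (?c * ?P) \<le> m j * (?c * ?P)" using mj c0 P0 by (intro mult_right_mono) auto
        moreover have "d * ?g \<le> d / \<phi> q * (m j * ?P)"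
        proof -
          have "d * ?g \<le> d * ?P" using IH d0 by (intro mult_left_mono) auto
          also have "\<dots> = d / \<phi> q * (\<phi> q * ?P)" using pos by simp
          also have "\<dots> \<le> d / \<phi> q * (m j * ?P)" using mj P0 d0 pos by (intro mult_left_mono mult_right_mono) auto
          finally show ?thesis .
        qed
        ultimately have "\<phi> q * (?c * ?P) + d * ?g \<le> m j * (?c * ?P) + d / \<phi> q * (m j * ?P)" by linarith
        also have "\<dots> = (KY + d / \<phi> q * real (length (j # ks))) * (m j * ?P)" by (simp add: algebra_simps add_divide_distrib)
        finally show "\<phi> q * (?c * ?P) + d * ?g \<le> (KY + d / \<phi> q * real (length (j # ks))) * (m j * ?P)" .
      qed
      finally show ?case using mult_mono[OF mj(2) IH(3)] IH gnn[of j] mj pos by auto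
    qed
    then have 1: "moment q ks \<le> ennreal ((KY + d / \<phi> q * real (length ks)) * (\<Prod>j\<leftarrow>ks. m j))" and 2: "0 \<le> (\<Prod>j\<leftarrow>ks. m j)" by auto
    note 1
    also have "ennreal ((KY + d / \<phi> q * real (length ks)) * (\<Prod>j\<leftarrow>ks. m j)) \<le> ennreal (K * (1 + real (length ks)) * (\<Prod>j\<leftarrow>ks. m j))"
    proof (intro ennreal_leI mult_right_mono 2)
      have "0 \<le> d / \<phi> q" using d0 pos by simp
      have "KY + r * n \<le> (KY + r) * (1 + n)" if "0 \<le> r" "0 \<le> n" for r n :: real
        using that KY by (simp add: algebra_simps)
      from this[OF \<open>0 \<le> d / \<phi> q\<close>, of "real (length ks)"]
      show "KY + d / \<phi> q * real (length ks) \<le> K * (1 + real (length ks))" by (simp add: K_def)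
    qed
    finally show "moment q ks \<le> ennreal (K * (1 + real (length ks)) * (\<Prod>j\<leftarrow>ks. m j))" .
  qed
qed

end

section \<open>Local behaviour of projected Mandelbrot measures\<close>

context cascade
begin

definition shifts :: "'a list \<Rightarrow> ('a list \<Rightarrow> 'a \<Rightarrow> real) \<Rightarrow> 'a list \<Rightarrow> 'a \<Rightarrow> real" where
  "shifts u w = (\<lambda>v\<in>lists S. w (u @ v))"

text \<open>Convergence in all subtrees at once makes the limit masses consistent along the tree, so
  that the cylinder masses define a measure. As there are only countably many words, this holds
  almost surely.\<close>

definition good :: "('a list \<Rightarrow> 'a \<Rightarrow> real) \<Rightarrow> bool" where
  "good w \<longleftrightarrow> w \<in> space G \<and> (\<forall>u\<in>lists S. (\<lambda>n. mass n (shifts u w)) \<longlonglongrightarrow> Y (shifts u w))"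

lemma measurable_shifts: "u \<in> lists S \<Longrightarrow> shifts u \<in> measurable G G"
  unfolding shifts_def G_def
  by (intro measurable_restrict measurable_component_singleton) auto

lemma distr_shifts: "u \<in> lists S \<Longrightarrow> distr G G (shifts u) = G"
  unfolding shifts_def G_def
  using distr_PiM_reindex[of "lists S" "\<lambda>_. M" "(@) u" "lists S"] prob_M by (auto simp: inj_on_def)

lemma AE_good:
  assumes "AE w in G. (\<lambda>n. mass n w) \<longlonglongrightarrow> Y w"
  shows "AE w in G. good w"
proof -
  have "countable (lists S)" using finS by (simp add: countable_finite)
  then have "AE w in G. \<forall>u\<in>lists S. (\<lambda>n. mass n (shifts u w)) \<longlonglongrightarrow> Y (shifts u w)"
  proof (subst AE_ball_countable, assumption, intro ballI)
    fix u assume u: "u \<in> lists S"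
    show "AE w in G. (\<lambda>n. mass n (shifts u w)) \<longlonglongrightarrow> Y (shifts u w)"
      using AE_distrD[OF measurable_shifts[OF u], of "\<lambda>w. (\<lambda>n. mass n w) \<longlonglongrightarrow> Y w"] assms
      unfolding distr_shifts[OF u] by blast
  qed
  then show ?thesis using AE_space by eventually_elim (simp add: good_def)
qed

lemma shifts_Nil: "w \<in> space G \<Longrightarrow> shifts [] w = w"
  by (auto simp: shifts_def G_def space_PiM PiE_iff extensional_def restrict_def fun_eq_iff)

lemma shift_shifts: "a \<in> S \<Longrightarrow> shift a (shifts u w) = shifts (u @ [a]) w"
  by (auto simp: shift_def shifts_def restrict_def fun_eq_iff)

lemma Q_weight_shifts:
  assumes "u \<in> lists S" "v \<in> lists S"
  shows "Q_weight w u v = Q_weight (shifts u w) [] v"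
  unfolding Q_weight_def using assms
  by (intro prod.cong refl) (simp add: shifts_def take_in_lists del: in_lists_conv_set)

lemma Y_limit_shifts:
  assumes "good w" "u \<in> lists S"
  shows "Y_limit S w u = Y (shifts u w)"
proof -
  have "(\<Sum>v\<in>words S n. Q_weight w u v) = mass n (shifts u w)" for n
    unfolding mass_def using assms by (intro sum.cong refl Q_weight_shifts) auto
  then show ?thesis using assms by (auto simp: Y_limit_def good_def intro!: limI)
qed

lemma Y_shifts_consistent:
  assumes g: "good w" and u: "u \<in> lists S"
  shows "Y (shifts u w) = (\<Sum>a\<in>S. w u a * Y (shifts (u @ [a]) w))"
proof (rule LIMSEQ_unique)
  show "(\<lambda>n. mass (Suc n) (shifts u w)) \<longlonglongrightarrow> Y (shifts u w)"
    using g u by (intro LIMSEQ_Suc) (auto simp: good_def)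
  have "mass (Suc n) (shifts u w) = (\<Sum>a\<in>S. w u a * mass n (shifts (u @ [a]) w))" for n
    unfolding mass_Suc by (intro sum.cong refl) (simp add: shift_shifts, simp add: shifts_def)
  moreover have "(\<lambda>n. \<Sum>a\<in>S. w u a * mass n (shifts (u @ [a]) w)) \<longlonglongrightarrow> (\<Sum>a\<in>S. w u a * Y (shifts (u @ [a]) w))"
    using g u by (intro tendsto_sum tendsto_mult tendsto_const) (auto simp: good_def)
  ultimately show "(\<lambda>n. mass (Suc n) (shifts u w)) \<longlonglongrightarrow> (\<Sum>a\<in>S. w u a * Y (shifts (u @ [a]) w))"
    by simp
qed

abbreviation \<mu> :: "('a list \<Rightarrow> 'a \<Rightarrow> real) \<Rightarrow> 'a stream measure" where
  "\<mu> w \<equiv> mandelbrot_measure S w"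

lemma sets_\<mu>: "sets (\<mu> w) = sets (stream_space (count_space S))"
  using finS by (intro sets_mandelbrot_measure countable_finite)

lemma space_\<mu>: "space (\<mu> w) = streams S"
  using sets_eq_imp_space_eq[OF sets_\<mu>] by (simp add: space_stream_space)

lemma emeasure_\<mu>_sstart:
  assumes g: "good w" and u: "u \<in> lists S"
  shows "emeasure (\<mu> w) (sstart S u) = ennreal (Q_weight w [] u * Y (shifts u w))"
proof -
  have "emeasure (\<mu> w) (sstart S u) = ennreal (Q_weight w [] u * Y_limit S w u)"
  proof (rule emeasure_mandelbrot_measure[OF finS _ _ u])
    fix u assume u: "u \<in> lists S"
    show "0 \<le> Q_weight w [] u * Y_limit S w u"
      using g u Q_nonneg[of w "[]" u] by (auto simp: Y_limit_shifts Y_nonneg good_def)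
    have "u @ [a] \<in> lists S" if "a \<in> S" for a using u that by auto
    then show "Y_limit S w u = (\<Sum>a\<in>S. w u a * Y_limit S w (u @ [a]))"
      using Y_shifts_consistent[OF g u] by (simp add: Y_limit_shifts[OF g] u del: in_lists_conv_set)
  qed
  then show ?thesis using g u by (simp add: Y_limit_shifts)
qed

lemma emeasure_\<mu>_space:
  assumes g: "good w"
  shows "emeasure (\<mu> w) (streams S) = ennreal (Y w)"
  using emeasure_\<mu>_sstart[OF g, of "[]"] g by (simp add: good_def shifts_Nil)

lemma finite_measure_\<mu>: "good w \<Longrightarrow> finite_measure (\<mu> w)"
  by (rule finite_measureI) (simp add: space_\<mu> emeasure_\<mu>_space)

lemma sets_stake_Collect: "{x \<in> streams S. P (stake n x)} \<in> sets (\<mu> w)"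
proof -
  have "{x \<in> streams S. P (stake n x)} = (\<lambda>x. P (stake n x)) -` {True} \<inter> space (stream_space (count_space S))"
    by (auto simp: space_stream_space)
  also have "\<dots> \<in> sets (stream_space (count_space S))"
    by (rule measurable_sets[OF measurable_stake_countable[OF finS]]) simp
  finally show ?thesis by (simp add: sets_\<mu>)
qed

end

section \<open>Masses of coded balls\<close>

context coded_cascade
begin

definition label :: "'j list \<Rightarrow> 'a stream \<Rightarrow> 'b list" where
  "label ks x = map2 f ks (stake (length ks) x)"

lemma label_Cons: "label (j # ks) x = f j (shd x) # label ks (stl x)"
  by (simp add: label_def)

lemma label_in_labels: "x \<in> streams S \<Longrightarrow> label ks x \<in> labels ks"
proof (induction ks arbitrary: x)
  case (Cons j ks)
  then show ?case by (auto simp: label_Cons streams_shd streams_stl)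
qed (simp add: label_def)

lemma sets_label_Collect: "{x \<in> streams S. P (label ks x)} \<in> sets (\<mu> w)"
  unfolding label_def by (rule sets_stake_Collect)

lemma length_labels: "bs \<in> labels ks \<Longrightarrow> length bs = length ks"
  by (induction ks arbitrary: bs) auto

text \<open>A starting word \<open>u\<close> is carried along because splitting the first coded
  position into the letters of its fibre prolongs the word that is known exactly.\<close>

lemma emeasure_\<mu>_label_aux:
  assumes g: "good w"
  shows "u \<in> lists S \<Longrightarrow> length bs = length ks \<Longrightarrow>
    emeasure (\<mu> w) {x \<in> streams S. stake (length u) x = u \<and> label ks (sdrop (length u) x) = bs}
    = ennreal (Q_weight w [] u * ball_mass ks bs (shifts u w))"
proof (induction ks arbitrary: u bs)
  case Nil
  then have "{x \<in> streams S. stake (length u) x = u \<and> label [] (sdrop (length u) x) = bs} = sstart S u"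
    by (auto simp: label_def sstart_eq_Collect)
  then show ?case using emeasure_\<mu>_sstart[OF g Nil.prems(1)] by simp
next
  case (Cons j ks)
  then obtain b bs' where bs: "bs = b # bs'" "length bs' = length ks" by (cases bs) auto
  have wG: "w \<in> space G" using g by (simp add: good_def)
  let ?A = "\<lambda>u ks bs. {x \<in> streams S. stake (length u) x = u \<and> label ks (sdrop (length u) x) = bs}"
  have ua: "u @ [a] \<in> lists S" if "a \<in> fib j b" for a using Cons.prems that fib_in_S by auto
  have sS: "shd (sdrop n x) \<in> S" if "x \<in> streams S" for n x
    using snth_in[OF that] by simp
  have eq: "?A u (j # ks) bs = (\<Union>a\<in>fib j b. ?A (u @ [a]) ks bs')"
    by (auto simp: bs label_Cons stake_Suc fib_def sS sdrop_simps(1)[symmetric] simp del: stake.simps sdrop_simps(1))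
  have As: "?A u ks bs \<in> sets (\<mu> w)" for u ks bs
  proof -
    have "?A u ks bs = {x \<in> streams S. stake (length u) x = u \<and> map2 f ks (drop (length u) (stake (length u + length ks) x)) = bs}"
      by (simp add: label_def drop_stake)
    also have "\<dots> = {x \<in> streams S. (\<lambda>v. take (length u) v = u \<and> map2 f ks (drop (length u) v) = bs) (stake (length u + length ks) x)}"
      by (simp add: take_stake)
    also have "\<dots> \<in> sets (\<mu> w)" by (rule sets_stake_Collect)
    finally show ?thesis .
  qed
  have "emeasure (\<mu> w) (?A u (j # ks) bs) = (\<Sum>a\<in>fib j b. emeasure (\<mu> w) (?A (u @ [a]) ks bs'))"
    unfolding eq
    by (intro sum_emeasure[symmetric] finite_fib image_subsetI As) (auto simp: disjoint_family_on_def simp del: stake.simps)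
  also have "\<dots> = (\<Sum>a\<in>fib j b. ennreal (Q_weight w [] (u @ [a]) * ball_mass ks bs' (shifts (u @ [a]) w)))"
    using Cons.IH[OF ua bs(2)] by (intro sum.cong refl) simp
  also have "\<dots> = ennreal (\<Sum>a\<in>fib j b. Q_weight w [] (u @ [a]) * ball_mass ks bs' (shifts (u @ [a]) w))"
    using Q_nonneg[OF wG _ ua, of "[]"] measurable_space[OF measurable_shifts[OF ua] wG]
    by (intro sum_ennreal mult_nonneg_nonneg ball_mass_nonneg) auto
  also have "(\<Sum>a\<in>fib j b. Q_weight w [] (u @ [a]) * ball_mass ks bs' (shifts (u @ [a]) w))
      = Q_weight w [] u * ball_mass (j # ks) bs (shifts u w)"
    by (auto simp: bs sum_distrib_left Q_weight_snoc shift_shifts[OF fib_in_S] mult.assoc intro!: sum.cong)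
      (simp add: shifts_def)
  finally show ?case .
qed

lemma emeasure_\<mu>_label:
  assumes g: "good w" and bs: "length bs = length ks"
  shows "emeasure (\<mu> w) {x \<in> streams S. label ks x = bs} = ennreal (ball_mass ks bs w)"
  using emeasure_\<mu>_label_aux[OF g, of "[]" bs ks] bs g by (simp add: shifts_Nil good_def)

lemma measure_\<mu>_label:
  assumes g: "good w" and bs: "length bs = length ks"
  shows "measure (\<mu> w) {x \<in> streams S. label ks x = bs} = ball_mass ks bs w"
  using emeasure_\<mu>_label[OF assms] g ball_mass_nonneg[of w ks bs] by (simp add: measure_def good_def)

lemma emeasure_\<mu>_label_Collect:
  assumes g: "good w"
  shows "emeasure (\<mu> w) {x \<in> streams S. P (label ks x)} = (\<Sum>bs\<in>{bs\<in>labels ks. P bs}. ennreal (ball_mass ks bs w))"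
proof -
  have "{x \<in> streams S. P (label ks x)} = (\<Union>bs\<in>{bs\<in>labels ks. P bs}. {x \<in> streams S. label ks x = bs})"
    using label_in_labels by auto
  then have "emeasure (\<mu> w) {x \<in> streams S. P (label ks x)} = (\<Sum>bs\<in>{bs\<in>labels ks. P bs}. emeasure (\<mu> w) {x \<in> streams S. label ks x = bs})"
    using finite_labels[of ks] sets_label_Collect[of "\<lambda>b. b = _" ks w]
    by (simp only:) (intro sum_emeasure[symmetric]; auto simp: disjoint_family_on_def)
  then show ?thesis using g by (simp add: emeasure_\<mu>_label length_labels)
qed

text \<open>Finite expected total mass of the bad sets first gives a summable sequence for almost
  every environment; Borel--Cantelli is then applied to the single measure \<open>\<mu> w\<close>.
  \<open>F\<close> is a measurable majorant, so that measurability of the bad masses in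
  \<open>w\<close> is not at issue.\<close>

lemma AE_eventually_not_bad:
  assumes F: "\<And>L. F L \<in> borel_measurable G" and sum: "(\<Sum>L. \<integral>\<^sup>+w. F L w \<partial>G) < \<infinity>"
    and le: "\<And>w L. good w \<Longrightarrow> emeasure (\<mu> w) {x \<in> streams S. Bad L w (label (ks L) x)} \<le> F L w"
  shows "AE w in G. good w \<longrightarrow> (AE x in \<mu> w. eventually (\<lambda>L. \<not> Bad L w (label (ks L) x)) sequentially)"
proof -
  have "(\<integral>\<^sup>+w. (\<Sum>L. F L w) \<partial>G) \<noteq> \<infinity>" using sum F by (subst nn_integral_suminf) auto
  then have "AE w in G. (\<Sum>L. F L w) \<noteq> \<infinity>" using F by (intro nn_integral_noteq_infinite) measurable
  then show ?thesis
  proof eventually_elim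
    case (elim w)
    show ?case
    proof
      assume g: "good w"
      interpret finite_measure "\<mu> w" by (rule finite_measure_\<mu>[OF g])
      let ?A = "\<lambda>L. {x \<in> streams S. Bad L w (label (ks L) x)}"
      have "(\<Sum>L. emeasure (\<mu> w) (?A L)) \<le> (\<Sum>L. F L w)" using le[OF g] by (intro suminf_le) auto
      then have "(\<Sum>L. ennreal (measure (\<mu> w) (?A L))) \<noteq> \<top>"
        using elim by (auto simp: emeasure_eq_measure top_unique)
      then have "summable (\<lambda>L. measure (\<mu> w) (?A L))" by (intro summable_suminf_not_top) auto
      then have "AE x in \<mu> w. eventually (\<lambda>L. x \<in> space (\<mu> w) - ?A L) sequentially"
        by (intro borel_cantelli_AE1 sets_label_Collect) (auto simp: emeasure_eq_measure)
      then show "AE x in \<mu> w. eventually (\<lambda>L. \<not> Bad L w (label (ks L) x)) sequentially"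
        by eventually_elim (auto elim!: eventually_mono simp: space_\<mu>)
    qed
  qed
qed

end

section \<open>Typical ball masses\<close>

context regular_cascade
begin

lemma AE_good': "AE w in G. good w"
  by (rule AE_good[OF AE_mass_tendsto])

text \<open>Markov's inequality with respect to the random measure itself: where the ball mass
  \<open>Z\<close> exceeds \<open>t\<close>, it is at most
  \<open>t powr (1 - q) * Z powr q\<close>.\<close>

lemma nn_integral_bad_high:
  assumes q: "1 < q" and t: "0 < t"
  shows "(\<integral>\<^sup>+w. (\<Sum>bs\<in>{bs\<in>labels ks. t < ball_mass ks bs w}. ennreal (ball_mass ks bs w)) \<partial>G) \<le> ennreal (t powr (1 - q)) * moment q ks"
    and "(\<lambda>w. \<Sum>bs\<in>{bs\<in>labels ks. t < ball_mass ks bs w}. ennreal (ball_mass ks bs w)) \<in> borel_measurable G"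
proof -
  have e: "(\<Sum>bs\<in>{bs\<in>labels ks. t < ball_mass ks bs w}. ennreal (ball_mass ks bs w))
      = (\<Sum>bs\<in>labels ks. if t < ball_mass ks bs w then ennreal (ball_mass ks bs w) else 0)" for w
    using finite_labels by (intro sum.mono_neutral_cong_left) auto
  show "(\<lambda>w. \<Sum>bs\<in>{bs\<in>labels ks. t < ball_mass ks bs w}. ennreal (ball_mass ks bs w)) \<in> borel_measurable G"
    unfolding e by measurable
  have "(\<integral>\<^sup>+w. (\<Sum>bs\<in>{bs\<in>labels ks. t < ball_mass ks bs w}. ennreal (ball_mass ks bs w)) \<partial>G)
      \<le> (\<integral>\<^sup>+w. (\<Sum>bs\<in>labels ks. ennreal (t powr (1 - q)) * ennreal (ball_mass ks bs w powr q)) \<partial>G)"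
    unfolding e
  proof (intro nn_integral_mono sum_mono)
    fix w bs
    show "(if t < ball_mass ks bs w then ennreal (ball_mass ks bs w) else 0) \<le> ennreal (t powr (1 - q)) * ennreal (ball_mass ks bs w powr q)"
    proof (cases "t < ball_mass ks bs w")
      case True
      let ?Z = "ball_mass ks bs w"
      have Z: "0 < ?Z" using True t by simp
      have "?Z = ?Z powr (1 - q) * ?Z powr q" using Z unfolding powr_add[symmetric] by simp
      also have "\<dots> \<le> t powr (1 - q) * ?Z powr q"
        using True t q by (intro mult_right_mono powr_mono2') auto
      finally show ?thesis using True by (simp add: ennreal_mult[symmetric] ennreal_leI)
    qed simp
  qed
  also have "\<dots> = ennreal (t powr (1 - q)) * moment q ks"
    unfolding moment_def sum_distrib_left
    by (subst nn_integral_sum, measurable) (intro sum.cong refl nn_integral_cmult, measurable)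
  finally show "(\<integral>\<^sup>+w. (\<Sum>bs\<in>{bs\<in>labels ks. t < ball_mass ks bs w}. ennreal (ball_mass ks bs w)) \<partial>G) \<le> ennreal (t powr (1 - q)) * moment q ks" .
qed

text \<open>For \<open>q < 1\<close> the same estimate holds where \<open>Z < t\<close>; balls of
  mass 0 contribute nothing.\<close>

lemma nn_integral_bad_low:
  assumes q: "0 < q" "q < 1" and t: "0 < t"
  shows "(\<integral>\<^sup>+w. (\<Sum>bs\<in>{bs\<in>labels ks. ball_mass ks bs w < t}. ennreal (ball_mass ks bs w)) \<partial>G) \<le> ennreal (t powr (1 - q)) * moment q ks"
    and "(\<lambda>w. \<Sum>bs\<in>{bs\<in>labels ks. ball_mass ks bs w < t}. ennreal (ball_mass ks bs w)) \<in> borel_measurable G"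
proof -
  have e: "(\<Sum>bs\<in>{bs\<in>labels ks. ball_mass ks bs w < t}. ennreal (ball_mass ks bs w))
      = (\<Sum>bs\<in>labels ks. if ball_mass ks bs w < t then ennreal (ball_mass ks bs w) else 0)" for w
    using finite_labels by (intro sum.mono_neutral_cong_left) auto
  show "(\<lambda>w. \<Sum>bs\<in>{bs\<in>labels ks. ball_mass ks bs w < t}. ennreal (ball_mass ks bs w)) \<in> borel_measurable G"
    unfolding e by measurable
  have "(\<integral>\<^sup>+w. (\<Sum>bs\<in>{bs\<in>labels ks. ball_mass ks bs w < t}. ennreal (ball_mass ks bs w)) \<partial>G)
      \<le> (\<integral>\<^sup>+w. (\<Sum>bs\<in>labels ks. ennreal (t powr (1 - q)) * ennreal (ball_mass ks bs w powr q)) \<partial>G)"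
    unfolding e
  proof (intro nn_integral_mono sum_mono)
    fix w bs assume w: "w \<in> space G"
    show "(if ball_mass ks bs w < t then ennreal (ball_mass ks bs w) else 0) \<le> ennreal (t powr (1 - q)) * ennreal (ball_mass ks bs w powr q)"
    proof (cases "ball_mass ks bs w < t \<and> ball_mass ks bs w \<noteq> 0")
      case True
      let ?Z = "ball_mass ks bs w"
      have Z: "0 < ?Z" using True ball_mass_nonneg[OF w, of ks bs] by simp
      have "?Z = ?Z powr (1 - q) * ?Z powr q" using Z unfolding powr_add[symmetric] by simp
      also have "\<dots> \<le> t powr (1 - q) * ?Z powr q"
        using True Z q by (intro mult_right_mono powr_mono2) auto
      finally show ?thesis using True by (simp add: ennreal_mult[symmetric] ennreal_leI)
    qed auto
  qed
  also have "\<dots> = ennreal (t powr (1 - q)) * moment q ks"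
    unfolding moment_def sum_distrib_left
    by (subst nn_integral_sum, measurable) (intro sum.cong refl nn_integral_cmult, measurable)
  finally show "(\<integral>\<^sup>+w. (\<Sum>bs\<in>{bs\<in>labels ks. ball_mass ks bs w < t}. ennreal (ball_mass ks bs w)) \<partial>G) \<le> ennreal (t powr (1 - q)) * moment q ks" .
qed

lemma g_derivative:
  assumes c: "c = 1 \<or> c = - 1"
  shows "(\<lambda>n. (g j (1 + c * step n) - 1) / step n) \<longlonglongrightarrow> - c * h j"
proof -
  have e: "(g j (1 + c * step n) - 1) / step n = (\<Sum>b\<in>f j ` S. fib_mean j b * ((exp (step n * (c * ln (fib_mean j b))) - 1) / step n))" for n
  proof -
    have "(g j (1 + c * step n) - 1) / step n = (\<Sum>b\<in>f j ` S. (fib_mean j b powr (1 + c * step n) - fib_mean j b) / step n)"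
      by (simp add: g_def sum_divide_distrib[symmetric] sum_subtractf sum_fib_mean)
    then show ?thesis by (simp only: powr_slope_eq[OF fib_mean_nonneg])
  qed
  have "(\<lambda>n. (g j (1 + c * step n) - 1) / step n) \<longlonglongrightarrow> (\<Sum>b\<in>f j ` S. fib_mean j b * (c * ln (fib_mean j b)))"
    unfolding e by (intro tendsto_sum tendsto_mult tendsto_const exp_slope_tendsto)
  moreover have "(\<Sum>b\<in>f j ` S. fib_mean j b * (c * ln (fib_mean j b))) = - c * h j"
    by (simp add: h_def sum_distrib_left mult.left_commute sum_negf)
  ultimately show ?thesis by simp
qed

lemma slope_le_exp:
  fixes z s d :: real
  assumes "(z - 1) / s < d" "0 < s"
  shows "z \<le> exp (s * d)"
proof -
  have "z \<le> 1 + s * d" using assms by (simp add: divide_less_eq algebra_simps)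
  also have "\<dots> \<le> exp (s * d)" by (rule exp_ge_add_one_self)
  finally show ?thesis .
qed

text \<open>Finitely many slopes are controlled simultaneously, so that one exponent serves every
  code that occurs.\<close>

lemma eventually_moment_bounds:
  assumes e: "0 < \<epsilon>" and J: "finite J"
  shows "eventually (\<lambda>n. \<phi> (1 + step n) \<le> exp (- step n * (H - \<epsilon>)) \<and> \<phi> (1 - step n) \<le> exp (step n * (H + \<epsilon>)) \<and>
    (\<forall>j\<in>J. g j (1 + step n) \<le> exp (- step n * (h j - \<epsilon>)) \<and> g j (1 - step n) \<le> exp (step n * (h j + \<epsilon>))) \<and>
    0 < \<phi> (1 + step n) \<and> step n < p - 1) sequentially"
proof -
  have s: "z \<le> exp (- step n * (c - \<epsilon>))" if "(z - 1) / step n < - c + \<epsilon>" for z n c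
    using slope_le_exp[OF that step_pos] by (simp add: algebra_simps)
  have s': "z \<le> exp (step n * (c + \<epsilon>))" if "(z - 1) / step n < c + \<epsilon>" for z n c
    using slope_le_exp[OF that step_pos] by (simp add: algebra_simps)
  have 1: "eventually (\<lambda>n. \<phi> (1 + step n) \<le> exp (- step n * (H - \<epsilon>))) sequentially"
    by (rule eventually_mono[OF order_tendstoD(2)[OF phi_derivative(1), of "- H + \<epsilon>"] s]) (use e in auto)
  have 2: "eventually (\<lambda>n. \<phi> (1 - step n) \<le> exp (step n * (H + \<epsilon>))) sequentially"
    by (rule eventually_mono[OF order_tendstoD(2)[OF phi_derivative(2), of "H + \<epsilon>"] s']) (use e in auto)
  have 3: "eventually (\<lambda>n. \<forall>j\<in>J. g j (1 + step n) \<le> exp (- step n * (h j - \<epsilon>)) \<and> g j (1 - step n) \<le> exp (step n * (h j + \<epsilon>))) sequentially"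
  proof (intro eventually_ball_finite[OF J] ballI eventually_conj)
    fix j
    have d: "(\<lambda>n. (g j (1 + step n) - 1) / step n) \<longlonglongrightarrow> - h j" "(\<lambda>n. (g j (1 - step n) - 1) / step n) \<longlonglongrightarrow> h j"
      using g_derivative[of 1 j] g_derivative[of "-1" j] by simp_all
    show "eventually (\<lambda>n. g j (1 + step n) \<le> exp (- step n * (h j - \<epsilon>))) sequentially"
      by (rule eventually_mono[OF order_tendstoD(2)[OF d(1), of "- h j + \<epsilon>"] s]) (use e in auto)
    show "eventually (\<lambda>n. g j (1 - step n) \<le> exp (step n * (h j + \<epsilon>))) sequentially"
      by (rule eventually_mono[OF order_tendstoD(2)[OF d(2), of "h j + \<epsilon>"] s']) (use e in auto)
  qed
  have 4: "eventually (\<lambda>n. 0 < \<phi> (1 + step n)) sequentially"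
  proof -
    have "(\<lambda>n. (\<phi> (1 + step n) - 1) / step n * step n + 1) \<longlonglongrightarrow> - H * 0 + 1"
      by (intro tendsto_intros phi_derivative step_tendsto)
    moreover have "(\<phi> (1 + step n) - 1) / step n * step n + 1 = \<phi> (1 + step n)" for n using step_pos[of n] by simp
    ultimately have "(\<lambda>n. \<phi> (1 + step n)) \<longlonglongrightarrow> 1" by simp
    then show ?thesis by (rule order_tendstoD(1)) simp
  qed
  have 5: "eventually (\<lambda>n. step n < p - 1) sequentially"
    using p by (intro order_tendstoD(2)[OF step_tendsto]) simp
  show ?thesis using 1 2 3 4 5 by eventually_elim simp
qed

definition dim_sum :: "'j list \<Rightarrow> real" where
  "dim_sum ks = (\<Sum>j\<leftarrow>ks. min H (h j))"

lemma prod_list_exp: "(\<Prod>j\<leftarrow>ks. exp (F j)) = exp (\<Sum>j\<leftarrow>ks. F j)" for F :: "'j \<Rightarrow> real"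
  by (induction ks) (auto simp: exp_add)

text \<open>Half of the exponential decay absorbs the linear factor; the other half is geometric in
  \<open>L\<close>.\<close>

lemma summable_linear_exp:
  assumes "0 < \<delta>" "0 < \<alpha>" and N: "\<And>L. \<alpha> * real L \<le> real (N L)"
  shows "summable (\<lambda>L. (1 + real (N L)) * exp (- \<delta> * real (N L)))"
proof (rule summable_comparison_test')
  define r where "r = exp (- (\<delta> / 2) * \<alpha>)"
  have r: "0 < r" "r < 1" using assms by (auto simp: r_def)
  show "summable (\<lambda>L. (1 + 2 / \<delta>) * r ^ L)" using r by (intro summable_mult summable_geometric) auto
  fix L :: nat
  let ?x = "real (N L)"
  have "1 + \<delta> / 2 * ?x \<le> exp (\<delta> / 2 * ?x)" by (rule exp_ge_add_one_self)
  then have "?x \<le> 2 / \<delta> * exp (\<delta> / 2 * ?x)" using assms by (simp add: field_simps)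
  moreover have "1 \<le> exp (\<delta> / 2 * ?x)" using assms by simp
  moreover have "(1 + 2 / \<delta>) * exp (\<delta> / 2 * ?x) = exp (\<delta> / 2 * ?x) + 2 / \<delta> * exp (\<delta> / 2 * ?x)"
    by (simp only: distrib_right mult_1)
  ultimately have "1 + ?x \<le> (1 + 2 / \<delta>) * exp (\<delta> / 2 * ?x)" by linarith
  then have "(1 + ?x) * exp (- \<delta> * ?x) \<le> (1 + 2 / \<delta>) * exp (\<delta> / 2 * ?x) * exp (- \<delta> * ?x)"
    by (intro mult_right_mono) auto
  also have "\<dots> = (1 + 2 / \<delta>) * exp (- (\<delta> / 2) * ?x)" by (simp add: mult.assoc exp_add[symmetric])
  also have "exp (- (\<delta> / 2) * ?x) \<le> exp (- (\<delta> / 2) * (\<alpha> * real L))" using N[of L] assms by simp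
  also have "\<dots> = r ^ L" by (simp add: r_def exp_of_nat_mult[symmetric] mult_ac)
  finally show "norm ((1 + ?x) * exp (- \<delta> * ?x)) \<le> (1 + 2 / \<delta>) * r ^ L"
    using assms by (simp add: abs_mult mult_left_mono)
qed

text \<open>The slack \<open>2 * \<epsilon>\<close> per letter is spent twice: one half covers the
  replacement of the moments by their slopes at 1, the other leaves a factor
  \<open>exp (- s * \<epsilon>)\<close> per letter for summability. The factors \<open>m j\<close>
  dominate both alternatives of the moment bound because they contain the minimum of
  \<open>H\<close> and \<open>h j\<close>.\<close>

lemma ball_mass_upper:
  fixes \<epsilon> :: real
  assumes e: "0 < \<epsilon>" and J: "finite J" "\<And>L. set (ks L) \<subseteq> J" and \<alpha>: "0 < \<alpha>" "\<And>L. \<alpha> * real L \<le> real (length (ks L))"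
  shows "AE w in G. good w \<longrightarrow> (AE x in \<mu> w. eventually (\<lambda>L.
    ball_mass (ks L) (label (ks L) x) w \<le> exp (- (dim_sum (ks L) - 2 * \<epsilon> * length (ks L)))) sequentially)"
proof -
  obtain n where n: "\<phi> (1 + step n) \<le> exp (- step n * (H - \<epsilon>))"
    "\<And>j. j \<in> J \<Longrightarrow> g j (1 + step n) \<le> exp (- step n * (h j - \<epsilon>))" "0 < \<phi> (1 + step n)" "step n < p - 1"
    using eventually_happens[OF eventually_moment_bounds[OF e J(1)]] by auto
  define s where "s = step n"
  have s: "0 < s" using step_pos by (simp add: s_def)
  obtain K where K: "K \<ge> 0" "\<And>ks m. (\<forall>j\<in>set ks. \<phi> (1 + s) \<le> m j \<and> g j (1 + s) \<le> m j) \<Longrightarrow>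
      moment (1 + s) ks \<le> ennreal (K * (1 + real (length ks)) * (\<Prod>j\<leftarrow>ks. m j))"
    using moment_high_le[of "1 + s"] s n by (auto simp: s_def)
  define t where "t L = exp (- (dim_sum (ks L) - 2 * \<epsilon> * length (ks L)))" for L
  define m where "m j = exp (- s * (min H (h j) - \<epsilon>))" for j
  have mJ: "\<phi> (1 + s) \<le> m j \<and> g j (1 + s) \<le> m j" if "j \<in> J" for j
  proof -
    have "exp (- s * (H - \<epsilon>)) \<le> m j" "exp (- s * (h j - \<epsilon>)) \<le> m j"
      using s by (auto simp: m_def)
    then show ?thesis using n(1) n(2)[OF that] by (auto simp: s_def)
  qed
  have pm: "(\<Prod>j\<leftarrow>ks. m j) = exp (- s * (dim_sum ks - \<epsilon> * length ks))" for ks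
  proof -
    have "(\<Sum>j\<leftarrow>ks. - s * (min H (h j) - \<epsilon>)) = - s * (dim_sum ks - \<epsilon> * length ks)"
      unfolding dim_sum_def by (induction ks) (auto simp: algebra_simps)
    then show ?thesis unfolding m_def prod_list_exp by simp
  qed
  have tq: "t L powr (1 - (1 + s)) * (\<Prod>j\<leftarrow>ks L. m j) = exp (- (s * \<epsilon>) * length (ks L))" for L
    unfolding pm t_def by (simp add: powr_def exp_add[symmetric] algebra_simps)
  define F where "F L w = (\<Sum>bs\<in>{bs\<in>labels (ks L). t L < ball_mass (ks L) bs w}. ennreal (ball_mass (ks L) bs w))" for L w
  have "AE w in G. good w \<longrightarrow> (AE x in \<mu> w. eventually (\<lambda>L. \<not> t L < ball_mass (ks L) (label (ks L) x) w) sequentially)"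
  proof (rule AE_eventually_not_bad[where F=F])
    show "F L \<in> borel_measurable G" for L
      unfolding F_def using s by (intro nn_integral_bad_high(2)[of "1 + s"]) (auto simp: t_def)
    show "emeasure (\<mu> w) {x \<in> streams S. t L < ball_mass (ks L) (label (ks L) x) w} \<le> F L w" if "good w" for w L
      unfolding F_def using emeasure_\<mu>_label_Collect[OF that, of "\<lambda>bs. t L < ball_mass (ks L) bs w" "ks L"] by simp
    have b: "(\<integral>\<^sup>+w. F L w \<partial>G) \<le> ennreal (K * ((1 + real (length (ks L))) * exp (- (s * \<epsilon>) * length (ks L))))" for L
    proof -
      have "(\<integral>\<^sup>+w. F L w \<partial>G) \<le> ennreal (t L powr (1 - (1 + s))) * moment (1 + s) (ks L)"
        unfolding F_def using s by (intro nn_integral_bad_high(1)) (auto simp: t_def)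
      also have "\<dots> \<le> ennreal (t L powr (1 - (1 + s))) * ennreal (K * (1 + real (length (ks L))) * (\<Prod>j\<leftarrow>ks L. m j))"
        using mJ J(2) by (intro mult_left_mono K(2)) auto
      also have "\<dots> = ennreal (K * (1 + real (length (ks L))) * (t L powr (1 - (1 + s)) * (\<Prod>j\<leftarrow>ks L. m j)))"
        using K(1) by (subst ennreal_mult[symmetric]) (auto simp: pm mult_ac)
      finally show ?thesis unfolding tq by (simp add: mult.assoc)
    qed
    have "summable (\<lambda>L. K * ((1 + real (length (ks L))) * exp (- (s * \<epsilon>) * length (ks L))))"
      using s e \<alpha> by (intro summable_mult summable_linear_exp[of _ \<alpha>]) auto
    then have "(\<Sum>L. ennreal (K * ((1 + real (length (ks L))) * exp (- (s * \<epsilon>) * length (ks L))))) < \<infinity>"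
      using K(1) by (subst suminf_ennreal_eq[OF _ summable_sums]) auto
    then show "(\<Sum>L. \<integral>\<^sup>+w. F L w \<partial>G) < \<infinity>"
      by (rule le_less_trans[OF suminf_le[OF b summableI summableI]])
  qed
  then show ?thesis by (simp add: t_def not_less)
qed

text \<open>The mirror image with exponent \<open>1 - s\<close>. The pinned positions contribute
  \<open>H\<close> and the others their entropies, without any minimum, so the bound is sharp only
  if the pinned positions are well chosen.\<close>

lemma ball_mass_lower:
  fixes \<epsilon> :: real
  assumes e: "0 < \<epsilon>" and J: "finite J" "\<And>L. set (ks L) \<subseteq> J" and inj: "inj_on (f j0) S"
    and \<alpha>: "0 < \<alpha>" "\<And>L. \<alpha> * real L \<le> real (m L + length (ks L))"
  shows "AE w in G. good w \<longrightarrow> (AE x in \<mu> w. eventually (\<lambda>L.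
    exp (- (real (m L) * H + (\<Sum>j\<leftarrow>ks L. h j) + 2 * \<epsilon> * real (m L + length (ks L)))) \<le>
    ball_mass (replicate (m L) j0 @ ks L) (label (replicate (m L) j0 @ ks L) x) w) sequentially)"
proof -
  obtain n where n: "\<phi> (1 - step n) \<le> exp (step n * (H + \<epsilon>))"
    "\<And>j. j \<in> J \<Longrightarrow> g j (1 - step n) \<le> exp (step n * (h j + \<epsilon>))" "step n < p - 1"
    using eventually_happens[OF eventually_moment_bounds[OF e J(1)]] by auto
  define s where "s = step n"
  have s: "0 < s" "s < 1" using step_pos n p by (auto simp: s_def)
  let ?ks = "\<lambda>L. replicate (m L) j0 @ ks L"
  define D where "D L = real (m L) * H + (\<Sum>j\<leftarrow>ks L. h j)" for L
  define t where "t L = exp (- (D L + 2 * \<epsilon> * real (m L + length (ks L))))" for L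
  have gs: "0 \<le> (\<Prod>j\<leftarrow>ks. g j q) \<and> ((\<forall>j\<in>set ks. g j q \<le> exp (s * (h j + \<epsilon>))) \<longrightarrow> (\<Prod>j\<leftarrow>ks. g j q) \<le> exp (s * ((\<Sum>j\<leftarrow>ks. h j) + \<epsilon> * real (length ks))))" for ks q
  proof (induction ks)
    case (Cons j ks)
    have g0: "0 \<le> g j q" by (auto simp: g_def intro: sum_nonneg)
    have "g j q * (\<Prod>j\<leftarrow>ks. g j q) \<le> exp (s * (h j + \<epsilon>)) * exp (s * ((\<Sum>j\<leftarrow>ks. h j) + \<epsilon> * real (length ks)))"
      if "\<forall>j\<in>set (j # ks). g j q \<le> exp (s * (h j + \<epsilon>))"
      using that Cons g0 by (intro mult_mono) auto
    then show ?case using Cons g0 by (simp add: exp_add[symmetric] algebra_simps)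
  qed simp
  have mom: "moment (1 - s) (?ks L) \<le> ennreal (exp (s * (D L + \<epsilon> * real (m L + length (ks L)))))" for L
  proof -
    have "moment (1 - s) (?ks L) \<le> ennreal (\<phi> (1 - s) ^ m L * (\<Prod>j\<leftarrow>ks L. g j (1 - s)))"
      using s by (intro moment_low_pinned_le inj) auto
    also have "\<dots> \<le> ennreal (exp (s * (H + \<epsilon>)) ^ m L * exp (s * ((\<Sum>j\<leftarrow>ks L. h j) + \<epsilon> * real (length (ks L)))))"
      using n gs[of "1 - s" "ks L"] J(2)[of L] phi_nonneg[of "1 - s"]
      by (intro ennreal_leI mult_mono power_mono) (auto simp: s_def)
    also have "exp (s * (H + \<epsilon>)) ^ m L * exp (s * ((\<Sum>j\<leftarrow>ks L. h j) + \<epsilon> * real (length (ks L)))) = exp (s * (D L + \<epsilon> * real (m L + length (ks L))))"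
      by (simp add: exp_of_nat_mult[symmetric] exp_add[symmetric] D_def algebra_simps)
    finally show ?thesis .
  qed
  have tq: "t L powr (1 - (1 - s)) * exp (s * (D L + \<epsilon> * real (m L + length (ks L)))) = exp (- (s * \<epsilon>) * real (m L + length (ks L)))" for L
    unfolding t_def by (simp add: powr_def exp_add[symmetric] algebra_simps)
  define F where "F L w = (\<Sum>bs\<in>{bs\<in>labels (?ks L). ball_mass (?ks L) bs w < t L}. ennreal (ball_mass (?ks L) bs w))" for L w
  have "AE w in G. good w \<longrightarrow> (AE x in \<mu> w. eventually (\<lambda>L. \<not> ball_mass (?ks L) (label (?ks L) x) w < t L) sequentially)"
  proof (rule AE_eventually_not_bad[where F=F])
    show "F L \<in> borel_measurable G" for L
      unfolding F_def using s by (intro nn_integral_bad_low(2)[of "1 - s"]) (auto simp: t_def)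
    show "emeasure (\<mu> w) {x \<in> streams S. ball_mass (?ks L) (label (?ks L) x) w < t L} \<le> F L w" if "good w" for w L
      unfolding F_def using emeasure_\<mu>_label_Collect[OF that, of "\<lambda>bs. ball_mass (?ks L) bs w < t L" "?ks L"] by simp
    have b: "(\<integral>\<^sup>+w. F L w \<partial>G) \<le> ennreal ((1 + real (m L + length (ks L))) * exp (- (s * \<epsilon>) * real (m L + length (ks L))))" for L
    proof -
      have "(\<integral>\<^sup>+w. F L w \<partial>G) \<le> ennreal (t L powr (1 - (1 - s))) * moment (1 - s) (?ks L)"
        unfolding F_def using s by (intro nn_integral_bad_low(1)) (auto simp: t_def)
      also have "\<dots> \<le> ennreal (t L powr (1 - (1 - s))) * ennreal (exp (s * (D L + \<epsilon> * real (m L + length (ks L)))))"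
        by (intro mult_left_mono mom) auto
      also have "\<dots> = ennreal (exp (- (s * \<epsilon>) * real (m L + length (ks L))))"
        by (subst ennreal_mult[symmetric, OF powr_ge_zero exp_ge_zero]) (simp only: tq)
      \<comment> \<open>The linear factor is inserted only to reuse the summability statement of the
        upper bound.\<close>
      also have "\<dots> \<le> ennreal ((1 + real (m L + length (ks L))) * exp (- (s * \<epsilon>) * real (m L + length (ks L))))"
        by (intro ennreal_leI) (simp add: mult_le_cancel_right1)
      finally show ?thesis .
    qed
    have "summable (\<lambda>L. (1 + real (m L + length (ks L))) * exp (- (s * \<epsilon>) * real (m L + length (ks L))))"
      using s e \<alpha> by (intro summable_linear_exp[of _ \<alpha>]) auto
    then have "(\<Sum>L. ennreal ((1 + real (m L + length (ks L))) * exp (- (s * \<epsilon>) * real (m L + length (ks L))))) < \<infinity>"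
      by (subst suminf_ennreal_eq[OF _ summable_sums]) auto
    then show "(\<Sum>L. \<integral>\<^sup>+w. F L w \<partial>G) < \<infinity>"
      by (rule le_less_trans[OF suminf_le[OF b summableI summableI]])
  qed
  then show ?thesis by (simp add: t_def D_def not_less)
qed

end

context coded_cascade
begin

definition ball :: "'j list \<Rightarrow> 'a stream \<Rightarrow> 'a stream set" where
  "ball ks x = {y \<in> streams S. label ks y = label ks x}"

lemma sets_ball: "ball ks x \<in> sets (\<mu> w)"
  unfolding ball_def by (rule sets_label_Collect)

lemma length_label: "length (label ks x) = length ks"
  by (simp add: label_def)

lemma label_eq_iff: "label ks y = label ks x \<longleftrightarrow> (\<forall>l<length ks. f (ks ! l) (y !! l) = f (ks ! l) (x !! l))"
  by (simp add: label_def list_eq_iff_nth_eq)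

lemma measure_ball: "good w \<Longrightarrow> measure (\<mu> w) (ball ks x) = ball_mass ks (label ks x) w"
  unfolding ball_def by (rule measure_\<mu>_label) (simp_all add: length_label)

lemma ball_pinned_subset:
  assumes x: "x \<in> streams S" and inj: "inj_on (f j0) S"
  shows "ball (replicate (length ks) j0 @ ks') x \<subseteq> ball (ks @ ks') x"
proof
  fix y assume y: "y \<in> ball (replicate (length ks) j0 @ ks') x"
  then have yS: "y \<in> streams S" and eq: "\<And>l. l < length ks + length ks' \<Longrightarrow>
      f ((replicate (length ks) j0 @ ks') ! l) (y !! l) = f ((replicate (length ks) j0 @ ks') ! l) (x !! l)"
    by (auto simp: ball_def label_eq_iff)
  have "f ((ks @ ks') ! l) (y !! l) = f ((ks @ ks') ! l) (x !! l)" if l: "l < length ks + length ks'" for l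
  proof (cases "l < length ks")
    case True
    then have "f j0 (y !! l) = f j0 (x !! l)" using eq[OF l] by (simp add: nth_append)
    then have "y !! l = x !! l" using inj snth_in[OF yS] snth_in[OF x] by (auto dest: inj_onD)
    then show ?thesis by simp
  qed (use eq[OF l] in \<open>simp add: nth_append\<close>)
  then show "y \<in> ball (ks @ ks') x" using yS by (auto simp: ball_def label_eq_iff)
qed

end

context regular_cascade
begin

text \<open>For the lower bound of the ball masses, the letters in the positions whose code has entropy at
  least \<open>H\<close> are pinned: the ball is replaced by the smaller one whose centre has the same letters there.\<close>

theorem AE_local_dimension:
  assumes J: "finite J" "\<And>L. set (pre L) \<subseteq> J" "\<And>L. set (post L) \<subseteq> J"
    and pre: "\<And>L j. j \<in> set (pre L) \<Longrightarrow> H \<le> h j" and post: "\<And>L j. j \<in> set (post L) \<Longrightarrow> h j \<le> H"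
    and inj: "inj_on (f j0) S" and \<alpha>: "0 < \<alpha>" "\<And>L. \<alpha> * real L \<le> real (length (pre L @ post L))"
  shows "AE w in G. good w \<and> (AE x in \<mu> w. \<forall>i. eventually (\<lambda>L. 0 < measure (\<mu> w) (ball (pre L @ post L) x) \<and>
    \<bar>ln (measure (\<mu> w) (ball (pre L @ post L) x)) + dim_sum (pre L @ post L)\<bar> \<le> step i * real (length (pre L @ post L))) sequentially)"
proof -
  let ?ks = "\<lambda>L. pre L @ post L" and ?N = "\<lambda>L. real (length (pre L @ post L))"
  have D: "dim_sum (?ks L) = real (length (pre L)) * H + (\<Sum>j\<leftarrow>post L. h j)" for L
  proof -
    have "(\<Sum>j\<leftarrow>pre L. min H (h j)) = (\<Sum>j\<leftarrow>pre L. H)"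
      using pre by (intro arg_cong[where f=sum_list] map_cong refl) (rule min_absorb1)
    moreover have "(\<Sum>j\<leftarrow>post L. min H (h j)) = (\<Sum>j\<leftarrow>post L. h j)"
      using post by (intro arg_cong[where f=sum_list] map_cong refl) (rule min_absorb2)
    ultimately show ?thesis by (simp add: dim_sum_def sum_list_triv)
  qed
  \<comment> \<open>With \<open>\<epsilon> = step i / 2\<close> the slack is \<open>step i\<close>
    per letter; countably many values of \<open>i\<close> can share one null set.\<close>
  have up: "AE w in G. \<forall>i. good w \<longrightarrow> (AE x in \<mu> w. eventually (\<lambda>L.
    ball_mass (?ks L) (label (?ks L) x) w \<le> exp (- (dim_sum (?ks L) - 2 * (step i / 2) * length (?ks L)))) sequentially)"
  proof (subst AE_all_countable, intro allI)
    fix i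
    show "AE w in G. good w \<longrightarrow> (AE x in \<mu> w. eventually (\<lambda>L.
      ball_mass (?ks L) (label (?ks L) x) w \<le> exp (- (dim_sum (?ks L) - 2 * (step i / 2) * length (?ks L)))) sequentially)"
      using J step_pos[of i] \<alpha> by (intro ball_mass_upper[of "step i / 2" J ?ks \<alpha>]) auto
  qed
  have low: "AE w in G. \<forall>i. good w \<longrightarrow> (AE x in \<mu> w. eventually (\<lambda>L.
    exp (- (real (length (pre L)) * H + (\<Sum>j\<leftarrow>post L. h j) + 2 * (step i / 2) * real (length (pre L) + length (post L)))) \<le>
    ball_mass (replicate (length (pre L)) j0 @ post L) (label (replicate (length (pre L)) j0 @ post L) x) w) sequentially)"
  proof (subst AE_all_countable, intro allI)
    fix i
    show "AE w in G. good w \<longrightarrow> (AE x in \<mu> w. eventually (\<lambda>L.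
      exp (- (real (length (pre L)) * H + (\<Sum>j\<leftarrow>post L. h j) + 2 * (step i / 2) * real (length (pre L) + length (post L)))) \<le>
      ball_mass (replicate (length (pre L)) j0 @ post L) (label (replicate (length (pre L)) j0 @ post L) x) w) sequentially)"
      using J step_pos[of i] \<alpha> inj by (intro ball_mass_lower[of "step i / 2" J post j0 \<alpha> "\<lambda>L. length (pre L)"]) auto
  qed
  show ?thesis
    using up low AE_good'
  proof eventually_elim
    case (elim w)
    note g = elim(3)
    interpret fm: finite_measure "\<mu> w" by (rule finite_measure_\<mu>[OF g])
    have "AE x in \<mu> w. \<forall>i. eventually (\<lambda>L.
      ball_mass (?ks L) (label (?ks L) x) w \<le> exp (- (dim_sum (?ks L) - 2 * (step i / 2) * length (?ks L)))) sequentially"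
      using elim(1) g by (simp add: AE_all_countable)
    moreover have "AE x in \<mu> w. \<forall>i. eventually (\<lambda>L.
      exp (- (real (length (pre L)) * H + (\<Sum>j\<leftarrow>post L. h j) + 2 * (step i / 2) * real (length (pre L) + length (post L)))) \<le>
      ball_mass (replicate (length (pre L)) j0 @ post L) (label (replicate (length (pre L)) j0 @ post L) x) w) sequentially"
      using elim(2) g by (simp add: AE_all_countable)
    ultimately have "AE x in \<mu> w. \<forall>i. eventually (\<lambda>L. 0 < measure (\<mu> w) (ball (pre L @ post L) x) \<and>
      \<bar>ln (measure (\<mu> w) (ball (pre L @ post L) x)) + dim_sum (pre L @ post L)\<bar> \<le> step i * ?N L) sequentially"
      using AE_space
    proof eventually_elim
      case (elim x)
      then have x: "x \<in> streams S" by (simp add: space_\<mu>)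
      show ?case
      proof
        fix i
        show "eventually (\<lambda>L. 0 < measure (\<mu> w) (ball (pre L @ post L) x) \<and>
          \<bar>ln (measure (\<mu> w) (ball (pre L @ post L) x)) + dim_sum (pre L @ post L)\<bar> \<le> step i * ?N L) sequentially"
          using elim(1)[rule_format, of i] elim(2)[rule_format, of i]
        proof eventually_elim
          case (elim L)
          let ?m = "measure (\<mu> w) (ball (?ks L) x)"
          have 1: "?m \<le> exp (- dim_sum (?ks L) + step i * ?N L)"
            using elim(1) by (simp add: measure_ball[OF g])
          have "exp (- dim_sum (?ks L) - step i * ?N L) \<le> measure (\<mu> w) (ball (replicate (length (pre L)) j0 @ post L) x)"
            using elim(2) by (simp add: measure_ball[OF g] D)
          also have "\<dots> \<le> ?m"
            by (intro fm.finite_measure_mono ball_pinned_subset x inj sets_ball)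
          finally have 2: "exp (- dim_sum (?ks L) - step i * ?N L) \<le> ?m" .
          have pos: "0 < ?m" using 2 by (meson exp_gt_zero less_le_trans)
          have "ln ?m \<le> ln (exp (- dim_sum (?ks L) + step i * ?N L))"
            using 1 pos by (subst ln_le_cancel_iff) auto
          then have "ln ?m \<le> - dim_sum (?ks L) + step i * ?N L" by simp
          moreover have "- dim_sum (?ks L) - step i * ?N L \<le> ln ?m" using 2 pos by (simp add: ln_ge_iff)
          ultimately show ?case using pos by (auto simp: abs_le_iff)
        qed
      qed
    qed
    then show ?case using g by blast
  qed
qed

subsection \<open>The mean of the projections\<close>

lemma bernoulli_shift_fib_mean:
  "bernoulli_shift (f j ` S) (point_measure (f j ` S) (\<lambda>b. ennreal (fib_mean j b)))"
proof (intro bernoulli_shift.intro prob_spaceI)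
  show "finite (f j ` S)" using finS by simp
  show "emeasure (point_measure (f j ` S) (\<lambda>b. ennreal (fib_mean j b))) (space (point_measure (f j ` S) (\<lambda>b. ennreal (fib_mean j b)))) = 1"
    using finS fib_mean_nonneg sum_fib_mean by (simp add: space_point_measure emeasure_point_measure_finite sum_ennreal)
qed (simp add: sets_point_measure)

lemma smap_code_in_streams: "x \<in> streams S \<Longrightarrow> smap (f j) x \<in> streams (f j ` S)"
  by (auto simp: smap_streams)

lemma measurable_smap_code: "smap (f j) \<in> measurable (\<mu> w) (stream_space (count_space (f j ` S)))"
proof -
  have "smap (f j) \<in> measurable (stream_space (count_space S)) (stream_space (count_space (f j ` S)))"
    by (intro measurable_smap) auto
  then show ?thesis by (simp cong: measurable_cong_sets add: sets_\<mu>)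
qed

lemma smap_code_sstart:
  assumes "u \<in> lists (f j ` S)"
  shows "smap (f j) -` sstart (f j ` S) u \<inter> streams S = {x \<in> streams S. label (replicate (length u) j) x = u}"
proof -
  have "map (f j) (stake (length u) x) = label (replicate (length u) j) x" for x
    by (simp add: label_def list_eq_iff_nth_eq)
  then show ?thesis
    using assms smap_code_in_streams by (auto simp: sstart_eq_Collect stake_smap)
qed

text \<open>Extension from cylinders, where the mean is a product of letter means, to all events.
  Off the good environments the measure need not have the prescribed masses, so the random mass of
  an event is handled through a measurable version \<open>F\<close> that agrees with it almost
  surely.\<close>

lemma mean_projection:
  fixes j :: 'j
  defines "N \<equiv> stream_space (point_measure (f j ` S) (\<lambda>b. ennreal (fib_mean j b)))"
  assumes B: "B \<in> sets N"
  shows "\<exists>F\<in>borel_measurable G. (AE w in G. emeasure (\<mu> w) (smap (f j) -` B \<inter> streams S) = F w) \<and>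
    (\<integral>\<^sup>+w. F w \<partial>G) = emeasure N B"
proof -
  let ?A = "f j ` S"
  let ?pre = "\<lambda>B. smap (f j) -` B \<inter> streams S"
  interpret N: bernoulli_shift ?A "point_measure ?A (\<lambda>b. ennreal (fib_mean j b))"
    by (rule bernoulli_shift_fib_mean)
  have sN: "sets N = sigma_sets (streams ?A) (sstart ?A ` lists ?A \<union> {{}})"
    unfolding N_def N.sets_N using finS by (intro sets_stream_space_eq_sigma_sets) (auto intro: countable_finite)
  have pre_sets: "?pre B \<in> sets (\<mu> w)" if "B \<in> sets N" for B w
    using measurable_sets[OF measurable_smap_code[of j w], of B] that
    by (simp add: N_def N.sets_N space_\<mu>)
  have sub: "sstart ?A ` lists ?A \<union> {{}} \<subseteq> Pow (streams ?A)"
    by (auto dest: sstart_in_streams del: in_listsD)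
  have "B \<in> sigma_sets (streams ?A) (sstart ?A ` lists ?A \<union> {{}})" using B sN by simp
  then show ?thesis
  proof (induction rule: sigma_sets_induct_disjoint[OF Int_stable_sstart sub, consumes 1, case_names basic empty compl union])
    case (basic C)
    then consider "C = {}" | u where "u \<in> lists ?A" "C = sstart ?A u" by blast
    then show ?case
    proof cases
      case 1
      then show ?thesis by (intro bexI[of _ "\<lambda>_. 0"]) auto
    next
      case 2
      let ?ks = "replicate (length u) j"
      have "AE w in G. emeasure (\<mu> w) (?pre C) = ennreal (ball_mass ?ks u w)"
        using AE_good' by eventually_elim (simp add: 2 smap_code_sstart emeasure_\<mu>_label)
      moreover have "ball_mean (replicate (length u) j) u = (\<Prod>l<length u. fib_mean j (u ! l))" for u
      proof (induction u)
        case (Cons b u)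
        then show ?case by (simp add: lessThan_Suc_eq_insert_0 prod.reindex)
      qed simp
      moreover have "emeasure N C = ennreal (\<Prod>l<length u. fib_mean j (u ! l))"
        unfolding N_def 2(2) N.emeasure_sstart[OF 2(1)]
        using 2(1) finS fib_mean_nonneg
        by (subst prod_ennreal[symmetric]) (auto simp: emeasure_point_measure_finite in_lists_conv_set intro!: prod.cong)
      ultimately show ?thesis
        by (intro bexI[of _ "\<lambda>w. ennreal (ball_mass ?ks u w)"]) (auto simp: nn_integral_ball_mass)
    qed
  next
    case empty
    show ?case by (intro bexI[of _ "\<lambda>_. 0"]) auto
  next
    case (compl C)
    then obtain F where F: "F \<in> borel_measurable G" "AE w in G. emeasure (\<mu> w) (?pre C) = F w" "(\<integral>\<^sup>+w. F w \<partial>G) = emeasure N C"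
      by blast
    have CN: "C \<in> sets N" using compl sN by simp
    have le: "AE w in G. F w \<le> ennreal (Y w)"
      using F(2) AE_good'
    proof eventually_elim
      case (elim w)
      have "F w = emeasure (\<mu> w) (?pre C)" using elim by simp
      also have "\<dots> \<le> emeasure (\<mu> w) (streams S)" using pre_sets[OF CN] by (intro emeasure_mono) (auto simp flip: space_\<mu>[of w])
      finally show ?case using emeasure_\<mu>_space[OF elim(2)] by simp
    qed
    have "AE w in G. emeasure (\<mu> w) (?pre (streams ?A - C)) = ennreal (Y w) - F w"
      using F(2) AE_good'
    proof eventually_elim
      case (elim w)
      interpret finite_measure "\<mu> w" by (rule finite_measure_\<mu>[OF elim(2)])
      have "?pre (streams ?A - C) = streams S - ?pre C" using smap_code_in_streams by auto
      then have "emeasure (\<mu> w) (?pre (streams ?A - C)) = emeasure (\<mu> w) (streams S) - emeasure (\<mu> w) (?pre C)"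
        using pre_sets[OF CN, of w] sets.top[of "\<mu> w"] by (simp add: space_\<mu>) (intro emeasure_Diff; auto)
      then show ?case using elim emeasure_\<mu>_space[OF elim(2)] by simp
    qed
    \<comment> \<open>For complements the random total mass \<open>Y\<close> replaces the constant
      1; its mean is 1, as it has to be for the mean to be a probability.\<close>
    moreover have "(\<integral>\<^sup>+w. ennreal (Y w) - F w \<partial>G) = (\<integral>\<^sup>+w. ennreal (Y w) \<partial>G) - (\<integral>\<^sup>+w. F w \<partial>G)"
      using F le N.N.emeasure_finite[of C] by (intro nn_integral_diff) (auto simp: N_def)
    moreover have "emeasure N (streams ?A - C) = emeasure N (streams ?A) - emeasure N C"
    proof (rule emeasure_Diff)
      show "emeasure N C \<noteq> \<infinity>" using N.N.emeasure_finite[of C] by (simp add: N_def)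
      show "streams ?A \<in> sets N" using sets.top[of N] by (simp add: N_def N.space_N)
      show "C \<subseteq> streams ?A" using sets.sets_into_space[OF CN] by (simp add: N_def N.space_N)
    qed (rule CN)
    moreover have "emeasure N (streams ?A) = 1" using N.N.emeasure_space_1 by (simp add: N_def N.space_N)
    moreover have "(\<integral>\<^sup>+w. ennreal (Y w) \<partial>G) = 1"
      using nn_integral_eq_integral[OF int_Y] Y_nonneg by (simp add: exp_Y)
    ultimately show ?case
      using F by (intro bexI[of _ "\<lambda>w. ennreal (Y w) - F w"]) auto
  next
    case (union C)
    then have "\<forall>i. \<exists>F. F \<in> borel_measurable G \<and> (AE w in G. emeasure (\<mu> w) (?pre (C i)) = F w) \<and> (\<integral>\<^sup>+w. F w \<partial>G) = emeasure N (C i)"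
      by blast
    then obtain F where F: "\<And>i. F i \<in> borel_measurable G" "\<And>i. AE w in G. emeasure (\<mu> w) (?pre (C i)) = F i w"
      "\<And>i. (\<integral>\<^sup>+w. F i w \<partial>G) = emeasure N (C i)"
      unfolding choice_iff by blast
    have CN: "range C \<subseteq> sets N" using union sN by auto
    have "AE w in G. \<forall>i. emeasure (\<mu> w) (?pre (C i)) = F i w" using F(2) by (simp add: AE_all_countable)
    then have "AE w in G. emeasure (\<mu> w) (?pre (\<Union>i. C i)) = (\<Sum>i. F i w)"
    proof eventually_elim
      case (elim w)
      have "?pre (\<Union>i. C i) = (\<Union>i. ?pre (C i))" by auto
      also have "emeasure (\<mu> w) \<dots> = (\<Sum>i. emeasure (\<mu> w) (?pre (C i)))"
        using pre_sets CN union(1)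
        by (intro suminf_emeasure[symmetric]) (auto, fastforce simp: disjoint_family_on_def)
      finally show ?case using elim by simp
    qed
    moreover have "(\<integral>\<^sup>+w. (\<Sum>i. F i w) \<partial>G) = (\<Sum>i. \<integral>\<^sup>+w. F i w \<partial>G)" using F(1) by (rule nn_integral_suminf)
    moreover have "emeasure N (\<Union>i. C i) = (\<Sum>i. emeasure N (C i))"
      using CN union(1) by (intro suminf_emeasure[symmetric])
    ultimately show ?case
      using F by (intro bexI[of _ "\<lambda>w. \<Sum>i. F i w"]) auto
  qed
qed

end

section \<open>Entropy dimension from local dimensions\<close>

text \<open>\<open>t * - ln t\<close> increases on the interval up to \<open>exp (- 1)\<close>; this
  is where \<open>1 \<le> y\<close> enters.\<close>

lemma xlnx_le_of_le_exp:
  fixes t y :: real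
  assumes "0 < t" "t \<le> exp (- y)" "1 \<le> y"
  shows "t * - ln t \<le> y * exp (- y)"
proof -
  define z where "z = - ln t"
  have t: "t = exp (- z)" using assms by (simp add: z_def)
  have zy: "y \<le> z" using assms by (simp add: t)
  have "z \<le> y * (1 + (z - y))"
  proof -
    have "0 \<le> (y - 1) * (z - y)" using assms zy by simp
    then show ?thesis by (simp add: algebra_simps)
  qed
  also have "\<dots> \<le> y * exp (z - y)" using assms by (intro mult_left_mono exp_ge_add_one_self) auto
  finally have "exp (- z) * z \<le> exp (- z) * (y * exp (z - y))" by (intro mult_left_mono) auto
  also have "\<dots> = y * exp (- y)" by (simp add: mult.left_commute exp_add[symmetric])
  finally show ?thesis by (simp add: t)
qed

text \<open>The quotient is the average of \<open>- ln\<close> of the normalised cylinder mass,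
  divided by \<open>n\<close>, and the local assumption gives its pointwise limit. These functions
  are unbounded; truncation at \<open>K\<close> permits dominated convergence, and the excess is
  negligible because it only involves words of mass at most \<open>exp (- K * n)\<close>, too light
  for their number.\<close>

lemma entropy_quotient_tendsto:
  assumes A: "finite A" and fin: "finite_measure \<nu>" and sets: "sets \<nu> = sets (stream_space (count_space A))"
    and pos: "0 < measure \<nu> (streams A)"
    and loc: "AE x in \<nu>. \<forall>i. eventually (\<lambda>n. 0 < measure \<nu> (sstart A (stake n x)) \<and>
      \<bar>ln (measure \<nu> (sstart A (stake n x))) + real n * D\<bar> \<le> step i * real n) sequentially"
  shows "entropy_quotient A \<nu> \<longlonglongrightarrow> D"
proof -
  interpret finite_measure \<nu> by fact
  have sp: "space \<nu> = streams A" using sets_eq_imp_space_eq[OF sets] by (simp add: space_stream_space)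
  define c where "c = measure \<nu> (streams A)"
  have c: "c > 0" using pos by (simp add: c_def)
  define m where "m u = measure \<nu> (sstart A u) / c" for u
  have su: "sstart A u \<in> sets \<nu>" if "u \<in> lists A" for u
    using that A by (simp add: sets sets_sstart_count_space countable_finite)
  have m01: "0 \<le> m u" "m u \<le> 1" if "u \<in> lists A" for u
  proof -
    have "measure \<nu> (sstart A u) \<le> c"
      unfolding c_def using sstart_in_streams[OF that] sets.top[of \<nu>] by (intro finite_measure_mono) (auto simp: sp)
    then show "0 \<le> m u" "m u \<le> 1" using c by (auto simp: m_def)
  qed
  have sw: "stake n x \<in> words A n" "stake n x \<in> lists A" if "x \<in> streams A" for x n
    using stake_in_words[OF that, of n] by auto
  have fib: "stake n -` {u} \<inter> space \<nu> = sstart A u" if "u \<in> words A n" for u n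
    using that by (subst sstart_eq_Collect) (auto simp: sp)
  have sf: "simple_function \<nu> (stake n)" for n
    unfolding simple_function_def
  proof (intro conjI ballI)
    have "stake n ` space \<nu> \<subseteq> words A n" using sw by (auto simp: sp simp del: mem_Collect_eq)
    then show "finite (stake n ` space \<nu>)" using finite_words[OF A] by (rule finite_subset)
    fix u assume "u \<in> stake n ` space \<nu>"
    then have "u \<in> words A n" using sw by (auto simp: sp simp del: mem_Collect_eq)
    then show "stake n -` {u} \<inter> space \<nu> \<in> sets \<nu>" using fib[of u n] su[of u] by (simp add: in_lists_conv_set subset_iff)
  qed
  define f where "f n u = - (1 / real n) * ln (m u)" for n u
  have int: "(\<integral>x. \<phi> (stake n x) \<partial>\<nu>) = (\<Sum>u\<in>words A n. measure \<nu> (sstart A u) * \<phi> u)" for n and \<phi> :: "'a list \<Rightarrow> real"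
  proof -
    have "(\<integral>x. \<phi> (stake n x) \<partial>\<nu>) = (\<Sum>u\<in>stake n ` space \<nu>. measure \<nu> (stake n -` {u} \<inter> space \<nu>) * \<phi> u)"
      by (rule integral_finite_range[OF sf])
    also have "\<dots> = (\<Sum>u\<in>words A n. measure \<nu> (sstart A u) * \<phi> u)"
    proof (rule sum.mono_neutral_cong_left[OF finite_words[OF A]])
      show "stake n ` space \<nu> \<subseteq> words A n" using sw by (auto simp: sp simp del: mem_Collect_eq)
      show "\<forall>u\<in>words A n - stake n ` space \<nu>. measure \<nu> (sstart A u) * \<phi> u = 0"
      proof
        fix u assume u: "u \<in> words A n - stake n ` space \<nu>"
        then have "sstart A u = {}" by (subst fib[symmetric, of u n]) (auto simp: image_iff)
        then show "measure \<nu> (sstart A u) * \<phi> u = 0" by simp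
      qed
      fix u assume "u \<in> stake n ` space \<nu>"
      then have "u \<in> words A n" using sw by (auto simp: sp simp del: mem_Collect_eq)
      then show "measure \<nu> (stake n -` {u} \<inter> space \<nu>) * \<phi> u = measure \<nu> (sstart A u) * \<phi> u" using fib[of u n] by presburger
    qed
    finally show ?thesis .
  qed
  have quot: "entropy_quotient A \<nu> n = (\<integral>x. f n (stake n x) \<partial>\<nu>) / c" for n
    unfolding int by (simp add: entropy_quotient_def f_def m_def c_def[symmetric] sum_distrib_left sum_divide_distrib sum_negf mult_ac)
  have f0: "0 \<le> f n u" if "u \<in> lists A" for n u
  proof -
    have "ln (m u) \<le> 0" using m01[OF that] by (cases "m u = 0") auto
    then show ?thesis by (simp add: f_def divide_nonpos_nonneg)
  qed
  have lim: "AE x in \<nu>. (\<lambda>n. f n (stake n x)) \<longlonglongrightarrow> D"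
    using loc
  proof eventually_elim
    case (elim x)
    show ?case
    proof (rule LIMSEQ_I)
      fix r :: real assume r: "r > 0"
      then obtain i where i: "step i < r / 2" using reals_Archimedean[of "r / 2"] by (auto simp: step_def)
      have "(\<lambda>n. \<bar>ln c\<bar> / real n) \<longlonglongrightarrow> 0" by (rule lim_const_over_n)
      then have "eventually (\<lambda>n. \<bar>ln c\<bar> / real n < r / 2) sequentially" using r by (intro order_tendstoD(2)) auto
      moreover note elim[rule_format, of i] eventually_gt_at_top[of 0]
      ultimately have "eventually (\<lambda>n. norm (f n (stake n x) - D) < r) sequentially"
      proof eventually_elim
        case (elim n)
        let ?M = "measure \<nu> (sstart A (stake n x))"
        have n: "real n > 0" using elim by simp
        have "f n (stake n x) - D = - (1 / real n) * ((ln ?M + real n * D) - ln c)"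
          using elim c n by (simp add: f_def m_def ln_div field_simps)
        then have "norm (f n (stake n x) - D) = \<bar>(ln ?M + real n * D) - ln c\<bar> / real n"
          using n by (simp add: abs_mult)
        also have "\<dots> \<le> (step i * real n + \<bar>ln c\<bar>) / real n"
          using elim n by (intro divide_right_mono) auto
        also have "\<dots> = step i + \<bar>ln c\<bar> / real n" using n by (simp add: field_simps)
        finally show ?case using i elim(1) by linarith
      qed
      then show "\<exists>N. \<forall>n\<ge>N. norm (f n (stake n x) - D) < r" by (simp add: eventually_sequentially)
    qed
  qed
  have Ane: "A \<noteq> {}"
  proof
    assume "A = {}"
    then have "streams A = {}" by (simp add: streams_empty)
    then show False using pos by simp
  qed
  then have cA: "card A > 0" using A by (simp add: card_gt_0_iff)
  \<comment> \<open>At least 1 for the monotonicity of \<open>t * - ln t\<close>, at least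
    \<open>D\<close> so that truncation does not change the limit, and at least
    \<open>ln (card A) + 1\<close> to outweigh the number of words.\<close>
  define K where "K = max 1 (max D (ln (card A) + 1))"
  have K: "1 \<le> K" "D \<le> K" "ln (card A) + 1 \<le> K" by (auto simp: K_def)
  have lim1: "(\<lambda>n. \<integral>x. min (f n (stake n x)) K \<partial>\<nu>) \<longlonglongrightarrow> (\<integral>x. D \<partial>\<nu>)"
  proof (rule integral_dominated_convergence[where w="\<lambda>_. K"])
    show "(\<lambda>x. min (f n (stake n x)) K) \<in> borel_measurable \<nu>" for n
      using integral_finite_range(2)[OF sf, of "\<lambda>u. min (f n u) K"] by blast
    show "AE x in \<nu>. (\<lambda>n. min (f n (stake n x)) K) \<longlonglongrightarrow> D"
      using lim
    proof eventually_elim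
      case (elim x)
      then have "(\<lambda>n. min (f n (stake n x)) K) \<longlonglongrightarrow> min D K" by (intro tendsto_intros)
      then show ?case using K by (simp add: min_absorb1)
    qed
    show "AE x in \<nu>. norm (min (f n (stake n x)) K) \<le> K" for n
      using AE_space by eventually_elim (use f0 sw K in \<open>auto simp: sp min_def abs_le_iff\<close>)
  qed auto
  have tail: "(\<integral>x. f n (stake n x) - min (f n (stake n x)) K \<partial>\<nu>) \<le> c * K * exp (- real n)" if n: "n > 0" for n
  proof -
    have "(\<integral>x. f n (stake n x) - min (f n (stake n x)) K \<partial>\<nu>) = (\<Sum>u\<in>words A n. measure \<nu> (sstart A u) * (f n u - min (f n u) K))"
      by (rule int[of "\<lambda>u. f n u - min (f n u) K"])
    also have "\<dots> \<le> (\<Sum>u\<in>words A n. c * (K * exp (- (K * real n))))"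
    proof (rule sum_mono)
      fix u assume u: "u \<in> words A n"
      have mu: "measure \<nu> (sstart A u) = c * m u" using c by (simp add: m_def)
      have "m u * (f n u - min (f n u) K) \<le> K * exp (- (K * real n))"
      proof (cases "f n u \<le> K \<or> m u = 0")
        case True
        then show ?thesis using K by (auto simp: min_def)
      next
        case False
        then have fK: "f n u > K" and mp: "m u > 0" using m01[of u] u by (auto simp: less_le)
        then have "K * real n \<le> - ln (m u)" using n by (simp add: f_def field_simps)
        then have "ln (m u) \<le> - (K * real n)" by simp
        then have le: "m u \<le> exp (- (K * real n))" using mp by (metis exp_le_cancel_iff exp_ln)
        have Kn: "1 \<le> K * real n" using K n mult_mono[of 1 K 1 "real n"] by simp
        have "m u * (f n u - min (f n u) K) \<le> m u * f n u" using mp fK K by (simp add: min_def)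
        also have "\<dots> = (m u * - ln (m u)) / real n" by (simp add: f_def)
        also have "\<dots> \<le> (K * real n * exp (- (K * real n))) / real n"
          by (intro divide_right_mono xlnx_le_of_le_exp mp le Kn) auto
        also have "\<dots> = K * exp (- (K * real n))" using n by simp
        finally show ?thesis .
      qed
      then show "measure \<nu> (sstart A u) * (f n u - min (f n u) K) \<le> c * (K * exp (- (K * real n)))"
        unfolding mu mult.assoc using c by (intro mult_left_mono) auto
    qed
    also have "\<dots> = real (card A) ^ n * (c * (K * exp (- (K * real n))))"
      using card_lists_length_eq[OF A, of n] by simp
    also have "real (card A) ^ n = exp (ln (card A) * real n)" using cA by (simp add: exp_of_nat2_mult)
    also have "exp (ln (card A) * real n) * (c * (K * exp (- (K * real n)))) = c * K * exp (ln (card A) * real n + - (K * real n))"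
      by (simp only: exp_add mult_ac)
    also have "\<dots> \<le> c * K * exp (- real n)"
    proof -
      have "(ln (card A) + 1 - K) * real n \<le> 0" using K by (intro mult_nonpos_nonneg) auto
      then have "ln (card A) * real n + - (K * real n) \<le> - real n" by (simp add: algebra_simps)
      then show ?thesis using c K by (intro mult_left_mono) auto
    qed
    finally show ?thesis .
  qed
  have i1: "integrable \<nu> (\<lambda>x. f n (stake n x))" for n by (rule integral_finite_range(2)[OF sf])
  have i2: "integrable \<nu> (\<lambda>x. min (f n (stake n x)) K)" for n
    using integral_finite_range(2)[OF sf, of "\<lambda>u. min (f n u) K"] .
  have "(\<lambda>n. (\<integral>x. f n (stake n x) \<partial>\<nu>) - (\<integral>x. min (f n (stake n x)) K \<partial>\<nu>)) \<longlonglongrightarrow> 0"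
  proof (rule tendsto_sandwich)
    show "eventually (\<lambda>n. 0 \<le> (\<integral>x. f n (stake n x) \<partial>\<nu>) - (\<integral>x. min (f n (stake n x)) K \<partial>\<nu>)) sequentially"
      using i1 i2 by (intro always_eventually allI) (simp add: integral_mono)
    show "eventually (\<lambda>n. (\<integral>x. f n (stake n x) \<partial>\<nu>) - (\<integral>x. min (f n (stake n x)) K \<partial>\<nu>) \<le> c * K * exp (- real n)) sequentially"
      using eventually_gt_at_top[of 0] by eventually_elim (use tail i1 i2 in \<open>simp add: Bochner_Integration.integral_diff\<close>)
    have "(\<lambda>n. exp (- 1) ^ n :: real) \<longlonglongrightarrow> 0" by (intro LIMSEQ_realpow_zero) simp_all
    then have "(\<lambda>n. c * K * exp (- 1) ^ n) \<longlonglongrightarrow> c * K * 0" by (rule tendsto_mult_left)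
    then show "(\<lambda>n. c * K * exp (- real n)) \<longlonglongrightarrow> 0" by (simp add: exp_of_nat_mult[symmetric])
  qed auto
  from tendsto_add[OF this lim1] have "(\<lambda>n. \<integral>x. f n (stake n x) \<partial>\<nu>) \<longlonglongrightarrow> D * c"
    by (simp add: c_def sp mult.commute)
  then have "(\<lambda>n. (\<integral>x. f n (stake n x) \<partial>\<nu>) / c) \<longlonglongrightarrow> D * c / c" using c by (intro tendsto_intros) auto
  then show ?thesis using c unfolding quot[abs_def, symmetric] by (simp add: quot[symmetric])
qed

section \<open>The sponge metric\<close>

lemma stake_eq_mono: "stake n x = stake n y \<Longrightarrow> m \<le> n \<Longrightarrow> stake m x = stake m y"
  by (metis min_absorb1 take_stake)

lemma le_lcp_length_iff: "enat n \<le> lcp_length x y \<longleftrightarrow> stake n x = stake n y"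
proof
  assume le: "enat n \<le> lcp_length x y"
  show "stake n x = stake n y"
  proof (rule ccontr)
    assume ne: "stake n x \<noteq> stake n y"
    then have n: "n > 0" by (cases n) auto
    have "lcp_length x y \<le> enat (n - 1)"
      unfolding lcp_length_def
    proof (rule SUP_least)
      fix m assume "m \<in> {n. stake n x = stake n y}"
      then have "m < n" using ne stake_eq_mono[of m x y n] by (auto simp: not_le[symmetric])
      then show "enat m \<le> enat (n - 1)" by simp
    qed
    then have "enat n \<le> enat (n - 1)" using le by (rule order_trans[rotated])
    then show False using n by simp
  qed
next
  assume "stake n x = stake n y"
  then show "enat n \<le> lcp_length x y" unfolding lcp_length_def by (intro SUP_upper) simp
qed

lemma lcp_length_commute: "lcp_length x y = lcp_length y x"
  unfolding lcp_length_def by (simp add: eq_commute)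

lemma lcp_length_eq_infinity_iff: "lcp_length x y = \<infinity> \<longleftrightarrow> x = y"
proof
  assume "lcp_length x y = \<infinity>"
  then have "stake n x = stake n y" for n by (simp add: le_lcp_length_iff[symmetric])
  then have "x !! n = y !! n" for n by (metis lessI stake_nth)
  then show "x = y" using smap_alt[of id x y] by (simp add: stream.map_id)
next
  assume "x = y"
  then have "enat n \<le> lcp_length x y" for n by (simp add: le_lcp_length_iff)
  then show "lcp_length x y = \<infinity>" by (metis enat_ord_simps(1) not_enat_eq not_less_eq_eq order_refl)
qed

lemma lcp_length_ultra: "min (lcp_length x y) (lcp_length y z) \<le> lcp_length x z"
proof (rule ccontr)
  assume "\<not> ?thesis"
  then have lt: "lcp_length x z < min (lcp_length x y) (lcp_length y z)" by (simp only: not_le)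
  then obtain n where n: "lcp_length x z = enat n" by (cases "lcp_length x z") auto
  then have "enat (Suc n) \<le> lcp_length x y" "enat (Suc n) \<le> lcp_length y z" using lt by (auto simp: Suc_ile_eq)
  then have "enat (Suc n) \<le> lcp_length x z" by (simp add: le_lcp_length_iff del: stake.simps)
  then show False using n by simp
qed

lemma exp_neg_nonneg: "0 \<le> exp_neg l s"
  by (cases l) (auto simp: exp_neg_def)

lemma exp_neg_eq_0_iff: "exp_neg l s = 0 \<longleftrightarrow> l = \<infinity>"
  by (cases l) (auto simp: exp_neg_def)

lemma exp_neg_antimono: "0 < s \<Longrightarrow> l \<le> l' \<Longrightarrow> exp_neg l' s \<le> exp_neg l s"
  by (cases l; cases l') (auto simp: exp_neg_def divide_right_mono)

text \<open>The ceiling converts a radius into the number of letters that must agree; radii above 1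
  correspond to negative \<open>t\<close> and impose nothing.\<close>

lemma exp_neg_le_iff:
  assumes "0 < s"
  shows "exp_neg l s \<le> exp (- t) \<longleftrightarrow> enat (nat \<lceil>s * t\<rceil>) \<le> l"
proof (cases l)
  case (enat n)
  have "exp_neg l s \<le> exp (- t) \<longleftrightarrow> s * t \<le> real n" using assms enat by (simp add: exp_neg_def field_simps)
  also have "\<dots> \<longleftrightarrow> enat (nat \<lceil>s * t\<rceil>) \<le> l" by (simp add: enat ceiling_le_iff nat_le_iff)
  finally show ?thesis .
qed (simp add: exp_neg_def)

section \<open>The ultrametric, its balls and its Borel sets\<close>

locale sponge =
  fixes k i :: nat and Alph :: "nat \<Rightarrow> 'a set" and \<pi> :: "nat \<Rightarrow> 'a \<Rightarrow> 'a" and \<gamma> :: "nat \<Rightarrow> real"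
  assumes i: "1 \<le> i" "i \<le> k" and fin: "finite (Alph i)"
    and gamma_pos: "\<And>j. 1 \<le> j \<Longrightarrow> j \<le> k \<Longrightarrow> 0 < \<gamma> j"
begin

abbreviation "X \<equiv> streams (Alph i)"
abbreviation "d \<equiv> sponge_dist k \<pi> \<gamma> i"

definition s :: "nat \<Rightarrow> real" where "s j = (\<Sum>l=1..j. \<gamma> l)"

definition len :: "real \<Rightarrow> nat \<Rightarrow> nat" where "len t j = nat \<lceil>s j * t\<rceil>"

definition close :: "real \<Rightarrow> 'a stream \<Rightarrow> 'a stream \<Rightarrow> bool" where
  "close t x y \<longleftrightarrow> (\<forall>j\<in>{i..k}. \<forall>l<len t j. factor_letter \<pi> i j (x !! l) = factor_letter \<pi> i j (y !! l))"

lemma s_pos: "j \<in> {i..k} \<Longrightarrow> 0 < s j"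
  unfolding s_def using i by (intro sum_pos gamma_pos) auto

lemma s_mono: "i \<le> j \<Longrightarrow> j \<le> j' \<Longrightarrow> j' \<le> k \<Longrightarrow> s j \<le> s j'"
  unfolding s_def by (intro sum_mono2) (auto intro: less_imp_le[OF gamma_pos])

lemma d_le_iff: "d x y \<le> r \<longleftrightarrow> (\<forall>j\<in>{i..k}. exp_neg (lcp_length (factor_map \<pi> i j x) (factor_map \<pi> i j y)) (s j) \<le> r)"
  unfolding sponge_dist_def s_def using i by (subst Max_le_iff) auto

lemma d_le_exp_iff: "d x y \<le> exp (- t) \<longleftrightarrow> close t x y"
proof -
  have "exp_neg (lcp_length (factor_map \<pi> i j x) (factor_map \<pi> i j y)) (s j) \<le> exp (- t) \<longleftrightarrow>
     (\<forall>l<len t j. factor_letter \<pi> i j (x !! l) = factor_letter \<pi> i j (y !! l))" if "j \<in> {i..k}" for j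
    unfolding exp_neg_le_iff[OF s_pos[OF that]] le_lcp_length_iff
    by (simp add: factor_map_def list_eq_iff_nth_eq len_def)
  then show ?thesis unfolding d_le_iff close_def by simp
qed

lemma d_nonneg: "0 \<le> d x y"
  unfolding sponge_dist_def using i by (subst Max_ge_iff) (auto intro!: exp_neg_nonneg)

lemma factor_map_self: "factor_map \<pi> i i x = x"
  by (simp add: factor_map_def factor_letter_def id_def stream.map_ident)

lemma d_eq_0_iff: "d x y = 0 \<longleftrightarrow> x = y"
proof
  assume "d x y = 0"
  then have "exp_neg (lcp_length x y) (s i) \<le> 0" using bspec[of "{i..k}" _ i, OF d_le_iff[THEN iffD1, of x y 0]] i factor_map_self by simp
  then show "x = y" using exp_neg_nonneg[of "lcp_length x y" "s i"]
    by (simp add: exp_neg_eq_0_iff lcp_length_eq_infinity_iff order_antisym_conv)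
next
  assume "x = y"
  then have "lcp_length (factor_map \<pi> i j x) (factor_map \<pi> i j y) = \<infinity>" for j
    by (simp add: lcp_length_eq_infinity_iff)
  then have "d x y \<le> 0" unfolding d_le_iff by (simp add: exp_neg_def)
  then show "d x y = 0" using d_nonneg[of x y] by simp
qed

lemma d_ultra: "d x z \<le> max (d x y) (d y z)"
  unfolding d_le_iff
proof
  fix j assume j: "j \<in> {i..k}"
  let ?F = "factor_map \<pi> i j"
  have "exp_neg (lcp_length (?F x) (?F z)) (s j) \<le> exp_neg (min (lcp_length (?F x) (?F y)) (lcp_length (?F y) (?F z))) (s j)"
    by (intro exp_neg_antimono s_pos j lcp_length_ultra)
  also have "\<dots> \<le> max (exp_neg (lcp_length (?F x) (?F y)) (s j)) (exp_neg (lcp_length (?F y) (?F z)) (s j))"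
    by (auto simp: min_def max_def)
  also have "\<dots> \<le> max (d x y) (d y z)"
    using d_le_iff[of x y "d x y"] d_le_iff[of y z "d y z"] j by (intro max.mono) auto
  finally show "exp_neg (lcp_length (?F x) (?F z)) (s j) \<le> max (d x y) (d y z)" .
qed

sublocale Metric_space X d
proof
  show "0 \<le> d x y" for x y by (rule d_nonneg)
  show "d x y = d y x" for x y unfolding sponge_dist_def by (simp add: lcp_length_commute)
  show "d x y = 0 \<longleftrightarrow> x = y" for x y by (rule d_eq_0_iff)
  show "d x z \<le> d x y + d y z" for x y z
    using d_ultra[of x z y] d_nonneg[of x y] d_nonneg[of y z] by auto
qed

lemma mcball_exp: "x \<in> X \<Longrightarrow> mcball x (exp (- t)) = {y \<in> X. close t x y}"
  by (auto simp: mcball_def d_le_exp_iff)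

lemma closeI_stake:
  assumes "stake n x = stake n y" "\<And>j. j \<in> {i..k} \<Longrightarrow> len t j \<le> n"
  shows "close t x y"
  unfolding close_def
proof (intro ballI allI impI)
  fix j l assume "j \<in> {i..k}" "l < len t j"
  then have "l < n" using assms(2)[of j] by simp
  then have "x !! l = y !! l" using assms(1) by (metis stake_nth)
  then show "factor_letter \<pi> i j (x !! l) = factor_letter \<pi> i j (y !! l)" by simp
qed

lemma close_commute: "close t x y \<longleftrightarrow> close t y x"
  unfolding close_def by (simp add: eq_commute)

lemma close_stake:
  assumes "\<And>j. j \<in> {i..k} \<Longrightarrow> len t j \<le> n"
  shows "close t x y \<longleftrightarrow> (\<forall>j\<in>{i..k}. \<forall>l<len t j. factor_letter \<pi> i j (stake n x ! l) = factor_letter \<pi> i j (y !! l))"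
  unfolding close_def
proof (intro ball_cong refl all_cong)
  fix j l assume "j \<in> {i..k}" "l < len t j"
  then have "l < n" using assms[of j] by linarith
  then show "factor_letter \<pi> i j (x !! l) = factor_letter \<pi> i j (y !! l) \<longleftrightarrow>
      factor_letter \<pi> i j (stake n x ! l) = factor_letter \<pi> i j (y !! l)"
    by simp
qed

lemma close_imp_stake: "close t x y \<Longrightarrow> stake (len t i) x = stake (len t i) y"
  using i by (auto simp: close_def list_eq_iff_nth_eq factor_letter_def dest!: bspec[of _ _ i])

text \<open>Cylinders are open, because \<open>j = i\<close> is among the maps in the metric.
  Conversely every point of an open set has a cylinder inside the set, and there are only countably
  many cylinders.\<close>

lemma borel_sets_eq: "sets (shift_space (Alph i)) = sigma_sets X {U. openin mtopology U}"
proof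
  have cnt: "countable (lists (Alph i))" using fin by (simp add: countable_finite)
  have sub: "sstart (Alph i) ` lists (Alph i) \<union> {{}} \<subseteq> {U. openin mtopology U}"
  proof
    fix U assume "U \<in> sstart (Alph i) ` lists (Alph i) \<union> {{}}"
    then consider "U = {}" | u where "u \<in> lists (Alph i)" "U = sstart (Alph i) u" by blast
    then show "U \<in> {U. openin mtopology U}"
    proof cases
      case 2
      have "openin mtopology (sstart (Alph i) u)"
        unfolding openin_mtopology
      proof (intro conjI allI impI)
        show "sstart (Alph i) u \<subseteq> X" using sstart_in_streams[OF 2(1)] .
        fix x assume x: "x \<in> sstart (Alph i) u"
        have sx: "stake (length u) x = u" "x \<in> X" using x 2(1) by (auto simp: sstart_eq_Collect)
        \<comment> \<open>Chosen so that \<open>s i * t\<close> is the length of \<open>u\<close>: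
          the ball then fixes at least these letters.\<close>
        define t where "t = real (length u) / s i"
        have lt: "length u \<le> len t i" using s_pos[of i] i by (simp add: len_def t_def)
        show "\<exists>r>0. mball x r \<subseteq> sstart (Alph i) u"
        proof (intro exI[of _ "exp (- t)"] conjI subsetI)
          fix y assume "y \<in> mball x (exp (- t))"
          then have y: "y \<in> X" "d x y \<le> exp (- t)" by auto
          then have "stake (len t i) x = stake (len t i) y" using close_imp_stake by (simp add: d_le_exp_iff)
          then have "stake (length u) y = u" using stake_eq_mono[OF _ lt] sx by metis
          then show "y \<in> sstart (Alph i) u" using y 2(1) by (simp add: sstart_eq_Collect)
        qed simp
      qed
      then show ?thesis using 2 by simp
    qed simp
  qed
  show "sets (shift_space (Alph i)) \<subseteq> sigma_sets X {U. openin mtopology U}"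
    unfolding sets_stream_space_eq_sigma_sets[OF countable_finite[OF fin]]
    using sub by (intro sigma_sets_mono') auto
  have "U \<in> sets (shift_space (Alph i))" if U: "openin mtopology U" for U
  proof -
    have UX: "U \<subseteq> X" using U by (simp add: openin_mtopology)
    have "U = (\<Union>u\<in>{u\<in>lists (Alph i). sstart (Alph i) u \<subseteq> U}. sstart (Alph i) u)"
    proof (intro equalityI subsetI)
      fix x assume x: "x \<in> U"
      then have xX: "x \<in> X" using UX by auto
      obtain r where r: "r > 0" "mball x r \<subseteq> U" using U x by (auto simp: openin_mtopology)
      \<comment> \<open>Closed balls of radius \<open>exp (- t) = r / 2\<close> stay inside the open
        ball of radius \<open>r\<close>.\<close>
      define t where "t = - ln (r / 2)"
      define n where "n = Max (len t ` {i..k})"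
      have le: "len t j \<le> n" if "j \<in> {i..k}" for j using that by (auto simp: n_def)
      have u: "stake n x \<in> lists (Alph i)" using stake_in_words[OF xX, of n] by auto
      have "sstart (Alph i) (stake n x) \<subseteq> U"
      proof
        fix y assume "y \<in> sstart (Alph i) (stake n x)"
        then have y: "y \<in> X" "stake n x = stake n y" using u by (auto simp: sstart_eq_Collect)
        then have "d x y \<le> exp (- t)" using closeI_stake[OF y(2) le] by (simp add: d_le_exp_iff)
        then have "d x y < r" using r by (simp add: t_def)
        then show "y \<in> U" using r y xX by auto
      qed
      moreover have "x \<in> sstart (Alph i) (stake n x)" using u xX by (simp add: sstart_eq_Collect)
      ultimately show "x \<in> (\<Union>u\<in>{u\<in>lists (Alph i). sstart (Alph i) u \<subseteq> U}. sstart (Alph i) u)" using u by blast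
    qed auto
    also have "\<dots> \<in> sets (shift_space (Alph i))"
      using cnt fin by (intro sets.countable_UN'[OF countable_subset[OF _ cnt]]) (auto intro!: sets_sstart_count_space countable_finite)
    finally show ?thesis .
  qed
  then show "sigma_sets X {U. openin mtopology U} \<subseteq> sets (shift_space (Alph i))"
    using sets.sigma_sets_subset[of "{U. openin mtopology U}" "shift_space (Alph i)"] by (auto simp: space_stream_space)
qed

end

section \<open>Radii and patterns\<close>

lemma real_nat_floor_div_tendsto: "((\<lambda>t. real (nat \<lfloor>t\<rfloor> + c) / t) \<longlongrightarrow> 1) at_top" for t :: real
proof (rule tendsto_sandwich)
  show "eventually (\<lambda>t. (t - 1) / t \<le> real (nat \<lfloor>t\<rfloor> + c) / t) at_top"
    using eventually_gt_at_top[of 0] by eventually_elim (intro divide_right_mono, linarith+)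
  show "eventually (\<lambda>t. real (nat \<lfloor>t\<rfloor> + c) / t \<le> (t + real c) / t) at_top"
    using eventually_gt_at_top[of 0] by eventually_elim (intro divide_right_mono, linarith+)
qed real_asymp+

text \<open>Monotonicity squeezes \<open>F r\<close> between its values at two consecutive radii
  \<open>exp (- n)\<close>. Both have \<open>n / - ln r\<close> tending to 1, so the limit along
  these radii is the limit along all radii.\<close>

lemma log_ratio_tendsto_at_right:
  fixes F :: "real \<Rightarrow> real"
  assumes mono: "\<And>r r'. 0 < r \<Longrightarrow> r \<le> r' \<Longrightarrow> F r \<le> F r'"
    and pos: "eventually (\<lambda>n. 0 < F (exp (- real n))) sequentially"
    and lim: "(\<lambda>n. ln (F (exp (- real n))) / real n) \<longlonglongrightarrow> - D"
  shows "\<forall>r>0. 0 < F r" and "((\<lambda>r. ln (F r) / ln r) \<longlongrightarrow> D) (at_right 0)"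
proof -
  have posr: "0 < F r" if r: "0 < r" for r
  proof -
    obtain N where N: "\<And>n. n \<ge> N \<Longrightarrow> 0 < F (exp (- real n))" using pos by (auto simp: eventually_sequentially)
    define n where "n = max N (nat \<lceil>- ln r\<rceil>)"
    have "- real n \<le> ln r" by (simp add: n_def) linarith
    then have "exp (- real n) \<le> r" using r by (metis exp_le_cancel_iff exp_ln)
    then have "F (exp (- real n)) \<le> F r" by (intro mono) auto
    then show ?thesis using N[of n] by (simp add: n_def)
  qed
  then show "\<forall>r>0. 0 < F r" by blast
  \<comment> \<open>The index with \<open>exp (- (L r + 1)) \<le> r \<le> exp (- L r)\<close>, for
    small \<open>r\<close>.\<close>
  define L where "L r = nat \<lfloor>- ln r\<rfloor>" for r :: real
  define q where "q n = - ln (F (exp (- real n))) / real n" for n :: nat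
  have q: "q \<longlonglongrightarrow> D" using tendsto_minus[OF lim] by (simp add: q_def[abs_def])
  have t: "filterlim (\<lambda>r. - ln r) at_top (at_right (0::real))"
    using ln_at_0 by (simp add: filterlim_uminus_at_top)
  have Linf: "filterlim (\<lambda>r. L r + c) sequentially (at_right 0)" for c
  proof -
    have "filterlim (\<lambda>t::real. nat \<lfloor>t\<rfloor> + c) sequentially at_top"
      using filterlim_floor_sequentially filterlim_nat_sequentially
      by (intro filterlim_add_const_nat_at_top[THEN filterlim_compose] filterlim_compose[OF filterlim_nat_sequentially filterlim_floor_sequentially])
    from filterlim_compose[OF this t] show ?thesis by (simp add: L_def)
  qed
  have rat: "((\<lambda>r. real (L r + c) / - ln r) \<longlongrightarrow> 1) (at_right 0)" for c
    using filterlim_compose[OF real_nat_floor_div_tendsto[of c] t] by (simp add: L_def)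
  have lims: "((\<lambda>r. q (L r + c) * (real (L r + c) / - ln r)) \<longlongrightarrow> D) (at_right 0)" for c
    using tendsto_mult[OF filterlim_compose[OF q Linf[of c]] rat[of c]] by simp
  show "((\<lambda>r. ln (F r) / ln r) \<longlongrightarrow> D) (at_right 0)"
  proof (rule tendsto_sandwich[OF _ _ lims[of 0] lims[of 1]])
    have ev: "eventually (\<lambda>r::real. 0 < r \<and> r < exp (- 1)) (at_right 0)"
      using eventually_at_right[of 0 "exp (- 1) :: real"] by (auto intro: exI[of _ "exp (- 1) :: real"])
    show "eventually (\<lambda>r. q (L r + 0) * (real (L r + 0) / - ln r) \<le> ln (F r) / ln r) (at_right 0)"
      using ev
    proof eventually_elim
      case (elim r)
      have l: "ln r < - 1" using elim by (metis ln_exp ln_less_cancel_iff exp_gt_zero)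
      then have "real (L r) \<le> - ln r" "0 < L r" by (auto simp: L_def)
      then have "r \<le> exp (- real (L r))" using elim by (metis exp_ln exp_le_cancel_iff minus_le_iff minus_minus)
      then have "ln (F r) \<le> ln (F (exp (- real (L r))))" using posr elim mono by (intro ln_mono) auto
      then have "- ln (F (exp (- real (L r)))) / - ln r \<le> - ln (F r) / - ln r" using l by (intro divide_right_mono) auto
      then show ?case using \<open>0 < L r\<close> by (simp add: q_def)
    qed
    show "eventually (\<lambda>r. ln (F r) / ln r \<le> q (L r + 1) * (real (L r + 1) / - ln r)) (at_right 0)"
      using ev
    proof eventually_elim
      case (elim r)
      have l: "ln r < - 1" using elim by (metis ln_exp ln_less_cancel_iff exp_gt_zero)
      then have "- real (L r + 1) \<le> ln r" by (simp add: L_def) linarith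
      then have "exp (- real (L r + 1)) \<le> r" using elim by (metis exp_ln exp_le_cancel_iff)
      then have "ln (F (exp (- real (L r + 1)))) \<le> ln (F r)" using posr elim mono by (intro ln_mono) auto
      then have "- ln (F r) / - ln r \<le> - ln (F (exp (- real (L r + 1)))) / - ln r" using l by (intro divide_right_mono) auto
      then show ?case by (simp add: q_def)
    qed
  qed
qed

lemma tendsto_of_step_bound:
  fixes a E :: "nat \<Rightarrow> real"
  assumes loc: "\<And>i. eventually (\<lambda>L. 0 < a L \<and> \<bar>ln (a L) + D L\<bar> \<le> step i * E L) sequentially"
    and D: "(\<lambda>L. D L / real L) \<longlonglongrightarrow> D0" and E: "(\<lambda>L. E L / real L) \<longlonglongrightarrow> E0"
  shows "(\<lambda>L. ln (a L) / real L) \<longlonglongrightarrow> - D0"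
proof -
  have "(\<lambda>L. (ln (a L) + D L) / real L) \<longlonglongrightarrow> 0"
  proof (rule LIMSEQ_I)
    fix r :: real assume r: "r > 0"
    have "\<bar>E0\<bar> + 1 > 0" by simp
    then obtain i where i: "step i < r / (\<bar>E0\<bar> + 1)" using reals_Archimedean[of "r / (\<bar>E0\<bar> + 1)"] r by (auto simp: step_def)
    have "eventually (\<lambda>L. E L / real L < \<bar>E0\<bar> + 1) sequentially" using E by (rule order_tendstoD(2)) simp
    then have "eventually (\<lambda>L. norm ((ln (a L) + D L) / real L - 0) < r) sequentially"
      using loc[of i] eventually_gt_at_top[of 0]
    proof eventually_elim
      case (elim L)
      have "norm ((ln (a L) + D L) / real L - 0) = \<bar>ln (a L) + D L\<bar> / real L" by simp
      also have "\<dots> \<le> step i * E L / real L" using elim by (intro divide_right_mono) auto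
      also have "\<dots> = step i * (E L / real L)" by simp
      also have "\<dots> \<le> step i * (\<bar>E0\<bar> + 1)" using elim step_pos[of i] by (intro mult_left_mono) auto
      also have "\<dots> < r" using i by (simp add: pos_less_divide_eq)
      finally show ?case .
    qed
    then show "\<exists>no. \<forall>n\<ge>no. norm ((ln (a n) + D n) / real n - 0) < r" by (simp add: eventually_sequentially)
  qed
  from tendsto_diff[OF this D] show ?thesis by (simp add: add_divide_distrib)
qed

text \<open>A coarser code has larger fibres. Written as averages over letters instead of labels,
  the two entropies can be compared term by term.\<close>

lemma (in coded_cascade) h_antimono:
  assumes "\<And>a. a \<in> S \<Longrightarrow> f j' a = t (f j a)"
  shows "h j' \<le> h j"
proof -
  have eq: "h j = - (\<Sum>a\<in>S. mean a * ln (fib_mean j (f j a)))" for j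
  proof -
    have "(\<Sum>a\<in>S. mean a * ln (fib_mean j (f j a))) = (\<Sum>b\<in>f j ` S. \<Sum>a\<in>fib j b. mean a * ln (fib_mean j (f j a)))"
      by (rule sum_fib[symmetric])
    also have "\<dots> = (\<Sum>b\<in>f j ` S. \<Sum>a\<in>fib j b. mean a * ln (fib_mean j b))"
      by (intro sum.cong refl) (auto simp: fib_def)
    also have "\<dots> = (\<Sum>b\<in>f j ` S. fib_mean j b * ln (fib_mean j b))"
      by (simp add: sum_distrib_right[symmetric] fib_mean_def[symmetric])
    finally show ?thesis by (simp add: h_def)
  qed
  have "mean a * ln (fib_mean j (f j a)) \<le> mean a * ln (fib_mean j' (f j' a))" if a: "a \<in> S" for a
  proof (cases "mean a = 0")
    case False
    then have pos: "0 < mean a" using mean_ge_0[OF a] by simp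
    have "mean a \<le> fib_mean j (f j a)"
      unfolding fib_mean_def using a finite_fib mean_ge_0 by (intro member_le_sum) (auto simp: fib_def)
    moreover have "fib_mean j (f j a) \<le> fib_mean j' (f j' a)"
      unfolding fib_mean_def using assms a finite_fib mean_ge_0 by (intro sum_mono2) (auto simp: fib_def)
    ultimately show ?thesis using pos by (intro mult_left_mono ln_mono) auto
  qed simp
  then show ?thesis unfolding eq by (simp add: sum_mono)
qed

section \<open>Projected measures and the code pattern of a metric ball\<close>

locale projected_cascade =
  sponge k i Alph \<pi> \<gamma> + regular_cascade "Alph 1" M q0 "factor_letter \<pi> 1" p
  for k i :: nat and Alph :: "nat \<Rightarrow> 'a set" and \<pi> \<gamma> and M q0 p +
  assumes fin_Alph: "\<And>j. 1 \<le> j \<Longrightarrow> j \<le> k \<Longrightarrow> finite (Alph j)"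
    and factors: "\<And>j. 1 \<le> j \<Longrightarrow> j < k \<Longrightarrow> \<pi> j ` Alph j = Alph (Suc j)"
begin

declare One_nat_def [simp del]

abbreviation code :: "nat \<Rightarrow> 'a \<Rightarrow> 'a" where "code \<equiv> factor_letter \<pi> 1"

lemma code_1: "code 1 = id"
  by (simp add: factor_letter_def id_def)

lemma code_comp: "1 \<le> l \<Longrightarrow> l \<le> j \<Longrightarrow> code j a = factor_letter \<pi> l j (code l a)"
  unfolding factor_letter_def using upt_add_eq_append[of 1 l "j - l"] by simp

lemma code_image: "1 \<le> j \<Longrightarrow> j \<le> k \<Longrightarrow> code j ` Alph 1 = Alph j"
proof (induction j rule: dec_induct)
  case (step j)
  have "code (Suc j) = \<pi> j \<circ> code j" using step by (simp add: factor_letter_def fun_eq_iff)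
  then have "code (Suc j) ` Alph 1 = \<pi> j ` code j ` Alph 1" by (simp only: image_comp)
  then show ?case using step factors[of j] by simp
qed (simp add: code_1)

lemma h_mono: "1 \<le> l \<Longrightarrow> l \<le> j \<Longrightarrow> h j \<le> h l"
  by (rule h_antimono[where t="factor_letter \<pi> l j"]) (rule code_comp)

abbreviation e :: "nat \<Rightarrow> real" where "e j \<equiv> min H (h j)"

text \<open>\<open>pattern L m\<close> gives, for each position, the smallest \<open>j \<in> {i..i + m}\<close> such that the ball of radius
  \<open>exp (- L)\<close> determines the image of the letter in \<open>Alph j\<close>.\<close>

primrec pattern :: "nat \<Rightarrow> nat \<Rightarrow> nat list" where
  "pattern L 0 = replicate (len (real L) i) i"
| "pattern L (Suc m) = pattern L m @ replicate (len (real L) (i + Suc m) - len (real L) (i + m)) (i + Suc m)"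

lemma len_mono: "i \<le> j \<Longrightarrow> j \<le> j' \<Longrightarrow> j' \<le> k \<Longrightarrow> 0 \<le> t \<Longrightarrow> len t j \<le> len t j'"
  unfolding len_def by (intro nat_mono ceiling_mono mult_right_mono s_mono)

lemma length_pattern: "i + m \<le> k \<Longrightarrow> length (pattern L m) = len (real L) (i + m)"
proof (induction m)
  case (Suc m)
  then show ?case using len_mono[of "i + m" "i + Suc m" "real L"] by simp
qed simp

lemma set_pattern: "set (pattern L m) \<subseteq> {i..i + m}"
  by (induction m) (auto split: if_splits)

text \<open>A position inside the range of several codes needs to be tested only with the finest of
  them, since agreement under \<open>code j\<close> implies agreement under all later codes.\<close>

lemma label_pattern_eq_iff:
  assumes "i + m \<le> k"
  shows "label (pattern L m) y = label (pattern L m) x \<longleftrightarrow>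
    (\<forall>j\<in>{i..i + m}. \<forall>l<len (real L) j. code j (y !! l) = code j (x !! l))"
  using assms
proof (induction m)
  case 0
  then show ?case by (simp add: label_eq_iff)
next
  case (Suc m)
  let ?n = "len (real L)"
  have n: "?n (i + m) \<le> ?n (i + Suc m)" using Suc.prems by (intro len_mono) auto
  have lp: "length (pattern L m) = ?n (i + m)" using Suc.prems by (intro length_pattern) simp
  have IH: "(\<forall>l<?n (i + m). code (pattern L m ! l) (y !! l) = code (pattern L m ! l) (x !! l)) \<longleftrightarrow>
    (\<forall>j\<in>{i..i + m}. \<forall>l<?n j. code j (y !! l) = code j (x !! l))" (is "?A \<longleftrightarrow> ?B")
    using Suc lp by (simp add: label_eq_iff)
  have "label (pattern L (Suc m)) y = label (pattern L (Suc m)) x \<longleftrightarrow>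
    (\<forall>l<?n (i + Suc m). code (pattern L (Suc m) ! l) (y !! l) = code (pattern L (Suc m) ! l) (x !! l))"
    using length_pattern[OF Suc.prems, of L] by (simp only: label_eq_iff)
  also have "\<dots> \<longleftrightarrow> ?A \<and> (\<forall>l<?n (i + Suc m). ?n (i + m) \<le> l \<longrightarrow> code (i + Suc m) (y !! l) = code (i + Suc m) (x !! l))"
    using n lp by (auto simp: nth_append not_less)
  also have "\<dots> \<longleftrightarrow> ?B \<and> (\<forall>l<?n (i + Suc m). code (i + Suc m) (y !! l) = code (i + Suc m) (x !! l))"
  proof -
    have "code (i + Suc m) (y !! l) = code (i + Suc m) (x !! l)" if ?B "l < ?n (i + m)" for l
    proof -
      have "code (i + m) (y !! l) = code (i + m) (x !! l)" using that by auto
      then show ?thesis using code_comp[of "i + m" "i + Suc m"] i by simp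
    qed
    then show ?thesis unfolding IH by (meson not_le)
  qed
  also have "\<dots> \<longleftrightarrow> (\<forall>j\<in>{i..i + Suc m}. \<forall>l<?n j. code j (y !! l) = code j (x !! l))"
    by (auto simp: atLeastAtMostSuc_conv)
  finally show ?case .
qed

text \<open>The indices in a pattern increase along the word and \<open>h\<close> decreases with the
  index, so the positions with \<open>H \<le> h j\<close> come first. This is the arrangement that
  the lower bound for ball masses requires.\<close>

lemma pattern_split:
  "pattern L m = filter (\<lambda>j. H \<le> h j) (pattern L m) @ filter (\<lambda>j. \<not> H \<le> h j) (pattern L m)"
proof (induction m)
  case (Suc m)
  show ?case
  proof (cases "H \<le> h (i + Suc m)")
    case True
    have "H \<le> h j" if "j \<in> set (pattern L (Suc m))" for j
    proof -
      have "i \<le> j" "j \<le> i + Suc m" using that set_pattern[of L "Suc m"] by auto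
      then show ?thesis using True h_mono[of j "i + Suc m"] i by simp
    qed
    then have "filter (\<lambda>j. H \<le> h j) (pattern L (Suc m)) = pattern L (Suc m)"
      "filter (\<lambda>j. \<not> H \<le> h j) (pattern L (Suc m)) = []"
      by (auto intro: filter_True simp del: pattern.simps)
    then show ?thesis by simp
  next
    case False
    then show ?thesis using Suc by (simp add: filter_replicate)
  qed
qed (auto simp: filter_replicate)

lemma len_div_tendsto: "j \<in> {i..k} \<Longrightarrow> (\<lambda>L. real (len (real L) j) / real L) \<longlonglongrightarrow> s j"
proof -
  assume j: "j \<in> {i..k}"
  have sp: "0 < s j" by (rule s_pos[OF j])
  have n: "s j * real L \<le> real (len (real L) j)" "real (len (real L) j) \<le> s j * real L + 1" for L
    using mult_nonneg_nonneg[OF less_imp_le[OF sp], of "real L"] by (auto simp: len_def)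
  show ?thesis
  proof (rule tendsto_sandwich)
    show "eventually (\<lambda>L. s j \<le> real (len (real L) j) / real L) sequentially"
      using eventually_gt_at_top[of 0] by eventually_elim (use n(1) in \<open>simp add: pos_le_divide_eq\<close>)
    show "eventually (\<lambda>L. real (len (real L) j) / real L \<le> s j + 1 / real L) sequentially"
      using eventually_gt_at_top[of 0] by eventually_elim (use n(2) in \<open>simp add: pos_divide_le_eq distrib_right\<close>)
    show "(\<lambda>L. s j + 1 / real L) \<longlonglongrightarrow> s j"
      using tendsto_add[OF tendsto_const lim_const_over_n[of 1], of "s j"] by simp
  qed simp
qed

lemma s_Suc: "s (Suc j) = s j + \<gamma> (Suc j)"
  by (simp add: s_def)

text \<open>Code \<open>i\<close> occupies about \<open>s i * L\<close> positions and each later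
  code \<open>j\<close> about \<open>(s j - s (j - 1)) * L\<close>, that is
  \<open>\<gamma> j * L\<close>: these are the weights \<open>gamma_vec \<gamma> i\<close>.\<close>

lemma dim_sum_pattern_tendsto:
  "i + m \<le> k \<Longrightarrow> (\<lambda>L. dim_sum (pattern L m) / real L) \<longlonglongrightarrow> (\<Sum>j=i..i + m. gamma_vec \<gamma> i j * e j)"
proof (induction m)
  case 0
  have "(\<lambda>L. real (len (real L) i) / real L * e i) \<longlonglongrightarrow> s i * e i"
    using i by (intro tendsto_mult_right len_div_tendsto) auto
  then show ?case by (simp add: dim_sum_def sum_list_replicate gamma_vec_def s_def)
next
  case (Suc m)
  let ?n = "len"
  have "(\<lambda>L. dim_sum (pattern L m) / real L + (real (len (real L) (i + Suc m)) / real L - real (len (real L) (i + m)) / real L) * e (i + Suc m))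
    \<longlonglongrightarrow> (\<Sum>j=i..i + m. gamma_vec \<gamma> i j * e j) + (s (i + Suc m) - s (i + m)) * e (i + Suc m)"
    using Suc by (intro tendsto_intros len_div_tendsto) auto
  moreover have "dim_sum (pattern L (Suc m)) / real L = dim_sum (pattern L m) / real L +
     (real (len (real L) (i + Suc m)) / real L - real (len (real L) (i + m)) / real L) * e (i + Suc m)" for L
    using len_mono[of "i + m" "i + Suc m" "real L"] Suc.prems
    by (simp add: dim_sum_def sum_list_replicate of_nat_diff add_divide_distrib diff_divide_distrib left_diff_distrib)
  moreover have "s (i + Suc m) - s (i + m) = gamma_vec \<gamma> i (i + Suc m)"
    by (simp add: s_Suc gamma_vec_def)
  ultimately show ?case by simp
qed

abbreviation proj :: "nat \<Rightarrow> ('a list \<Rightarrow> 'a \<Rightarrow> real) \<Rightarrow> 'a stream measure" where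
  "proj j w \<equiv> push_factor Alph \<pi> j (\<mu> w)"

lemma measurable_factor_map:
  "1 \<le> j \<Longrightarrow> j \<le> k \<Longrightarrow> factor_map \<pi> 1 j \<in> measurable (\<mu> w) (shift_space (Alph j))"
  using measurable_smap_code[of j w] code_image[of j] by (simp add: factor_map_def)

lemma sets_proj: "sets (proj j w) = sets (shift_space (Alph j))"
  by (simp add: push_factor_def)

lemma space_proj: "space (proj j w) = streams (Alph j)"
  by (simp add: push_factor_def space_stream_space)

lemma factor_map_in_streams: "1 \<le> j \<Longrightarrow> j \<le> k \<Longrightarrow> x \<in> streams (Alph 1) \<Longrightarrow> factor_map \<pi> 1 j x \<in> streams (Alph j)"
  using smap_code_in_streams[of x j] code_image[of j] by (simp add: factor_map_def)

lemma finite_measure_proj: "good w \<Longrightarrow> 1 \<le> j \<Longrightarrow> j \<le> k \<Longrightarrow> finite_measure (proj j w)"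
  unfolding push_factor_def using finite_measure.finite_measure_distr[OF finite_measure_\<mu> measurable_factor_map] by blast

lemma measure_proj:
  assumes "1 \<le> j" "j \<le> k" "B \<in> sets (shift_space (Alph j))"
  shows "measure (proj j w) B = measure (\<mu> w) {x \<in> streams (Alph 1). factor_map \<pi> 1 j x \<in> B}"
proof -
  have "factor_map \<pi> 1 j -` B \<inter> space (\<mu> w) = {x \<in> streams (Alph 1). factor_map \<pi> 1 j x \<in> B}"
    by (auto simp: space_\<mu>)
  then show ?thesis unfolding push_factor_def using assms by (simp add: measure_distr measurable_factor_map)
qed

text \<open>Moving an almost sure statement along the projection requires a measurable event.
  Letting \<open>F\<close> depend on a finite prefix secures this.\<close>

lemma AE_proj_local:
  fixes F :: "nat \<Rightarrow> 'a list \<Rightarrow> real"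
  assumes j: "1 \<le> j" "j \<le> k"
    and AE: "AE x in \<mu> w. \<forall>i. eventually (\<lambda>L. 0 < F L (stake (n L) (factor_map \<pi> 1 j x)) \<and>
      \<bar>ln (F L (stake (n L) (factor_map \<pi> 1 j x))) + D L\<bar> \<le> step i * E L) sequentially"
  shows "AE y in proj j w. \<forall>i. eventually (\<lambda>L. 0 < F L (stake (n L) y) \<and>
      \<bar>ln (F L (stake (n L) y)) + D L\<bar> \<le> step i * E L) sequentially"
proof -
  have m [measurable]: "(\<lambda>y. F L (stake (n L) y)) \<in> borel_measurable (shift_space (Alph j))" for L
    using measurable_compose[OF measurable_stake_countable[OF fin_Alph[OF j], of "F L" "n L"], of id borel] by simp
  show ?thesis
    unfolding push_factor_def
  proof (subst AE_distr_iff[OF measurable_factor_map[OF j]])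
    show "{y \<in> space (shift_space (Alph j)). \<forall>i. eventually (\<lambda>L. 0 < F L (stake (n L) y) \<and>
      \<bar>ln (F L (stake (n L) y)) + D L\<bar> \<le> step i * E L) sequentially} \<in> sets (shift_space (Alph j))"
      unfolding eventually_sequentially by measurable
  qed (rule AE)
qed

lemma AE_entropy_quotient:
  assumes j: "1 \<le> j" "j \<le> k"
  shows "AE w in G. good w \<and> (0 < Y w \<longrightarrow> entropy_quotient (Alph j) (proj j w) \<longlonglongrightarrow> e j)"
proof -
  \<comment> \<open>With a constant sequence of codes the comparison of \<open>H\<close> with
    \<open>h j\<close> is the same everywhere, so either all positions are pinned or none
    is.\<close>
  define pre post where "pre L = (if H \<le> h j then replicate L j else [])"
    and "post L = (if H \<le> h j then [] else replicate L j)" for L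
  have pp: "pre L @ post L = replicate L j" for L by (simp add: pre_def post_def)
  have "AE w in G. good w \<and> (AE x in \<mu> w. \<forall>i. eventually (\<lambda>L. 0 < measure (\<mu> w) (ball (pre L @ post L) x) \<and>
    \<bar>ln (measure (\<mu> w) (ball (pre L @ post L) x)) + dim_sum (pre L @ post L)\<bar> \<le> step i * real (length (pre L @ post L))) sequentially)"
  proof (rule AE_local_dimension[of "{j}" _ _ 1 1])
    show "inj_on (code 1) (Alph 1)" by (simp add: code_1)
  qed (auto simp: pre_def post_def split: if_splits)
  then show ?thesis
  proof eventually_elim
    case (elim w)
    then have g: "good w" by blast
    have A: "finite (Alph j)" by (rule fin_Alph[OF j])
    have pb: "measure (proj j w) (sstart (Alph j) (stake L (factor_map \<pi> 1 j x))) = measure (\<mu> w) (ball (replicate L j) x)"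
      if x: "x \<in> streams (Alph 1)" for x L
    proof -
      let ?u = "stake L (factor_map \<pi> 1 j x)"
      have u: "?u \<in> lists (Alph j)" using stake_in_words[OF factor_map_in_streams[OF j x], of L] by auto
      have "{y \<in> streams (Alph 1). factor_map \<pi> 1 j y \<in> sstart (Alph j) ?u} = ball (replicate L j) x"
      proof -
        have "factor_map \<pi> 1 j y \<in> sstart (Alph j) ?u \<longleftrightarrow> label (replicate L j) y = label (replicate L j) x"
          if "y \<in> streams (Alph 1)" for y
          unfolding mem_sstart_iff[OF factor_map_in_streams[OF j that]] label_eq_iff
          by (simp add: list_eq_iff_nth_eq factor_map_def)
        then show ?thesis by (auto simp: ball_def)
      qed
      then show ?thesis using u A by (subst measure_proj[OF j]) (auto intro!: sets_sstart_count_space countable_finite)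
    qed
    have "AE x in \<mu> w. \<forall>i. eventually (\<lambda>L. 0 < measure (proj j w) (sstart (Alph j) (stake L (factor_map \<pi> 1 j x))) \<and>
      \<bar>ln (measure (proj j w) (sstart (Alph j) (stake L (factor_map \<pi> 1 j x)))) + real L * e j\<bar> \<le> step i * real L) sequentially"
      using conjunct2[OF elim] AE_space
    proof eventually_elim
      case (elim x)
      then show ?case by (simp add: space_\<mu> pb pp dim_sum_def sum_list_replicate)
    qed
    then have loc: "AE y in proj j w. \<forall>i. eventually (\<lambda>L. 0 < measure (proj j w) (sstart (Alph j) (stake L y)) \<and>
      \<bar>ln (measure (proj j w) (sstart (Alph j) (stake L y))) + real L * e j\<bar> \<le> step i * real L) sequentially"
      by (rule AE_proj_local[OF j, where F="\<lambda>L u. measure (proj j w) (sstart (Alph j) u)" and n="\<lambda>L. L"])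
    have mass: "measure (proj j w) (streams (Alph j)) = Y w"
    proof -
      have "{x \<in> streams (Alph 1). factor_map \<pi> 1 j x \<in> streams (Alph j)} = streams (Alph 1)"
        using factor_map_in_streams[OF j] by blast
      then show ?thesis
        using measure_proj[OF j, of "streams (Alph j)" w] sets.top[of "shift_space (Alph j)"] emeasure_\<mu>_space[OF g] Y_nonneg[of w]
        by (simp add: space_stream_space measure_def)
    qed
    show ?case
      using g mass entropy_quotient_tendsto[OF A finite_measure_proj[OF g j] sets_proj _ loc] by simp
  qed
qed

lemma AE_exact_dimensional:
  "AE w in G. good w \<and> exact_dimensional (streams (Alph i)) (sponge_dist k \<pi> \<gamma> i) (proj i w) (\<Sum>j=i..k. gamma_vec \<gamma> i j * e j)"
proof -
  define m where "m = k - i"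
  have im: "i + m = k" using i by (simp add: m_def)
  have j: "1 \<le> i" "i \<le> k" using i by auto
  define pre post where "pre L = filter (\<lambda>j. H \<le> h j) (pattern L m)"
    and "post L = filter (\<lambda>j. \<not> H \<le> h j) (pattern L m)" for L
  have pp: "pre L @ post L = pattern L m" for L using pattern_split[of L m] by (simp add: pre_def post_def)
  have lp: "length (pattern L m) = len (real L) k" for L using length_pattern[of m L] im by simp
  have sk: "0 < s k" using i by (intro s_pos) auto
  have "AE w in G. good w \<and> (AE x in \<mu> w. \<forall>i. eventually (\<lambda>L. 0 < measure (\<mu> w) (ball (pre L @ post L) x) \<and>
    \<bar>ln (measure (\<mu> w) (ball (pre L @ post L) x)) + dim_sum (pre L @ post L)\<bar> \<le> step i * real (length (pre L @ post L))) sequentially)"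
  proof (rule AE_local_dimension[of "{i..i + m}" _ _ 1 "s k"])
    show "inj_on (code 1) (Alph 1)" by (simp add: code_1)
    show "set (pre L) \<subseteq> {i..i + m}" "set (post L) \<subseteq> {i..i + m}" for L
      using set_pattern[of L m] by (auto simp: pre_def post_def)
    show "s k * real L \<le> real (length (pre L @ post L))" for L
      unfolding pp lp len_def by linarith
  qed (use sk in \<open>auto simp: pre_def post_def\<close>)
  then show ?thesis
  proof eventually_elim
    case (elim w)
    then have g: "good w" by blast
    let ?\<nu> = "proj i w"
    interpret \<nu>: finite_measure ?\<nu> by (rule finite_measure_proj[OF g j])
    have close_sets: "{z \<in> X. close t y z} \<in> sets ?\<nu>" if "y \<in> X" for t y
    proof -
      define N where "N = Max (len t ` {i..k})"
      have le: "len t j \<le> N" if "j \<in> {i..k}" for j using that by (auto simp: N_def)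
      have "{z \<in> X. close t y z} = {z \<in> space (shift_space (Alph i)). \<forall>j\<in>{i..k}. \<forall>l<len t j. factor_letter \<pi> i j (stake N z ! l) = factor_letter \<pi> i j (y !! l)}"
        unfolding close_commute[of t y] using close_stake[OF le] by (simp add: space_stream_space)
      also have "\<dots> \<in> sets (shift_space (Alph i))"
        by (rule predE[OF measurable_stake_countable[OF fin_Alph[OF j], of "\<lambda>u. \<forall>j\<in>{i..k}. \<forall>l<len t j. factor_letter \<pi> i j (u ! l) = factor_letter \<pi> i j (y !! l)" N]])
      finally show ?thesis by (simp add: sets_proj)
    qed
    \<comment> \<open>The mass of the ball of radius \<open>exp (- L)\<close> as a function of the
      prefix of its centre of length \<open>N L\<close>, the largest number of letters that any of
      the maps inspects.\<close>
    define F where "F L u = measure ?\<nu> {z \<in> X. \<forall>j\<in>{i..k}. \<forall>l<len (real L) j. factor_letter \<pi> i j (u ! l) = factor_letter \<pi> i j (z !! l)}" for L u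
    define N where "N L = Max (len (real L) ` {i..k})" for L
    have le: "len (real L) j \<le> N L" if "j \<in> {i..k}" for j L using that by (auto simp: N_def)
    have F: "F L (stake (N L) y) = measure ?\<nu> {z \<in> X. close (real L) y z}" for L y
      unfolding F_def using close_stake[OF le] by simp
    have pb: "measure ?\<nu> {z \<in> X. close (real L) (factor_map \<pi> 1 i x) z} = measure (\<mu> w) (ball (pattern L m) x)"
      if x: "x \<in> streams (Alph 1)" for x L
    proof -
      have fl: "factor_letter \<pi> i j (factor_map \<pi> 1 i z !! l) = code j (z !! l)" if "j \<in> {i..k}" for j z l
        using that code_comp[OF j(1), of j] by (simp add: factor_map_def)
      have "close (real L) (factor_map \<pi> 1 i x) (factor_map \<pi> 1 i y) \<longleftrightarrow> label (pattern L m) y = label (pattern L m) x" for y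
        unfolding label_pattern_eq_iff[OF eq_refl[OF im]] close_commute[of _ "factor_map \<pi> 1 i x"] unfolding im close_def
        by (intro ball_cong refl all_cong) (simp only: fl)
      then have "{y \<in> streams (Alph 1). factor_map \<pi> 1 i y \<in> {z \<in> X. close (real L) (factor_map \<pi> 1 i x) z}} = ball (pattern L m) x"
        using factor_map_in_streams[OF j] unfolding ball_def by blast
      then show ?thesis using close_sets[OF factor_map_in_streams[OF j x]] by (subst measure_proj[OF j]) (auto simp: sets_proj)
    qed
    have "AE x in \<mu> w. \<forall>n. eventually (\<lambda>L. 0 < F L (stake (N L) (factor_map \<pi> 1 i x)) \<and>
      \<bar>ln (F L (stake (N L) (factor_map \<pi> 1 i x))) + dim_sum (pattern L m)\<bar> \<le> step n * real (len (real L) k)) sequentially"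
      using conjunct2[OF elim] AE_space
    proof eventually_elim
      case (elim x)
      then show ?case unfolding F pp by (simp add: space_\<mu> pb lp)
    qed
    then have loc: "AE y in ?\<nu>. \<forall>n. eventually (\<lambda>L. 0 < F L (stake (N L) y) \<and>
      \<bar>ln (F L (stake (N L) y)) + dim_sum (pattern L m)\<bar> \<le> step n * real (len (real L) k)) sequentially"
      by (rule AE_proj_local[OF j])
    have "AE y in ?\<nu>. (\<forall>r>0. 0 < measure ?\<nu> (mcball y r)) \<and>
      ((\<lambda>r. ln (measure ?\<nu> (mcball y r)) / ln r) \<longlongrightarrow> (\<Sum>j=i..k. gamma_vec \<gamma> i j * e j)) (at_right 0)"
      using loc AE_space
    proof eventually_elim
      case (elim y)
      then have y: "y \<in> X" by (simp add: space_proj)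
      have eq: "measure ?\<nu> (mcball y (exp (- real L))) = F L (stake (N L) y)" for L
        unfolding F mcball_exp[OF y] ..
      \<comment> \<open>Every positive radius is of the form \<open>exp (- t)\<close>, so all balls,
        not only those with integer \<open>t\<close>, are measurable.\<close>
      have mono: "measure ?\<nu> (mcball y r) \<le> measure ?\<nu> (mcball y r')" if "0 < r" "r \<le> r'" for r r'
      proof (rule \<nu>.finite_measure_mono)
        have "mcball y r' = {z \<in> X. close (- ln r') y z}" using mcball_exp[OF y, of "- ln r'"] that by simp
        then show "mcball y r' \<in> sets ?\<nu>" using close_sets[OF y] by simp
      qed (use that mcball_subset_concentric in auto)
      have lim: "(\<lambda>n. ln (measure ?\<nu> (mcball y (exp (- real n)))) / real n) \<longlonglongrightarrow> - (\<Sum>j=i..k. gamma_vec \<gamma> i j * e j)"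
        unfolding eq
      proof (rule tendsto_of_step_bound)
        show "eventually (\<lambda>L. 0 < F L (stake (N L) y) \<and> \<bar>ln (F L (stake (N L) y)) + dim_sum (pattern L m)\<bar> \<le> step n * real (len (real L) k)) sequentially" for n
          using elim by blast
        show "(\<lambda>L. dim_sum (pattern L m) / real L) \<longlonglongrightarrow> (\<Sum>j=i..k. gamma_vec \<gamma> i j * e j)"
          using dim_sum_pattern_tendsto[of m] im by simp
        show "(\<lambda>L. real (len (real L) k) / real L) \<longlonglongrightarrow> s k"
          using j by (intro len_div_tendsto) auto
      qed
      have pos: "eventually (\<lambda>n. 0 < measure ?\<nu> (mcball y (exp (- real n)))) sequentially"
        unfolding eq using elim(1)[rule_format, of 0] by eventually_elim blast
      show ?case
        using log_ratio_tendsto_at_right[of "\<lambda>r. measure ?\<nu> (mcball y r)", OF mono pos lim] by blast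
    qed
    then show ?case
      unfolding exact_dimensional_def using g
      by (auto simp: space_proj sets_proj borel_sets_eq Metric_space_axioms \<nu>.emeasure_eq_measure intro!: exI[of _ 1])
  qed
qed

text \<open>\<open>measure_of\<close> depends only on the values on the sigma-algebra, so equality
  of the expected masses identifies the mean measure with a product measure, whose entropy is
  known.\<close>

lemma mean_measure_bernoulli:
  assumes j: "1 \<le> j" "j \<le> k"
    and law: "\<And>B. B \<in> sets (shift_space (Alph j)) \<Longrightarrow>
      (\<integral>\<^sup>+\<omega>. emeasure (\<kappa> \<omega>) B \<partial>P) = emeasure (stream_space (point_measure (Alph j) (\<lambda>b. ennreal (fib_mean j b)))) B"
  shows "bernoulli_product (Alph j) (mean_measure P (shift_space (Alph j)) \<kappa>)"
    and "ks_entropy (mean_measure P (shift_space (Alph j)) \<kappa>) stl = ereal (h j)"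
proof -
  let ?p = "point_measure (Alph j) (\<lambda>b. ennreal (fib_mean j b))"
  interpret N: bernoulli_shift "Alph j" ?p
    using bernoulli_shift_fib_mean[of j] by (simp add: code_image j)
  have eq: "mean_measure P (shift_space (Alph j)) \<kappa> = stream_space ?p"
  proof (rule measure_eqI)
    fix B assume "B \<in> sets (mean_measure P (shift_space (Alph j)) \<kappa>)"
    then have B: "B \<in> sets (shift_space (Alph j))" by (simp add: mean_measure_def)
    have "mean_measure P (shift_space (Alph j)) \<kappa> =
        measure_of (space (shift_space (Alph j))) (sets (shift_space (Alph j))) (emeasure (stream_space ?p))"
      unfolding mean_measure_def by (rule measure_of_eq[OF sets.space_closed]) (simp add: sets.sigma_sets_eq law)
    also have "\<dots> = measure_of (space (stream_space ?p)) (sets (stream_space ?p)) (emeasure (stream_space ?p))"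
      using N.sets_N N.space_N by (simp add: space_stream_space)
    finally show "emeasure (mean_measure P (shift_space (Alph j)) \<kappa>) B = emeasure (stream_space ?p) B"
      by (simp add: measure_of_of_measure)
  qed (simp add: mean_measure_def N.sets_N)
  have ent: "N.entropy = h j"
  proof -
    have "N.p.prob {b} = fib_mean j b" if "b \<in> Alph j" for b
      using that fin_Alph[OF j] fib_mean_nonneg by (simp add: measure_def emeasure_point_measure_finite)
    then show ?thesis using code_image[OF j] by (simp add: N.entropy_def h_def)
  qed
  show "bernoulli_product (Alph j) (mean_measure P (shift_space (Alph j)) \<kappa>)"
    unfolding bernoulli_product_def eq using N.p.prob_space_axioms by (intro exI[of _ ?p]) (simp add: sets_point_measure)
  show "ks_entropy (mean_measure P (shift_space (Alph j)) \<kappa>) stl = ereal (h j)"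
    unfolding eq N.ks_entropy_eq ent ..
qed

end

section \<open>The law of the environment\<close>

text \<open>The copies \<open>W(u)\<close> are non-negative only almost surely, and their values outside the alphabet are
  arbitrary. Clipping them changes the Mandelbrot measure only on a null set.\<close>

definition clip :: "'a set \<Rightarrow> ('a \<Rightarrow> real) \<Rightarrow> 'a \<Rightarrow> real" where
  "clip S x = (\<lambda>a\<in>S. max 0 (x a))"

text \<open>The coordinates range over \<open>{0..}\<close> so that every point of the space is
  non-negative, as the cascade demands of its environments.\<close>

definition weight_space :: "'a set \<Rightarrow> ('a \<Rightarrow> real) measure" where
  "weight_space S = (\<Pi>\<^sub>M a\<in>S. restrict_space borel {0..})"

lemma measurable_clip: "(\<lambda>z. clip S (snd z)) \<in> measurable (AW_space S) (weight_space S)"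
  unfolding clip_def weight_space_def AW_space_def
proof (rule measurable_restrict)
  fix a assume a: "a \<in> S"
  have "(\<lambda>z. max 0 (snd z a)) \<in> borel_measurable (count_space (Pow S) \<Otimes>\<^sub>M (\<Pi>\<^sub>M a\<in>S. borel :: real measure))"
    using a by (intro borel_measurable_max measurable_const measurable_compose[OF measurable_snd measurable_component_singleton]) auto
  then show "(\<lambda>z. max 0 (snd z a)) \<in> measurable (count_space (Pow S) \<Otimes>\<^sub>M (\<Pi>\<^sub>M a\<in>S. borel :: real measure)) (restrict_space borel {0..})"
    by (intro measurable_restrict_space2) auto
qed

lemma measurable_weight_coord: "a \<in> S \<Longrightarrow> (\<lambda>x. x a) \<in> borel_measurable (weight_space S)"
  unfolding weight_space_def
  using measurable_compose[OF measurable_component_singleton[of a S "\<lambda>_. restrict_space borel {0::real..}"]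
      measurable_restrict_space1[OF measurable_ident]]
  by (simp add: id_def)

lemma weight_space_nonneg: "x \<in> space (weight_space S) \<Longrightarrow> a \<in> S \<Longrightarrow> 0 \<le> x a"
  by (auto simp: weight_space_def space_PiM space_restrict_space PiE_def Pi_def)

lemma cascade_clip:
  assumes S: "finite S" and P0: "prob_space P0"
    and AW0: "(\<lambda>\<omega>. (A0 \<omega>, W0 \<omega>)) \<in> measurable P0 (AW_space S)"
    and nonneg: "\<And>\<omega> a. \<omega> \<in> space P0 \<Longrightarrow> a \<in> S \<Longrightarrow> 0 \<le> W0 \<omega> a"
    and mean: "(\<integral>\<omega>. (\<Sum>a\<in>S. W0 \<omega> a) \<partial>P0) = 1"
    and q: "1 < q" "T_fun P0 S W0 q > - \<infinity>"
  shows "cascade S (distr P0 (weight_space S) (\<lambda>\<omega>. clip S (W0 \<omega>))) q"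
proof -
  let ?X = "\<lambda>\<omega>. clip S (W0 \<omega>)"
  have X: "?X \<in> measurable P0 (weight_space S)"
    using measurable_compose[OF AW0 measurable_clip] by simp
  have Wm: "(\<lambda>\<omega>. W0 \<omega> a) \<in> borel_measurable P0" if "a \<in> S" for a
  proof -
    have "(\<lambda>z. snd z a) \<in> borel_measurable (AW_space S)"
      unfolding AW_space_def using that
      by (intro measurable_compose[OF measurable_snd measurable_component_singleton]) auto
    from measurable_compose[OF AW0 this] show ?thesis by simp
  qed
  have eq: "?X \<omega> a = W0 \<omega> a" if "\<omega> \<in> space P0" "a \<in> S" for \<omega> a
    using nonneg[OF that] that by (simp add: clip_def)
  \<comment> \<open>The integral of a function that is not integrable is 0 by convention, so the
    value 1 forces integrability.\<close>
  have int_sum: "integrable P0 (\<lambda>\<omega>. \<Sum>a\<in>S. W0 \<omega> a)"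
    using mean not_integrable_integral_eq by fastforce
  have int_W: "integrable P0 (\<lambda>\<omega>. W0 \<omega> a)" if "a \<in> S" for a
  proof (rule Bochner_Integration.integrable_bound[OF int_sum Wm[OF that]], rule AE_I2)
    fix \<omega> assume \<omega>: "\<omega> \<in> space P0"
    have "W0 \<omega> a \<le> (\<Sum>a\<in>S. W0 \<omega> a)" using S that nonneg[OF \<omega>] by (intro member_le_sum) auto
    then show "norm (W0 \<omega> a) \<le> norm (\<Sum>a\<in>S. W0 \<omega> a)" using nonneg[OF \<omega> that] by simp
  qed
  have int_q: "integrable P0 (\<lambda>\<omega>. W0 \<omega> a powr q)" if a: "a \<in> S" for a
  proof (rule integrableI_nonneg)
    have "(\<integral>\<^sup>+ \<omega>. (\<Sum>a\<in>S. ennreal (W0 \<omega> a powr q)) \<partial>P0) \<noteq> \<infinity>"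
      using q(2) by (auto simp: T_fun_def Let_def split: if_splits)
    moreover have "(\<integral>\<^sup>+ \<omega>. ennreal (W0 \<omega> a powr q) \<partial>P0) \<le> (\<integral>\<^sup>+ \<omega>. (\<Sum>a\<in>S. ennreal (W0 \<omega> a powr q)) \<partial>P0)"
      using S a by (intro nn_integral_mono member_le_sum) auto
    ultimately show "(\<integral>\<^sup>+ \<omega>. ennreal (W0 \<omega> a powr q) \<partial>P0) < \<infinity>"
      by (simp add: less_top[symmetric] top_unique) (metis neq_top_trans)
  qed (use Wm[OF a] in auto)
  show ?thesis
  proof (rule cascade.intro)
    show "finite S" by (rule S)
    show "prob_space (distr P0 (weight_space S) ?X)" using X by (rule prob_space.prob_space_distr[OF P0])
    show "(\<lambda>x. x a) \<in> borel_measurable (distr P0 (weight_space S) ?X)" if "a \<in> S" for a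
      using measurable_weight_coord[OF that] by simp
    show "0 \<le> x a" if "x \<in> space (distr P0 (weight_space S) ?X)" "a \<in> S" for x a
      using that weight_space_nonneg by simp
    show "1 < q" by (rule q)
    show "integrable (distr P0 (weight_space S) ?X) (\<lambda>x. x a powr q)" if a: "a \<in> S" for a
    proof (subst integrable_distr_eq[OF X])
      show "(\<lambda>x. x a powr q) \<in> borel_measurable (weight_space S)"
        using measurable_weight_coord[OF a] by simp
      show "integrable P0 (\<lambda>\<omega>. ?X \<omega> a powr q)"
        using int_q[OF a] by (rule Bochner_Integration.integrable_cong[THEN iffD1, OF refl, rotated]) (simp add: eq a)
    qed
    have "(\<Sum>a\<in>S. \<integral>x. x a \<partial>distr P0 (weight_space S) ?X) = (\<Sum>a\<in>S. \<integral>\<omega>. W0 \<omega> a \<partial>P0)"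
    proof (intro sum.cong refl)
      fix a assume a: "a \<in> S"
      have "(\<integral>x. x a \<partial>distr P0 (weight_space S) ?X) = (\<integral>\<omega>. ?X \<omega> a \<partial>P0)"
        by (rule integral_distr[OF X measurable_weight_coord[OF a]])
      also have "\<dots> = (\<integral>\<omega>. W0 \<omega> a \<partial>P0)" by (intro Bochner_Integration.integral_cong refl) (simp add: eq a)
      finally show "(\<integral>x. x a \<partial>distr P0 (weight_space S) ?X) = (\<integral>\<omega>. W0 \<omega> a \<partial>P0)" .
    qed
    also have "\<dots> = 1" using mean int_W by (subst Bochner_Integration.integral_sum[symmetric]) auto
    finally show "(\<Sum>a\<in>S. \<integral>x. x a \<partial>distr P0 (weight_space S) ?X) = 1" .
  qed
qed

lemma
  assumes P: "prob_space P"
    and indep: "prob_space.indep_vars P (\<lambda>_. AW_space S) (\<lambda>u \<omega>. (A u \<omega>, W u \<omega>)) (lists S)"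
    and copies: "\<And>u. u \<in> lists S \<Longrightarrow>
      distr P (AW_space S) (\<lambda>\<omega>. (A u \<omega>, W u \<omega>)) = distr P0 (AW_space S) (\<lambda>\<omega>. (A0 \<omega>, W0 \<omega>))"
    and AW0: "(\<lambda>\<omega>. (A0 \<omega>, W0 \<omega>)) \<in> measurable P0 (AW_space S)"
  shows measurable_environment:
      "(\<lambda>\<omega>. \<lambda>u\<in>lists S. clip S (W u \<omega>)) \<in> measurable P (\<Pi>\<^sub>M u\<in>lists S. weight_space S)"
    and distr_environment: "distr P (\<Pi>\<^sub>M u\<in>lists S. weight_space S) (\<lambda>\<omega>. \<lambda>u\<in>lists S. clip S (W u \<omega>)) =
      (\<Pi>\<^sub>M u\<in>lists S. distr P0 (weight_space S) (\<lambda>\<omega>. clip S (W0 \<omega>)))"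
proof -
  interpret prob_space P by fact
  have AW: "(\<lambda>\<omega>. (A u \<omega>, W u \<omega>)) \<in> measurable P (AW_space S)" if "u \<in> lists S" for u
    using indep that by (auto simp: indep_vars_def)
  have m: "(\<lambda>\<omega>. clip S (W u \<omega>)) \<in> measurable P (weight_space S)" if "u \<in> lists S" for u
    using measurable_compose[OF AW[OF that] measurable_clip] by simp
  show "(\<lambda>\<omega>. \<lambda>u\<in>lists S. clip S (W u \<omega>)) \<in> measurable P (\<Pi>\<^sub>M u\<in>lists S. weight_space S)"
    by (intro measurable_restrict m)
  have "indep_vars (\<lambda>_. weight_space S) (\<lambda>u \<omega>. clip S (W u \<omega>)) (lists S)"
    using indep_vars_compose2[OF indep, of "\<lambda>_ z. clip S (snd z)" "\<lambda>_. weight_space S", OF measurable_clip] by simp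
  then have "distr P (\<Pi>\<^sub>M u\<in>lists S. weight_space S) (\<lambda>\<omega>. \<lambda>u\<in>lists S. clip S (W u \<omega>)) =
      (\<Pi>\<^sub>M u\<in>lists S. distr P (weight_space S) (\<lambda>\<omega>. clip S (W u \<omega>)))"
    using m by (subst (asm) indep_vars_iff_distr_eq_PiM') auto
  also have "\<dots> = (\<Pi>\<^sub>M u\<in>lists S. distr P0 (weight_space S) (\<lambda>\<omega>. clip S (W0 \<omega>)))"
  proof (intro PiM_cong refl)
    fix u assume u: "u \<in> lists S"
    have "distr P (weight_space S) (\<lambda>\<omega>. clip S (W u \<omega>)) =
        distr (distr P (AW_space S) (\<lambda>\<omega>. (A u \<omega>, W u \<omega>))) (weight_space S) (\<lambda>z. clip S (snd z))"
      by (subst distr_distr[OF measurable_clip AW[OF u]]) (simp add: comp_def)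
    also have "\<dots> = distr P0 (weight_space S) (\<lambda>\<omega>. clip S (W0 \<omega>))"
      unfolding copies[OF u] by (subst distr_distr[OF measurable_clip AW0]) (simp add: comp_def)
    finally show "distr P (weight_space S) (\<lambda>\<omega>. clip S (W u \<omega>)) = distr P0 (weight_space S) (\<lambda>\<omega>. clip S (W0 \<omega>))" .
  qed
  finally show "distr P (\<Pi>\<^sub>M u\<in>lists S. weight_space S) (\<lambda>\<omega>. \<lambda>u\<in>lists S. clip S (W u \<omega>)) =
      (\<Pi>\<^sub>M u\<in>lists S. distr P0 (weight_space S) (\<lambda>\<omega>. clip S (W0 \<omega>)))" .
qed

text \<open>Non-negativity is known for the model vector and passes to its copies only through their
  common law, hence almost surely.\<close>

lemma AE_copies_nonneg:
  assumes S: "finite S" and P: "prob_space P"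
    and AW: "\<And>u. u \<in> lists S \<Longrightarrow> (\<lambda>\<omega>. (A u \<omega>, W u \<omega>)) \<in> measurable P (AW_space S)"
    and copies: "\<And>u. u \<in> lists S \<Longrightarrow>
      distr P (AW_space S) (\<lambda>\<omega>. (A u \<omega>, W u \<omega>)) = distr P0 (AW_space S) (\<lambda>\<omega>. (A0 \<omega>, W0 \<omega>))"
    and AW0: "(\<lambda>\<omega>. (A0 \<omega>, W0 \<omega>)) \<in> measurable P0 (AW_space S)"
    and nonneg: "\<And>\<omega> a. \<omega> \<in> space P0 \<Longrightarrow> a \<in> S \<Longrightarrow> 0 \<le> W0 \<omega> a"
  shows "AE \<omega> in P. \<forall>u\<in>lists S. \<forall>a\<in>S. 0 \<le> W u \<omega> a"
proof (subst AE_ball_countable)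
  show "countable (lists S)" using S by (simp add: countable_finite)
  show "\<forall>u\<in>lists S. AE \<omega> in P. \<forall>a\<in>S. 0 \<le> W u \<omega> a"
  proof
    fix u assume u: "u \<in> lists S"
    have snd_m: "(\<lambda>z. snd z a) \<in> borel_measurable (AW_space S)" if "a \<in> S" for a
      unfolding AW_space_def using that
      by (intro measurable_compose[OF measurable_snd measurable_component_singleton]) auto
    have set: "{z \<in> space (AW_space S). \<forall>a\<in>S. 0 \<le> snd z a} \<in> sets (AW_space S)"
      using S by (intro sets.sets_Collect_finite_All borel_measurable_le measurable_const snd_m) auto
    have "AE z in distr P0 (AW_space S) (\<lambda>\<omega>. (A0 \<omega>, W0 \<omega>)). \<forall>a\<in>S. 0 \<le> snd z a"
      unfolding AE_distr_iff[OF AW0 set] using nonneg by (intro AE_I2) auto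
    then have "AE z in distr P (AW_space S) (\<lambda>\<omega>. (A u \<omega>, W u \<omega>)). \<forall>a\<in>S. 0 \<le> snd z a"
      unfolding copies[OF u] .
    from AE_distrD[OF AW[OF u] this] show "AE \<omega> in P. \<forall>a\<in>S. 0 \<le> W u \<omega> a" by simp
  qed
qed

lemma mandelbrot_measure_cong:
  assumes "\<And>u a. u \<in> lists S \<Longrightarrow> a \<in> S \<Longrightarrow> w u a = w' u a"
  shows "mandelbrot_measure S w = mandelbrot_measure S w'"
proof -
  have Q: "Q_weight w u v = Q_weight w' u v" if "u \<in> lists S" "v \<in> lists S" for u v
    unfolding Q_weight_def
  proof (intro prod.cong refl assms)
    fix j assume "j \<in> {..<length v}"
    then show "u @ take j v \<in> lists S" "v ! j \<in> S" using that by (auto dest: in_set_takeD)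
  qed
  have "Y_limit S w u = Y_limit S w' u" if "u \<in> lists S" for u
    unfolding Y_limit_def using that by (intro arg_cong[where f=lim] ext sum.cong refl Q) auto
  then have eq: "ennreal (Q_weight w [] u * Y_limit S w u) = ennreal (Q_weight w' [] u * Y_limit S w' u)" if "u \<in> lists S" for u
    using Q[of "[]" u] that by simp
  have "(\<forall>u\<in>lists S. m u = ennreal (Q_weight w [] u * Y_limit S w u)) \<longleftrightarrow>
      (\<forall>u\<in>lists S. m u = ennreal (Q_weight w' [] u * Y_limit S w' u))"
    "(\<forall>u\<in>lists S. ennreal (Q_weight w [] u * Y_limit S w u) = 0) \<longleftrightarrow>
      (\<forall>u\<in>lists S. ennreal (Q_weight w' [] u * Y_limit S w' u) = 0)" for m
    by (intro ball_cong refl; simp only: eq)+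
  then show ?thesis
    unfolding mandelbrot_measure_def extend_measure_def by (simp only:)
qed

text \<open>This has to cover environments whose cylinder masses are not consistent. If no measure
  extends them, \<open>extend_measure\<close> returns the zero measure; otherwise the total mass is
  the prescribed one.\<close>

lemma emeasure_mandelbrot_measure_eq_0:
  assumes "Y_limit S w [] = 0"
  shows "emeasure (mandelbrot_measure S w) (streams S) = 0"
proof (cases "\<exists>\<mu>'. (\<forall>u\<in>lists S. \<mu>' (sstart S u) = ennreal (Q_weight w [] u * Y_limit S w u)) \<and>
    measure_space (streams S) (sigma_sets (streams S) (sstart S ` lists S)) \<mu>'")
  case True
  then obtain \<mu>' where \<mu>': "\<And>u. u \<in> lists S \<Longrightarrow> \<mu>' (sstart S u) = ennreal (Q_weight w [] u * Y_limit S w u)"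
      "measure_space (streams S) (sigma_sets (streams S) (sstart S ` lists S)) \<mu>'"
    by blast
  have sub: "sstart S ` lists S \<subseteq> Pow (streams S)" by (auto dest: sstart_in_streams del: in_listsD)
  have "emeasure (mandelbrot_measure S w) (sstart S []) = ennreal (Q_weight w [] [] * Y_limit S w [])"
    using \<mu>'(2) by (intro emeasure_extend_measure[OF mandelbrot_measure_def \<mu>'(1) sub])
      (auto simp: mandelbrot_measure_def sets_extend_measure[OF sub] measure_space_def)
  then show ?thesis using assms by simp
next
  case False
  then have "mandelbrot_measure S w = measure_of (streams S) (sstart S ` lists S) (\<lambda>_. 0)"
    unfolding mandelbrot_measure_def extend_measure_def by (subst if_not_P) auto
  then show ?thesis by (simp add: emeasure_sigma)
qed

lemma push_factor_1:
  assumes "sets \<nu> = sets (shift_space (Alph 1))"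
  shows "push_factor Alph \<pi> 1 \<nu> = \<nu>"
proof -
  have "factor_map \<pi> 1 1 = (\<lambda>x. x)"
    by (simp add: factor_map_def factor_letter_def fun_eq_iff id_def stream.map_ident)
  then show ?thesis unfolding push_factor_def using distr_id2[OF assms[symmetric]] by simp
qed

theorem theorem2p7:
  fixes k i :: nat
    and Alph :: "nat \<Rightarrow> 'a set"
    and \<pi> :: "nat \<Rightarrow> 'a \<Rightarrow> 'a"
    and \<gamma> :: "nat \<Rightarrow> real"
    and P0 :: "'v measure" and A0 :: "'v \<Rightarrow> 'a set" and W0 :: "'v \<Rightarrow> 'a \<Rightarrow> real"
    and P :: "'w measure" and A :: "'a list \<Rightarrow> 'w \<Rightarrow> 'a set" and W :: "'a list \<Rightarrow> 'w \<Rightarrow> 'a \<Rightarrow> real"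
    and \<mu> :: "'w \<Rightarrow> 'a stream measure"
    and \<nu> :: "nat \<Rightarrow> 'a stream measure"
  assumes k: "2 \<le> k"
    and alphabets: "\<And>j. 1 \<le> j \<Longrightarrow> j \<le> k \<Longrightarrow> finite (Alph j) \<and> 2 \<le> card (Alph j)"
    and factors: "\<And>j. 1 \<le> j \<Longrightarrow> j < k \<Longrightarrow> \<pi> j ` Alph j = Alph (Suc j)"
    and gamma_pos: "\<And>j. 1 \<le> j \<Longrightarrow> j \<le> k \<Longrightarrow> 0 < \<gamma> j"
    \<comment> \<open>the random vector \<open>(A, W)\<close>\<close>
    and P0: "prob_space P0"
    and AW0: "(\<lambda>\<omega>. (A0 \<omega>, W0 \<omega>)) \<in> measurable P0 (AW_space (Alph 1))"
    and mean_card: "(\<integral>\<omega>. real (card (A0 \<omega>)) \<partial>P0) > 1"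
    and W0_nonneg: "\<And>\<omega> a. \<omega> \<in> space P0 \<Longrightarrow> a \<in> Alph 1 \<Longrightarrow> 0 \<le> W0 \<omega> a"
    and W0_support: "\<And>\<omega> a. \<omega> \<in> space P0 \<Longrightarrow> a \<in> Alph 1 \<Longrightarrow> 0 < W0 \<omega> a \<Longrightarrow> a \<in> A0 \<omega>"
    and W0_mean: "(\<integral>\<omega>. (\<Sum>a\<in>Alph 1. W0 \<omega> a) \<partial>P0) = 1"
    \<comment> \<open>independent copies \<open>(A(u), W(u))\<close>, indexed by the finite words \<open>u\<close>\<close>
    and P: "prob_space P"
    and indep: "prob_space.indep_vars P (\<lambda>_. AW_space (Alph 1))
                  (\<lambda>u \<omega>. (A u \<omega>, W u \<omega>)) (lists (Alph 1))"
    and copies: "\<And>u. u \<in> lists (Alph 1) \<Longrightarrow>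
                  distr P (AW_space (Alph 1)) (\<lambda>\<omega>. (A u \<omega>, W u \<omega>)) =
                  distr P0 (AW_space (Alph 1)) (\<lambda>\<omega>. (A0 \<omega>, W0 \<omega>))"
    \<comment> \<open>the Mandelbrot measure and the expectations of its projections\<close>
    and mu: "\<mu> = (\<lambda>\<omega>. mandelbrot_measure (Alph 1) (\<lambda>u. W u \<omega>))"
    and nondegenerate: "\<P>(\<omega> in P. emeasure (\<mu> \<omega>) (streams (Alph 1)) \<noteq> 0) > 0"
    and nu: "\<nu> = (\<lambda>j. mean_measure P (shift_space (Alph j)) (\<lambda>\<omega>. push_factor Alph \<pi> j (\<mu> \<omega>)))"
    and i: "2 \<le> i" "i \<le> k"
    and T_finite: "\<exists>q>1. T_fun P0 (Alph 1) W0 q > - \<infinity>"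
  shows "(\<forall>j\<in>{i..k}. bernoulli_product (Alph j) (\<nu> j)) \<and>
    (AE \<omega> in P. emeasure (\<mu> \<omega>) (streams (Alph 1)) \<noteq> 0 \<longrightarrow>
       has_entropy_dim (Alph 1) (\<mu> \<omega>) \<and>
       (\<forall>j\<in>{i..k}. has_entropy_dim (Alph j) (push_factor Alph \<pi> j (\<mu> \<omega>))) \<and>
       exact_dimensional (streams (Alph i)) (sponge_dist k \<pi> \<gamma> i) (push_factor Alph \<pi> i (\<mu> \<omega>))
         (weighted_entropy_dim k Alph \<pi> \<gamma> i (\<mu> \<omega>)) \<and>
       ereal (weighted_entropy_dim k Alph \<pi> \<gamma> i (\<mu> \<omega>)) =
         (\<Sum>j=i..k. ereal (gamma_vec \<gamma> i j) *
            min (ereal (entropy_dim (Alph 1) (\<mu> \<omega>))) (ks_entropy (\<nu> j) stl)))"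
proof -
  note One_nat_def [simp del]
  let ?S = "Alph 1"
  have k1: "1 \<le> k" using k by simp
  have S: "finite ?S" using alphabets[of 1] k1 by blast
  obtain q where q: "1 < q" "T_fun P0 ?S W0 q > - \<infinity>" using T_finite by blast
  define M where "M = distr P0 (weight_space ?S) (\<lambda>\<omega>. clip ?S (W0 \<omega>))"
  define env where "env \<omega> = (\<lambda>u\<in>lists ?S. clip ?S (W u \<omega>))" for \<omega>
  interpret P: prob_space P by (rule P)
  interpret cascade ?S M q
    unfolding M_def by (rule cascade_clip[OF S P0 AW0 W0_nonneg W0_mean q])
  have env_m: "env \<in> measurable P (\<Pi>\<^sub>M u\<in>lists ?S. weight_space ?S)"
    using measurable_environment[OF P indep copies AW0] by (simp add: env_def[abs_def])
  have env_law: "distr P (\<Pi>\<^sub>M u\<in>lists ?S. weight_space ?S) env = G"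
    unfolding G_def unfolding env_def[abs_def] M_def by (rule distr_environment[OF P indep copies AW0])
  have transfer: "AE \<omega> in P. R (env \<omega>)" if "AE w in G. R w" for R
    using AE_distrD[OF env_m] that unfolding env_law[symmetric] by blast
  have AW: "(\<lambda>\<omega>. (A u \<omega>, W u \<omega>)) \<in> measurable P (AW_space ?S)" if "u \<in> lists ?S" for u
    using indep that by (auto simp: P.indep_vars_def)
  have "AE \<omega> in P. \<forall>u\<in>lists ?S. \<forall>a\<in>?S. 0 \<le> W u \<omega> a"
    by (rule AE_copies_nonneg[OF S P _ _ AW0]) (fact AW copies W0_nonneg)+
  then have mu_env: "AE \<omega> in P. \<mu> \<omega> = mandelbrot_measure ?S (env \<omega>)"
  proof eventually_elim
    case (elim \<omega>)
    then show ?case unfolding mu by (intro mandelbrot_measure_cong) (simp add: env_def clip_def)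
  qed
  \<comment> \<open>Non-degeneracy excludes the vanishing alternative of the dichotomy and thereby
    yields a regular exponent.\<close>
  have "\<not> (AE w in G. (\<lambda>n. mass n w) \<longlonglongrightarrow> 0)"
  proof
    assume "AE w in G. (\<lambda>n. mass n w) \<longlonglongrightarrow> 0"
    then have "AE \<omega> in P. (\<lambda>n. mass n (env \<omega>)) \<longlonglongrightarrow> 0" by (rule transfer)
    then have "AE \<omega> in P. \<not> emeasure (\<mu> \<omega>) (streams ?S) \<noteq> 0"
      using mu_env
    proof eventually_elim
      case (elim \<omega>)
      have "Y_limit ?S (env \<omega>) [] = 0" using limI[OF elim(1)] by (simp add: Y_limit_def mass_def)
      then show ?case unfolding elim(2) by (simp add: emeasure_mandelbrot_measure_eq_0)
    qed
    then have "emeasure P {\<omega> \<in> space P. emeasure (\<mu> \<omega>) (streams ?S) \<noteq> 0} = 0"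
      by (rule emeasure_eq_0_AE)
    then show False using nondegenerate by (simp add: measure_def)
  qed
  then obtain p where p: "regular p" using dichotomy by blast
  interpret projected_cascade k i Alph \<pi> \<gamma> M q p
  proof (intro projected_cascade.intro sponge.intro regular_cascade.intro coded_cascade.intro
      regular_cascade_axioms.intro projected_cascade_axioms.intro)
    show "1 \<le> i" "i \<le> k" using i by auto
    show "finite (Alph i)" using alphabets[of i] i by simp
    show "finite (Alph j)" if "1 \<le> j" "j \<le> k" for j using alphabets[OF that] by blast
  qed (fact cascade_axioms p gamma_pos factors)+
  have law: "(\<integral>\<^sup>+\<omega>. emeasure (push_factor Alph \<pi> j (\<mu> \<omega>)) B \<partial>P) =
      emeasure (stream_space (point_measure (Alph j) (\<lambda>b. ennreal (fib_mean j b)))) B"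
    if j: "1 \<le> j" "j \<le> k" and B: "B \<in> sets (shift_space (Alph j))" for j B
  proof -
    interpret N: bernoulli_shift "Alph j" "point_measure (Alph j) (\<lambda>b. ennreal (fib_mean j b))"
      using bernoulli_shift_fib_mean[of j] unfolding code_image[OF j] .
    obtain F where F: "F \<in> borel_measurable G"
      "AE w in G. emeasure (mandelbrot_measure ?S w) (smap (code j) -` B \<inter> streams ?S) = F w"
      "(\<integral>\<^sup>+w. F w \<partial>G) = emeasure N.N B"
      using mean_projection[of B j] B unfolding code_image[OF j] N.sets_N by blast
    have "(\<integral>\<^sup>+\<omega>. emeasure (push_factor Alph \<pi> j (\<mu> \<omega>)) B \<partial>P) = (\<integral>\<^sup>+\<omega>. F (env \<omega>) \<partial>P)"
    proof (rule nn_integral_cong_AE)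
      show "AE \<omega> in P. emeasure (push_factor Alph \<pi> j (\<mu> \<omega>)) B = F (env \<omega>)"
        using mu_env transfer[OF F(2)]
      proof eventually_elim
        case (elim \<omega>)
        have "emeasure (proj j (env \<omega>)) B = emeasure (mandelbrot_measure ?S (env \<omega>)) (factor_map \<pi> 1 j -` B \<inter> streams ?S)"
          unfolding push_factor_def by (subst emeasure_distr[OF measurable_factor_map[OF j] B]) (simp add: space_\<mu>)
        then show ?case using elim by (simp add: factor_map_def)
      qed
    qed
    also have "\<dots> = (\<integral>\<^sup>+w. F w \<partial>G)"
    proof -
      \<comment> \<open>Measurability with respect to \<open>G\<close> refers only to its
        sigma-algebra, which is that of the target of \<open>env\<close>.\<close>
      have "F \<in> borel_measurable (\<Pi>\<^sub>M u\<in>lists ?S. weight_space ?S)"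
        using F(1) unfolding env_law[symmetric] by simp
      then show ?thesis unfolding env_law[symmetric] by (subst nn_integral_distr[OF env_m]) simp_all
    qed
    finally show ?thesis using F(3) by simp
  qed
  have nu_j: "bernoulli_product (Alph j) (\<nu> j)" "ks_entropy (\<nu> j) stl = ereal (h j)" if "1 \<le> j" "j \<le> k" for j
    unfolding nu using mean_measure_bernoulli[OF that law[OF that]] by blast+
  \<comment> \<open>The index 1 is included because it gives the entropy dimension of
    \<open>\<mu>\<close> itself.\<close>
  have "AE w in G. \<forall>j\<in>{1..k}. good w \<and> (0 < Y w \<longrightarrow> entropy_quotient (Alph j) (proj j w) \<longlonglongrightarrow> e j)"
    using AE_entropy_quotient by (subst AE_ball_countable) auto
  from transfer[OF this] transfer[OF AE_exact_dimensional] mu_env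
  have "AE \<omega> in P. emeasure (\<mu> \<omega>) (streams ?S) \<noteq> 0 \<longrightarrow>
       has_entropy_dim ?S (\<mu> \<omega>) \<and>
       (\<forall>j\<in>{i..k}. has_entropy_dim (Alph j) (push_factor Alph \<pi> j (\<mu> \<omega>))) \<and>
       exact_dimensional (streams (Alph i)) (sponge_dist k \<pi> \<gamma> i) (push_factor Alph \<pi> i (\<mu> \<omega>))
         (weighted_entropy_dim k Alph \<pi> \<gamma> i (\<mu> \<omega>)) \<and>
       ereal (weighted_entropy_dim k Alph \<pi> \<gamma> i (\<mu> \<omega>)) =
         (\<Sum>j=i..k. ereal (gamma_vec \<gamma> i j) * min (ereal (entropy_dim ?S (\<mu> \<omega>))) (ks_entropy (\<nu> j) stl))"
  proof eventually_elim
    case (elim \<omega>)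
    show ?case
    proof
      assume pos: "emeasure (\<mu> \<omega>) (streams ?S) \<noteq> 0"
      have g: "good (env \<omega>)" using elim(2) by blast
      have "0 < Y (env \<omega>)"
        using pos Y_nonneg[of "env \<omega>"] unfolding elim(3) emeasure_\<mu>_space[OF g] by (simp add: less_le)
      then have lim: "entropy_quotient (Alph j) (push_factor Alph \<pi> j (\<mu> \<omega>)) \<longlonglongrightarrow> e j" if "1 \<le> j" "j \<le> k" for j
        using elim(1) that unfolding elim(3) by simp
      have dim: "entropy_dim (Alph j) (push_factor Alph \<pi> j (\<mu> \<omega>)) = e j" if "1 \<le> j" "j \<le> k" for j
        unfolding entropy_dim_def using lim[OF that] by (rule limI)
      have mu1: "push_factor Alph \<pi> 1 (\<mu> \<omega>) = \<mu> \<omega>"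
        unfolding elim(3) by (rule push_factor_1) (rule sets_\<mu>)
      have D: "weighted_entropy_dim k Alph \<pi> \<gamma> i (\<mu> \<omega>) = (\<Sum>j=i..k. gamma_vec \<gamma> i j * e j)"
        unfolding weighted_entropy_dim_def using i dim by (intro sum.cong refl) auto
      have "(\<Sum>j=i..k. ereal (gamma_vec \<gamma> i j) * min (ereal (entropy_dim ?S (\<mu> \<omega>))) (ks_entropy (\<nu> j) stl)) =
          (\<Sum>j=i..k. ereal (gamma_vec \<gamma> i j * e j))"
      proof (intro sum.cong refl)
        fix j assume "j \<in> {i..k}"
        then have j: "1 \<le> j" "j \<le> k" using i by auto
        have min_ereal: "min (ereal x) (ereal y) = ereal (min x y)" for x y by (simp add: min_def)
        \<comment> \<open>The entropy dimension of \<open>\<mu>\<close> appears here as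
          \<open>min H (h 1)\<close>. Since \<open>h j \<le> h 1\<close>, taking the minimum with
          \<open>h j\<close> gives the same value as starting from \<open>H\<close>.\<close>
        have e_j: "min (e 1) (h j) = e j" using h_mono[OF order_refl j(1)] by (simp add: min_def)
        have "entropy_dim ?S (\<mu> \<omega>) = e 1" using dim[OF order_refl k1] unfolding mu1 .
        then show "ereal (gamma_vec \<gamma> i j) * min (ereal (entropy_dim ?S (\<mu> \<omega>))) (ks_entropy (\<nu> j) stl) =
            ereal (gamma_vec \<gamma> i j * e j)"
          by (simp only: nu_j(2)[OF j] min_ereal e_j times_ereal.simps)
      qed
      then have "ereal (weighted_entropy_dim k Alph \<pi> \<gamma> i (\<mu> \<omega>)) =
         (\<Sum>j=i..k. ereal (gamma_vec \<gamma> i j) * min (ereal (entropy_dim ?S (\<mu> \<omega>))) (ks_entropy (\<nu> j) stl))"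
        by (simp add: D)
      moreover have "has_entropy_dim ?S (\<mu> \<omega>)"
        using lim[OF order_refl k1] unfolding mu1 has_entropy_dim_def by (rule convergentI)
      moreover have "\<forall>j\<in>{i..k}. has_entropy_dim (Alph j) (push_factor Alph \<pi> j (\<mu> \<omega>))"
        using i unfolding has_entropy_dim_def by (intro ballI convergentI[OF lim]) auto
      moreover have "exact_dimensional (streams (Alph i)) (sponge_dist k \<pi> \<gamma> i) (push_factor Alph \<pi> i (\<mu> \<omega>))
         (weighted_entropy_dim k Alph \<pi> \<gamma> i (\<mu> \<omega>))"
        unfolding D unfolding elim(3) using elim(2) by blast
      ultimately show "has_entropy_dim ?S (\<mu> \<omega>) \<and>
       (\<forall>j\<in>{i..k}. has_entropy_dim (Alph j) (push_factor Alph \<pi> j (\<mu> \<omega>))) \<and>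
       exact_dimensional (streams (Alph i)) (sponge_dist k \<pi> \<gamma> i) (push_factor Alph \<pi> i (\<mu> \<omega>))
         (weighted_entropy_dim k Alph \<pi> \<gamma> i (\<mu> \<omega>)) \<and>
       ereal (weighted_entropy_dim k Alph \<pi> \<gamma> i (\<mu> \<omega>)) =
         (\<Sum>j=i..k. ereal (gamma_vec \<gamma> i j) * min (ereal (entropy_dim ?S (\<mu> \<omega>))) (ks_entropy (\<nu> j) stl))"
        by blast
    qed
  qed
  moreover have "\<forall>j\<in>{i..k}. bernoulli_product (Alph j) (\<nu> j)"
    using nu_j(1) i by auto
  ultimately show ?thesis by blast
qed

end
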